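(* Let $n\geq 6$ be even. Then \[ L^{-\frac{n}{2}-\frac{2}{n}+1+\epsilon }\gg\textnormal{Prob}(G_f = (C_2\wr S_{n/2})\cap A_n) \gg L^{-\frac{n+1 }{2}}. \] In particular, $\textnormal{Prob}(\operatorname{disc} f=\square)\gg L^{-\frac{n+1}{2}}$.
   Context: Large box model: $f$ is a random monic polynomial of degree $n$ with integer coefficients chosen independently and uniformly from $[-L,L]\cap\mathbb{Z}$, and probabilities are considered as $L\to\infty$ (with $\epsilon>0$ arbitrary). $G_f$ denotes the Galois group of $f$, viewed as a subgroup of $S_n$ via its action on the roots. $C_2\wr S_{n/2}$ is the permutational wreath product (signed permutation group) embedded in $S_n$ via its imprimitive action on pairs $(\pm1,i)$, $1\le i\le n/2$. $\operatorname{disc} f$ is the discriminant of $f$, and $\square$ denotes a perfect square (of an integer). *)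

theory Defs
  imports
    "HOL-Probability.Probability"
    "HOL-Library.Landau_Symbols"
    "HOL-Algebra.Algebraic_Closure_Type"
    "HOL-Algebra.Sym_Groups"
    "HOL-Algebra.QuotRing"
    "HOL-Algebra.Generated_Fields"
    "HOL-Computational_Algebra.Nth_Powers"
    "Subresultants.Resultant_Prelim"
begin

text \<open>The large box model. The box parameter \<open>L\<close> is a real number; the asymptotic statements
  are about \<open>L\<close> tending to infinity, so the value for negative \<open>L\<close> is irrelevant.\<close>

definition random_monic_poly :: "nat \<Rightarrow> real \<Rightarrow> int poly pmf" where
  "random_monic_poly n L =
     map_pmf (\<lambda>c. Polynomial.monom 1 n + (\<Sum>i<n. Polynomial.monom (c i) i))
       (Pi_pmf {..<n} 0 (\<lambda>_. pmf_of_set {a :: int. - L \<le> of_int a \<and> of_int a \<le> L}))"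

definition complex_roots :: "int poly \<Rightarrow> complex set" where
  "complex_roots f = {z. poly (map_poly of_int f) z = 0}"

definition splitting_field :: "int poly \<Rightarrow> complex ring" where
  "splitting_field f =
     ring_of_type_algebra \<lparr> carrier :=
       generate_field ring_of_type_algebra (\<rat> \<union> complex_roots f) \<rparr>"

text \<open>The elements are functions on all of the complex numbers; only their values on the
  splitting field are meaningful.\<close>

definition field_automorphisms :: "int poly \<Rightarrow> (complex \<Rightarrow> complex) set" where
  "field_automorphisms f =
     {\<sigma> \<in> ring_iso (splitting_field f) (splitting_field f). \<forall>q \<in> \<rat>. \<sigma> q = q}"

text \<open>The action of the Galois group on the roots \<open>r 1, \<dots>, r n\<close>.\<close>

definition galois_perms :: "nat \<Rightarrow> (nat \<Rightarrow> complex) \<Rightarrow> int poly \<Rightarrow> (nat \<Rightarrow> nat) set" where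
  "galois_perms n r f =
     {\<pi> \<in> carrier (sym_group n).
        \<exists>\<sigma> \<in> field_automorphisms f. \<forall>i \<in> {1..n}. \<sigma> (r i) = r (\<pi> i)}"

text \<open>As a subgroup of the symmetric group on \<open>1, \<dots>, n\<close> the Galois group depends on a
  numbering of the roots, i.e. it is defined up to conjugation; hence the existential quantifier.
  For a polynomial of degree \<open>n\<close> such a numbering exists iff its \<open>n\<close> roots are distinct.\<close>

definition is_galois_group :: "nat \<Rightarrow> int poly \<Rightarrow> (nat \<Rightarrow> nat) set \<Rightarrow> bool" where
  "is_galois_group n f G \<longleftrightarrow>
     (\<exists>r. bij_betw r {1..n} (complex_roots f) \<and> galois_perms n r f = G)"

text \<open>A numbering by \<open>1, \<dots>, 2 * m\<close> of the pairs \<open>(s, i)\<close> with \<open>s = 1\<close> or \<open>s = -1\<close> and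
  \<open>1 \<le> i \<le> m\<close>.\<close>

definition signed_point :: "nat \<Rightarrow> int \<Rightarrow> nat \<Rightarrow> nat" where
  "signed_point m s i = (if s = 1 then i else m + i)"

text \<open>The element of the wreath product given by the signs \<open>\<epsilon>\<close> and the permutation \<open>\<tau>\<close> acts
  by sending \<open>(s, i)\<close> to \<open>(\<epsilon> i * s, \<tau> i)\<close>.\<close>

definition signed_perm_group :: "nat \<Rightarrow> (nat \<Rightarrow> nat) set" where
  "signed_perm_group m =
     {\<pi> \<in> carrier (sym_group (2 * m)).
        \<exists>\<epsilon> \<tau>. \<epsilon> \<in> {1..m} \<rightarrow> {1, -1} \<and> \<tau> \<in> carrier (sym_group m) \<and>
          (\<forall>i \<in> {1..m}. \<forall>s \<in> {1, -1}.
             \<pi> (signed_point m s i) = signed_point m (\<epsilon> i * s) (\<tau> i))}"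

text \<open>The division is exact, since the leading coefficient divides the first column of the
  Sylvester matrix.\<close>

definition discriminant :: "int poly \<Rightarrow> int" where
  "discriminant f =
     (-1) ^ (Polynomial.degree f * (Polynomial.degree f - 1) div 2) * resultant f (pderiv f)
       div Polynomial.lead_coeff f"

end

theory Submission
  imports Defs "Berlekamp_Zassenhaus.Mahler_Measure" "Jordan_Normal_Form.Char_Poly" "HOL-Number_Theory.Number_Theory" "HOL-Real_Asymp.Real_Asymp"
begin

text \<open>Write \<open>n = 2 m\<close>.

  Upper bound. If the Galois group of \<open>f\<close> consists of the even signed permutations, then
  \<open>f = \<Prod>i. (x\<^sup>2 - s i x + t i)\<close>, where \<open>s\<close> and \<open>t\<close> lie in the lattice of integral
  vectors on which the Galois group acts by permuting the \<open>m\<close> coordinates. A nonconstant vector has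
  distinct coordinates and determines the lattice. By Landau's inequality \<open>s\<close> and \<open>t\<close> lie in one
  of \<open>O((log L)\<^sup>m)\<close> dyadic boxes \<open>B\<close> of volume \<open>Z = O(L)\<close>, so one has to bound the sum over
  all lattices of \<open>N\<^sup>2\<close>, where \<open>N = O(Z)\<close> is the number of lattice points in \<open>B\<close>. A pigeonhole
  modulo \<open>q\<close> gives \<open>N \<le> q\<^sup>m N'\<close> with \<open>N'\<close> the number of points in \<open>(2/q) B\<close>, and the
  nonconstant points of all lattices in a box are counted by their characteristic polynomials; the choice
  \<open>q\<close> of order \<open>Z powr (1 / m\<^sup>2)\<close> yields \<open>O(Z powr (m + 1 - 1 / m))\<close>.

  Lower bound. Take \<open>f = g(x\<^sup>2)\<close> with \<open>(-1)\<^sup>m g(0)\<close> a square, which makes the discriminant of \<open>f\<close> a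
  square. Congruences modulo the squares of three primes make the Galois group of \<open>g\<close> transitive, doubly
  transitive and contain a transposition, and the real shape of \<open>g\<close> gives exactly two negative and
  \<open>m - 2\<close> positive roots, so that complex conjugation flips exactly two signs. Its conjugates generate all
  even sign changes. There are \<open>L powr (m - 1/2)\<close> such \<open>g\<close> up to a constant.\<close>

section \<open>Algebraic integers\<close>

text \<open>Upper bound: \<open>N\<close> = O(Z) for each lattice and O(Z powr m) for the sum of
  \<open>N\<close> over the lattices give only Z powr (m + 1). The factor Z powr (1 / m) is saved by
  two counts in the shrunken box: few lattices have a nonconstant point there, and the constant
  vectors, present in every lattice, number O(Z powr (1 / m)) because the box has a side that short.
  With about L powr (2 m) polynomials in all, the exponents become m + 1 - 1/m - 2m = -n/2 - 2/n + 1
  and m - 1/2 - 2m = -(n + 1)/2.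

  Lower bound: the obstacle is to force elements into the Galois group of g. The source is
  ramification: if modulo q the polynomial g is (x - 1)^e times other distinct linear factors, and q
  divides g(1) exactly once, then the automorphisms fixing the simple roots permute the e merging
  roots transitively. This is proved without completions, by a norm computation modulo a prime ideal
  of the ring of all algebraic integers. The simple roots modulo q are squares, to keep the
  congruences compatible with the constant term being (-1)^m times a square.\<close>

lemma algebraic_int_of_integer_eigenvector:
  fixes x :: complex and v :: "nat \<Rightarrow> complex"
  assumes nz: "\<exists>i<n. v i \<noteq> 0"
    and eq: "\<And>i. i < n \<Longrightarrow> x * v i = (\<Sum>j<n. of_int (a i j) * v j)"
  shows "algebraic_int x"
proof -
  define A where "A = mat n n (\<lambda>(i,j). a i j)"
  define B where "B = map_mat (of_int :: int \<Rightarrow> complex) A"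
  have A: "A \<in> carrier_mat n n" and B: "B \<in> carrier_mat n n"
    by (auto simp: A_def B_def)
  have "eigenvector B (vec n v) x"
    unfolding eigenvector_def
  proof (intro conjI)
    show "vec n v \<in> carrier_vec (dim_row B)" using B by auto
    show "vec n v \<noteq> 0\<^sub>v (dim_row B)"
      using nz B by (auto simp: vec_eq_iff)
    show "B *\<^sub>v vec n v = x \<cdot>\<^sub>v vec n v"
      using B by (auto simp: vec_eq_iff scalar_prod_def eq B_def A_def atLeast0LessThan
          intro!: sum.cong)
  qed
  hence "poly (char_poly B) x = 0"
    using eigenvalue_root_char_poly[OF B] by (auto simp: eigenvalue_def)
  moreover have "char_poly B = map_poly of_int (char_poly A)"
    unfolding B_def by (rule of_int_hom.char_poly_hom[OF A])
  moreover have "Polynomial.lead_coeff (char_poly A) = 1"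
    using degree_monic_char_poly[OF A] by auto
  ultimately show ?thesis
    unfolding algebraic_int_altdef_ipoly by metis
qed

lemma algebraic_int_power_basis:
  fixes x :: complex
  assumes "algebraic_int x"
  obtains n c where "n > 0" "x ^ n = (\<Sum>j<n. of_int (c j) * x ^ j)"
proof -
  obtain p where p: "poly (map_poly of_int p) x = 0" "Polynomial.lead_coeff p = (1::int)"
    using assms unfolding algebraic_int_altdef_ipoly by blast
  define n where "n = Polynomial.degree p"
  have "n > 0"
  proof (rule ccontr)
    assume "\<not> n > 0"
    then have "p = 1" using p(2) by (metis degree_0_id n_def not_gr_zero one_pCons)
    with p(1) show False by simp
  qed
  have "0 = (\<Sum>j\<le>n. of_int (poly.coeff p j) * x ^ j)"
    using p(1) by (simp add: poly_altdef n_def)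
  also have "\<dots> = (\<Sum>j<n. of_int (poly.coeff p j) * x ^ j) + x ^ n"
    using p(2) by (simp add: n_def lessThan_Suc_atMost[symmetric])
  finally have "x ^ n = (\<Sum>j<n. of_int (- poly.coeff p j) * x ^ j)"
    by (simp add: sum_negf eq_neg_iff_add_eq_0 add.commute)
  with that[of n "\<lambda>j. - poly.coeff p j"] \<open>n > 0\<close> show ?thesis by simp
qed

text \<open>The monomials \<open>x ^ i * y ^ j\<close> span a module stable under \<open>x\<close> and \<open>y\<close>.\<close>
lemma algebraic_int_combine:
  fixes x y z :: complex
  assumes "algebraic_int x" "algebraic_int y"
    and z: "z = x + y \<or> z = x * y"
  shows "algebraic_int z"
proof -
  obtain n c where n: "n > 0" and c: "x ^ n = (\<Sum>j<n. of_int (c j) * x ^ j)"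
    using algebraic_int_power_basis[OF assms(1)] by blast
  obtain m d where m: "m > 0" and d: "y ^ m = (\<Sum>j<m. of_int (d j) * y ^ j)"
    using algebraic_int_power_basis[OF assms(2)] by blast
  \<comment> \<open>The integer span of the monomials. A single index \<open>k < n * m\<close>
    encodes the exponents as \<open>k div m\<close> and \<open>k mod m\<close>, which is the shape
    of vector that the eigenvector criterion takes.\<close>
  define S where "S = {(\<Sum>k<n*m. of_int (a k) * (x ^ (k div m) * y ^ (k mod m))) | a. True}"
  have S_add: "u + w \<in> S" if uw: "u \<in> S" "w \<in> S" for u w
  proof -
    obtain a where a: "u = (\<Sum>k<n*m. of_int (a k) * (x ^ (k div m) * y ^ (k mod m)))"
      using uw(1) unfolding S_def by blast
    obtain b where b: "w = (\<Sum>k<n*m. of_int (b k) * (x ^ (k div m) * y ^ (k mod m)))"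
      using uw(2) unfolding S_def by blast
    have "u + w = (\<Sum>k<n*m. of_int (a k + b k) * (x ^ (k div m) * y ^ (k mod m)))"
      by (simp add: a b sum.distrib algebra_simps)
    then show ?thesis unfolding S_def mem_Collect_eq by (intro exI[of _ "\<lambda>k. a k + b k"]) simp
  qed
  have S_scale: "of_int t * u \<in> S" if u: "u \<in> S" for u t
  proof -
    obtain a where a: "u = (\<Sum>k<n*m. of_int (a k) * (x ^ (k div m) * y ^ (k mod m)))"
      using u unfolding S_def by blast
    have "of_int t * u = (\<Sum>k<n*m. of_int (t * a k) * (x ^ (k div m) * y ^ (k mod m)))"
      by (simp add: a sum_distrib_left algebra_simps)
    then show ?thesis unfolding S_def mem_Collect_eq by (intro exI[of _ "\<lambda>k. t * a k"]) simp
  qed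
  have S_zero: "0 \<in> S" unfolding S_def mem_Collect_eq by (intro exI[of _ "\<lambda>k. 0"]) simp
  have S_sum: "(\<Sum>k\<in>I. of_int (t k) * u k) \<in> S" if "\<And>k. k \<in> I \<Longrightarrow> u k \<in> S" for I :: "nat set" and t u
    using that by (induction I rule: infinite_finite_induct) (auto simp: S_zero S_add S_scale)
  have basis: "x ^ i * y ^ j \<in> S" if ij: "i < n" "j < m" for i j
  proof -
    define k0 where "k0 = i * m + j"
    have k0: "k0 < n * m" "k0 div m = i" "k0 mod m = j"
    proof -
      have "k0 < (i + 1) * m" using ij by (simp add: k0_def)
      also have "\<dots> \<le> n * m" using ij by (intro mult_le_mono1) simp
      finally show "k0 < n * m" .
    qed (use ij in \<open>simp_all add: k0_def\<close>)
    have "x ^ i * y ^ j = (\<Sum>k<n*m. of_int (if k = k0 then 1 else 0) * (x ^ (k div m) * y ^ (k mod m)))"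
      using k0 by (simp add: if_distrib[of of_int] if_distrib[of "\<lambda>u. u * _"] cong: if_cong)
    then show ?thesis unfolding S_def mem_Collect_eq
      by (intro exI[of _ "\<lambda>k. if k = k0 then 1 else 0"]) simp
  qed
  have mx: "x * (x ^ i * y ^ j) \<in> S" if ij: "i < n" "j < m" for i j
  proof (cases "Suc i < n")
    case True
    then show ?thesis using basis[of "Suc i" j] ij by (simp add: mult.assoc)
  next
    case False
    hence "Suc i = n" using ij by simp
    hence "x * (x ^ i * y ^ j) = x ^ n * y ^ j" by (metis mult.assoc power_Suc)
    also have "\<dots> = (\<Sum>k<n. of_int (c k) * (x ^ k * y ^ j))"
      by (simp add: c sum_distrib_right mult.assoc)
    also have "\<dots> \<in> S" using ij by (intro S_sum basis) auto
    finally show ?thesis .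
  qed
  have my: "y * (x ^ i * y ^ j) \<in> S" if ij: "i < n" "j < m" for i j
  proof (cases "Suc j < m")
    case True
    then show ?thesis using basis[of i "Suc j"] ij by (simp add: algebra_simps)
  next
    case False
    hence "Suc j = m" using ij by simp
    hence "y * (x ^ i * y ^ j) = x ^ i * y ^ m" by (metis mult.left_commute power_Suc)
    also have "\<dots> = (\<Sum>k<m. of_int (d k) * (x ^ i * y ^ k))"
      by (simp add: d sum_distrib_left algebra_simps)
    also have "\<dots> \<in> S" using ij by (intro S_sum basis) auto
    finally show ?thesis .
  qed
  have comb: "x * u \<in> S" "y * u \<in> S" if u: "u \<in> S" for u
  proof -
    obtain a where a: "u = (\<Sum>k<n*m. of_int (a k) * (x ^ (k div m) * y ^ (k mod m)))"
      using u unfolding S_def by blast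
    have *: "k div m < n" "k mod m < m" if "k < n * m" for k
      using that m by (auto simp: less_mult_imp_div_less)
    have "x * u = (\<Sum>k<n*m. of_int (a k) * (x * (x ^ (k div m) * y ^ (k mod m))))"
      by (simp add: a sum_distrib_left algebra_simps)
    also have "\<dots> \<in> S" using * by (intro S_sum mx) auto
    finally show "x * u \<in> S" .
    have "y * u = (\<Sum>k<n*m. of_int (a k) * (y * (x ^ (k div m) * y ^ (k mod m))))"
      by (simp add: a sum_distrib_left algebra_simps)
    also have "\<dots> \<in> S" using * by (intro S_sum my) auto
    finally show "y * u \<in> S" .
  qed
  have zS: "z * u \<in> S" if u: "u \<in> S" for u
    using z comb[OF u] comb(1)[OF comb(2)[OF u]] S_add[of "x * u" "y * u"]
    by (auto simp: algebra_simps)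
  define v where "v k = x ^ (k div m) * y ^ (k mod m)" for k
  have "\<forall>k<n*m. \<exists>a. z * v k = (\<Sum>j<n*m. of_int (a j) * v j)"
  proof (intro allI impI)
    fix k assume "k < n * m"
    hence "v k \<in> S" unfolding v_def using m by (intro basis) (auto simp: less_mult_imp_div_less)
    from zS[OF this] show "\<exists>a. z * v k = (\<Sum>j<n*m. of_int (a j) * v j)"
      unfolding S_def v_def by simp
  qed
  then obtain a where a: "\<And>k. k < n * m \<Longrightarrow> z * v k = (\<Sum>j<n*m. of_int (a k j) * v j)"
    by metis
  have "\<exists>k<n*m. v k \<noteq> 0"
    using n m by (intro exI[of _ 0]) (auto simp: v_def)
  with a show ?thesis by (intro algebraic_int_of_integer_eigenvector[of "n*m" v z a]) auto
qed

lemma algebraic_int_add: "algebraic_int x \<Longrightarrow> algebraic_int y \<Longrightarrow> algebraic_int (x + y :: complex)"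
  using algebraic_int_combine by blast

lemma algebraic_int_mult: "algebraic_int x \<Longrightarrow> algebraic_int y \<Longrightarrow> algebraic_int (x * y :: complex)"
  using algebraic_int_combine by blast

lemma algebraic_int_diff: "algebraic_int x \<Longrightarrow> algebraic_int y \<Longrightarrow> algebraic_int (x - y :: complex)"
  using algebraic_int_add[of x "- y"] by simp

lemma algebraic_int_sum: "(\<And>i. i \<in> I \<Longrightarrow> algebraic_int (f i)) \<Longrightarrow> algebraic_int (\<Sum>i\<in>I. f i :: complex)"
  by (induction I rule: infinite_finite_induct) (auto intro: algebraic_int_add)

lemma algebraic_int_prod: "(\<And>i. i \<in> I \<Longrightarrow> algebraic_int (f i)) \<Longrightarrow> algebraic_int (\<Prod>i\<in>I. f i :: complex)"
  by (induction I rule: infinite_finite_induct) (auto intro: algebraic_int_mult)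

lemma algebraic_int_power: "algebraic_int x \<Longrightarrow> algebraic_int (x ^ n :: complex)"
  by (induction n) (auto intro: algebraic_int_mult)

text \<open>Clearing the leading coefficient \<open>D\<close> of an integer polynomial makes \<open>D * x\<close> integral.\<close>
lemma algebraic_imp_integer_multiple:
  fixes x :: complex
  assumes "algebraic x"
  obtains D :: int where "D > 0" "algebraic_int (of_int D * x)"
proof -
  obtain p where p: "\<forall>i. poly.coeff p i \<in> \<int>" "p \<noteq> 0" "poly p x = 0"
    using assms by (auto elim: algebraicE)
  define n where "n = Polynomial.degree p"
  have "\<forall>i. \<exists>k. poly.coeff p i = of_int k"
    using p(1) by (auto elim: Ints_cases)
  then obtain a where a: "\<And>i. poly.coeff p i = of_int (a i)"
    by metis
  have n: "n > 0"
  proof (rule ccontr)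
    assume "\<not> n > 0"
    then obtain c where "p = [:c:]" using degree_eq_zeroE[of p] unfolding n_def by auto
    then show False using p by simp
  qed
  define D where "D = a n"
  have D0: "D \<noteq> 0" using p(2) a[of n] by (auto simp: D_def n_def)
  have 0: "of_int D * x ^ n = (\<Sum>j<n. of_int (- a j) * x ^ j)"
  proof -
    have "0 = (\<Sum>j\<le>n. of_int (a j) * x ^ j)" using p(3) by (simp add: poly_altdef n_def a)
    also have "\<dots> = (\<Sum>j<n. of_int (a j) * x ^ j) + of_int D * x ^ n"
      by (simp add: D_def lessThan_Suc_atMost[symmetric])
    finally show ?thesis by (simp add: sum_negf eq_neg_iff_add_eq_0 add.commute)
  qed
  \<comment> \<open>This is D^(n - 1) p(X / D): the top coefficient D cancels to 1, and every lower
    coefficient stays integral.\<close>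
  define q where "q = Polynomial.monom 1 n + (\<Sum>j<n. Polynomial.monom (a j * D ^ (n - 1 - j)) j)"
  have cq: "poly.coeff q i = (if i = n then 1 else if i < n then a i * D ^ (n - 1 - i) else 0)" for i
    by (simp add: q_def coeff_sum)
  have "Polynomial.degree q = n"
    using degree_le[of n q] le_degree[of q n] by (simp add: cq)
  hence lq: "Polynomial.lead_coeff q = 1" by (simp add: cq)
  have "poly (map_poly of_int q) (of_int D * x) =
     (of_int D * x) ^ n + (\<Sum>j<n. of_int (a j * D ^ (n - 1 - j)) * (of_int D * x) ^ j)"
    using \<open>Polynomial.degree q = n\<close> by (simp add: poly_altdef cq lessThan_Suc_atMost[symmetric])
  also have "(\<Sum>j<n. of_int (a j * D ^ (n - 1 - j)) * (of_int D * x) ^ j) =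
     of_int D ^ (n - 1) * (\<Sum>j<n. of_int (a j) * x ^ j)"
    unfolding sum_distrib_left
  proof (intro sum.cong refl)
    fix j assume "j \<in> {..<n}"
    hence "of_int D ^ (n - 1) = (of_int D ^ (n - 1 - j) * of_int D ^ j :: complex)"
      by (simp flip: power_add)
    thus "of_int (a j * D ^ (n - 1 - j)) * (of_int D * x) ^ j =
      of_int D ^ (n - 1) * (of_int (a j) * x ^ j)" by (simp add: power_mult_distrib)
  qed
  also have "(\<Sum>j<n. of_int (a j) * x ^ j) = - (of_int D * x ^ n)"
    by (simp add: 0 sum_negf)
  also have "(of_int D * x) ^ n = of_int D ^ (n - 1) * (of_int D * x ^ n)"
    using n by (cases n) (auto simp: power_mult_distrib)
  finally have "algebraic_int (of_int D * x)"
    unfolding algebraic_int_altdef_ipoly using lq by (intro exI[of _ q]) auto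
  moreover from this have "algebraic_int (of_int \<bar>D\<bar> * x)" by (cases "D \<ge> 0") auto
  ultimately show ?thesis using D0 that[of "\<bar>D\<bar>"] by auto
qed

lemma algebraic_of_integer_multiple:
  fixes x :: complex
  assumes "D \<noteq> 0" "algebraic_int (of_int D * x)"
  shows "algebraic x"
proof -
  obtain p where p: "Polynomial.lead_coeff p = 1" "\<forall>i. poly.coeff p i \<in> \<int>" "poly p (of_int D * x) = 0"
    using assms(2) by (auto simp: algebraic_int.simps)
  define q where "q = p \<circ>\<^sub>p [:0, of_int D:]"
  have "poly q x = 0" using p(3) by (simp add: q_def poly_pcompose mult.commute)
  moreover have "q \<noteq> 0"
    using p(1) assms(1) by (auto simp: q_def pcompose_eq_0_iff)
  moreover have "poly.coeff q i \<in> \<int>" for i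
    unfolding q_def coeff_pcompose_linear using p(2) by auto
  ultimately show ?thesis by (intro algebraicI[of q]) auto
qed

lemma algebraic_add: "algebraic x \<Longrightarrow> algebraic y \<Longrightarrow> algebraic (x + y :: complex)"
proof -
  assume "algebraic x" "algebraic y"
  then obtain D E :: int where DE: "D > 0" "algebraic_int (of_int D * x)" "E > 0" "algebraic_int (of_int E * y)"
    by (meson algebraic_imp_integer_multiple)
  have "algebraic_int (of_int E * (of_int D * x) + of_int D * (of_int E * y))"
    by (intro algebraic_int_add algebraic_int_mult[OF _ DE(2)] algebraic_int_mult[OF _ DE(4)]) auto
  also have "of_int E * (of_int D * x) + of_int D * (of_int E * y) = of_int (D * E) * (x + y)"
    by (simp add: algebra_simps)
  finally show ?thesis using DE by (intro algebraic_of_integer_multiple[of "D * E"]) auto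
qed

lemma algebraic_mult: "algebraic x \<Longrightarrow> algebraic y \<Longrightarrow> algebraic (x * y :: complex)"
proof -
  assume "algebraic x" "algebraic y"
  then obtain D E :: int where DE: "D > 0" "algebraic_int (of_int D * x)" "E > 0" "algebraic_int (of_int E * y)"
    by (meson algebraic_imp_integer_multiple)
  have "algebraic_int ((of_int D * x) * (of_int E * y))"
    by (rule algebraic_int_mult[OF DE(2) DE(4)])
  also have "(of_int D * x) * (of_int E * y) = of_int (D * E) * (x * y)"
    by (simp add: algebra_simps)
  finally show ?thesis using DE by (intro algebraic_of_integer_multiple[of "D * E"]) auto
qed

section \<open>Galois theory of subfields of the complex numbers\<close>

text \<open>Subfields are plain sets of complex numbers, so that minimality can quantify over them
  and elements keep the ordinary arithmetic. As \<open>inverse 0 = 0\<close>, closure under inverses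
  needs no exception at zero.\<close>

definition is_subfield :: "complex set \<Rightarrow> bool" where
  "is_subfield K \<longleftrightarrow> 1 \<in> K \<and> (\<forall>x\<in>K. \<forall>y\<in>K. x - y \<in> K \<and> x * y \<in> K) \<and> (\<forall>x\<in>K. inverse x \<in> K)"

text \<open>An embedding of \<open>K\<close> into the complex numbers: its values may leave
  \<open>K\<close>, and nothing is said about its behaviour off \<open>K\<close>.\<close>

definition subfield_hom :: "complex set \<Rightarrow> (complex \<Rightarrow> complex) \<Rightarrow> bool" where
  "subfield_hom K \<sigma> \<longleftrightarrow> \<sigma> 1 = 1 \<and> (\<forall>x\<in>K. \<forall>y\<in>K. \<sigma> (x + y) = \<sigma> x + \<sigma> y \<and> \<sigma> (x * y) = \<sigma> x * \<sigma> y)"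

definition coeffs_in :: "complex set \<Rightarrow> complex poly \<Rightarrow> bool" where
  "coeffs_in K p \<longleftrightarrow> (\<forall>i. poly.coeff p i \<in> K)"

lemma map_poly_pCons_0: "h 0 = 0 \<Longrightarrow> map_poly h (pCons a p) = pCons (h a) (map_poly h p)"
  by (intro poly_eqI) (simp add: coeff_map_poly coeff_pCons split: nat.splits)

section \<open>Arithmetic in a subfield and polynomials with coefficients in it\<close>

context
  fixes K :: "complex set"
  assumes K: "is_subfield K"
begin

lemma subfield_1: "1 \<in> K"
  and subfield_diff: "x \<in> K \<Longrightarrow> y \<in> K \<Longrightarrow> x - y \<in> K"
  and subfield_mult: "x \<in> K \<Longrightarrow> y \<in> K \<Longrightarrow> x * y \<in> K"
  and subfield_inverse: "x \<in> K \<Longrightarrow> inverse x \<in> K"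
  using K by (auto simp: is_subfield_def)

lemma subfield_0: "0 \<in> K"
  using subfield_diff[OF subfield_1 subfield_1] by simp

lemma subfield_uminus: "x \<in> K \<Longrightarrow> - x \<in> K"
  using subfield_diff[OF subfield_0, of x] by simp

lemma subfield_add: "x \<in> K \<Longrightarrow> y \<in> K \<Longrightarrow> x + y \<in> K"
  using subfield_diff[of x "- y"] subfield_uminus[of y] by simp

lemma subfield_divide: "x \<in> K \<Longrightarrow> y \<in> K \<Longrightarrow> x / y \<in> K"
  by (simp add: divide_inverse subfield_mult subfield_inverse)

lemma subfield_sum: "(\<And>i. i \<in> I \<Longrightarrow> f i \<in> K) \<Longrightarrow> (\<Sum>i\<in>I. f i) \<in> K"
  by (induction I rule: infinite_finite_induct) (auto intro: subfield_0 subfield_add)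

lemma subfield_prod: "(\<And>i. i \<in> I \<Longrightarrow> f i \<in> K) \<Longrightarrow> (\<Prod>i\<in>I. f i) \<in> K"
  by (induction I rule: infinite_finite_induct) (auto intro: subfield_1 subfield_mult)

lemma subfield_power: "x \<in> K \<Longrightarrow> x ^ n \<in> K"
  by (induction n) (auto intro: subfield_1 subfield_mult)

lemma subfield_of_nat: "of_nat n \<in> K"
  by (induction n) (auto intro: subfield_0 subfield_add subfield_1)

lemma subfield_of_int: "of_int n \<in> K"
  by (cases n rule: int_cases2) (auto intro: subfield_of_nat subfield_uminus)

lemma subfield_Rats: "x \<in> \<rat> \<Longrightarrow> x \<in> K"
  by (elim Rats_cases') (simp add: subfield_divide subfield_of_int)

lemma subfield_poly: "coeffs_in K p \<Longrightarrow> x \<in> K \<Longrightarrow> poly p x \<in> K"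
  unfolding poly_altdef coeffs_in_def by (intro subfield_sum subfield_mult subfield_power) auto

lemma coeffs_in_arith:
  "coeffs_in K 0" "coeffs_in K 1" "coeffs_in K p \<Longrightarrow> coeffs_in K q \<Longrightarrow> coeffs_in K (p + q)"
  "coeffs_in K p \<Longrightarrow> coeffs_in K q \<Longrightarrow> coeffs_in K (p - q)"
  "coeffs_in K p \<Longrightarrow> coeffs_in K q \<Longrightarrow> coeffs_in K (p * q)"
  "c \<in> K \<Longrightarrow> coeffs_in K (Polynomial.monom c n)"
  "c \<in> K \<Longrightarrow> coeffs_in K p \<Longrightarrow> coeffs_in K (pCons c p)"
  "coeffs_in K p \<Longrightarrow> coeffs_in K (pderiv p)"
  "c \<in> K \<Longrightarrow> coeffs_in K p \<Longrightarrow> coeffs_in K (Polynomial.smult c p)"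
  by (auto simp: coeffs_in_def coeff_mult coeff_pderiv coeff_pCons
      intro!: subfield_0 subfield_1 subfield_add subfield_diff subfield_sum subfield_mult subfield_of_nat split: nat.splits)

lemma coeffs_in_prod: "(\<And>i. i \<in> I \<Longrightarrow> coeffs_in K (f i)) \<Longrightarrow> coeffs_in K (\<Prod>i\<in>I. f i)"
  by (induction I rule: infinite_finite_induct) (auto intro: coeffs_in_arith)

lemma coeffs_in_sum: "(\<And>i. i \<in> I \<Longrightarrow> coeffs_in K (f i)) \<Longrightarrow> coeffs_in K (\<Sum>i\<in>I. f i)"
  by (induction I rule: infinite_finite_induct) (auto intro: coeffs_in_arith)

text \<open>Long division. As \<mu> is monic, each step subtracts \<mu> times a monomial whose
  coefficient is the leading coefficient of what is left of \<open>p\<close>, so quotient and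
  remainder keep their coefficients in \<open>K\<close>.\<close>

lemma coeffs_in_division:
  assumes p: "coeffs_in K p" and \<mu>: "coeffs_in K \<mu>" and m1: "Polynomial.lead_coeff \<mu> = 1"
  shows "\<exists>s t. coeffs_in K s \<and> coeffs_in K t \<and> p = \<mu> * s + t \<and> (t = 0 \<or> Polynomial.degree t < Polynomial.degree \<mu>)"
  using p
proof (induction "Polynomial.degree p" arbitrary: p rule: less_induct)
  case less
  show ?case
  proof (cases "p = 0 \<or> Polynomial.degree p < Polynomial.degree \<mu>")
    case True
    with less.prems show ?thesis by (intro exI[of _ 0] exI[of _ p]) (auto intro: coeffs_in_arith)
  next
    case False
    define a where "a = Polynomial.monom (Polynomial.lead_coeff p) (Polynomial.degree p - Polynomial.degree \<mu>)"
    have a: "coeffs_in K a" unfolding a_def using less.prems by (intro coeffs_in_arith) (auto simp: coeffs_in_def)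
    have a0: "a \<noteq> 0" using False by (simp add: a_def)
    have \<mu>0: "\<mu> \<noteq> 0" using m1 by auto
    define r where "r = p - \<mu> * a"
    have r: "coeffs_in K r" unfolding r_def by (intro coeffs_in_arith less.prems \<mu> a)
    have deg: "Polynomial.degree (\<mu> * a) = Polynomial.degree p"
      using False a0 \<mu>0 by (simp add: degree_mult_eq a_def degree_monom_eq)
    have lc: "Polynomial.lead_coeff (\<mu> * a) = Polynomial.lead_coeff p"
      using m1 False by (simp add: lead_coeff_mult a_def degree_monom_eq)
    show ?thesis
    proof (cases "r = 0")
      case True
      then show ?thesis using a by (intro exI[of _ a] exI[of _ 0]) (auto simp: r_def intro: coeffs_in_arith)
    next
      case rn: False
      have "Polynomial.degree r \<le> Polynomial.degree p"
        unfolding r_def using deg by (intro degree_diff_le) auto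
      moreover have "poly.coeff r (Polynomial.degree p) = 0"
        using lc deg by (simp add: r_def)
      ultimately have "Polynomial.degree r < Polynomial.degree p"
        using rn by (metis leading_coeff_0_iff order_le_less)
      from less.hyps[OF this r] obtain s t where st: "coeffs_in K s" "coeffs_in K t" "r = \<mu> * s + t"
        "t = 0 \<or> Polynomial.degree t < Polynomial.degree \<mu>" by blast
      have "p = \<mu> * (s + a) + t" using st(3) by (simp add: r_def algebra_simps)
      with st a show ?thesis by (intro exI[of _ "s + a"] exI[of _ t]) (auto intro: coeffs_in_arith)
    qed
  qed
qed

end

section \<open>Field homomorphisms from a subfield into the complex numbers\<close>

context
  fixes K :: "complex set" and \<sigma> :: "complex \<Rightarrow> complex"
  assumes K: "is_subfield K" and \<sigma>: "subfield_hom K \<sigma>"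
begin

lemma hom_1: "\<sigma> 1 = 1" and hom_add: "x \<in> K \<Longrightarrow> y \<in> K \<Longrightarrow> \<sigma> (x + y) = \<sigma> x + \<sigma> y"
  and hom_mult: "x \<in> K \<Longrightarrow> y \<in> K \<Longrightarrow> \<sigma> (x * y) = \<sigma> x * \<sigma> y"
  using \<sigma> by (auto simp: subfield_hom_def)

lemma hom_0: "\<sigma> 0 = 0"
  using hom_add[OF subfield_0[OF K] subfield_0[OF K]] by simp

lemma hom_uminus: "x \<in> K \<Longrightarrow> \<sigma> (- x) = - \<sigma> x"
  using hom_add[OF subfield_uminus[OF K] , of x x] hom_0 by (simp add: eq_neg_iff_add_eq_0)

lemma hom_diff: "x \<in> K \<Longrightarrow> y \<in> K \<Longrightarrow> \<sigma> (x - y) = \<sigma> x - \<sigma> y"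
  using hom_add[OF _ subfield_uminus[OF K], of x y] by (simp add: hom_uminus)

lemma hom_eq_0_iff: "x \<in> K \<Longrightarrow> \<sigma> x = 0 \<longleftrightarrow> x = 0"
  using hom_mult[OF _ subfield_inverse[OF K], of x x] hom_0 hom_1 by (cases "x = 0") auto

lemma hom_inj: "inj_on \<sigma> K"
  using hom_eq_0_iff[OF subfield_diff[OF K]] by (intro inj_onI) (auto simp: hom_diff)

lemma hom_inverse: "x \<in> K \<Longrightarrow> \<sigma> (inverse x) = inverse (\<sigma> x)"
proof (cases "x = 0")
  case False
  assume x: "x \<in> K"
  have "\<sigma> x * \<sigma> (inverse x) = 1"
    using hom_mult[OF x subfield_inverse[OF K x]] False by (simp add: hom_1)
  then show ?thesis by (simp add: inverse_unique)
qed (simp add: hom_0)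

lemma hom_sum: "(\<And>i. i \<in> I \<Longrightarrow> f i \<in> K) \<Longrightarrow> \<sigma> (\<Sum>i\<in>I. f i) = (\<Sum>i\<in>I. \<sigma> (f i))"
  by (induction I rule: infinite_finite_induct) (auto simp: hom_0 hom_add subfield_sum[OF K])

lemma hom_prod: "(\<And>i. i \<in> I \<Longrightarrow> f i \<in> K) \<Longrightarrow> \<sigma> (\<Prod>i\<in>I. f i) = (\<Prod>i\<in>I. \<sigma> (f i))"
  by (induction I rule: infinite_finite_induct) (auto simp: hom_1 hom_mult subfield_prod[OF K])

lemma hom_power: "x \<in> K \<Longrightarrow> \<sigma> (x ^ n) = \<sigma> x ^ n"
  by (induction n) (auto simp: hom_1 hom_mult subfield_power[OF K])

lemma hom_of_nat: "\<sigma> (of_nat n) = of_nat n"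
  by (induction n) (auto simp: hom_0 hom_1 hom_add subfield_of_nat[OF K] subfield_1[OF K])

lemma hom_of_int: "\<sigma> (of_int n) = of_int n"
  by (cases n rule: int_cases2) (auto simp: hom_of_nat hom_uminus subfield_of_nat[OF K])

lemma hom_Rats: "x \<in> \<rat> \<Longrightarrow> \<sigma> x = x"
  by (elim Rats_cases') (simp add: divide_inverse hom_mult hom_inverse hom_of_int
      subfield_of_int[OF K] subfield_inverse[OF K])

lemma coeff_map_hom: "poly.coeff (map_poly \<sigma> p) i = \<sigma> (poly.coeff p i)"
  by (simp add: coeff_map_poly hom_0)

lemma map_hom_add: "coeffs_in K p \<Longrightarrow> coeffs_in K q \<Longrightarrow> map_poly \<sigma> (p + q) = map_poly \<sigma> p + map_poly \<sigma> q"
  by (intro poly_eqI) (simp add: coeff_map_hom hom_add coeffs_in_def)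

lemma map_hom_mult: "coeffs_in K p \<Longrightarrow> coeffs_in K q \<Longrightarrow> map_poly \<sigma> (p * q) = map_poly \<sigma> p * map_poly \<sigma> q"
  by (intro poly_eqI) (simp add: coeff_map_hom coeff_mult hom_sum hom_mult coeffs_in_def subfield_mult[OF K])

lemma hom_poly:
  assumes "coeffs_in K p" "x \<in> K"
  shows "\<sigma> (poly p x) = poly (map_poly \<sigma> p) (\<sigma> x)"
  using assms(1)
proof (induction p)
  case (pCons a q)
  have "coeffs_in K q" unfolding coeffs_in_def
  proof
    fix i show "poly.coeff q i \<in> K"
      using pCons.prems unfolding coeffs_in_def by (metis coeff_pCons_Suc)
  qed
  moreover have "a \<in> K"
    using pCons.prems unfolding coeffs_in_def by (metis coeff_pCons_0)
  ultimately show ?case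
    using pCons.IH assms(2)
    by (simp add: hom_add hom_mult map_poly_pCons_0 hom_0 subfield_mult[OF K] subfield_poly[OF K])
qed (simp add: hom_0)

end

text \<open>For algebraic nonzero x an integral relation a + x q(x) = 0 with a nonzero gives 1/x = -
  q(x)/a, a polynomial in x. Hence a ring of algebraic numbers containing the rationals is a
  field.\<close>

lemma is_subfieldI_algebraic:
  assumes Rats: "\<rat> \<subseteq> S" and diff: "\<And>x y. x \<in> S \<Longrightarrow> y \<in> S \<Longrightarrow> x - y \<in> S"
    and mult: "\<And>x y. x \<in> S \<Longrightarrow> y \<in> S \<Longrightarrow> x * y \<in> S"
    and alg: "\<And>x. x \<in> S \<Longrightarrow> algebraic x"
  shows "is_subfield S"
  unfolding is_subfield_def
proof (intro conjI ballI)
  show "1 \<in> S" using Rats by auto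
  fix x assume x: "x \<in> S"
  have zero: "0 \<in> S" using Rats by auto
  have add: "u + w \<in> S" if "u \<in> S" "w \<in> S" for u w
    using diff[OF that(1) diff[OF zero that(2)]] by simp
  have poly: "poly p x \<in> S" if "\<And>i. poly.coeff p i \<in> \<rat>" for p
    using that
  proof (induction p)
    case (pCons a q)
    have "poly.coeff q i \<in> \<rat>" for i using pCons.prems[of "Suc i"] by simp
    moreover have "a \<in> \<rat>" using pCons.prems[of 0] by simp
    ultimately show ?case using pCons.IH Rats x by (auto intro!: add mult)
  qed (simp add: zero)
  show "inverse x \<in> S"
  proof (cases "x = 0")
    case False
    from algebraicE'_nonzero[OF alg[OF x] False] obtain p where
      p: "p \<noteq> 0" "poly.coeff p 0 \<noteq> 0" "poly (map_poly of_int p) x = 0" by blast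
    obtain a q where pq: "p = pCons a q" by (cases p) auto
    define w where "w = Polynomial.smult (- inverse (of_int a)) (map_poly of_int q :: complex poly)"
    have "of_int a + x * poly (map_poly of_int q) x = 0"
      using p(3) by (simp add: pq map_poly_pCons_0)
    hence "x * poly (map_poly of_int q) x = - of_int a"
      by (simp add: add_eq_0_iff)
    moreover have "a \<noteq> 0" using p(2) by (simp add: pq)
    ultimately have "x * poly w x = 1" by (simp add: w_def field_simps)
    hence "inverse x = poly w x" by (rule inverse_unique)
    also have "\<dots> \<in> S" by (rule poly) (auto simp: w_def)
    finally show ?thesis .
  qed (simp add: zero)
qed (use diff mult in auto)

lemma is_subfield_Rats: "is_subfield \<rat>"
  by (auto simp: is_subfield_def)

text \<open>Minimal polynomial and extension theorem in one statement, because it has two uses: with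
  an arbitrary root \<beta> it extends a homomorphism, and with a root other than \<alpha> it moves
  \<alpha>. The closing clause says that \<open>K'\<close> is the least subfield containing
  \<open>K\<close> and \<alpha>; it later identifies the top of a tower of such extensions with the
  splitting field.\<close>

lemma simple_extension:
  assumes K: "is_subfield K" and algK: "\<forall>x\<in>K. algebraic x"
    and \<alpha>: "algebraic \<alpha>"
  shows "\<exists>\<mu>. coeffs_in K \<mu> \<and> Polynomial.lead_coeff \<mu> = 1 \<and> poly \<mu> \<alpha> = 0 \<and>
    (\<forall>p. coeffs_in K p \<longrightarrow> p \<noteq> 0 \<longrightarrow> poly p \<alpha> = 0 \<longrightarrow> Polynomial.degree \<mu> \<le> Polynomial.degree p) \<and>
    (\<forall>\<sigma> \<beta>. subfield_hom K \<sigma> \<longrightarrow> poly (map_poly \<sigma> \<mu>) \<beta> = 0 \<longrightarrow>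
      (\<exists>K' \<sigma>'. is_subfield K' \<and> K \<subseteq> K' \<and> \<alpha> \<in> K' \<and> (\<forall>x\<in>K'. algebraic x) \<and> subfield_hom K' \<sigma>' \<and>
        (\<forall>x\<in>K. \<sigma>' x = \<sigma> x) \<and> \<sigma>' \<alpha> = \<beta> \<and> (\<forall>E. is_subfield E \<longrightarrow> K \<subseteq> E \<longrightarrow> \<alpha> \<in> E \<longrightarrow> K' \<subseteq> E)))"
proof -
  define P where "P p \<longleftrightarrow> coeffs_in K p \<and> p \<noteq> 0 \<and> poly p \<alpha> = 0" for p
  have "\<exists>p. P p"
  proof -
    obtain p where "p \<noteq> 0" "poly (map_poly of_int p) \<alpha> = 0"
      using algebraicE'[OF \<alpha>] by blast
    then show ?thesis unfolding P_def coeffs_in_def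
      by (intro exI[of _ "map_poly of_int p"]) (auto simp: subfield_of_int[OF K])
  qed
  then obtain \<mu>0 where \<mu>0: "P \<mu>0" and min0: "\<And>p. P p \<Longrightarrow> Polynomial.degree \<mu>0 \<le> Polynomial.degree p"
    using ex_has_least_nat[of P _ Polynomial.degree] by blast
  define \<mu> where "\<mu> = Polynomial.smult (inverse (Polynomial.lead_coeff \<mu>0)) \<mu>0"
  have \<mu>: "coeffs_in K \<mu>" "Polynomial.lead_coeff \<mu> = 1" "poly \<mu> \<alpha> = 0"
    using \<mu>0 unfolding \<mu>_def P_def by (auto simp: coeffs_in_def intro!: subfield_mult[OF K] subfield_inverse[OF K])
  have deg: "Polynomial.degree \<mu> = Polynomial.degree \<mu>0" using \<mu>0 by (simp add: \<mu>_def P_def)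
  have min: "Polynomial.degree \<mu> \<le> Polynomial.degree p" if "coeffs_in K p" "p \<noteq> 0" "poly p \<alpha> = 0" for p
    using min0[of p] that unfolding deg P_def by simp
  have dvd: "\<exists>s. coeffs_in K s \<and> p = \<mu> * s" if p: "coeffs_in K p" "poly p \<alpha> = 0" for p
  proof -
    obtain s t where st: "coeffs_in K s" "coeffs_in K t" "p = \<mu> * s + t"
      "t = 0 \<or> Polynomial.degree t < Polynomial.degree \<mu>"
      using coeffs_in_division[OF K p(1) \<mu>(1,2)] by blast
    have "poly t \<alpha> = 0" using p(2) \<mu>(3) by (simp add: st(3))
    hence "t = 0" using min[OF st(2)] st(4) by linarith
    with st show ?thesis by auto
  qed
  have ext: "\<exists>K' \<sigma>'. is_subfield K' \<and> K \<subseteq> K' \<and> \<alpha> \<in> K' \<and> (\<forall>x\<in>K'. algebraic x) \<and> subfield_hom K' \<sigma>' \<and>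
        (\<forall>x\<in>K. \<sigma>' x = \<sigma> x) \<and> \<sigma>' \<alpha> = \<beta> \<and> (\<forall>E. is_subfield E \<longrightarrow> K \<subseteq> E \<longrightarrow> \<alpha> \<in> E \<longrightarrow> K' \<subseteq> E)"
    if \<sigma>: "subfield_hom K \<sigma>" and \<beta>: "poly (map_poly \<sigma> \<mu>) \<beta> = 0" for \<sigma> \<beta>
  proof -
    define K' where "K' = {poly p \<alpha> | p. coeffs_in K p}"
    \<comment> \<open>Two polynomials over \<open>K\<close> with the same value at \<alpha> differ
      by a multiple of \<mu>, whose image vanishes at \<beta>; so the choice of a representative
      does not affect the value.\<close>
    define \<sigma>' where "\<sigma>' x = poly (map_poly \<sigma> (SOME p. coeffs_in K p \<and> poly p \<alpha> = x)) \<beta>" for x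
    have \<sigma>': "\<sigma>' (poly p \<alpha>) = poly (map_poly \<sigma> p) \<beta>" if p: "coeffs_in K p" for p
    proof -
      define q where "q = (SOME q. coeffs_in K q \<and> poly q \<alpha> = poly p \<alpha>)"
      have q: "coeffs_in K q" "poly q \<alpha> = poly p \<alpha>"
        using someI[of "\<lambda>q. coeffs_in K q \<and> poly q \<alpha> = poly p \<alpha>" p] p unfolding q_def by auto
      have "coeffs_in K (q - p)" "poly (q - p) \<alpha> = 0"
        using p q by (auto intro: coeffs_in_arith[OF K])
      from dvd[OF this] obtain s where s: "coeffs_in K s" "q - p = \<mu> * s" by blast
      from s(2) have "q = p + \<mu> * s" by (simp add: algebra_simps)
      hence "map_poly \<sigma> q = map_poly \<sigma> p + map_poly \<sigma> \<mu> * map_poly \<sigma> s"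
        using p s \<mu> by (simp add: map_hom_add[OF K \<sigma>] map_hom_mult[OF K \<sigma>] coeffs_in_arith[OF K])
      hence "poly (map_poly \<sigma> q) \<beta> = poly (map_poly \<sigma> p) \<beta>" using \<beta> by simp
      then show ?thesis unfolding \<sigma>'_def q_def by simp
    qed
    have const: "coeffs_in K [:c:]" if "c \<in> K" for c
      using that by (intro coeffs_in_arith[OF K])
    have KK': "K \<subseteq> K'" unfolding K'_def using const by (auto intro!: exI[of _ "[:_:]"])
    have X: "coeffs_in K [:0, 1:]"
      by (intro coeffs_in_arith[OF K] subfield_0[OF K] subfield_1[OF K])
    have \<alpha>K': "\<alpha> \<in> K'" unfolding K'_def using X by (auto intro!: exI[of _ "[:0, 1:]"])
    have alg: "algebraic x" if "x \<in> K'" for x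
    proof -
      obtain p where p: "coeffs_in K p" "x = poly p \<alpha>" using \<open>x \<in> K'\<close> unfolding K'_def by blast
      show ?thesis unfolding p(2) using p(1)
      proof (induction p)
        case (pCons a q)
        have "coeffs_in K q" using pCons.prems unfolding coeffs_in_def by (metis coeff_pCons_Suc)
        moreover have "a \<in> K" using pCons.prems unfolding coeffs_in_def by (metis coeff_pCons_0)
        ultimately show ?case using pCons.IH \<alpha> algK by (auto intro!: algebraic_add algebraic_mult)
      qed simp
    qed
    have sub: "is_subfield K'"
    proof (rule is_subfieldI_algebraic)
      show "\<rat> \<subseteq> K'" using subfield_Rats[OF K] KK' by blast
      show "algebraic x" if "x \<in> K'" for x using alg that .
      fix x y assume "x \<in> K'" "y \<in> K'"
      then obtain p q where pq: "coeffs_in K p" "x = poly p \<alpha>" "coeffs_in K q" "y = poly q \<alpha>"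
        unfolding K'_def by blast
      show "x - y \<in> K'" unfolding K'_def using pq coeffs_in_arith(4)[OF K pq(1,3)]
        by (auto intro!: exI[of _ "p - q"])
      show "x * y \<in> K'" unfolding K'_def using pq coeffs_in_arith(5)[OF K pq(1,3)]
        by (auto intro!: exI[of _ "p * q"])
    qed
    have hom: "subfield_hom K' \<sigma>'"
      unfolding subfield_hom_def
    proof (intro conjI ballI)
      have "\<sigma>' (poly 1 \<alpha>) = poly (map_poly \<sigma> 1) \<beta>" by (rule \<sigma>') (rule coeffs_in_arith[OF K])
      then show "\<sigma>' 1 = 1" by (simp add: map_poly_1' hom_1[OF K \<sigma>])
      fix x y assume "x \<in> K'" "y \<in> K'"
      then obtain p q where pq: "coeffs_in K p" "x = poly p \<alpha>" "coeffs_in K q" "y = poly q \<alpha>"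
        unfolding K'_def by blast
      have "\<sigma>' (poly (p + q) \<alpha>) = poly (map_poly \<sigma> (p + q)) \<beta>"
        by (rule \<sigma>') (rule coeffs_in_arith(3)[OF K pq(1,3)])
      then show "\<sigma>' (x + y) = \<sigma>' x + \<sigma>' y"
        using pq by (simp add: \<sigma>' map_hom_add[OF K \<sigma>])
      have "\<sigma>' (poly (p * q) \<alpha>) = poly (map_poly \<sigma> (p * q)) \<beta>"
        by (rule \<sigma>') (rule coeffs_in_arith(5)[OF K pq(1,3)])
      then show "\<sigma>' (x * y) = \<sigma>' x * \<sigma>' y"
        using pq by (simp add: \<sigma>' map_hom_mult[OF K \<sigma>])
    qed
    have res: "\<sigma>' x = \<sigma> x" if "x \<in> K" for x
      using \<sigma>'[OF const[OF that]] by (simp add: map_poly_pCons_0 hom_0[OF K \<sigma>])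
    have "\<sigma>' \<alpha> = \<beta>"
      using \<sigma>'[OF X] by (simp add: map_poly_pCons_0 hom_0[OF K \<sigma>] hom_1[OF K \<sigma>])
    moreover have "K' \<subseteq> E" if E: "is_subfield E" "K \<subseteq> E" "\<alpha> \<in> E" for E
    proof
      fix x assume "x \<in> K'"
      then obtain p where p: "coeffs_in K p" "x = poly p \<alpha>" unfolding K'_def by blast
      have "coeffs_in E p" using p(1) E(2) by (auto simp: coeffs_in_def)
      then show "x \<in> E" using subfield_poly[OF E(1) _ E(3)] p(2) by simp
    qed
    ultimately show ?thesis using sub KK' \<alpha>K' alg hom res
      by (intro exI[of _ K'] exI[of _ \<sigma>']) simp
  qed
  show ?thesis
    by (intro exI[of _ \<mu>] conjI allI impI \<mu> min ext)
qed

text \<open>The elements are adjoined one at a time. Since the complex field is algebraically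
  closed, the image of the next minimal polynomial always has a root to which the new element can be
  sent.\<close>

lemma finite_extension:
  assumes "finite T" "\<forall>x\<in>T. algebraic x"
    and "is_subfield K" "\<forall>x\<in>K. algebraic x" "subfield_hom K \<sigma>"
  shows "\<exists>K' \<sigma>'. is_subfield K' \<and> K \<subseteq> K' \<and> T \<subseteq> K' \<and> (\<forall>x\<in>K'. algebraic x) \<and> subfield_hom K' \<sigma>' \<and>
        (\<forall>x\<in>K. \<sigma>' x = \<sigma> x) \<and> (\<forall>E. is_subfield E \<longrightarrow> K \<subseteq> E \<longrightarrow> T \<subseteq> E \<longrightarrow> K' \<subseteq> E)"
  using assms
proof (induction T rule: finite_induct)
  case empty
  then show ?case by (intro exI[of _ K] exI[of _ \<sigma>]) auto
next
  case (insert \<alpha> T)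
  have "\<exists>K' \<sigma>'. is_subfield K' \<and> K \<subseteq> K' \<and> T \<subseteq> K' \<and> (\<forall>x\<in>K'. algebraic x) \<and> subfield_hom K' \<sigma>' \<and>
        (\<forall>x\<in>K. \<sigma>' x = \<sigma> x) \<and> (\<forall>E. is_subfield E \<longrightarrow> K \<subseteq> E \<longrightarrow> T \<subseteq> E \<longrightarrow> K' \<subseteq> E)"
    using insert.IH insert.prems by blast
  then obtain K1 \<sigma>1 where 1: "is_subfield K1" "K \<subseteq> K1" "T \<subseteq> K1" "\<forall>x\<in>K1. algebraic x" "subfield_hom K1 \<sigma>1"
      "\<forall>x\<in>K. \<sigma>1 x = \<sigma> x" "\<forall>E. is_subfield E \<longrightarrow> K \<subseteq> E \<longrightarrow> T \<subseteq> E \<longrightarrow> K1 \<subseteq> E"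
    by (elim exE conjE) (rule that; assumption)
  have alg\<alpha>: "algebraic \<alpha>" using insert.prems(1) by simp
  obtain \<mu> where \<mu>: "coeffs_in K1 \<mu>" "Polynomial.lead_coeff \<mu> = 1" "poly \<mu> \<alpha> = 0"
    and ext: "\<forall>\<sigma> \<beta>. subfield_hom K1 \<sigma> \<longrightarrow> poly (map_poly \<sigma> \<mu>) \<beta> = 0 \<longrightarrow>
      (\<exists>K' \<sigma>'. is_subfield K' \<and> K1 \<subseteq> K' \<and> \<alpha> \<in> K' \<and> (\<forall>x\<in>K'. algebraic x) \<and> subfield_hom K' \<sigma>' \<and>
        (\<forall>x\<in>K1. \<sigma>' x = \<sigma> x) \<and> \<sigma>' \<alpha> = \<beta> \<and> (\<forall>E. is_subfield E \<longrightarrow> K1 \<subseteq> E \<longrightarrow> \<alpha> \<in> E \<longrightarrow> K' \<subseteq> E))"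
    using simple_extension[OF 1(1,4) alg\<alpha>] by (elim exE conjE) (rule that; assumption)
  have "Polynomial.degree \<mu> \<noteq> 0"
  proof
    assume "Polynomial.degree \<mu> = 0"
    then obtain c where "\<mu> = [:c:]" by (rule degree_eq_zeroE)
    with \<mu>(2,3) show False by simp
  qed
  moreover have "Polynomial.degree (map_poly \<sigma>1 \<mu>) = Polynomial.degree \<mu>"
    using \<mu>(2) by (intro degree_map_poly) (auto simp: hom_1[OF 1(1,5)])
  ultimately have "\<not> constant (poly (map_poly \<sigma>1 \<mu>))"
    by (simp add: constant_degree)
  then obtain \<beta> where "poly (map_poly \<sigma>1 \<mu>) \<beta> = 0"
    using fundamental_theorem_of_algebra by blast
  from ext[rule_format, OF 1(5) this]
  obtain K' \<sigma>' where 2: "is_subfield K'" "K1 \<subseteq> K'" "\<alpha> \<in> K'" "\<forall>x\<in>K'. algebraic x"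
    "subfield_hom K' \<sigma>'" "\<forall>x\<in>K1. \<sigma>' x = \<sigma>1 x" "\<forall>E. is_subfield E \<longrightarrow> K1 \<subseteq> E \<longrightarrow> \<alpha> \<in> E \<longrightarrow> K' \<subseteq> E"
    by (elim exE conjE) (rule that; assumption)
  have "\<forall>E. is_subfield E \<longrightarrow> K \<subseteq> E \<longrightarrow> insert \<alpha> T \<subseteq> E \<longrightarrow> K' \<subseteq> E"
    using 2(7) 1(7) by simp
  moreover have "K \<subseteq> K'" "insert \<alpha> T \<subseteq> K'" "\<forall>x\<in>K. \<sigma>' x = \<sigma> x"
    using 1(2,3,6) 2(2,3,6) by auto
  ultimately show ?case
    by (intro exI[of _ K'] exI[of _ \<sigma>'] conjI 2)
qed

text \<open>The splitting field is captured by minimality instead of a description of its elements: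
  whatever defines a subfield and holds for the roots of \<open>f\<close> holds on all of
  \<open>F\<close>.\<close>

locale splitting =
  fixes F :: "complex set" and f :: "int poly"
  assumes F: "is_subfield F"
    and f0: "f \<noteq> 0"
    and roots_in: "{z. poly (map_poly of_int f) z = 0} \<subseteq> F"
    and generated: "\<And>E. is_subfield E \<Longrightarrow> {z. poly (map_poly of_int f) z = 0} \<subseteq> E \<Longrightarrow> F \<subseteq> E"
begin

definition Aut :: "(complex \<Rightarrow> complex) set" where
  "Aut = {\<sigma>. bij_betw \<sigma> F F \<and> subfield_hom F \<sigma>}"

lemma Aut_hom: "\<sigma> \<in> Aut \<Longrightarrow> subfield_hom F \<sigma>" and Aut_bij: "\<sigma> \<in> Aut \<Longrightarrow> bij_betw \<sigma> F F"
  by (auto simp: Aut_def)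

lemma Aut_in: "\<sigma> \<in> Aut \<Longrightarrow> x \<in> F \<Longrightarrow> \<sigma> x \<in> F"
  using Aut_bij bij_betwE by blast

lemma hom_root:
  assumes \<sigma>: "subfield_hom F \<sigma>" and z: "z \<in> F" "poly (map_poly of_int (p :: int poly)) z = 0"
  shows "poly (map_poly of_int p) (\<sigma> z) = 0"
proof -
  have c: "coeffs_in F (map_poly of_int p)"
    by (auto simp: coeffs_in_def subfield_of_int[OF F])
  have "map_poly \<sigma> (map_poly of_int p) = map_poly of_int p"
    by (intro poly_eqI) (simp add: coeff_map_hom[OF F \<sigma>] hom_of_int[OF F \<sigma>])
  with hom_poly[OF F \<sigma> c z(1)] z(2) show ?thesis by (simp add: hom_0[OF F \<sigma>])
qed

text \<open>Normality. An embedding of \<open>F\<close> maps the finite set of roots injectively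
  into itself, hence permutes it. So the elements of \<open>F\<close> with image in
  \<open>F\<close>, and the image of \<open>F\<close>, are both subfields containing the roots, and
  minimality applies to each.\<close>

lemma hom_in_Aut:
  assumes \<sigma>: "subfield_hom F \<sigma>"
  shows "\<sigma> \<in> Aut"
proof -
  define R where "R = {z. poly (map_poly of_int f) z = (0::complex)}"
  have fin: "finite R" unfolding R_def using f0 by (intro poly_roots_finite) auto
  have RF: "R \<subseteq> F" using roots_in by (simp add: R_def)
  have inj: "inj_on \<sigma> F" by (rule hom_inj[OF F \<sigma>])
  have "\<sigma> ` R \<subseteq> R" using hom_root[OF \<sigma>] RF by (auto simp: R_def)
  hence R: "\<sigma> ` R = R"
    using endo_inj_surj[OF fin] inj_on_subset[OF inj RF] by blast
  have "F \<subseteq> {x \<in> F. \<sigma> x \<in> F}"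
  proof (rule generated)
    show "is_subfield {x \<in> F. \<sigma> x \<in> F}"
      unfolding is_subfield_def
      by (auto simp: hom_1[OF F \<sigma>] hom_diff[OF F \<sigma>] hom_mult[OF F \<sigma>] hom_inverse[OF F \<sigma>]
         intro!: subfield_1[OF F] subfield_diff[OF F] subfield_mult[OF F] subfield_inverse[OF F])
    show "{z. poly (map_poly of_int f) z = 0} \<subseteq> {x \<in> F. \<sigma> x \<in> F}"
      using R RF by (auto simp: R_def)
  qed
  moreover have "F \<subseteq> \<sigma> ` F"
  proof (rule generated)
    have "1 \<in> \<sigma> ` F" using hom_1[OF F \<sigma>] subfield_1[OF F] by (metis imageI)
    moreover have "\<sigma> x - \<sigma> y \<in> \<sigma> ` F" if "x \<in> F" "y \<in> F" for x y
      using hom_diff[OF F \<sigma> that] subfield_diff[OF F that] by (metis imageI)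
    moreover have "\<sigma> x * \<sigma> y \<in> \<sigma> ` F" if "x \<in> F" "y \<in> F" for x y
      using hom_mult[OF F \<sigma> that] subfield_mult[OF F that] by (metis imageI)
    moreover have "inverse (\<sigma> x) \<in> \<sigma> ` F" if "x \<in> F" for x
      using hom_inverse[OF F \<sigma> that] subfield_inverse[OF F that] by (metis imageI)
    ultimately show "is_subfield (\<sigma> ` F)" unfolding is_subfield_def by blast
    show "{z. poly (map_poly of_int f) z = 0} \<subseteq> \<sigma> ` F"
      using R RF unfolding R_def by blast
  qed
  ultimately show ?thesis using inj \<sigma> by (auto simp: Aut_def bij_betw_def)
qed

text \<open>An irrational x has a minimal polynomial of degree at least 2, hence a second root
  \<beta>. The embedding that sends x to \<beta> extends to all roots of \<open>f\<close> and
  thereby becomes an automorphism of \<open>F\<close> that moves x.\<close>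

lemma fixed_imp_rational:
  assumes x: "x \<in> F" "algebraic x" and fixed: "\<And>\<sigma>. \<sigma> \<in> Aut \<Longrightarrow> \<sigma> x = x"
  shows "x \<in> \<rat>"
proof (rule ccontr)
  assume notin: "x \<notin> \<rat>"
  have algQ: "\<forall>y\<in>\<rat>. algebraic (y :: complex)"
  proof
    fix y :: complex assume "y \<in> \<rat>"
    then show "algebraic y" by (intro algebraicI'[of "[:- y, 1:]"]) (auto simp: coeff_pCons split: nat.splits)
  qed
  obtain \<mu> where \<mu>: "coeffs_in \<rat> \<mu>" "Polynomial.lead_coeff \<mu> = 1" "poly \<mu> x = 0"
    and min: "\<forall>p. coeffs_in \<rat> p \<longrightarrow> p \<noteq> 0 \<longrightarrow> poly p x = 0 \<longrightarrow> Polynomial.degree \<mu> \<le> Polynomial.degree p"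
    and ext: "\<forall>\<sigma> \<beta>. subfield_hom \<rat> \<sigma> \<longrightarrow> poly (map_poly \<sigma> \<mu>) \<beta> = 0 \<longrightarrow>
      (\<exists>K' \<sigma>'. is_subfield K' \<and> \<rat> \<subseteq> K' \<and> x \<in> K' \<and> (\<forall>x\<in>K'. algebraic x) \<and> subfield_hom K' \<sigma>' \<and>
        (\<forall>x\<in>\<rat>. \<sigma>' x = \<sigma> x) \<and> \<sigma>' x = \<beta> \<and> (\<forall>E. is_subfield E \<longrightarrow> \<rat> \<subseteq> E \<longrightarrow> x \<in> E \<longrightarrow> K' \<subseteq> E))"
    using simple_extension[OF is_subfield_Rats algQ x(2)] by (elim exE conjE) (rule that; assumption)
  obtain \<nu> where \<nu>: "\<mu> = [:- x, 1:] * \<nu>"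
    using \<mu>(3) by (auto simp: poly_eq_0_iff_dvd)
  have \<mu>0: "\<mu> \<noteq> 0" using \<mu>(2) by auto
  hence \<nu>0: "\<nu> \<noteq> 0" using \<nu> by auto
  have "Polynomial.lead_coeff \<nu> = 1"
    using \<mu>(2) unfolding \<nu> lead_coeff_mult by simp
  have "Polynomial.degree \<nu> \<noteq> 0"
  proof
    assume "Polynomial.degree \<nu> = 0"
    then obtain c where c: "\<nu> = [:c:]" by (auto elim: degree_eq_zeroE)
    with \<open>Polynomial.lead_coeff \<nu> = 1\<close> have "\<mu> = [:- x, 1:]" by (simp add: \<nu>)
    with \<mu>(1) have "- x \<in> \<rat>" unfolding coeffs_in_def by (metis coeff_pCons_0)
    then show False using notin by simp
  qed
  hence "\<not> constant (poly \<nu>)" by (simp add: constant_degree)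
  then obtain \<beta> where \<beta>: "poly \<nu> \<beta> = 0"
    using fundamental_theorem_of_algebra by blast
  \<comment> \<open>Separability: if x were a double root, the derivative of \<mu> would be a
    nonzero polynomial of smaller degree vanishing at x.\<close>
  have "\<beta> \<noteq> x"
  proof
    assume "\<beta> = x"
    have "poly (pderiv \<mu>) x = 0"
      using \<beta> unfolding \<nu> pderiv_mult by (simp add: pderiv_pCons \<open>\<beta> = x\<close>)
    moreover have "Polynomial.degree \<mu> \<noteq> 0" using \<nu>0 unfolding \<nu> by (subst degree_mult_eq) auto
    moreover from this have "pderiv \<mu> \<noteq> 0" by (simp add: pderiv_eq_0_iff)
    ultimately have "Polynomial.degree \<mu> \<le> Polynomial.degree (pderiv \<mu>)"
      by (intro min[rule_format] coeffs_in_arith[OF is_subfield_Rats] \<mu>)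
    with \<open>Polynomial.degree \<mu> \<noteq> 0\<close> show False by (simp add: degree_pderiv)
  qed
  have id: "subfield_hom \<rat> (\<lambda>x. x)" by (simp add: subfield_hom_def)
  have "poly (map_poly (\<lambda>x. x) \<mu>) \<beta> = 0" using \<beta> by (simp add: \<nu>)
  from ext[rule_format, OF id this] obtain K1 \<sigma>1 where 1: "is_subfield K1" "\<rat> \<subseteq> K1" "x \<in> K1" "\<forall>x\<in>K1. algebraic x"
    "subfield_hom K1 \<sigma>1" "\<sigma>1 x = \<beta>" "\<forall>E. is_subfield E \<longrightarrow> \<rat> \<subseteq> E \<longrightarrow> x \<in> E \<longrightarrow> K1 \<subseteq> E"
    by (elim exE conjE) (rule that; assumption)
  define R where "R = {z. poly (map_poly of_int f) z = (0::complex)}"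
  have finR: "finite R" unfolding R_def using f0 by (intro poly_roots_finite) auto
  have algR: "\<forall>z\<in>R. algebraic z"
    using f0 by (auto simp: R_def intro!: algebraicI[of "map_poly of_int f"])
  obtain K' \<sigma>' where 2: "is_subfield K'" "K1 \<subseteq> K'" "R \<subseteq> K'" "subfield_hom K' \<sigma>'"
      "\<forall>x\<in>K1. \<sigma>' x = \<sigma>1 x" "\<forall>E. is_subfield E \<longrightarrow> K1 \<subseteq> E \<longrightarrow> R \<subseteq> E \<longrightarrow> K' \<subseteq> E"
    using finite_extension[OF finR algR 1(1,4,5)] by (elim exE conjE) (rule that; assumption)
  \<comment> \<open>The tower from the rationals over x to the roots of \<open>f\<close> ends
    exactly at \<open>F\<close>: it stays inside by its own minimality and contains \<open>F\<close>
    by the minimality of \<open>F\<close>.\<close>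
  have "K1 \<subseteq> F" using 1(7) F subfield_Rats[OF F] x(1) by blast
  hence "K' \<subseteq> F" using 2(6) F roots_in unfolding R_def by blast
  moreover have "F \<subseteq> K'" using generated[OF 2(1)] 2(3) unfolding R_def by blast
  ultimately have "K' = F" by blast
  hence "\<sigma>' \<in> Aut" using 2(4) hom_in_Aut by simp
  from fixed[OF this] 2(5) 1(3,6) \<open>\<beta> \<noteq> x\<close> show False by simp
qed

lemma fixed_integral_imp_int:
  assumes "x \<in> F" "algebraic_int x" "\<And>\<sigma>. \<sigma> \<in> Aut \<Longrightarrow> \<sigma> x = x"
  shows "x \<in> \<int>"
  using assms by (intro rational_algebraic_int_is_int fixed_imp_rational) auto

lemma Aut_id: "(\<lambda>x. x) \<in> Aut"
  by (auto simp: Aut_def subfield_hom_def bij_betw_def)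

lemma Aut_comp: "\<sigma> \<in> Aut \<Longrightarrow> \<tau> \<in> Aut \<Longrightarrow> (\<lambda>x. \<sigma> (\<tau> x)) \<in> Aut"
  using bij_betw_trans[of \<tau> F F \<sigma> F] Aut_in[of \<tau>] by (auto simp: Aut_def subfield_hom_def comp_def)

lemma Aut_algebraic_int: "\<sigma> \<in> Aut \<Longrightarrow> x \<in> F \<Longrightarrow> algebraic_int x \<Longrightarrow> algebraic_int (\<sigma> x)"
  unfolding algebraic_int_altdef_ipoly using hom_root[OF Aut_hom] by blast

end

section \<open>Inertia at a prime\<close>

text \<open>A prime ideal above q in the ring of all algebraic integers. Working in this one ring
  avoids the ring of integers of a particular field, and \<open>x - y \<in> P\<close> reads as
  equality of residues.\<close>

locale prime_over =
  fixes q :: int and P :: "complex set"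
  assumes q: "Factorial_Ring.prime q"
    and P_int: "\<And>x. x \<in> P \<Longrightarrow> algebraic_int x"
    and P_add: "\<And>x y. x \<in> P \<Longrightarrow> y \<in> P \<Longrightarrow> x + y \<in> P"
    and P_mult: "\<And>x y. x \<in> P \<Longrightarrow> algebraic_int y \<Longrightarrow> y * x \<in> P"
    and q_in: "of_int q \<in> P"
    and one_notin: "1 \<notin> P"
    and P_prime: "\<And>x y. algebraic_int x \<Longrightarrow> algebraic_int y \<Longrightarrow> x * y \<in> P \<Longrightarrow> x \<in> P \<or> y \<in> P"
begin

lemma P_mult': "x \<in> P \<Longrightarrow> algebraic_int y \<Longrightarrow> x * y \<in> P"
  using P_mult[of x y] by (simp add: mult.commute)

lemma P_0: "0 \<in> P"
  using P_mult[OF q_in algebraic_int_0] by simp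

lemma P_uminus: "x \<in> P \<Longrightarrow> - x \<in> P"
  using P_mult[of x "-1"] by simp

lemma P_uminus_iff: "- x \<in> P \<longleftrightarrow> x \<in> P"
  using P_uminus[of x] P_uminus[of "- x"] by auto

lemma P_diff: "x \<in> P \<Longrightarrow> y \<in> P \<Longrightarrow> x - y \<in> P"
  using P_add[of x "- y"] P_uminus[of y] by simp

lemma P_commute: "x - y \<in> P \<longleftrightarrow> y - x \<in> P"
  using P_uminus_iff[of "x - y"] by simp

lemma P_sum: "(\<And>i. i \<in> I \<Longrightarrow> f i \<in> P) \<Longrightarrow> (\<Sum>i\<in>I. f i) \<in> P"
  by (induction I rule: infinite_finite_induct) (auto intro: P_0 P_add)

text \<open>By Bezout an integer in \<open>P\<close> that is prime to q would put 1 into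
  \<open>P\<close>. This turns residues of integers modulo \<open>P\<close> into divisibility by q,
  which can then be refuted by size.\<close>

lemma P_of_int_iff: "of_int z \<in> P \<longleftrightarrow> q dvd z"
proof
  assume "q dvd z"
  then show "of_int z \<in> P" using P_mult[OF q_in] by (auto simp: mult.commute)
next
  assume z: "of_int z \<in> P"
  show "q dvd z"
  proof (rule ccontr)
    assume "\<not> q dvd z"
    hence "Rings.coprime q z" using q by (simp add: prime_imp_coprime)
    then obtain a b where "a * q + b * z = 1"
      using bezout_int[of q z] by (metis coprime_iff_gcd_eq_1)
    hence "of_int a * of_int q + of_int b * of_int z = (1::complex)"
      by (metis of_int_1 of_int_add of_int_mult)
    moreover have "of_int a * of_int q + of_int b * of_int z \<in> P"
      using z q_in by (intro P_add P_mult) auto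
    ultimately show False using one_notin by simp
  qed
qed

lemma P_prod_prime:
  assumes "finite I" "\<And>i. i \<in> I \<Longrightarrow> algebraic_int (f i)" "(\<Prod>i\<in>I. f i) \<in> P"
  shows "\<exists>i\<in>I. f i \<in> P"
  using assms
proof (induction I rule: finite_induct)
  case (insert j I)
  then show ?case using P_prime[of "f j" "\<Prod>i\<in>I. f i"] algebraic_int_prod[of I f] by auto
qed (use one_notin in auto)

lemma P_prodI:
  assumes "finite I" "\<And>i. i \<in> I \<Longrightarrow> algebraic_int (f i)" "i \<in> I" "f i \<in> P"
  shows "(\<Prod>i\<in>I. f i) \<in> P"
  using assms by (subst prod.remove[of _ i]) (auto intro!: P_mult' algebraic_int_prod)

lemma P_poly_cong:
  assumes "\<And>i. q dvd poly.coeff (g - G) i" "algebraic_int x" "poly (map_poly of_int G) x \<in> P"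
  shows "poly (map_poly of_int g) x \<in> P"
proof -
  have "poly (map_poly of_int (g - G)) x \<in> P"
    unfolding poly_altdef
  proof (intro P_sum P_mult')
    fix i
    show "poly.coeff (map_poly of_int (g - G)) i \<in> P"
      using assms(1)[of i] by (simp only: coeff_map_poly of_int_0 P_of_int_iff)
  qed (rule algebraic_int_power[OF assms(2)])
  from P_add[OF this assms(3)] show ?thesis by (simp add: of_int_poly_hom.hom_minus)
qed

end

text \<open>Zorn's lemma for the proper ideals containing q. The ideal generated by q is proper
  because 1/q is rational without being an integer. A maximal such ideal M is prime: if xy lies in M
  and y does not, then 1 = u + c x with u in M would give y = y u + c x y in M, so adjoining x keeps
  the ideal proper.\<close>

lemma exists_prime_over:
  assumes "Factorial_Ring.prime (q::int)"
  shows "\<exists>P. prime_over q P"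
proof -
  define isid where "isid I \<longleftrightarrow> (\<forall>x\<in>I. algebraic_int x) \<and> (\<forall>x\<in>I. \<forall>y\<in>I. x + y \<in> I) \<and>
      (\<forall>x\<in>I. \<forall>y. algebraic_int y \<longrightarrow> y * x \<in> I) \<and> of_int q \<in> I \<and> 1 \<notin> I" for I :: "complex set"
  have "Collect isid \<noteq> {}"
  proof -
    define Q where "Q = {of_int q * x | x :: complex. algebraic_int x}"
    have "isid Q"
      unfolding isid_def
    proof (intro conjI ballI allI impI)
      fix x y assume "x \<in> Q" "y \<in> Q"
      then obtain a b where "x = of_int q * a" "y = of_int q * b" "algebraic_int a" "algebraic_int b" unfolding Q_def by blast
      then show "x + y \<in> Q"
        by (auto simp: Q_def distrib_left[symmetric] intro: algebraic_int_add)
    next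
      fix x y assume "x \<in> Q" "algebraic_int (y :: complex)"
      then obtain a where "x = of_int q * a" "algebraic_int a" unfolding Q_def by blast
      then show "y * x \<in> Q"
        using \<open>algebraic_int y\<close> unfolding Q_def by (auto simp: mult.left_commute intro!: exI[of _ "y * a"] algebraic_int_mult)
    next
      show "1 \<notin> Q"
      proof
        assume "1 \<in> Q"
        then obtain x :: complex where x: "1 = of_int q * x" "algebraic_int x" unfolding Q_def by blast
        have q0: "q \<noteq> 0" using assms by auto
        hence "x = 1 / of_int q" using x(1) by (simp add: field_simps)
        hence "x \<in> \<rat>" by auto
        with x(2) have "x \<in> \<int>" by (rule rational_algebraic_int_is_int)
        then obtain k where "x = of_int k" by (auto elim: Ints_cases)
        with x(1) have "of_int (q * k) = (1::complex)" by simp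
        hence "q * k = 1" by (simp only: of_int_eq_1_iff)
        hence "is_unit q" by (metis dvd_triv_left)
        then show False using assms not_prime_unit by blast
      qed
    next
      show "of_int q \<in> Q" unfolding Q_def by (intro CollectI exI[of _ 1]) auto
    qed (auto simp: Q_def intro: algebraic_int_mult)
    then show ?thesis by blast
  qed
  moreover have "\<Union>C \<in> Collect isid" if C: "C \<noteq> {}" "subset.chain (Collect isid) C" for C
  proof -
    have ch: "A \<subseteq> B \<or> B \<subseteq> A" if "A \<in> C" "B \<in> C" for A B
      using C(2) that by (auto simp: subset_chain_def)
    have id: "isid A" if "A \<in> C" for A using C(2) that by (auto simp: subset_chain_def)
    have "isid (\<Union>C)" unfolding isid_def
    proof (intro conjI ballI allI impI)
      fix x y assume "x \<in> \<Union>C" "y \<in> \<Union>C"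
      then obtain A B where "x \<in> A" "A \<in> C" "y \<in> B" "B \<in> C" by blast
      then obtain D where "D \<in> C" "x \<in> D" "y \<in> D" using ch by blast
      then show "x + y \<in> \<Union>C" using id[of D] unfolding isid_def by blast
    qed (use id C(1) in \<open>unfold isid_def, blast\<close>)+
    then show "\<Union>C \<in> Collect isid" by simp
  qed
  ultimately obtain M where M: "isid M" and max: "\<And>W. isid W \<Longrightarrow> M \<subseteq> W \<Longrightarrow> W = M"
    using subset_Zorn_nonempty[of "Collect isid"] by auto
  have Mint: "\<And>x. x \<in> M \<Longrightarrow> algebraic_int x" and Madd: "\<And>x y. x \<in> M \<Longrightarrow> y \<in> M \<Longrightarrow> x + y \<in> M"
    and Mmult: "\<And>x y. x \<in> M \<Longrightarrow> algebraic_int y \<Longrightarrow> y * x \<in> M" and Mq: "of_int q \<in> M" and M1: "1 \<notin> M"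
    using M by (auto simp: isid_def)
  have "prime_over q M"
  proof
    fix x y :: complex
    assume x: "algebraic_int x" and y: "algebraic_int y" and xy: "x * y \<in> M"
    show "x \<in> M \<or> y \<in> M"
    proof (rule ccontr)
      assume neg: "\<not> (x \<in> M \<or> y \<in> M)"
      define N where "N = {u + c * x | u c. u \<in> M \<and> algebraic_int c}"
      have M0: "0 \<in> M" using Mmult[OF Mq algebraic_int_0] by simp
      have MN: "M \<subseteq> N" unfolding N_def
      proof
        fix u assume "u \<in> M"
        then show "u \<in> {u + c * x | u c. u \<in> M \<and> algebraic_int c}"
          by (intro CollectI exI[of _ u] exI[of _ 0]) auto
      qed
      have "x \<in> N" unfolding N_def
        using M0 by (intro CollectI exI[of _ 0] exI[of _ 1]) auto
      hence "N \<noteq> M" using neg by blast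
      have "1 \<notin> N"
      proof
        assume "1 \<in> N"
        then obtain u c where uc: "u \<in> M" "algebraic_int c" "1 = u + c * x" unfolding N_def by blast
        have "y = y * (u + c * x)" using uc(3) by simp
        also have "\<dots> = y * u + c * (x * y)" by (simp add: algebra_simps)
        also have "\<dots> \<in> M" by (intro Madd Mmult[OF uc(1) y] Mmult[OF xy uc(2)])
        finally show False using neg by blast
      qed
      moreover have "algebraic_int v" if "v \<in> N" for v
        using that x Mint unfolding N_def by (auto intro!: algebraic_int_add algebraic_int_mult)
      moreover have "v + w \<in> N" if vw: "v \<in> N" "w \<in> N" for v w
      proof -
        obtain a c b d where "v = a + c * x" "a \<in> M" "algebraic_int c" "w = b + d * x" "b \<in> M" "algebraic_int d"
          using vw unfolding N_def by blast
        then show ?thesis unfolding N_def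
          by (intro CollectI exI[of _ "a + b"] exI[of _ "c + d"] conjI Madd algebraic_int_add)
            (auto simp: algebra_simps)
      qed
      moreover have "w * v \<in> N" if vw: "v \<in> N" "algebraic_int w" for v w
      proof -
        obtain a c where "v = a + c * x" "a \<in> M" "algebraic_int c"
          using vw unfolding N_def by blast
        then show ?thesis unfolding N_def using vw(2)
          by (intro CollectI exI[of _ "w * a"] exI[of _ "w * c"] conjI Mmult algebraic_int_mult)
            (auto simp: distrib_left mult.assoc)
      qed
      ultimately have "isid N" unfolding isid_def using MN Mq by blast
      from max[OF this MN] \<open>N \<noteq> M\<close> show False by simp
    qed
  qed (use assms Mint Madd Mmult Mq M1 in auto)
  then show ?thesis by blast
qed

text \<open>Uniqueness of expansions in base B with signed digits: in a vanishing sum the lowest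
  nonzero digit would be divisible by B, yet it is smaller than B in absolute value.\<close>

lemma digits_zero:
  fixes d :: "nat \<Rightarrow> int"
  assumes "finite T" "\<And>t. t \<in> T \<Longrightarrow> \<bar>d t\<bar> < B" "(\<Sum>t\<in>T. d t * B ^ t) = 0" "t \<in> T"
  shows "d t = 0"
proof (rule ccontr)
  assume "d t \<noteq> 0"
  define S where "S = {t \<in> T. d t \<noteq> 0}"
  have S: "finite S" "S \<noteq> {}" using assms \<open>d t \<noteq> 0\<close> by (auto simp: S_def)
  define s where "s = Min S"
  have s: "s \<in> S" "\<And>u. u \<in> S \<Longrightarrow> s \<le> u" using S by (auto simp: s_def)
  have "0 = (\<Sum>t\<in>S. d t * B ^ t)"
    unfolding assms(3)[symmetric] using assms(1) by (intro sum.mono_neutral_right) (auto simp: S_def)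
  also have "\<dots> = d s * B ^ s + (\<Sum>t\<in>S-{s}. d t * B ^ t)"
    using S(1) s(1) by (subst sum.remove[of _ s]) auto
  finally have "d s * B ^ s = - (\<Sum>t\<in>S-{s}. d t * B ^ t)" by simp
  moreover have "B ^ Suc s dvd (\<Sum>t\<in>S-{s}. d t * B ^ t)"
    by (intro dvd_sum dvd_mult le_imp_power_dvd) (use s in force)
  ultimately have "B ^ Suc s dvd d s * B ^ s" by simp
  have B: "0 < B" using assms(2)[OF assms(4)] by linarith
  hence "B dvd d s" using \<open>B ^ Suc s dvd d s * B ^ s\<close> by simp
  moreover have "\<bar>d s\<bar> < B" "d s \<noteq> 0" using s(1) assms(2) by (auto simp: S_def)
  ultimately show False using dvd_imp_le_int[of "d s" B] B by auto
qed

text \<open>Congruences modulo \<open>P\<close> cannot see multiplicities, hence the second claim on \<open>R\<close>.\<close>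
lemma (in prime_over) prod_shift:
  assumes "finite I" "\<And>i. i \<in> I \<Longrightarrow> x i \<in> P" "\<kappa> \<in> P"
  shows "\<exists>R. algebraic_int R \<and> (\<Prod>i\<in>I. x i + \<kappa>) = (\<Prod>i\<in>I. x i) + \<kappa> * R \<and> (2 \<le> card I \<longrightarrow> R \<in> P)"
  using assms(1,2)
proof (induction I rule: finite_induct)
  case empty
  then show ?case by (intro exI[of _ 0]) auto
next
  case (insert j I)
  then obtain R where R: "algebraic_int R" "(\<Prod>i\<in>I. x i + \<kappa>) = (\<Prod>i\<in>I. x i) + \<kappa> * R" by auto
  have j: "x j \<in> P" using insert.prems by simp
  have int: "algebraic_int (x i)" if "i \<in> insert j I" for i using insert.prems that P_int by blast
  have "(\<Prod>i\<in>insert j I. x i + \<kappa>) = (\<Prod>i\<in>insert j I. x i) + \<kappa> * ((x j + \<kappa>) * R + (\<Prod>i\<in>I. x i))"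
    using insert.hyps by (simp add: R(2) ring_distribs mult_ac)
  moreover have "algebraic_int ((x j + \<kappa>) * R + (\<Prod>i\<in>I. x i))"
    using int R(1) P_int[OF assms(3)]
    by (intro algebraic_int_add algebraic_int_mult algebraic_int_prod) auto
  moreover have "(x j + \<kappa>) * R + (\<Prod>i\<in>I. x i) \<in> P" if c: "2 \<le> card (insert j I)"
  proof -
    have "I \<noteq> {}" using c insert.hyps by auto
    then obtain i where "i \<in> I" by blast
    then have "(\<Prod>i\<in>I. x i) \<in> P"
      using insert.prems int insert.hyps by (intro P_prodI[of I x i]) auto
    then show ?thesis using j assms(3) R(1) by (intro P_add P_mult') auto
  qed
  ultimately show ?case by blast
qed

text \<open>A polynomial of degree m with the root 1 of multiplicity e and the m - e simple roots 4,
  9, ..., (m - e + 1)^2. Squares are taken because then (-1)^m times the constant term is a square,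
  as the construction of g demands.\<close>

definition inertia_model :: "nat \<Rightarrow> nat \<Rightarrow> int poly" where
  "inertia_model m e = [:-1, 1:] ^ e * (\<Prod>t\<in>{2..m - e + 1}. [:- (int t)\<^sup>2, 1:])"

text \<open>Larger than every root of \<open>inertia_model\<close>, hence than the distance between
  any two of them.\<close>

definition digit_base :: "nat \<Rightarrow> int" where "digit_base m = (int m)\<^sup>2 + 1"

text \<open>Bounds the absolute value of every integer with signed digits below
  \<open>digit_base m\<close> at the positions 0, ..., m. A prime beyond it divides such an integer
  only if the integer is zero, and then all digits are zero.\<close>

definition prime_bound :: "nat \<Rightarrow> int" where
  "prime_bound m = (\<Sum>t\<le>m. digit_base m * digit_base m ^ t)"

lemma digit_base_le_prime_bound: "digit_base m \<le> prime_bound m"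
proof -
  have "digit_base m * digit_base m ^ 0 \<le> prime_bound m"
    unfolding prime_bound_def by (rule member_le_sum) (auto simp: digit_base_def)
  then show ?thesis by simp
qed

text \<open>The roots merging at 1 form a totally ramified cluster: \<open>exact\<close> is the
  Eisenstein condition at 1. The argument is global. Suppose that from i0 in I only a proper subset
  I0 of I can be reached by automorphisms fixing the simple roots. The norm of a suitable element z
  i0 is an integer in \<open>P\<close>, so q divides it, and its factors in \<open>P\<close> are
  exactly the z i with i in I0. Hence the product of z i over all of I, which has a further factor
  in \<open>P\<close>, lies in q P up to factors outside \<open>P\<close>. But up to factors outside
  \<open>P\<close> and terms in q P that product is g(1), which q divides only once.\<close>

lemma (in splitting) inertia:
  fixes y :: "nat \<Rightarrow> complex" and m e :: nat and q :: int and g :: "int poly"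
  assumes yF: "\<And>i. i \<in> {1..m} \<Longrightarrow> y i \<in> F" and inj: "inj_on y {1..m}"
    and g: "map_poly of_int g = (\<Prod>i\<in>{1..m}. [:- y i, 1:])"
    and q: "Factorial_Ring.prime q" and qb: "prime_bound m < q" and e: "2 \<le> e" "e \<le> m"
    and cong: "\<And>i. q dvd poly.coeff (g - inertia_model m e) i"
    and exact: "\<not> q\<^sup>2 dvd poly g 1"
  obtains I where "I \<subseteq> {1..m}" "card I = e"
    "\<And>i i'. i \<in> I \<Longrightarrow> i' \<in> I \<Longrightarrow> \<exists>\<sigma>\<in>Aut. \<sigma> (y i) = y i' \<and> (\<forall>j\<in>{1..m} - I. \<sigma> (y j) = y j)"
proof -
  define G where "G = inertia_model m e"
  define T where "T = {2..m - e + 1}"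
  have finT: "finite T" by (simp add: T_def)
  have Tm: "t < m" if "t \<in> T" for t using that e by (auto simp: T_def)
  have qgt: "digit_base m < q" using qb digit_base_le_prime_bound[of m] by linarith
  have sq: "(int t)\<^sup>2 < digit_base m" if "t \<in> T" for t
  proof -
    have "(int t)\<^sup>2 \<le> (int m)\<^sup>2" using Tm[OF that] by (intro power_mono) auto
    then show ?thesis by (simp add: digit_base_def)
  qed
  have sq_dist: "\<not> q dvd (int t)\<^sup>2 - (int t')\<^sup>2" if "t \<in> insert 1 T" "t' \<in> insert 1 T" "t \<noteq> t'" for t t'
  proof
    assume dv: "q dvd (int t)\<^sup>2 - (int t')\<^sup>2"
    have "(int t)\<^sup>2 < digit_base m" "(int t')\<^sup>2 < digit_base m"
      using that sq e by (auto simp: digit_base_def)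
    hence "\<bar>(int t)\<^sup>2 - (int t')\<^sup>2\<bar> < q" using qgt by (smt (verit) zero_le_power2)
    hence "(int t)\<^sup>2 - (int t')\<^sup>2 = 0" using dvd_imp_le_int[OF _ dv] by linarith
    hence "t = t'" by (auto simp: power2_eq_iff)
    then show False using that(3) by simp
  qed
  obtain P where "prime_over q P" using exists_prime_over[OF q] by blast
  then interpret P: prime_over q P .
  have polyg: "poly (map_poly of_int g) x = (\<Prod>i\<in>{1..m}. x - y i)" for x
    by (simp add: g poly_prod)
  have polyg_int: "of_int (poly g z) = (\<Prod>i\<in>{1..m}. of_int z - y i)" for z
    using polyg[of "of_int z"] by simp
  have polyG: "poly (map_poly of_int G) x = (x - 1) ^ e * (\<Prod>t\<in>T. x - (of_nat t)\<^sup>2)" for x :: complex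
    unfolding G_def inertia_model_def T_def[symmetric]
    by (simp add: of_int_poly_hom.hom_mult of_int_poly_hom.hom_power of_int_poly_hom.hom_prod poly_prod
        map_poly_pCons_0 of_int_hom.hom_uminus)
  have monic: "Polynomial.lead_coeff g = 1"
  proof -
    have "Polynomial.lead_coeff (map_poly of_int g :: complex poly) = 1"
      unfolding g by (simp add: lead_coeff_prod)
    then show ?thesis by simp
  qed
  have yint: "algebraic_int (y i)" if "i \<in> {1..m}" for i
    unfolding algebraic_int_altdef_ipoly using monic that
    by (intro exI[of _ g]) (auto simp: polyg)
  have intsq [simp]: "algebraic_int ((of_nat t)\<^sup>2 :: complex)" for t
    by (intro algebraic_int_power algebraic_int_of_nat)
  have cong': "\<And>i. q dvd poly.coeff (g - G) i" using cong by (simp add: G_def)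
  have cong'': "\<And>i. q dvd poly.coeff (G - g) i"
    using cong' by (metis coeff_diff dvd_diff_commute)
  have cls: "y i - 1 \<in> P \<or> (\<exists>t\<in>T. y i - (of_nat t)\<^sup>2 \<in> P)" if i: "i \<in> {1..m}" for i
  proof -
    have "poly (map_poly of_int g) (y i) = 0" using i by (auto simp: polyg)
    hence "poly (map_poly of_int G) (y i) \<in> P"
      using P.P_poly_cong[OF cong'' yint[OF i]] P.P_0 by simp
    hence "(y i - 1) ^ e \<in> P \<or> (\<Prod>t\<in>T. y i - (of_nat t)\<^sup>2) \<in> P"
      unfolding polyG using yint[OF i]
      by (intro P.P_prime algebraic_int_power algebraic_int_prod algebraic_int_diff) auto
    then show ?thesis
    proof
      assume "(y i - 1) ^ e \<in> P"
      hence "(\<Prod>k<e. y i - 1) \<in> P" by simp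
      hence "\<exists>k\<in>{..<e}. y i - 1 \<in> P" using yint[OF i]
        by (intro P.P_prod_prime algebraic_int_diff) auto
      then show ?thesis by auto
    next
      assume "(\<Prod>t\<in>T. y i - (of_nat t)\<^sup>2) \<in> P"
      hence "\<exists>t\<in>T. y i - (of_nat t)\<^sup>2 \<in> P" using yint[OF i] finT
        by (intro P.P_prod_prime algebraic_int_diff) auto
      then show ?thesis by blast
    qed
  qed
  have ex: "\<exists>i\<in>{1..m}. (of_nat t)\<^sup>2 - y i \<in> P" if t: "t \<in> T" for t
  proof -
    have "poly (map_poly of_int G) ((of_nat t)\<^sup>2 :: complex) = 0"
      unfolding polyG using t finT by auto
    hence "poly (map_poly of_int g) ((of_nat t)\<^sup>2) \<in> P"
      using P.P_poly_cong[OF cong' intsq, of t] P.P_0 by simp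
    then show ?thesis unfolding polyg
      by (intro P.P_prod_prime algebraic_int_diff yint intsq) auto
  qed
  have uniq: "i = i'" if t: "t \<in> T" and i: "i \<in> {1..m}" "(of_nat t)\<^sup>2 - y i \<in> P"
    and i': "i' \<in> {1..m}" "(of_nat t)\<^sup>2 - y i' \<in> P" for t i i'
  proof (rule ccontr)
    assume ne: "i \<noteq> i'"
    define x where "x = ((of_nat t)\<^sup>2 :: complex)"
    have xint: "algebraic_int x" unfolding x_def by (rule intsq)
    \<comment> \<open>With two roots of g congruent to t^2, every summand of the derivative of g at
      t^2 has a factor in \<open>P\<close>. The model, however, has t^2 as a simple root modulo q,
      so its derivative there is a product of differences prime to q.\<close>
    have "poly (pderiv (map_poly of_int g)) x = (\<Sum>k\<in>{1..m}. \<Prod>l\<in>{1..m} - {k}. x - y l)"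
      unfolding g pderiv_prod by (simp add: poly_sum poly_prod pderiv_pCons)
    also have "\<dots> \<in> P"
    proof (rule P.P_sum)
      fix k assume "k \<in> {1..m}"
      show "(\<Prod>l\<in>{1..m} - {k}. x - y l) \<in> P"
      proof (cases "k = i")
        case True
        then show ?thesis using i' ne xint yint
          by (intro P.P_prodI[of _ _ i'] algebraic_int_diff) (auto simp: x_def)
      next
        case False
        then show ?thesis using i xint yint
          by (intro P.P_prodI[of _ _ i] algebraic_int_diff) (auto simp: x_def)
      qed
    qed
    also have "pderiv (map_poly of_int g :: complex poly) = map_poly of_int (pderiv g)"
      by (simp add: of_int_hom.map_poly_pderiv)
    finally have 1: "poly (map_poly of_int (pderiv g)) x \<in> P" .
    have "\<And>i. q dvd poly.coeff (pderiv G - pderiv g) i"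
      using cong'' by (auto simp: coeff_pderiv right_diff_distrib[symmetric] simp flip: coeff_diff pderiv_diff)
    from P.P_poly_cong[OF this xint 1] have "poly (map_poly of_int (pderiv G)) (of_int ((int t)\<^sup>2)) \<in> P"
      by (simp add: x_def)
    hence "of_int (poly (pderiv G) ((int t)\<^sup>2)) \<in> P" by (simp only: of_int_hom.poly_map_poly)
    hence qd: "q dvd poly (pderiv G) ((int t)\<^sup>2)" by (simp add: P.P_of_int_iff)
    define H where "H = [:-1, 1:] ^ e * (\<Prod>t'\<in>T - {t}. [:- (int t')\<^sup>2, 1:])"
    have "G = [:- (int t)\<^sup>2, 1:] * H"
      unfolding G_def inertia_model_def T_def[symmetric] H_def
      using t finT by (subst prod.remove[of T t]) (auto simp: algebra_simps)
    hence "poly (pderiv G) ((int t)\<^sup>2) = poly H ((int t)\<^sup>2)"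
      by (simp only: pderiv_mult poly_add poly_mult) (simp add: pderiv_pCons)
    also have "\<dots> = ((int t)\<^sup>2 - 1) ^ e * (\<Prod>t'\<in>T - {t}. (int t)\<^sup>2 - (int t')\<^sup>2)"
      by (simp add: H_def poly_prod)
    finally have "q dvd ((int t)\<^sup>2 - 1) ^ e * (\<Prod>t'\<in>T - {t}. (int t)\<^sup>2 - (int t')\<^sup>2)"
      using qd by simp
    hence "q dvd (int t)\<^sup>2 - 1 \<or> (\<exists>t'\<in>T - {t}. q dvd (int t)\<^sup>2 - (int t')\<^sup>2)"
      using q finT by (auto simp: prime_dvd_mult_iff prime_dvd_prod_iff dest: prime_dvd_power)
    moreover have "1 \<notin> T" by (simp add: T_def)
    ultimately show False using sq_dist[of t] sq_dist[of t 1] t by auto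
  qed
  define idx where "idx t = (SOME i. i \<in> {1..m} \<and> (of_nat t)\<^sup>2 - y i \<in> P)" for t
  have idx: "idx t \<in> {1..m}" "(of_nat t)\<^sup>2 - y (idx t) \<in> P" if "t \<in> T" for t
    using someI_ex[OF ex[OF that, unfolded Bex_def]] unfolding idx_def by blast+
  have idx_uniq: "i = idx t" if "t \<in> T" "i \<in> {1..m}" "(of_nat t)\<^sup>2 - y i \<in> P" for i t
    using uniq[OF that idx[OF that(1)]] .
  have idx_inj: "inj_on idx T"
  proof (rule inj_onI, rule ccontr)
    fix s t assume st: "s \<in> T" "t \<in> T" "idx s = idx t" "s \<noteq> t"
    have "((of_nat s)\<^sup>2 - y (idx s)) - ((of_nat t)\<^sup>2 - y (idx t)) \<in> P"
      by (rule P.P_diff[OF idx(2)[OF st(1)] idx(2)[OF st(2)]])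
    hence "of_int ((int s)\<^sup>2 - (int t)\<^sup>2) \<in> P" using st(3) by simp
    with sq_dist[of s t] st show False unfolding P.P_of_int_iff by simp
  qed
  define J where "J = idx ` T"
  define I where "I = {1..m} - J"
  have Jm: "J \<subseteq> {1..m}" using idx by (auto simp: J_def)
  have cardJ: "card J = m - e" unfolding J_def using idx_inj e by (simp add: card_image T_def)
  have cardI: "card I = e" unfolding I_def using Jm cardJ e by (simp add: card_Diff_subset finite_subset)
  have finI: "finite I" by (simp add: I_def)
  have I1: "1 - y i \<in> P" if "i \<in> I" for i
  proof (rule ccontr)
    assume "1 - y i \<notin> P"
    hence "y i - 1 \<notin> P" by (subst P.P_commute)
    with cls[of i] that obtain t where t: "t \<in> T" "y i - (of_nat t)\<^sup>2 \<in> P" by (auto simp: I_def)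
    hence "(of_nat t)\<^sup>2 - y i \<in> P" by (subst P.P_commute)
    from idx_uniq[OF t(1) _ this] that t(1) show False by (auto simp: I_def J_def)
  qed
  have J1: "1 - y j \<notin> P" if "j \<in> J" for j
  proof
    assume a: "1 - y j \<in> P"
    from that obtain t where t: "t \<in> T" "j = idx t" by (auto simp: J_def)
    have "((of_nat t)\<^sup>2 - y j) - (1 - y j) \<in> P" 
      unfolding t(2) by (rule P.P_diff[OF idx(2)[OF t(1)] a[unfolded t(2)]])
    hence "of_int ((int t)\<^sup>2 - (int 1)\<^sup>2) \<in> P" by simp
    moreover have "t \<noteq> 1" using t(1) by (auto simp: T_def)
    ultimately show False using sq_dist[of t 1] t(1) unfolding P.P_of_int_iff by auto
  qed
  define B where "B = digit_base m"
  have B0: "B > 0" by (simp add: B_def digit_base_def add_nonneg_pos)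
  define lin where "lin w = 1 - w 0 + (\<Sum>t\<in>T. of_int (B ^ t) * ((of_nat t)\<^sup>2 - w t))" for w :: "nat \<Rightarrow> complex"
  \<comment> \<open>All the differences t^2 - y (idx t) are packed into one number in base B. A
    conjugate of 1 - y i alone would not reveal whether the automorphism fixes the simple roots;
    after adding \<kappa> it does. The indices t start at 2, so digit 0 is free for 1 - y i.\<close>
  define \<kappa> where "\<kappa> = (\<Sum>t\<in>T. of_int (B ^ t) * ((of_nat t)\<^sup>2 - y (idx t)))"
  define z where "z i = 1 - y i + \<kappa>" for i
  have \<kappa>P: "\<kappa> \<in> P" unfolding \<kappa>_def by (intro P.P_sum P.P_mult idx algebraic_int_of_int)
  have zP: "z i \<in> P" if "i \<in> I" for i unfolding z_def using I1[OF that] \<kappa>P by (rule P.P_add)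
  have \<kappa>F: "\<kappa> \<in> F" unfolding \<kappa>_def
    by (intro subfield_sum[OF F] subfield_mult[OF F] subfield_diff[OF F] subfield_of_int[OF F] subfield_power[OF F] subfield_of_nat[OF F] yF idx)
  have zF: "z i \<in> F" if "i \<in> {1..m}" for i unfolding z_def
    by (intro subfield_add[OF F] subfield_diff[OF F] subfield_1[OF F] \<kappa>F yF that)
  have zint: "algebraic_int (z i)" if "i \<in> {1..m}" for i unfolding z_def
    by (rule algebraic_int_add[OF algebraic_int_diff[OF algebraic_int_1 yint[OF that]] P.P_int[OF \<kappa>P]])
  have zinj: "inj_on z {1..m}"
  proof (rule inj_onI)
    fix a b assume "a \<in> {1..m}" "b \<in> {1..m}" "z a = z b"
    then show "a = b" using inj_onD[OF inj, of a b] by (simp add: z_def)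
  qed
  have \<sigma>z: "\<sigma> (z i) = 1 - \<sigma> (y i) + (\<Sum>t\<in>T. of_int (B ^ t) * ((of_nat t)\<^sup>2 - \<sigma> (y (idx t))))"
    if s: "\<sigma> \<in> Aut" and i: "i \<in> {1..m}" for \<sigma> i
  proof -
    have h: "subfield_hom F \<sigma>" using s by (rule Aut_hom)
    have "\<sigma> \<kappa> = (\<Sum>t\<in>T. of_int (B ^ t) * ((of_nat t)\<^sup>2 - \<sigma> (y (idx t))))"
      unfolding \<kappa>_def
      by (subst hom_sum[OF F h], intro subfield_mult[OF F] subfield_diff[OF F] subfield_of_int[OF F] subfield_power[OF F] subfield_of_nat[OF F] yF idx, assumption)
        (intro sum.cong refl, subst hom_mult[OF F h], rule subfield_of_int[OF F],
          intro subfield_diff[OF F] subfield_of_int[OF F] subfield_power[OF F] subfield_of_nat[OF F] yF idx, assumption,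
          simp only: hom_of_int[OF F h] hom_power[OF F h subfield_of_nat[OF F]] hom_of_nat[OF F h] hom_diff[OF F h subfield_power[OF F subfield_of_nat[OF F]] yF[OF idx(1)]])
    then show ?thesis unfolding z_def
      using hom_add[OF F h subfield_diff[OF F subfield_1[OF F] yF[OF i]] \<kappa>F]
        hom_diff[OF F h subfield_1[OF F] yF[OF i]] hom_1[OF F h] by simp
  qed
  have \<sigma>y: "\<exists>k\<in>{1..m}. \<sigma> (y i) = y k" if s: "\<sigma> \<in> Aut" and i: "i \<in> {1..m}" for \<sigma> i
  proof -
    have "poly (map_poly of_int g) (y i) = 0" using i by (auto simp: polyg)
    from hom_root[OF Aut_hom[OF s] yF[OF i] this] show ?thesis by (auto simp: polyg)
  qed
  have main: "\<exists>\<sigma>\<in>Aut. \<sigma> (y i0) = y i1 \<and> (\<forall>j\<in>{1..m} - I. \<sigma> (y j) = y j)"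
    if i0: "i0 \<in> I" and i1: "i1 \<in> I" for i0 i1
  proof (rule ccontr)
    assume contra: "\<not> ?thesis"
    have IJ: "{1..m} - I = J" using Jm by (auto simp: I_def)
    define I0 where "I0 = {i \<in> I. \<exists>\<sigma>\<in>Aut. \<sigma> (y i0) = y i \<and> (\<forall>j\<in>J. \<sigma> (y j) = y j)}"
    have i1': "i1 \<in> I - I0" using i1 contra IJ by (auto simp: I0_def)
    have i0m: "i0 \<in> {1..m}" using i0 by (simp add: I_def)
    \<comment> \<open>The orbit is a set, so its product is invariant under all automorphisms
      without any multiplicities to follow. It is a rational integer, and divisible by q since its
      member z i0 lies in \<open>P\<close>.\<close>
    define \<Omega> where "\<Omega> = (\<lambda>\<sigma>. \<sigma> (z i0)) ` Aut"
    have "\<Omega> \<subseteq> (\<lambda>(a, b). 1 - y a + (\<Sum>t\<in>T. of_int (B ^ t) * ((of_nat t)\<^sup>2 - y (b t)))) ` ({1..m} \<times> (T \<rightarrow>\<^sub>E {1..m}))"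
    proof
      fix \<omega> assume "\<omega> \<in> \<Omega>"
      then obtain \<sigma> where s: "\<sigma> \<in> Aut" "\<omega> = \<sigma> (z i0)" by (auto simp: \<Omega>_def)
      obtain a where a: "a \<in> {1..m}" "\<sigma> (y i0) = y a" using \<sigma>y[OF s(1) i0m] by blast
      have "\<forall>t\<in>T. \<exists>k. k \<in> {1..m} \<and> \<sigma> (y (idx t)) = y k" using \<sigma>y[OF s(1) idx(1)] by blast
      from bchoice[OF this] obtain b where b: "\<forall>t\<in>T. b t \<in> {1..m} \<and> \<sigma> (y (idx t)) = y (b t)" ..
      have eq: "\<omega> = 1 - y a + (\<Sum>t\<in>T. of_int (B ^ t) * ((of_nat t)\<^sup>2 - y (restrict b T t)))"
        unfolding s(2) \<sigma>z[OF s(1) i0m] a(2) using b by (intro arg_cong2[where f = "(+)"] sum.cong refl) simp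
      show "\<omega> \<in> (\<lambda>(a, b). 1 - y a + (\<Sum>t\<in>T. of_int (B ^ t) * ((of_nat t)\<^sup>2 - y (b t)))) ` ({1..m} \<times> (T \<rightarrow>\<^sub>E {1..m}))"
      proof (rule image_eqI[of _ _ "(a, restrict b T)"])
        show "(a, restrict b T) \<in> {1..m} \<times> (T \<rightarrow>\<^sub>E {1..m})" using a(1) b by (intro SigmaI restrict_PiE_iff[THEN iffD2]) auto
      qed (simp only: eq prod.case)
    qed
    hence fin\<Omega>: "finite \<Omega>" by (rule finite_subset) (auto intro!: finite_PiE finT)
    have \<Omega>F: "\<omega> \<in> F" "algebraic_int \<omega>" if "\<omega> \<in> \<Omega>" for \<omega>
      using that Aut_in[OF _ zF[OF i0m]] Aut_algebraic_int[OF _ zF[OF i0m] zint[OF i0m]] by (auto simp: \<Omega>_def)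
    have stable: "\<sigma> ` \<Omega> = \<Omega>" if s: "\<sigma> \<in> Aut" for \<sigma>
    proof (rule endo_inj_surj[OF fin\<Omega>])
      show "\<sigma> ` \<Omega> \<subseteq> \<Omega>"
      proof
        fix x assume "x \<in> \<sigma> ` \<Omega>"
        then obtain \<tau> where "\<tau> \<in> Aut" "x = \<sigma> (\<tau> (z i0))" unfolding \<Omega>_def by blast
        then show "x \<in> \<Omega>" unfolding \<Omega>_def using Aut_comp[OF s, of \<tau>] by (intro image_eqI[of _ _ "\<lambda>x. \<sigma> (\<tau> x)"])
      qed
      show "inj_on \<sigma> \<Omega>"
        by (rule inj_on_subset[OF bij_betw_imp_inj_on[OF Aut_bij[OF s]]]) (use \<Omega>F(1) in blast)
    qed
    define N where "N = \<Prod>\<Omega>"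
    have "N \<in> \<int>"
    proof (rule fixed_integral_imp_int)
      show "N \<in> F" unfolding N_def using \<Omega>F by (intro subfield_prod[OF F]) auto
      show "algebraic_int N" unfolding N_def using \<Omega>F by (intro algebraic_int_prod) auto
      fix \<sigma> assume s: "\<sigma> \<in> Aut"
      have "\<sigma> N = (\<Prod>\<omega>\<in>\<Omega>. \<sigma> \<omega>)" unfolding N_def
        using hom_prod[OF F Aut_hom[OF s], of \<Omega> "\<lambda>x. x"] \<Omega>F by simp
      also have "\<dots> = \<Prod>(\<sigma> ` \<Omega>)"
        using Aut_bij[OF s] \<Omega>F(1) by (subst prod.reindex) (auto simp: bij_betw_def inj_on_def)
      finally show "\<sigma> N = N" using stable[OF s] by (simp add: N_def)
    qed
    then obtain N' where N': "N = of_int N'" by (auto elim: Ints_cases)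
    have "z i0 \<in> \<Omega>" unfolding \<Omega>_def using Aut_id by (auto intro!: image_eqI[of _ _ "\<lambda>x. x"])
    hence "N \<in> P" unfolding N_def using \<Omega>F fin\<Omega> zP[OF i0] by (intro P.P_prodI[of _ _ "z i0"]) auto
    hence "q dvd N'" by (simp add: N' P.P_of_int_iff)
    then obtain w where "N' = q * w" by (elim dvdE)
    hence w: "N = of_int q * of_int w" by (simp add: N')
    \<comment> \<open>Membership of a conjugate in \<open>P\<close> is decided digit by digit, which
      singles out the automorphisms that fix every simple root and send y i0 to another root
      congruent to 1.\<close>
    have \<Omega>P: "\<Omega> \<inter> P = z ` I0"
    proof (intro equalityI subsetI)
      fix \<omega> assume "\<omega> \<in> z ` I0"
      then obtain i \<sigma> where i: "i \<in> I" "\<omega> = z i" "\<sigma> \<in> Aut" "\<sigma> (y i0) = y i" "\<forall>j\<in>J. \<sigma> (y j) = y j"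
        by (auto simp: I0_def)
      have "(\<Sum>t\<in>T. of_int (B ^ t) * ((of_nat t)\<^sup>2 - \<sigma> (y (idx t)))) = \<kappa>"
        unfolding \<kappa>_def using i(5) by (intro sum.cong refl) (simp add: J_def)
      hence "\<sigma> (z i0) = z i" unfolding \<sigma>z[OF i(3) i0m] i(4) by (simp add: z_def)
      hence "\<omega> \<in> \<Omega>" unfolding \<Omega>_def i(2) using i(3) by (intro image_eqI[of _ _ \<sigma>]) simp_all
      then show "\<omega> \<in> \<Omega> \<inter> P" using zP[OF i(1)] unfolding i(2) by simp
    next
      fix \<omega> assume "\<omega> \<in> \<Omega> \<inter> P"
      then obtain \<sigma> where s: "\<sigma> \<in> Aut" "\<omega> = \<sigma> (z i0)" "\<omega> \<in> P" by (auto simp: \<Omega>_def)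
      \<comment> \<open>The integer residue of y i modulo \<open>P\<close>. Replacing all roots by
        their residues turns a conjugate of z i0 into an integer with the signed digits
        \<open>D\<close>; if the conjugate lies in \<open>P\<close>, then q divides this integer,
        and by the size of q all digits vanish.\<close>
      define b where "b i = (if i \<in> I then 1 else (int (inv_into T idx i))\<^sup>2)" for i
      have b: "of_int (b i) - y i \<in> P" if "i \<in> {1..m}" for i
      proof (cases "i \<in> I")
        case False
        hence "i \<in> J" using that by (auto simp: I_def)
        hence "inv_into T idx i \<in> T" "idx (inv_into T idx i) = i"
          unfolding J_def by (auto simp: inv_into_into f_inv_into_f)
        then show ?thesis using idx(2)[of "inv_into T idx i"] False by (simp add: b_def)
      qed (use I1 in \<open>auto simp: b_def\<close>)
      have bT: "b (idx t) = (int t)\<^sup>2" if "t \<in> T" for t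
        using that idx_inj by (auto simp: b_def I_def J_def inv_into_f_f)
      have bb: "0 \<le> b i \<and> b i < B" if "i \<in> {1..m}" for i
      proof (cases "i \<in> I")
        case False
        hence "i \<in> J" using that by (auto simp: I_def)
        hence "inv_into T idx i \<in> T" unfolding J_def by (auto simp: inv_into_into)
        then show ?thesis using False sq by (auto simp: b_def B_def)
      qed (use e in \<open>auto simp: b_def B_def digit_base_def\<close>)
      obtain a where a: "a \<in> {1..m}" "\<sigma> (y i0) = y a" using \<sigma>y[OF s(1) i0m] by blast
      have "\<forall>t\<in>T. \<exists>k. k \<in> {1..m} \<and> \<sigma> (y (idx t)) = y k" using \<sigma>y[OF s(1) idx(1)] by blast
      from bchoice[OF this] obtain c' where c': "\<forall>t\<in>T. c' t \<in> {1..m} \<and> \<sigma> (y (idx t)) = y (c' t)" ..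
      define c where "c = c'"
      have c: "c t \<in> {1..m}" "\<sigma> (y (idx t)) = y (c t)" if "t \<in> T" for t using c' that by (simp_all add: c_def)
      define D where "D t = (if t = 0 then 1 - b a else (int t)\<^sup>2 - b (c t))" for t
      have T0: "0 \<notin> T" by (simp add: T_def)
      have D0: "\<bar>D t\<bar> < B" if "t \<in> insert 0 T" for t
      proof (cases "t = 0")
        case True
        have "1 < B" using e by (simp add: B_def digit_base_def)
        then show ?thesis using bb[OF a(1)] True by (auto simp: D_def)
      next
        case False
        hence t: "t \<in> T" using that by simp
        have "D t = (int t)\<^sup>2 - b (c t)" using False by (simp add: D_def)
        moreover have "(int t)\<^sup>2 < B" "0 \<le> (int t)\<^sup>2" using sq[OF t] by (simp_all add: B_def)
        moreover have "0 \<le> b (c t)" "b (c t) < B" using bb[OF c(1)[OF t]] by simp_all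
        ultimately show ?thesis by linarith
      qed
      have "of_int (\<Sum>t\<in>insert 0 T. D t * B ^ t) = of_int (1 - b a) + (\<Sum>t\<in>T. of_int (B ^ t) * of_int ((int t)\<^sup>2 - b (c t)) :: complex)"
        using T0 finT by (auto simp: D_def mult.commute intro!: sum.cong)
      also have "\<dots> = \<omega> - ((of_int (b a) - y a) + (\<Sum>t\<in>T. of_int (B ^ t) * (of_int (b (c t)) - y (c t))))"
        unfolding s(2) \<sigma>z[OF s(1) i0m] a(2)
        by (simp add: c(2) sum.distrib sum_subtractf algebra_simps)
      also have "\<dots> \<in> P" 
        by (rule P.P_diff[OF s(3) P.P_add[OF b[OF a(1)] P.P_sum[OF P.P_mult[OF b[OF c(1)] algebraic_int_of_int]]]])
      finally have "q dvd (\<Sum>t\<in>insert 0 T. D t * B ^ t)" by (simp only: P.P_of_int_iff)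
      moreover have "\<bar>\<Sum>t\<in>insert 0 T. D t * B ^ t\<bar> < q"
      proof -
        have "\<bar>\<Sum>t\<in>insert 0 T. D t * B ^ t\<bar> \<le> (\<Sum>t\<in>insert 0 T. \<bar>D t * B ^ t\<bar>)" by (rule sum_abs)
        also have "\<dots> \<le> (\<Sum>t\<in>insert 0 T. B * B ^ t)"
          using D0 B0 by (intro sum_mono) (auto simp: abs_mult intro!: mult_right_mono less_imp_le)
        also have "\<dots> \<le> (\<Sum>t\<le>m. B * B ^ t)"
          using Tm B0 by (intro sum_mono2) (auto simp: less_imp_le)
        also have "\<dots> < q" using qb by (simp add: prime_bound_def B_def)
        finally show ?thesis .
      qed
      ultimately have sum0: "(\<Sum>t\<in>insert 0 T. D t * B ^ t) = 0"
        using dvd_imp_le_int[of "\<Sum>t\<in>insert 0 T. D t * B ^ t" q] q prime_gt_0_int[of q] by (cases "(\<Sum>t\<in>insert 0 T. D t * B ^ t) = 0") auto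
      have Dz: "D t = 0" if "t \<in> insert 0 T" for t
      proof (rule digits_zero[of "insert 0 T" D B t])
        show "\<bar>D u\<bar> < B" if "u \<in> insert 0 T" for u by (rule D0[OF that])
      qed (use finT sum0 that in auto)
      have fixJ: "\<sigma> (y j) = y j" if "j \<in> J" for j
      proof -
        obtain t where t: "t \<in> T" "j = idx t" using \<open>j \<in> J\<close> by (auto simp: J_def)
        have "b (c t) = (int t)\<^sup>2" using Dz[of t] t T0 by (auto simp: D_def split: if_splits)
        hence "(of_nat t)\<^sup>2 - y (c t) \<in> P" using b[OF c(1)[OF t(1)]] by simp
        hence "c t = idx t" by (rule idx_uniq[OF t(1) c(1)[OF t(1)]])
        then show ?thesis using c(2)[OF t(1)] t(2) by simp
      qed
      have "b a = 1" using Dz[of 0] by (simp add: D_def)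
      hence a1: "1 - y a \<in> P" using b[OF a(1)] by simp
      have "a \<in> I" using J1[of a] a1 a(1) by (auto simp: I_def)
      hence "a \<in> I0" unfolding I0_def using s(1) a(2) fixJ by blast
      moreover have "(\<Sum>t\<in>T. of_int (B ^ t) * ((of_nat t)\<^sup>2 - \<sigma> (y (idx t)))) = \<kappa>"
        unfolding \<kappa>_def using fixJ by (intro sum.cong refl) (simp add: J_def)
      hence "\<omega> = z a" unfolding s(2) \<sigma>z[OF s(1) i0m] a(2) by (simp add: z_def)
      ultimately show "\<omega> \<in> z ` I0" by blast
    qed
    define u where "u = \<Prod>(\<Omega> - P)"
    have "u \<notin> P"
    proof
      assume "u \<in> P"
      hence "\<exists>\<omega>\<in>\<Omega> - P. \<omega> \<in> P" unfolding u_def using fin\<Omega> \<Omega>F by (intro P.P_prod_prime) auto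
      then show False by blast
    qed
    have uint: "algebraic_int u" unfolding u_def using \<Omega>F by (intro algebraic_int_prod) auto
    have I0I: "I0 \<subseteq> I" by (auto simp: I0_def)
    have Im: "I \<subseteq> {1..m}" by (auto simp: I_def)
    have N_split: "N = u * (\<Prod>i\<in>I0. z i)"
    proof -
      have "N = \<Prod>(\<Omega> - P) * \<Prod>(\<Omega> \<inter> P)"
        unfolding N_def using fin\<Omega> by (subst prod.union_disjoint[symmetric]) (auto intro!: prod.cong)
      also have "\<Prod>(\<Omega> \<inter> P) = (\<Prod>i\<in>I0. z i)"
        unfolding \<Omega>P using inj_on_subset[OF zinj] I0I Im by (subst prod.reindex) auto
      finally show ?thesis by (simp add: u_def)
    qed
    define v where "v = (\<Prod>i\<in>I - I0. z i)"
    have vP: "v \<in> P" unfolding v_def using i1' zP zint Im finI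
      by (intro P.P_prodI[of _ _ i1]) auto
    \<comment> \<open>Here u is the product of the conjugates outside \<open>P\<close>, and v
      carries the factor z i1 of the index that is assumed to be unreachable. So the product over I
      times u is not merely in q times the ring but in q P.\<close>
    have eq1: "u * (\<Prod>i\<in>I. z i) = of_int q * of_int w * v"
    proof -
      have "(\<Prod>i\<in>I. z i) = v * (\<Prod>i\<in>I0. z i)"
        unfolding v_def using I0I finI by (metis prod.subset_diff)
      then show ?thesis using N_split w by (simp add: algebra_simps)
    qed
    define h where "h = (\<Prod>j\<in>J. 1 - y j)"
    have hint: "algebraic_int h" unfolding h_def using yint Jm by (intro algebraic_int_prod algebraic_int_diff) auto
    have hP: "h \<notin> P"
    proof
      assume "h \<in> P"
      hence "\<exists>j\<in>J. 1 - y j \<in> P" unfolding h_def using finT yint Jm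
        by (intro P.P_prod_prime algebraic_int_diff) (auto simp: J_def)
      then show False using J1 by blast
    qed
    have g1: "of_int (poly g 1) = (\<Prod>i\<in>I. 1 - y i) * h"
    proof -
      have "{1..m} = I \<union> J" "I \<inter> J = {}" using Jm by (auto simp: I_def)
      then show ?thesis using polyg_int[of 1] finI finT by (simp add: h_def prod.union_disjoint J_def)
    qed
    have "(\<Prod>i\<in>I. 1 - y i) \<in> P" using i0 I1 finI yint Im
      by (intro P.P_prodI[of _ _ i0] algebraic_int_diff) auto
    hence "of_int (poly g 1) \<in> P" unfolding g1 using hint by (intro P.P_mult') auto
    hence "q dvd poly g 1" by (simp only: P.P_of_int_iff)
    then obtain g' where g': "poly g 1 = q * g'" by (elim dvdE)
    have g'q: "\<not> q dvd g'" using exact g' by (auto simp: power2_eq_square)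
    \<comment> \<open>A multiplier outside \<open>P\<close> that makes \<kappa> divisible by q: t^2
      - y (idx t) times the other factors is g(t^2), an integer multiple of q. Membership of
      \<kappa> in \<open>P\<close> alone would be too weak for a comparison modulo q P.\<close>
    define U where "U = (\<Prod>t\<in>T. \<Prod>i\<in>{1..m} - {idx t}. (of_nat t)\<^sup>2 - y i)"
    have Uint: "algebraic_int U" unfolding U_def using yint
      by (intro algebraic_int_prod algebraic_int_diff intsq) auto
    have UP: "U \<notin> P"
    proof
      assume "U \<in> P"
      hence "\<exists>t\<in>T. (\<Prod>i\<in>{1..m} - {idx t}. (of_nat t)\<^sup>2 - y i) \<in> P"
        unfolding U_def using yint
        by (intro P.P_prod_prime algebraic_int_prod algebraic_int_diff intsq finT) auto
      then obtain t where t: "t \<in> T" "(\<Prod>i\<in>{1..m} - {idx t}. (of_nat t)\<^sup>2 - y i) \<in> P" by blast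
      have "\<exists>i\<in>{1..m} - {idx t}. (of_nat t)\<^sup>2 - y i \<in> P"
        by (rule P.P_prod_prime[OF _ _ t(2)]) (use yint in \<open>auto intro!: algebraic_int_diff intsq\<close>)
      then show False using idx_uniq[OF t(1)] by auto
    qed
    have "\<exists>\<kappa>'. algebraic_int \<kappa>' \<and> U * \<kappa> = of_int q * \<kappa>'"
    proof -
      have "\<exists>k. algebraic_int k \<and> U * (of_int (B ^ t) * ((of_nat t)\<^sup>2 - y (idx t))) = of_int q * k" if t: "t \<in> T" for t
      proof -
        define U' where "U' = (\<Prod>s\<in>T - {t}. \<Prod>i\<in>{1..m} - {idx s}. (of_nat s)\<^sup>2 - y i)"
        have U'int: "algebraic_int U'" unfolding U'_def using yint
          by (intro algebraic_int_prod algebraic_int_diff intsq) auto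
        have "of_int (poly g ((int t)\<^sup>2)) = (\<Prod>i\<in>{1..m}. (of_nat t)\<^sup>2 - y i)"
          using polyg_int[of "(int t)\<^sup>2"] by simp
        also have "\<dots> = ((of_nat t)\<^sup>2 - y (idx t)) * (\<Prod>i\<in>{1..m} - {idx t}. (of_nat t)\<^sup>2 - y i)"
          using idx(1)[OF t] by (subst prod.remove[of _ "idx t"]) auto
        finally have *: "of_int (poly g ((int t)\<^sup>2)) = \<dots>" .
        have "poly (map_poly of_int G) ((of_nat t)\<^sup>2 :: complex) = 0"
          unfolding polyG using t finT by auto
        hence "poly (map_poly of_int g) ((of_nat t)\<^sup>2) \<in> P"
          using P.P_poly_cong[OF cong' intsq, of t] P.P_0 by simp
        hence "of_int (poly g ((int t)\<^sup>2)) \<in> P" unfolding * polyg using idx(1)[OF t]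
          by (subst (asm) prod.remove[of _ "idx t"]) auto
        hence "q dvd poly g ((int t)\<^sup>2)" by (simp only: P.P_of_int_iff)
        then obtain k where k: "poly g ((int t)\<^sup>2) = q * k" by (elim dvdE)
        have "U = (\<Prod>i\<in>{1..m} - {idx t}. (of_nat t)\<^sup>2 - y i) * U'"
          unfolding U_def U'_def using t finT by (subst prod.remove[of _ t]) auto
        hence "U * (of_int (B ^ t) * ((of_nat t)\<^sup>2 - y (idx t))) = U' * of_int (B ^ t) * of_int (poly g ((int t)\<^sup>2))"
          unfolding * by (simp only: mult_ac)
        also have "\<dots> = of_int q * (U' * of_int (B ^ t) * of_int k)" unfolding k by simp
        finally have E: "U * (of_int (B ^ t) * ((of_nat t)\<^sup>2 - y (idx t))) = of_int q * (U' * of_int (B ^ t) * of_int k)" .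
        show ?thesis
          by (intro exI[of _ "U' * of_int (B ^ t) * of_int k"] conjI E algebraic_int_mult U'int algebraic_int_of_int)
      qed
      then obtain k where k: "\<And>t. t \<in> T \<Longrightarrow> algebraic_int (k t) \<and> U * (of_int (B ^ t) * ((of_nat t)\<^sup>2 - y (idx t))) = of_int q * k t"
        by metis
      have "U * \<kappa> = of_int q * (\<Sum>t\<in>T. k t)" unfolding \<kappa>_def sum_distrib_left using k by (intro sum.cong) auto
      moreover have "algebraic_int (\<Sum>t\<in>T. k t)" using k by (intro algebraic_int_sum) auto
      ultimately show ?thesis by blast
    qed
    then obtain \<kappa>' where \<kappa>': "algebraic_int \<kappa>'" "U * \<kappa> = of_int q * \<kappa>'" by blast
    \<comment> \<open>Since e is at least 2, the cofactor R of \<kappa> lies in \<open>P\<close>.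
      After multiplication by U the shift by \<kappa> therefore changes the product only by an
      element of q P.\<close>
    obtain R where R: "(\<Prod>i\<in>I. 1 - y i + \<kappa>) = (\<Prod>i\<in>I. 1 - y i) + \<kappa> * R" "R \<in> P"
      using P.prod_shift[OF finI, of "\<lambda>i. 1 - y i" \<kappa>] I1 \<kappa>P cardI e by auto
    have q0: "of_int q \<noteq> (0::complex)" using q by auto
    have "of_int q * (U * h * of_int w * v) = U * h * (u * (\<Prod>i\<in>I. z i))"
      unfolding eq1 by (simp add: algebra_simps)
    also have "\<dots> = u * U * ((\<Prod>i\<in>I. 1 - y i) * h) + u * h * (U * \<kappa>) * R"
      unfolding z_def R(1) by (simp add: algebra_simps)
    also have "\<dots> = of_int q * (u * U * of_int g' + u * h * \<kappa>' * R)"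
      unfolding \<kappa>'(2) g1[symmetric] g' by (simp add: algebra_simps)
    finally have "U * h * of_int w * v = u * U * of_int g' + u * h * \<kappa>' * R" using q0 by simp
    hence "u * U * of_int g' = U * h * of_int w * v - u * h * \<kappa>' * R" by simp
    also have "\<dots> \<in> P" using vP R(2) Uint hint uint \<kappa>'(1)
      by (intro P.P_diff P.P_mult algebraic_int_mult) auto
    finally have "u * U * of_int g' \<in> P" .
    hence "u * U \<in> P \<or> of_int g' \<in> P" by (intro P.P_prime algebraic_int_mult uint Uint) auto
    hence "u \<in> P \<or> U \<in> P \<or> of_int g' \<in> P" using P.P_prime[OF uint Uint] by blast
    then show False using \<open>u \<notin> P\<close> UP g'q by (simp add: P.P_of_int_iff)
  qed
  show ?thesis by (rule that[OF _ cardI main]) (auto simp: I_def)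
qed

section \<open>Signed permutations and the Galois group of an even polynomial\<close>

text \<open>In the numbering by \<open>signed_point\<close> the pair i consists of i and m + i.
  \<open>pair_perm\<close> is the part of the wreath product that moves pairs and keeps signs, and
  \<open>flip\<close> below is the part that only changes signs.\<close>

definition pair_perm :: "nat \<Rightarrow> (nat \<Rightarrow> nat) \<Rightarrow> nat \<Rightarrow> nat" where
  "pair_perm m \<tau> k = (if k \<in> {1..m} then \<tau> k else if k \<in> {m+1..2*m} then m + \<tau> (k - m) else k)"

definition flip :: "nat \<Rightarrow> nat set \<Rightarrow> nat \<Rightarrow> nat" where
  "flip m D k = (if k \<in> D then m + k else if m < k \<and> k - m \<in> D then k - m else k)"

lemma flip_permutes_sign:
  assumes "finite D" "D \<subseteq> {1..m}"
  shows "flip m D permutes {1..2*m} \<and> sign (flip m D) = (-1) ^ card D"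
  using assms
proof (induction D rule: finite_induct)
  case empty
  have "flip m {} = id" by (auto simp: flip_def)
  then show ?case by (simp only: permutes_id sign_id card.empty power_0)
next
  case (insert d D)
  have eq: "flip m (insert d D) = Transposition.transpose d (m + d) \<circ> flip m D"
  proof
    fix k
    show "flip m (insert d D) k = (Transposition.transpose d (m + d) \<circ> flip m D) k"
      using insert.hyps insert.prems
      by (auto simp: flip_def Transposition.transpose_def)
  qed
  have t: "Transposition.transpose d (m + d) permutes {1..2*m}"
    using insert.prems by (intro permutes_swap_id) auto
  have IH: "flip m D permutes {1..2*m}" "sign (flip m D) = (-1) ^ card D" using insert by auto
  have perm: "permutation (flip m D)" using IH(1) by (auto simp: permutation_permutes)
  have "d \<noteq> m + d" using insert.prems by auto
  hence "sign (Transposition.transpose d (m + d) \<circ> flip m D) = (-1) ^ card (insert d D)"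
    unfolding sign_compose[OF permutation_swap_id perm] using insert.hyps IH(2) by (simp add: sign_swap_id)
  with permutes_compose[OF IH(1) t] show ?case unfolding eq by blast
qed

lemmas flip_permutes = flip_permutes_sign[THEN conjunct1]
  and sign_flip = flip_permutes_sign[THEN conjunct2]

text \<open>Conjugation by the full flip carries \<tau> from the lower half to the upper half. The
  two copies have equal signs, so \<open>pair_perm\<close> is always even, and the parity of a
  signed permutation is that of its number of sign changes.\<close>

lemma pair_perm_eq:
  assumes "\<tau> permutes {1..m}"
  shows "pair_perm m \<tau> = \<tau> \<circ> (flip m {1..m} \<circ> \<tau> \<circ> flip m {1..m})"
proof
  fix k
  have in1: "\<tau> i \<in> {1..m} \<longleftrightarrow> i \<in> {1..m}" for i using permutes_in_image[OF assms] .
  have out: "\<tau> i = i" if "i \<notin> {1..m}" for i using permutes_not_in[OF assms that] .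
  consider "k \<in> {1..m}" | i where "k = m + i" "i \<in> {1..m}" | "k = 0" | "k > 2 * m"
  proof -
    have "k \<in> {1..m} \<or> (k = m + (k - m) \<and> k - m \<in> {1..m}) \<or> k = 0 \<or> k > 2 * m" by auto
    then show ?thesis using that by blast
  qed
  then show "pair_perm m \<tau> k = (\<tau> \<circ> (flip m {1..m} \<circ> \<tau> \<circ> flip m {1..m})) k"
  proof cases
    case 1
    then show ?thesis by (simp add: pair_perm_def flip_def out)
  next
    case (2 i)
    have "\<tau> i \<in> {1..m}" using 2 in1 by simp
    then show ?thesis using 2 by (auto simp: pair_perm_def flip_def out)
  next
    case 3
    then show ?thesis by (simp add: pair_perm_def flip_def out)
  next
    case 4
    hence "flip m {1..m} k = k" "pair_perm m \<tau> k = k" by (auto simp: pair_perm_def flip_def)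
    then show ?thesis using 4 by (simp add: out)
  qed
qed

lemma pair_perm_permutes_sign:
  assumes "\<tau> permutes {1..m}"
  shows "pair_perm m \<tau> permutes {1..2*m}" "sign (pair_perm m \<tau>) = 1"
proof -
  have t: "\<tau> permutes {1..2*m}" by (rule permutes_subset[OF assms]) auto
  have f: "flip m {1..m} permutes {1..2*m}" by (rule flip_permutes) auto
  have pt: "permutation \<tau>" and pf: "permutation (flip m {1..m})"
    using t f by (auto simp: permutation_permutes)
  show "pair_perm m \<tau> permutes {1..2*m}"
    unfolding pair_perm_eq[OF assms] by (intro permutes_compose t f)
  have "sign (pair_perm m \<tau>) = sign \<tau> * (sign (flip m {1..m}) * sign \<tau> * sign (flip m {1..m}))"
    unfolding pair_perm_eq[OF assms]
    by (simp only: sign_compose[OF pt permutation_compose[OF permutation_compose[OF pf pt] pf]]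
        sign_compose[OF permutation_compose[OF pf pt] pf] sign_compose[OF pf pt])
  also have "\<dots> = 1" by (auto simp: sign_def)
  finally show "sign (pair_perm m \<tau>) = 1" .
qed

lemma pair_perm_flip:
  assumes "\<tau> permutes {1..m}" "D \<subseteq> {1..m}"
  shows "pair_perm m \<tau> \<circ> flip m D permutes {1..2*m}"
    "evenperm (pair_perm m \<tau> \<circ> flip m D) \<longleftrightarrow> even (card D)"
proof -
  have fin: "finite D" using assms(2) finite_subset by blast
  note p = pair_perm_permutes_sign[OF assms(1)] and f = flip_permutes[OF fin assms(2)] sign_flip[OF fin assms(2)]
  show "pair_perm m \<tau> \<circ> flip m D permutes {1..2*m}" by (rule permutes_compose[OF f(1) p(1)])
  have "permutation (pair_perm m \<tau>)" "permutation (flip m D)"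
    using p f by (auto simp: permutation_permutes)
  hence "sign (pair_perm m \<tau> \<circ> flip m D) = (-1) ^ card D"
    by (simp add: sign_compose p f)
  then show "evenperm (pair_perm m \<tau> \<circ> flip m D) \<longleftrightarrow> even (card D)"
    by (cases "even (card D)") (auto simp: sign_def split: if_splits)
qed

lemma pair_perm_flip_apply:
  assumes "D \<subseteq> {1..m}" "i \<in> {1..m}"
  shows "(pair_perm m \<tau> \<circ> flip m D) i = (if i \<in> D then m + \<tau> i else \<tau> i)"
    "(pair_perm m \<tau> \<circ> flip m D) (m + i) = (if i \<in> D then \<tau> i else m + \<tau> i)"
  using assms by (auto simp: pair_perm_def flip_def)

text \<open>A normal form in which the sign function is replaced by the set D where it is -1. In
  this form the intersection with the alternating group is the condition
  \<open>even (card D)\<close>.\<close>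

lemma signed_perm_group_eq:
  "signed_perm_group m = {pair_perm m \<tau> \<circ> flip m D | \<tau> D. \<tau> permutes {1..m} \<and> D \<subseteq> {1..m}}"
proof (intro equalityI subsetI)
  fix \<pi> assume "\<pi> \<in> signed_perm_group m"
  then obtain \<epsilon> \<tau> where \<pi>: "\<pi> permutes {1..2*m}" "\<tau> permutes {1..m}"
      and \<epsilon>: "\<And>i. i \<in> {1..m} \<Longrightarrow> \<epsilon> i = 1 \<or> \<epsilon> i = -1"
      and eq: "\<And>i s. i \<in> {1..m} \<Longrightarrow> s \<in> {1,-1} \<Longrightarrow> \<pi> (signed_point m s i) = signed_point m (\<epsilon> i * s) (\<tau> i)"
    
  proof -
    from \<open>\<pi> \<in> signed_perm_group m\<close> obtain \<epsilon> \<tau> where *: "\<pi> permutes {1..2*m}" "\<tau> permutes {1..m}"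
      "\<epsilon> \<in> {1..m} \<rightarrow> {1, -1}"
      "\<forall>i\<in>{1..m}. \<forall>s\<in>{1, -1}. \<pi> (signed_point m s i) = signed_point m (\<epsilon> i * s) (\<tau> i)"
      unfolding signed_perm_group_def sym_group_carrier by blast
    show ?thesis by (rule that[of \<tau> \<epsilon>]) (use * in blast)+
  qed
  define D where "D = {i \<in> {1..m}. \<epsilon> i = -1}"
  have D: "D \<subseteq> {1..m}" by (auto simp: D_def)
  have "\<pi> = pair_perm m \<tau> \<circ> flip m D"
  proof
    fix k
    consider "k \<in> {1..m}" | i where "k = m + i" "i \<in> {1..m}" | "k \<notin> {1..2*m}"
    proof -
      have "k \<in> {1..m} \<or> (k = m + (k - m) \<and> k - m \<in> {1..m}) \<or> k \<notin> {1..2*m}" by auto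
      then show ?thesis using that by blast
    qed
    then show "\<pi> k = (pair_perm m \<tau> \<circ> flip m D) k"
    proof cases
      case 1
      then show ?thesis unfolding pair_perm_flip_apply(1)[OF D 1]
        using eq[OF 1, of 1] \<epsilon>[OF 1] by (auto simp: signed_point_def D_def)
    next
      case (2 i)
      show ?thesis unfolding 2(1) pair_perm_flip_apply(2)[OF D 2(2)]
        using eq[OF 2(2), of "-1"] \<epsilon>[OF 2(2)] 2(2) by (auto simp: signed_point_def D_def)
    next
      case 3
      then show ?thesis
        using permutes_not_in[OF \<pi>(1)] permutes_not_in[OF pair_perm_flip(1)[OF \<pi>(2) D]] by metis
    qed
  qed
  with \<pi>(2) D show "\<pi> \<in> {pair_perm m \<tau> \<circ> flip m D | \<tau> D. \<tau> permutes {1..m} \<and> D \<subseteq> {1..m}}" by blast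
next
  fix \<pi> assume "\<pi> \<in> {pair_perm m \<tau> \<circ> flip m D | \<tau> D. \<tau> permutes {1..m} \<and> D \<subseteq> {1..m}}"
  then obtain \<tau> D where \<pi>: "\<pi> = pair_perm m \<tau> \<circ> flip m D" "\<tau> permutes {1..m}" "D \<subseteq> {1..m}" by blast
  define \<epsilon> where "\<epsilon> i = (if i \<in> D then -1 else 1 :: int)" for i
  have "\<pi> (signed_point m s i) = signed_point m (\<epsilon> i * s) (\<tau> i)" if i: "i \<in> {1..m}" and s: "s \<in> {1,-1}" for i s
    using s pair_perm_flip_apply[OF \<pi>(3) i, of \<tau>] unfolding \<pi>(1)[symmetric]
    by (auto simp: signed_point_def \<epsilon>_def)
  moreover have "\<epsilon> \<in> {1..m} \<rightarrow> {1, -1}" by (auto simp: \<epsilon>_def)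
  moreover have "\<pi> permutes {1..2*m}" unfolding \<pi>(1) by (rule pair_perm_flip(1)[OF \<pi>(2,3)])
  ultimately show "\<pi> \<in> signed_perm_group m"
    unfolding signed_perm_group_def sym_group_carrier using \<pi>(2) by blast
qed

section \<open>The splitting field and the Galois group of the definitions in terms of subfields of
  the complex numbers\<close>

abbreviation "Cring \<equiv> (ring_of_type_algebra :: complex ring)"

lemma complex_ring_ops:
  "\<one>\<^bsub>Cring\<^esub> = 1" "\<zero>\<^bsub>Cring\<^esub> = 0" "x \<oplus>\<^bsub>Cring\<^esub> y = x + y" "x \<otimes>\<^bsub>Cring\<^esub> y = x * y" "carrier Cring = UNIV"
  by (simp_all add: ring_of_type_algebra_def)

lemma complex_ring_inv: "\<ominus>\<^bsub>Cring\<^esub> x = - x" "x \<noteq> 0 \<Longrightarrow> inv\<^bsub>Cring\<^esub> x = inverse x"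
proof -
  interpret R: Ring.field Cring by (rule field_from_type_algebra)
  show "\<ominus>\<^bsub>Cring\<^esub> x = - x"
    by (rule R.minus_equality) (simp_all add: complex_ring_ops)
  show "inv\<^bsub>Cring\<^esub> x = inverse x" if "x \<noteq> 0"
    using that by (intro R.comm_inv_char) (simp_all add: complex_ring_ops)
qed

lemma splitting_field_splitting:
  assumes "f \<noteq> 0"
  shows "splitting (carrier (splitting_field f)) f"
proof
  define H where "H = \<rat> \<union> complex_roots f"
  have car: "carrier (splitting_field f) = generate_field Cring H"
    by (simp add: splitting_field_def H_def)
  have one: "1 \<in> generate_field Cring H" using generate_field.one[of Cring H] by (simp add: complex_ring_ops)
  have neg: "- x \<in> generate_field Cring H" if "x \<in> generate_field Cring H" for x
    using generate_field.a_inv[OF that] by (simp add: complex_ring_inv)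
  have add: "x + y \<in> generate_field Cring H" if "x \<in> generate_field Cring H" "y \<in> generate_field Cring H" for x y
    using generate_field.eng_add[OF that] by (simp add: complex_ring_ops)
  have mult: "x * y \<in> generate_field Cring H" if "x \<in> generate_field Cring H" "y \<in> generate_field Cring H" for x y
    using generate_field.eng_mult[OF that] by (simp add: complex_ring_ops)
  have inv: "inverse x \<in> generate_field Cring H" if "x \<in> generate_field Cring H" for x
    using generate_field.m_inv[OF that] that by (cases "x = 0") (simp_all add: complex_ring_ops complex_ring_inv)
  show "is_subfield (carrier (splitting_field f))" unfolding car is_subfield_def
    using one mult inv add[OF _ neg] by (metis (no_types, lifting) add_uminus_conv_diff)
  show "f \<noteq> 0" by fact
  show "{z. poly (map_poly of_int f) z = 0} \<subseteq> carrier (splitting_field f)"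
    unfolding car using generate_field.incl[of _ H Cring] by (auto simp: H_def complex_roots_def)
  fix E assume E: "is_subfield E" "{z. poly (map_poly of_int f) z = 0} \<subseteq> E"
  show "carrier (splitting_field f) \<subseteq> E"
  proof
    fix x assume "x \<in> carrier (splitting_field f)"
    hence "x \<in> generate_field Cring H" by (simp add: car)
    then show "x \<in> E"
    proof (induction rule: generate_field.induct)
      case (incl h)
      then show ?case using E subfield_Rats[OF E(1)] by (auto simp: H_def complex_roots_def)
    qed (auto simp: complex_ring_ops complex_ring_inv intro: subfield_1[OF E(1)] subfield_uminus[OF E(1)]
        subfield_inverse[OF E(1)] subfield_add[OF E(1)] subfield_mult[OF E(1)])
  qed
qed

lemma field_automorphisms_eq_Aut:
  assumes "f \<noteq> 0"
  shows "field_automorphisms f = splitting.Aut (carrier (splitting_field f))"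
proof -
  interpret splitting "carrier (splitting_field f)" f by (rule splitting_field_splitting[OF assms])
  have ops: "x \<oplus>\<^bsub>splitting_field f\<^esub> y = x + y" "x \<otimes>\<^bsub>splitting_field f\<^esub> y = x * y" "\<one>\<^bsub>splitting_field f\<^esub> = 1" for x y
    by (simp_all add: splitting_field_def ring_of_type_algebra_def)
  show ?thesis
  proof (intro equalityI subsetI)
    fix \<sigma> assume "\<sigma> \<in> field_automorphisms f"
    then show "\<sigma> \<in> Aut"
      by (auto simp: field_automorphisms_def ring_iso_def Ring.ring_hom_def Aut_def subfield_hom_def ops)
  next
    fix \<sigma> assume \<sigma>: "\<sigma> \<in> Aut"
    then show "\<sigma> \<in> field_automorphisms f"
      using hom_Rats[OF F Aut_hom[OF \<sigma>]] Aut_in[OF \<sigma>]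
      by (auto simp: field_automorphisms_def ring_iso_def Ring.ring_hom_def Aut_def subfield_hom_def ops)
  qed
qed

text \<open>An automorphism is arbitrary off \<open>F\<close> and may fail to be injective there, so
  the inverse is formed relative to \<open>F\<close> and the identity is claimed on \<open>F\<close>
  only.\<close>

lemma (in splitting) Aut_inverse:
  assumes \<sigma>: "\<sigma> \<in> Aut"
  obtains \<rho> where "\<rho> \<in> Aut" "\<And>x. x \<in> F \<Longrightarrow> \<rho> (\<sigma> x) = x"
proof -
  define \<rho> where "\<rho> = inv_into F \<sigma>"
  have bij: "inj_on \<sigma> F" "\<sigma> ` F = F" using Aut_bij[OF \<sigma>] by (auto simp: bij_betw_def)
  have \<rho>\<sigma>: "\<rho> (\<sigma> x) = x" if "x \<in> F" for x unfolding \<rho>_def using bij(1) that by (rule inv_into_f_f)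
  note h = Aut_hom[OF \<sigma>]
  have "subfield_hom F \<rho>" unfolding subfield_hom_def
  proof (intro conjI ballI)
    show "\<rho> 1 = 1" using \<rho>\<sigma>[OF subfield_1[OF F]] by (simp add: hom_1[OF F h])
    fix a b assume "a \<in> F" "b \<in> F"
    hence "a \<in> \<sigma> ` F" "b \<in> \<sigma> ` F" using bij(2) by simp_all
    then obtain u w where uw: "u \<in> F" "w \<in> F" "a = \<sigma> u" "b = \<sigma> w" by (elim imageE) (rule that)
    have "\<rho> (a + b) = \<rho> (\<sigma> (u + w))" using uw by (simp add: hom_add[OF F h])
    then show "\<rho> (a + b) = \<rho> a + \<rho> b" using uw by (simp add: \<rho>\<sigma> subfield_add[OF F])
    have "\<rho> (a * b) = \<rho> (\<sigma> (u * w))" using uw by (simp add: hom_mult[OF F h])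
    then show "\<rho> (a * b) = \<rho> a * \<rho> b" using uw by (simp add: \<rho>\<sigma> subfield_mult[OF F])
  qed
  hence "\<rho> \<in> Aut" by (rule hom_in_Aut)
  with that \<rho>\<sigma> show ?thesis by blast
qed

definition sgnD :: "nat set \<Rightarrow> nat \<Rightarrow> complex" where "sgnD D i = (if i \<in> D then -1 else 1)"

lemma prod_sgnD: "D \<subseteq> {1..m} \<Longrightarrow> (\<Prod>i\<in>{1..m}. sgnD D i) = (-1) ^ card D"
proof -
  assume D: "D \<subseteq> {1..m}"
  have "(\<Prod>i\<in>{1..m}. sgnD D i) = (\<Prod>i\<in>D. -1) * (\<Prod>i\<in>{1..m} - D. 1)"
    unfolding sgnD_def using D
    by (subst prod.If_cases) (auto intro!: arg_cong2[where f = times] prod.cong simp: Int_absorb1)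
  then show ?thesis by simp
qed

text \<open>The value e = m makes the action on the m pairs transitive, e = m - 1 makes the
  stabiliser of one index transitive on the others, and e = 2 gives a transposition; so every
  permutation of the pairs occurs. The square condition on g(0) makes the product of the chosen
  square roots rational, which excludes odd sign changes; the signs of the y i supply the even
  ones.\<close>

lemma is_galois_group_even_signed:
  fixes g :: "int poly" and y :: "nat \<Rightarrow> real"
  assumes m: "3 \<le> m"
    and g: "map_poly of_int g = (\<Prod>i\<in>{1..m}. [:- complex_of_real (y i), 1:])"
    and inj: "inj_on y {1..m}"
    and neg: "y 1 < 0" "y 2 < 0" and pos: "\<And>i. i \<in> {3..m} \<Longrightarrow> 0 < y i"
    and g0: "poly g 0 = (-1) ^ m * k\<^sup>2"
    and primes: "\<And>e. e \<in> {m, m - 1, 2} \<Longrightarrow> \<exists>q. Factorial_Ring.prime q \<and> prime_bound m < q \<and>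
        (\<forall>i. q dvd poly.coeff (g - inertia_model m e) i) \<and> \<not> q\<^sup>2 dvd poly g 1"
  shows "is_galois_group (2 * m) (g \<circ>\<^sub>p [:0, 0, 1:]) (signed_perm_group m \<inter> carrier (alt_group (2 * m)))"
proof -
  define f where "f = g \<circ>\<^sub>p [:0, 0, 1:]"
  define F where "F = carrier (splitting_field f)"
  define x where "x i = complex_of_real (y i)" for i
  \<comment> \<open>The roots numbered i and m + i are the two square roots of x i, so the pairs of
    \<open>signed_point\<close> are the fibres of squaring.\<close>
  define r where "r k = (if k \<le> m then csqrt (x k) else - csqrt (x (k - m)))" for k
  have r_sq: "(r i)\<^sup>2 = x i" if "i \<in> {1..m}" for i using that by (simp add: r_def)
  have r_m: "r (m + i) = - r i" if "i \<in> {1..m}" for i using that by (auto simp: r_def)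
  have y0: "y i \<noteq> 0" if "i \<in> {1..m}" for i
  proof -
    have "i = 1 \<or> i = 2 \<or> i \<in> {3..m}" using that by auto
    then show ?thesis using neg pos[of i] by auto
  qed
  have x0: "x i \<noteq> 0" if "i \<in> {1..m}" for i using y0[OF that] by (simp add: x_def)
  have r0: "r i \<noteq> 0" if "i \<in> {1..m}" for i using x0[OF that] r_sq[OF that] by auto
  have xinj: "inj_on x {1..m}"
  proof (rule inj_onI)
    fix a b assume "a \<in> {1..m}" "b \<in> {1..m}" "x a = x b"
    then show "a = b" using inj_onD[OF inj, of a b] by (simp add: x_def)
  qed
  have polyg: "poly (map_poly of_int g) z = (\<Prod>i\<in>{1..m}. z - x i)" for z
    by (simp add: g poly_prod x_def)
  have polyf: "poly (map_poly of_int f) z = (\<Prod>i\<in>{1..m}. z\<^sup>2 - x i)" for z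
  proof -
    have "map_poly of_int f = map_poly complex_of_int g \<circ>\<^sub>p [:0, 0, 1:]"
      by (simp add: f_def of_int_hom.map_poly_pcompose map_poly_pCons_0)
    then show ?thesis by (simp add: poly_pcompose polyg power2_eq_square)
  qed
  have g_ne: "g \<noteq> 0"
  proof
    assume "g = 0"
    hence "(\<Prod>i\<in>{1..m}. [:- x i, 1:]) = 0" using g by (simp add: x_def)
    then show False by simp
  qed
  have f0: "f \<noteq> 0"
  proof
    assume "f = 0"
    hence "(\<Prod>i\<in>{1..m}. z\<^sup>2 - x i) = 0" for z using polyf[of z] by simp
    moreover obtain z :: complex where "z\<^sup>2 \<notin> x ` {1..m}"
    proof -
      obtain w where "w \<notin> x ` {1..m}" using ex_new_if_finite[of "x ` {1..m}"] by (auto simp: infinite_UNIV_char_0)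
      then show ?thesis using that[of "csqrt w"] by simp
    qed
    ultimately show False by auto
  qed
  interpret splitting F f unfolding F_def by (rule splitting_field_splitting[OF f0])
  have aut: "field_automorphisms f = Aut" unfolding F_def by (rule field_automorphisms_eq_Aut[OF f0])
  have rF: "r i \<in> F" if "i \<in> {1..m}" for i
  proof -
    have "poly (map_poly of_int f) (r i) = 0" unfolding polyf using r_sq[OF that] that by (intro prod_zero) auto
    then show ?thesis using roots_in by blast
  qed
  have xF: "x i \<in> F" if "i \<in> {1..m}" for i
    unfolding r_sq[OF that, symmetric] by (rule subfield_power[OF F rF[OF that]])
  have roots: "bij_betw r {1..2*m} (complex_roots f)"
    unfolding bij_betw_def
  proof
    show "inj_on r {1..2*m}"
    proof (rule inj_onI)
      fix a b assume ab: "a \<in> {1..2*m}" "b \<in> {1..2*m}" "r a = r b"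
      define a' where "a' = (if a \<le> m then a else a - m)"
      define b' where "b' = (if b \<le> m then b else b - m)"
      have a'b': "a' \<in> {1..m}" "b' \<in> {1..m}" using ab by (auto simp: a'_def b'_def)
      have "(r a)\<^sup>2 = x a'" "(r b)\<^sup>2 = x b'" by (auto simp: r_def a'_def b'_def)
      hence "a' = b'" using ab(3) inj_onD[OF xinj _ a'b'] by simp
      moreover have "(a \<le> m) = (b \<le> m)"
      proof (rule ccontr)
        assume "(a \<le> m) \<noteq> (b \<le> m)"
        hence "r a = - r b" using \<open>a' = b'\<close> by (auto simp: r_def a'_def b'_def)
        hence "(r b) = 0" using ab(3) by simp
        hence "x b' = 0" using \<open>(r b)\<^sup>2 = x b'\<close> by simp
        with x0[OF a'b'(2)] show False by simp
      qed
      ultimately show "a = b" using ab by (auto simp: a'_def b'_def split: if_splits)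
    qed
    show "r ` {1..2*m} = complex_roots f"
    proof (intro equalityI subsetI)
      fix z assume "z \<in> r ` {1..2*m}"
      then obtain a where a: "a \<in> {1..2*m}" "z = r a" by blast
      define a' where "a' = (if a \<le> m then a else a - m)"
      have "a' \<in> {1..m}" "z\<^sup>2 = x a'" using a by (auto simp: a'_def r_def)
      then show "z \<in> complex_roots f" by (auto simp: complex_roots_def polyf)
    next
      fix z assume "z \<in> complex_roots f"
      then obtain i where i: "i \<in> {1..m}" "z\<^sup>2 = x i" by (auto simp: complex_roots_def polyf)
      hence "z\<^sup>2 = (r i)\<^sup>2" using r_sq by simp
      hence "z = r i \<or> z = r (m + i)" unfolding r_m[OF i(1)] by (simp add: power2_eq_iff)
      then show "z \<in> r ` {1..2*m}" using i(1) by auto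
    qed
  qed
  define acts where "acts \<sigma> \<tau> \<longleftrightarrow> (\<forall>i\<in>{1..m}. \<sigma> (x i) = x (\<tau> i))" for \<sigma> and \<tau> :: "nat \<Rightarrow> nat"
  have \<sigma>x: "\<exists>k\<in>{1..m}. \<sigma> (x i) = x k" if s: "\<sigma> \<in> Aut" and i: "i \<in> {1..m}" for \<sigma> i
  proof -
    have "poly (map_poly of_int g) (x i) = 0" using i by (auto simp: polyg)
    from hom_root[OF Aut_hom[OF s] xF[OF i] this] show ?thesis by (auto simp: polyg)
  qed
  have ex_perm: "\<exists>\<tau>. \<tau> permutes {1..m} \<and> acts \<sigma> \<tau>" if s: "\<sigma> \<in> Aut" for \<sigma>
  proof -
    have "\<forall>i\<in>{1..m}. \<exists>k. k \<in> {1..m} \<and> \<sigma> (x i) = x k" using \<sigma>x[OF s] by blast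
    from bchoice[OF this] obtain t where t: "\<forall>i\<in>{1..m}. t i \<in> {1..m} \<and> \<sigma> (x i) = x (t i)" ..
    define \<tau> where "\<tau> i = (if i \<in> {1..m} then t i else i)" for i
    have "inj_on \<tau> {1..m}"
    proof (rule inj_onI)
      fix i j assume ij: "i \<in> {1..m}" "j \<in> {1..m}" "\<tau> i = \<tau> j"
      hence "\<sigma> (x i) = \<sigma> (x j)" using t by (simp add: \<tau>_def)
      hence "x i = x j" using inj_onD[OF bij_betw_imp_inj_on[OF Aut_bij[OF s]]] xF ij by blast
      then show "i = j" using inj_onD[OF xinj _ ij(1,2)] by simp
    qed
    moreover have "\<tau> ` {1..m} \<subseteq> {1..m}" using t by (auto simp: \<tau>_def)
    ultimately have "bij_betw \<tau> {1..m} {1..m}" by (simp add: bij_betw_def endo_inj_surj)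
    hence "\<tau> permutes {1..m}" by (rule bij_imp_permutes) (simp add: \<tau>_def del: atLeastAtMost_iff)
    moreover have "acts \<sigma> \<tau>" using t by (simp add: acts_def \<tau>_def)
    ultimately show ?thesis by blast
  qed
  define \<Gamma> where "\<Gamma> = {\<tau>. \<tau> permutes {1..m} \<and> (\<exists>\<sigma>\<in>Aut. acts \<sigma> \<tau>)}"
  have \<Gamma>p: "\<tau> permutes {1..m}" if "\<tau> \<in> \<Gamma>" for \<tau> using that by (simp add: \<Gamma>_def)
  have \<Gamma>_id: "id \<in> \<Gamma>" unfolding \<Gamma>_def acts_def using Aut_id permutes_id by (auto intro!: bexI[of _ "\<lambda>x. x"])
  have \<Gamma>_comp: "\<tau> \<circ> \<tau>' \<in> \<Gamma>" if t: "\<tau> \<in> \<Gamma>" "\<tau>' \<in> \<Gamma>" for \<tau> \<tau>'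
  proof -
    obtain \<sigma> \<sigma>' where s: "\<sigma> \<in> Aut" "acts \<sigma> \<tau>" "\<sigma>' \<in> Aut" "acts \<sigma>' \<tau>'" using t by (auto simp: \<Gamma>_def)
    have "acts (\<lambda>x. \<sigma> (\<sigma>' x)) (\<tau> \<circ> \<tau>')"
      using s permutes_in_image[OF \<Gamma>p[OF t(2)]] by (simp add: acts_def)
    then show ?thesis unfolding \<Gamma>_def using Aut_comp[OF s(1,3)] permutes_compose[OF \<Gamma>p[OF t(2)] \<Gamma>p[OF t(1)]] by blast
  qed
  have \<Gamma>_inv: "Hilbert_Choice.inv \<tau> \<in> \<Gamma>" if t: "\<tau> \<in> \<Gamma>" for \<tau>
  proof -
    obtain \<sigma> where s: "\<sigma> \<in> Aut" "acts \<sigma> \<tau>" using t by (auto simp: \<Gamma>_def)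
    obtain \<rho> where \<rho>: "\<rho> \<in> Aut" "\<And>x. x \<in> F \<Longrightarrow> \<rho> (\<sigma> x) = x" using Aut_inverse[OF s(1)] by blast
    have "acts \<rho> (Hilbert_Choice.inv \<tau>)" unfolding acts_def
    proof
      fix i assume i: "i \<in> {1..m}"
      hence j: "Hilbert_Choice.inv \<tau> i \<in> {1..m}" using permutes_in_image[OF permutes_inv[OF \<Gamma>p[OF t]]] by simp
      have "\<sigma> (x (Hilbert_Choice.inv \<tau> i)) = x i" using s(2) j permutes_inverses(1)[OF \<Gamma>p[OF t]] by (simp add: acts_def)
      then show "\<rho> (x i) = x (Hilbert_Choice.inv \<tau> i)" using \<rho>(2)[OF xF[OF j]] by simp
    qed
    then show ?thesis unfolding \<Gamma>_def using \<rho>(1) permutes_inv[OF \<Gamma>p[OF t]] by blast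
  qed
  have inertia': "\<exists>I. I \<subseteq> {1..m} \<and> card I = e \<and> (\<forall>i\<in>I. \<forall>i'\<in>I. \<exists>\<tau>\<in>\<Gamma>. \<tau> i = i' \<and> (\<forall>j\<in>{1..m} - I. \<tau> j = j))"
    if e: "e \<in> {m, m - 1, 2}" for e
  proof -
    obtain q where q: "Factorial_Ring.prime q" "prime_bound m < q"
        "\<And>i. q dvd poly.coeff (g - inertia_model m e) i" "\<not> q\<^sup>2 dvd poly g 1"
      using primes[OF e] by blast
    have e2: "2 \<le> e" "e \<le> m" using e m by auto
    have gx: "map_poly of_int g = (\<Prod>i\<in>{1..m}. [:- x i, 1:])" using g by (simp add: x_def)
    obtain I where I: "I \<subseteq> {1..m}" "card I = e"
      "\<And>i i'. i \<in> I \<Longrightarrow> i' \<in> I \<Longrightarrow> \<exists>\<sigma>\<in>Aut. \<sigma> (x i) = x i' \<and> (\<forall>j\<in>{1..m} - I. \<sigma> (x j) = x j)"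
      using inertia[OF xF xinj gx q(1,2) e2 q(3,4)] by blast
    have "\<exists>\<tau>\<in>\<Gamma>. \<tau> i = i' \<and> (\<forall>j\<in>{1..m} - I. \<tau> j = j)" if ii: "i \<in> I" "i' \<in> I" for i i'
    proof -
      obtain \<sigma> where s: "\<sigma> \<in> Aut" "\<sigma> (x i) = x i'" "\<And>j. j \<in> {1..m} - I \<Longrightarrow> \<sigma> (x j) = x j" using I(3)[OF ii] by blast
      obtain \<tau> where t: "\<tau> permutes {1..m}" "acts \<sigma> \<tau>" using ex_perm[OF s(1)] by blast
      have val: "\<tau> a = b" if "a \<in> {1..m}" "b \<in> {1..m}" "\<sigma> (x a) = x b" for a b
      proof -
        have "\<tau> a \<in> {1..m}" using permutes_in_image[OF t(1)] that(1) by simp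
        moreover have "x (\<tau> a) = x b" using t(2) that by (simp add: acts_def)
        ultimately show ?thesis using inj_onD[OF xinj] that(2) by blast
      qed
      have "\<tau> i = i'" using val[of i i'] s(2) ii I(1) by blast
      moreover have "\<tau> j = j" if "j \<in> {1..m} - I" for j using val[of j j] s(3)[OF that] that by blast
      moreover have "\<tau> \<in> \<Gamma>" unfolding \<Gamma>_def using t s(1) by blast
      ultimately show ?thesis by blast
    qed
    with I(1,2) show ?thesis by blast
  qed
  have in_set: "m \<in> {m, m - 1, 2}" "m - 1 \<in> {m, m - 1, 2}" "2 \<in> {m, m - 1, 2}" by simp_all
  have trans: "\<exists>\<tau>\<in>\<Gamma>. \<tau> i = i'" if ii: "i \<in> {1..m}" "i' \<in> {1..m}" for i i'
  proof -
    obtain I where I: "I \<subseteq> {1..m}" "card I = m"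
      "\<forall>i\<in>I. \<forall>i'\<in>I. \<exists>\<tau>\<in>\<Gamma>. \<tau> i = i' \<and> (\<forall>j\<in>{1..m} - I. \<tau> j = j)"
      using inertia'[OF in_set(1)] by (elim exE conjE) (rule that; assumption)
    have "I = {1..m}" using I(1,2) by (intro card_subset_eq) auto
    with I(3) ii show ?thesis by blast
  qed
  \<comment> \<open>For e = m - 1 the merging roots miss exactly one index c, and the automorphisms
    obtained fix x c.\<close>
  obtain c where c: "c \<in> {1..m}"
    "\<And>i i'. i \<in> {1..m} - {c} \<Longrightarrow> i' \<in> {1..m} - {c} \<Longrightarrow> \<exists>\<tau>\<in>\<Gamma>. \<tau> i = i' \<and> \<tau> c = c"
  proof -
    obtain I where I: "I \<subseteq> {1..m}" "card I = m - 1"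
      "\<forall>i\<in>I. \<forall>i'\<in>I. \<exists>\<tau>\<in>\<Gamma>. \<tau> i = i' \<and> (\<forall>j\<in>{1..m} - I. \<tau> j = j)" 
      using inertia'[OF in_set(2)] by (elim exE conjE) (rule that; assumption)
    have "card ({1..m} - I) = 1" using I(1,2) m by (simp add: card_Diff_subset finite_subset)
    then obtain c where c: "{1..m} - I = {c}" by (auto simp: card_1_singleton_iff)
    hence "I = {1..m} - {c}" "c \<in> {1..m}" using I(1) by auto
    with I(3) c show ?thesis by (intro that[of c]) auto
  qed
  have two_trans: "\<exists>\<tau>\<in>\<Gamma>. \<tau> i = i' \<and> \<tau> j = j'"
    if ij: "i \<in> {1..m}" "j \<in> {1..m}" "i \<noteq> j" "i' \<in> {1..m}" "j' \<in> {1..m}" "i' \<noteq> j'" for i j i' j'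
  proof -
    obtain t1 where t1: "t1 \<in> \<Gamma>" "t1 j = c" using trans[OF ij(2) c(1)] by blast
    obtain t3 where t3: "t3 \<in> \<Gamma>" "t3 c = j'" using trans[OF c(1) ij(5)] by blast
    \<comment> \<open>A detour through the index c: t1 takes j to c and t3 takes c to j'. It remains
      to join t1 i to the preimage z of i' under t3 by an element of the stabiliser of c.\<close>
    define z where "z = Hilbert_Choice.inv t3 i'"
    have z: "t3 z = i'" "z \<in> {1..m}"
      using permutes_inverses(1)[OF \<Gamma>p[OF t3(1)]] permutes_in_image[OF permutes_inv[OF \<Gamma>p[OF t3(1)]]] ij(4) by (auto simp: z_def)
    have "z \<noteq> c" using z(1) t3(2) ij(6) by auto
    have "t1 i \<in> {1..m}" using permutes_in_image[OF \<Gamma>p[OF t1(1)]] ij(1) by simp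
    moreover have "t1 i \<noteq> c" using t1(2) ij(3) permutes_inj[OF \<Gamma>p[OF t1(1)]] by (metis injD)
    ultimately obtain t2 where t2: "t2 \<in> \<Gamma>" "t2 (t1 i) = z" "t2 c = c"
      using c(2)[of "t1 i" z] z(2) \<open>z \<noteq> c\<close> by blast
    have "t3 \<circ> (t2 \<circ> t1) \<in> \<Gamma>" by (intro \<Gamma>_comp t1 t2 t3)
    then show ?thesis using t1 t2 t3 z by (intro bexI[of _ "t3 \<circ> (t2 \<circ> t1)"]) auto
  qed
  obtain a b where ab: "a \<in> {1..m}" "b \<in> {1..m}" "a \<noteq> b" "Transposition.transpose a b \<in> \<Gamma>"
  proof -
    obtain I where I: "I \<subseteq> {1..m}" "card I = 2"
      "\<forall>i\<in>I. \<forall>i'\<in>I. \<exists>\<tau>\<in>\<Gamma>. \<tau> i = i' \<and> (\<forall>j\<in>{1..m} - I. \<tau> j = j)" 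
      using inertia'[OF in_set(3)] by (elim exE conjE) (rule that; assumption)
    obtain a b where ab: "I = {a, b}" "a \<noteq> b" using I(2) by (auto simp: card_2_iff)
    obtain \<tau> where t: "\<tau> \<in> \<Gamma>" "\<tau> a = b" "\<And>j. j \<in> {1..m} - {a, b} \<Longrightarrow> \<tau> j = j" using I(3) ab by blast
    note p = \<Gamma>p[OF t(1)]
    have "\<tau> b = a"
    proof -
      have "\<tau> b \<in> {1..m}" using permutes_in_image[OF p] I(1) ab by auto
      moreover have "\<tau> b \<noteq> b" using t(2) ab(2) permutes_inj[OF p] by (metis injD)
      moreover have "\<tau> b \<notin> {1..m} - {a, b}"
      proof
        assume *: "\<tau> b \<in> {1..m} - {a, b}"
        hence "\<tau> (\<tau> b) = \<tau> b" by (rule t(3))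
        hence "\<tau> b = b" using permutes_inj[OF p] by (metis injD)
        with * show False by simp
      qed
      ultimately show ?thesis by blast
    qed
    have "\<tau> = Transposition.transpose a b"
    proof
      fix j show "\<tau> j = Transposition.transpose a b j"
        using t(3)[of j] \<open>\<tau> b = a\<close> permutes_not_in[OF p, of j] t(2)
        by (cases "j = a"; cases "j = b"; cases "j \<in> {1..m}") (auto simp: Transposition.transpose_def t(3))
    qed
    with t(1) I(1) ab show ?thesis by (intro that[of a b]) auto
  qed
  have transp: "Transposition.transpose i j \<in> \<Gamma>" if ij: "i \<in> {1..m}" "j \<in> {1..m}" "i \<noteq> j" for i j
  proof -
    obtain \<tau> where t: "\<tau> \<in> \<Gamma>" "\<tau> i = a" "\<tau> j = b" using two_trans[OF ij ab(1-3)] by blast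
    note p = \<Gamma>p[OF t(1)]
    have "Transposition.transpose i j = Hilbert_Choice.inv \<tau> \<circ> (Transposition.transpose a b \<circ> \<tau>)"
    proof
      fix l
      have "\<tau> l = a \<longleftrightarrow> l = i" "\<tau> l = b \<longleftrightarrow> l = j" using t(2,3) permutes_inj[OF p] by (metis injD)+
      then show "Transposition.transpose i j l = (Hilbert_Choice.inv \<tau> \<circ> (Transposition.transpose a b \<circ> \<tau>)) l"
        using t(2,3) permutes_inverses(2)[OF p] by (auto simp: Transposition.transpose_def)
    qed
    also have "\<dots> \<in> \<Gamma>" by (intro \<Gamma>_comp \<Gamma>_inv t(1) ab(4))
    finally show ?thesis .
  qed
  have all_perms: "\<tau> \<in> \<Gamma>" if "\<tau> permutes {1..m}" for \<tau>
  proof (rule permutes_induct[OF that, where P = "\<lambda>p. p \<in> \<Gamma>"])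
    show "Transposition.transpose i j \<circ> p \<in> \<Gamma>" if "i \<in> {1..m}" "j \<in> {1..m}" "i \<noteq> j" "p \<in> \<Gamma>" "p permutes {1..m}" for i j p
      using \<Gamma>_comp[OF transp] that by blast
  qed (simp_all add: \<Gamma>_id)

  have sgn_ex: "\<exists>D\<subseteq>{1..m}. \<forall>i\<in>{1..m}. \<sigma> (r i) = sgnD D i * r (\<tau> i)"
    if s: "\<sigma> \<in> Aut" and t: "\<tau> permutes {1..m}" "acts \<sigma> \<tau>" for \<sigma> \<tau>
  proof -
    define D where "D = {i \<in> {1..m}. \<sigma> (r i) \<noteq> r (\<tau> i)}"
    have "\<sigma> (r i) = sgnD D i * r (\<tau> i)" if i: "i \<in> {1..m}" for i
    proof -
      have ti: "\<tau> i \<in> {1..m}" using permutes_in_image[OF t(1)] i by simp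
      have "(\<sigma> (r i))\<^sup>2 = \<sigma> ((r i)\<^sup>2)" by (simp add: hom_power[OF F Aut_hom[OF s] rF[OF i]])
      also have "\<dots> = (r (\<tau> i))\<^sup>2" unfolding r_sq[OF i] r_sq[OF ti] using t(2) i by (simp add: acts_def)
      finally have "\<sigma> (r i) = r (\<tau> i) \<or> \<sigma> (r i) = - r (\<tau> i)" by (simp add: power2_eq_iff)
      then show ?thesis using i by (auto simp: sgnD_def D_def)
    qed
    then show ?thesis by (intro exI[of _ D]) (auto simp: D_def)
  qed
  \<comment> \<open>The square of R is the product of the x i, which is (-1)^m g(0) = k^2. So R is
    an integer, fixed by every automorphism, and the signs of an automorphism multiply to 1.\<close>
  define R where "R = (\<Prod>i\<in>{1..m}. r i)"
  have R_int: "R = of_int k \<or> R = - of_int k" and R0: "R \<noteq> 0"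
  proof -
    have "R\<^sup>2 = (\<Prod>i\<in>{1..m}. x i)" unfolding R_def by (simp add: prod_power_distrib r_sq)
    also have "\<dots> = (-1) ^ m * poly (map_poly of_int g) 0" unfolding polyg by (simp add: prod_uminus)
    also have "poly (map_poly of_int g) 0 = complex_of_int (poly g 0)"
      using of_int_hom.poly_map_poly[of g 0, where 'a = complex] by simp
    also have "(-1) ^ m * \<dots> = (of_int k)\<^sup>2" unfolding g0 by (simp add: power_mult_distrib[symmetric] flip: mult.assoc)
    finally show "R = of_int k \<or> R = - of_int k" by (simp add: power2_eq_iff)
    show "R \<noteq> 0" unfolding R_def using r0 by simp
  qed
  have even_sgn: "even (card D)"
    if s: "\<sigma> \<in> Aut" and t: "\<tau> permutes {1..m}" and D: "D \<subseteq> {1..m}" "\<And>i. i \<in> {1..m} \<Longrightarrow> \<sigma> (r i) = sgnD D i * r (\<tau> i)" for \<sigma> \<tau> D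
  proof -
    have "\<sigma> R = R" using R_int hom_of_int[OF F Aut_hom[OF s]] hom_of_int[OF F Aut_hom[OF s], of "- k"] by auto
    moreover have "\<sigma> R = (\<Prod>i\<in>{1..m}. sgnD D i * r (\<tau> i))"
      unfolding R_def using D(2) by (subst hom_prod[OF F Aut_hom[OF s] rF]) auto
    moreover have "(\<Prod>i\<in>{1..m}. sgnD D i * r (\<tau> i)) = (-1) ^ card D * R"
      unfolding prod.distrib prod_sgnD[OF D(1)] R_def using prod.permute[OF t, of r] by (simp add: comp_def)
    ultimately have "(-1) ^ card D = (1::complex)" using R0 by simp
    then show ?thesis by (auto simp: minus_one_power_iff split: if_splits)
  qed
  \<comment> \<open>Sign sets of the automorphisms that preserve every pair. Composition becomes
    symmetric difference, so it suffices to find all two-element sets in it.\<close>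
  define \<E> where "\<E> = {D. D \<subseteq> {1..m} \<and> (\<exists>\<sigma>\<in>Aut. \<forall>i\<in>{1..m}. \<sigma> (r i) = sgnD D i * r i)}"
  have E_diff: "(D - D') \<union> (D' - D) \<in> \<E>" if D: "D \<in> \<E>" "D' \<in> \<E>" for D D'
  proof -
    obtain \<sigma> \<sigma>' where s: "\<sigma> \<in> Aut" "\<And>i. i \<in> {1..m} \<Longrightarrow> \<sigma> (r i) = sgnD D i * r i"
      "\<sigma>' \<in> Aut" "\<And>i. i \<in> {1..m} \<Longrightarrow> \<sigma>' (r i) = sgnD D' i * r i" using D by (auto simp: \<E>_def)
    have "\<sigma> (\<sigma>' (r i)) = sgnD ((D - D') \<union> (D' - D)) i * r i" if i: "i \<in> {1..m}" for i
      using s(2)[OF i] s(4)[OF i] hom_uminus[OF F Aut_hom[OF s(1)] rF[OF i]] by (auto simp: sgnD_def)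
    then show ?thesis using D Aut_comp[OF s(1,3)] by (auto simp: \<E>_def intro!: bexI[of _ "\<lambda>x. \<sigma> (\<sigma>' x)"])
  qed
  \<comment> \<open>Complex conjugation negates the purely imaginary roots, that is, those over the
    negative y 1 and y 2, and fixes the real ones: its sign set is {1, 2}.\<close>
  have cnj_Aut: "cnj \<in> Aut" by (rule hom_in_Aut) (simp add: subfield_hom_def)
  have cnj_r: "cnj (r i) = sgnD {1, 2} i * r i" if i: "i \<in> {1..m}" for i
  proof (cases "i \<in> {1, 2}")
    case True
    hence "y i < 0" using neg by auto
    hence "r i = \<i> * of_real (sqrt (- y i))" using i by (simp add: r_def x_def csqrt_of_real_nonpos)
    then show ?thesis using True by (simp add: sgnD_def)
  next
    case False
    hence "0 < y i" using pos[of i] i by auto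
    hence "r i = of_real (sqrt (y i))" using i by (simp add: r_def x_def csqrt_of_real_nonneg)
    then show ?thesis using False by (simp add: sgnD_def)
  qed
  have E_pair: "{i, j} \<in> \<E>" if ij: "i \<in> {1..m}" "j \<in> {1..m}" "i \<noteq> j" for i j
  proof -
    obtain \<tau> where t: "\<tau> \<in> \<Gamma>" "\<tau> i = 1" "\<tau> j = 2" using two_trans[OF ij, of 1 2] m by auto
    note p = \<Gamma>p[OF t(1)]
    obtain \<sigma> where s: "\<sigma> \<in> Aut" "acts \<sigma> \<tau>" using t(1) by (auto simp: \<Gamma>_def)
    obtain D where D: "D \<subseteq> {1..m}" "\<And>i. i \<in> {1..m} \<Longrightarrow> \<sigma> (r i) = sgnD D i * r (\<tau> i)" using sgn_ex[OF s(1) p s(2)] by blast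
    obtain \<rho> where \<rho>: "\<rho> \<in> Aut" "\<And>x. x \<in> F \<Longrightarrow> \<rho> (\<sigma> x) = x" using Aut_inverse[OF s(1)] by blast
    \<comment> \<open>Conjugating \<open>cnj\<close> by an automorphism that carries i, j to 1, 2
      moves its sign set to {i, j}. The unknown signs D of \<sigma> occur twice and cancel.\<close>
    have "\<rho> (cnj (\<sigma> (r l))) = sgnD {i, j} l * r l" if l: "l \<in> {1..m}" for l
    proof -
      have tl: "\<tau> l \<in> {1..m}" using permutes_in_image[OF p] l by simp
      have iff: "\<tau> l \<in> {1, 2} \<longleftrightarrow> l \<in> {i, j}" using t(2,3) permutes_inj[OF p] by (metis injD insertE insert_iff singletonD)
      have "cnj (\<sigma> (r l)) = sgnD {1, 2} (\<tau> l) * \<sigma> (r l)"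
        unfolding D(2)[OF l] using cnj_r[OF tl] by (simp add: sgnD_def)
      also have "sgnD {1, 2} (\<tau> l) = sgnD {i, j} l" using iff by (simp add: sgnD_def)
      finally show ?thesis using \<rho>(2)[OF rF[OF l]] hom_uminus[OF F Aut_hom[OF \<rho>(1)] Aut_in[OF s(1) rF[OF l]]]
        by (auto simp: sgnD_def)
    qed
    moreover have "(\<lambda>x. \<rho> (cnj (\<sigma> x))) \<in> Aut" by (rule Aut_comp[OF \<rho>(1) Aut_comp[OF cnj_Aut s(1)]])
    ultimately have "\<exists>\<sigma>\<in>Aut. \<forall>l\<in>{1..m}. \<sigma> (r l) = sgnD {i, j} l * r l"
      by (intro bexI[of _ "\<lambda>x. \<rho> (cnj (\<sigma> x))"] ballI)
    moreover have "{i, j} \<subseteq> {1..m}" using ij(1,2) by simp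
    ultimately show ?thesis unfolding \<E>_def mem_Collect_eq by (intro conjI)
  qed
  have E_even: "D \<in> \<E>" if "D \<subseteq> {1..m}" "even (card D)" for D
    using that
  proof (induction "card D" arbitrary: D rule: less_induct)
    case less
    have fin: "finite D" using less.prems(1) finite_subset by blast
    show ?case
    proof (cases "D = {}")
      case True
      then show ?thesis unfolding \<E>_def sgnD_def using Aut_id by (auto intro!: bexI[of _ "\<lambda>x. x"])
    next
      case False
      hence "card D \<ge> 2" using less.prems(2) fin by (metis One_nat_def Suc_leI card_gt_0_iff dvd_imp_le)
      then obtain D2 where "D2 \<subseteq> D" "card D2 = 2" using obtain_subset_with_card_n by metis
      then obtain i j where ij: "i \<in> D" "j \<in> D" "i \<noteq> j" by (auto simp: card_2_iff)
      define D' where "D' = D - {i, j}"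
      have c: "card D' = card D - 2" unfolding D'_def using ij fin by (simp add: card_Diff_subset)
      have "D' \<in> \<E>" using less.prems c \<open>card D \<ge> 2\<close> by (intro less.hyps) (auto simp: D'_def)
      moreover have "{i, j} \<in> \<E>" using ij less.prems(1) by (intro E_pair) auto
      ultimately have "(D' - {i, j}) \<union> ({i, j} - D') \<in> \<E>" by (rule E_diff)
      moreover have "(D' - {i, j}) \<union> ({i, j} - D') = D" using ij by (auto simp: D'_def)
      ultimately show ?thesis by simp
    qed
  qed
  have r_perm: "r ((pair_perm m \<tau> \<circ> flip m D) i) = sgnD D i * r (\<tau> i)"
      "r ((pair_perm m \<tau> \<circ> flip m D) (m + i)) = - (sgnD D i * r (\<tau> i))"
    if D: "D \<subseteq> {1..m}" and t: "\<tau> permutes {1..m}" and i: "i \<in> {1..m}" for D \<tau> i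
  proof -
    have "\<tau> i \<in> {1..m}" using permutes_in_image[OF t] i by simp
    from r_m[OF this] show "r ((pair_perm m \<tau> \<circ> flip m D) i) = sgnD D i * r (\<tau> i)"
      "r ((pair_perm m \<tau> \<circ> flip m D) (m + i)) = - (sgnD D i * r (\<tau> i))"
      unfolding pair_perm_flip_apply[OF D i] by (auto simp: sgnD_def)
  qed
  have split: "i \<in> {1..m} \<or> (\<exists>j\<in>{1..m}. i = m + j)" if "i \<in> {1..2*m}" for i
  proof -
    have "i \<in> {1..m} \<or> (i - m \<in> {1..m} \<and> i = m + (i - m))" using that by auto
    then show ?thesis by blast
  qed
  have "galois_perms (2 * m) r f = signed_perm_group m \<inter> carrier (alt_group (2 * m))"
  proof (intro equalityI subsetI)
    fix \<pi> assume "\<pi> \<in> galois_perms (2 * m) r f"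
    then obtain \<sigma> where \<pi>: "\<pi> permutes {1..2*m}" and s: "\<sigma> \<in> Aut" and eq: "\<And>i. i \<in> {1..2*m} \<Longrightarrow> \<sigma> (r i) = r (\<pi> i)"
      by (auto simp: galois_perms_def sym_group_carrier aut)
    obtain \<tau> where t: "\<tau> permutes {1..m}" "acts \<sigma> \<tau>" using ex_perm[OF s] by blast
    obtain D where D: "D \<subseteq> {1..m}" "\<And>i. i \<in> {1..m} \<Longrightarrow> \<sigma> (r i) = sgnD D i * r (\<tau> i)" using sgn_ex[OF s t] by blast
    define \<pi>' where "\<pi>' = pair_perm m \<tau> \<circ> flip m D"
    have \<pi>': "\<pi>' permutes {1..2*m}" unfolding \<pi>'_def by (rule pair_perm_flip(1)[OF t(1) D(1)])
    have "\<pi> = \<pi>'"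
    proof
      fix i show "\<pi> i = \<pi>' i"
      proof (cases "i \<in> {1..2*m}")
        case True
        have "r (\<pi> i) = r (\<pi>' i)"
        proof (cases "i \<in> {1..m}")
          case im: True
          then show ?thesis using eq[OF True] D(2) r_perm(1)[OF D(1) t(1) im] by (simp add: \<pi>'_def)
        next
          case False
          then obtain j where j: "j \<in> {1..m}" "i = m + j" using split[OF True] by blast
          have "\<sigma> (r i) = - \<sigma> (r j)" unfolding j(2) r_m[OF j(1)] by (rule hom_uminus[OF F Aut_hom[OF s] rF[OF j(1)]])
          then show ?thesis using eq[OF True] D(2)[OF j(1)] r_perm(2)[OF D(1) t(1) j(1)] by (simp add: \<pi>'_def j(2))
        qed
        then show ?thesis using inj_onD[OF bij_betw_imp_inj_on[OF roots]] permutes_in_image[OF \<pi>] permutes_in_image[OF \<pi>'] True by blast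
      next
        case False
        then show ?thesis using permutes_not_in[OF \<pi>] permutes_not_in[OF \<pi>'] by simp
      qed
    qed
    moreover have "evenperm \<pi>'" unfolding \<pi>'_def pair_perm_flip(2)[OF t(1) D(1)] by (rule even_sgn[OF s t(1) D])
    ultimately show "\<pi> \<in> signed_perm_group m \<inter> carrier (alt_group (2 * m))"
      unfolding Int_iff signed_perm_group_eq alt_group_carrier using \<pi>' t(1) D(1) by (auto simp: \<pi>'_def)
  next
    fix \<pi> assume "\<pi> \<in> signed_perm_group m \<inter> carrier (alt_group (2 * m))"
    then obtain \<tau> D where \<pi>: "\<pi> = pair_perm m \<tau> \<circ> flip m D" "\<tau> permutes {1..m}" "D \<subseteq> {1..m}" "evenperm \<pi>"
      unfolding Int_iff signed_perm_group_eq alt_group_carrier by blast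
    hence evD: "even (card D)" using pair_perm_flip(2)[OF \<pi>(2,3)] by simp
    obtain \<sigma>0 where s0: "\<sigma>0 \<in> Aut" "acts \<sigma>0 \<tau>" using all_perms[OF \<pi>(2)] by (auto simp: \<Gamma>_def)
    obtain D0 where D0: "D0 \<subseteq> {1..m}" "\<And>i. i \<in> {1..m} \<Longrightarrow> \<sigma>0 (r i) = sgnD D0 i * r (\<tau> i)" using sgn_ex[OF s0(1) \<pi>(2) s0(2)] by blast
    \<comment> \<open>The automorphism found for \<tau> comes with its own sign set D0. Both D and
      D0 are even, so their symmetric difference is realised inside the pairs and corrects D0 to
      D.\<close>
    have "D \<in> \<E>" "D0 \<in> \<E>" using E_even[OF \<pi>(3) evD] E_even[OF D0(1) even_sgn[OF s0(1) \<pi>(2) D0]] by auto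
    hence "(D - D0) \<union> (D0 - D) \<in> \<E>" by (rule E_diff)
    then obtain \<sigma>1 where s1: "\<sigma>1 \<in> Aut" "\<And>i. i \<in> {1..m} \<Longrightarrow> \<sigma>1 (r i) = sgnD ((D - D0) \<union> (D0 - D)) i * r i" by (auto simp: \<E>_def)
    have \<sigma>r: "\<sigma>0 (\<sigma>1 (r i)) = sgnD D i * r (\<tau> i)" if i: "i \<in> {1..m}" for i
      using s1(2)[OF i] D0(2)[OF i] hom_uminus[OF F Aut_hom[OF s0(1)] rF[OF i]] by (auto simp: sgnD_def)
    have \<sigma>A: "(\<lambda>x. \<sigma>0 (\<sigma>1 x)) \<in> Aut" by (rule Aut_comp[OF s0(1) s1(1)])
    have "\<sigma>0 (\<sigma>1 (r i)) = r (\<pi> i)" if i2: "i \<in> {1..2*m}" for i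
    proof (cases "i \<in> {1..m}")
      case True
      then show ?thesis using \<sigma>r r_perm(1)[OF \<pi>(3,2) True] by (simp add: \<pi>(1))
    next
      case False
      then obtain j where j: "j \<in> {1..m}" "i = m + j" using split[OF i2] by blast
      have "\<sigma>0 (\<sigma>1 (r i)) = - \<sigma>0 (\<sigma>1 (r j))"
        unfolding j(2) r_m[OF j(1)] by (rule hom_uminus[OF F Aut_hom[OF \<sigma>A] rF[OF j(1)]])
      then show ?thesis using \<sigma>r[OF j(1)] r_perm(2)[OF \<pi>(3,2) j(1)] by (simp add: \<pi>(1) j(2))
    qed
    then have "\<exists>\<sigma>\<in>Aut. \<forall>i\<in>{1..2*m}. \<sigma> (r i) = r (\<pi> i)"
      by (intro bexI[OF _ \<sigma>A] ballI)
    moreover have "\<pi> permutes {1..2*m}" unfolding \<pi>(1) by (rule pair_perm_flip(1)[OF \<pi>(2,3)])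
    ultimately show "\<pi> \<in> galois_perms (2 * m) r f"
      unfolding galois_perms_def mem_Collect_eq sym_group_carrier aut by (intro conjI)
  qed
  with roots show ?thesis unfolding is_galois_group_def f_def[symmetric] by blast
qed

section \<open>Counting points in families of lattices\<close>

text \<open>Vieta's formulas, with the signs left inside the products and the size of S fixed by a
  sum, which avoids subtraction of natural numbers.\<close>

lemma coeff_prod_linear:
  fixes v :: "nat \<Rightarrow> complex"
  assumes "finite I"
  shows "poly.coeff (\<Prod>i\<in>I. [:- v i, 1:]) k = (\<Sum>S | S \<subseteq> I \<and> card S + k = card I. \<Prod>i\<in>S. - v i)"
proof -
  have "(\<Prod>i\<in>I. [:- v i, 1:]) = (\<Prod>i\<in>I. [:- v i:] + Polynomial.monom 1 1)"
    by (intro prod.cong refl) (simp add: monom_altdef)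
  also have "\<dots> = (\<Sum>S\<in>Pow I. (\<Prod>i\<in>S. [:- v i:]) * (\<Prod>i\<in>I - S. Polynomial.monom 1 1))"
    by (rule prod_add[OF assms])
  also have "\<dots> = (\<Sum>S\<in>Pow I. Polynomial.monom (\<Prod>i\<in>S. - v i) (card (I - S)))"
  proof (intro sum.cong refl)
    fix S assume "S \<in> Pow I"
    hence "finite S" using assms by (auto intro: finite_subset)
    hence "(\<Prod>i\<in>S. [:- v i:]) = [:\<Prod>i\<in>S. - v i:]"
    proof (induction S rule: finite_induct)
      case (insert j S)
      then show ?case by simp
    qed (simp add: pCons_one)
    then show "(\<Prod>i\<in>S. [:- v i:]) * (\<Prod>i\<in>I - S. Polynomial.monom 1 1) = Polynomial.monom (\<Prod>i\<in>S. - v i) (card (I - S))"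
      by (simp add: monom_power smult_monom)
  qed
  finally have "poly.coeff (\<Prod>i\<in>I. [:- v i, 1:]) k =
      poly.coeff (\<Sum>S\<in>Pow I. Polynomial.monom (\<Prod>i\<in>S. - v i) (card (I - S))) k" by simp
  also have "\<dots> = (\<Sum>S\<in>Pow I. if card (I - S) = k then \<Prod>i\<in>S. - v i else 0)"
    by (simp add: coeff_sum)
  also have "\<dots> = (\<Sum>S\<in>{S \<in> Pow I. card (I - S) = k}. \<Prod>i\<in>S. - v i)"
    using assms by (intro sum.inter_filter[symmetric]) auto
  also have "{S \<in> Pow I. card (I - S) = k} = {S. S \<subseteq> I \<and> card S + k = card I}"
  proof -
    have "card (I - S) = k \<longleftrightarrow> card S + k = card I" if "S \<subseteq> I" for S
      using that assms card_mono[OF assms that] by (auto simp: card_Diff_subset finite_subset)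
    then show ?thesis by blast
  qed
  finally show ?thesis .
qed

text \<open>The facts about equivariant vectors on which the counting rests, detached from Galois
  theory. A member of the family stands for the ring of integers of a field of degree m, embedded by
  its conjugates. Vectors vanish off {1..m}, so that equality of coordinates is equality of
  functions. The last condition makes the generators of different lattices disjoint, so that their
  numbers can be added.\<close>

locale lattice_family =
  fixes m :: nat and \<LL> :: "(nat \<Rightarrow> complex) set set"
  assumes m3: "m \<ge> 3"
    and outside: "\<And>\<Lambda> v i. \<Lambda> \<in> \<LL> \<Longrightarrow> v \<in> \<Lambda> \<Longrightarrow> i \<notin> {1..m} \<Longrightarrow> v i = 0"
    and diff_closed: "\<And>\<Lambda> v w. \<Lambda> \<in> \<LL> \<Longrightarrow> v \<in> \<Lambda> \<Longrightarrow> w \<in> \<Lambda> \<Longrightarrow> (\<lambda>i. v i - w i) \<in> \<Lambda>"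
    and mult_closed: "\<And>\<Lambda> v w. \<Lambda> \<in> \<LL> \<Longrightarrow> v \<in> \<Lambda> \<Longrightarrow> w \<in> \<Lambda> \<Longrightarrow> (\<lambda>i. v i * w i) \<in> \<Lambda>"
    and const_in: "\<And>\<Lambda> c. \<Lambda> \<in> \<LL> \<Longrightarrow> (\<lambda>i. if i \<in> {1..m} then of_int c else 0) \<in> \<Lambda>"
    and integral: "\<And>\<Lambda> v k. \<Lambda> \<in> \<LL> \<Longrightarrow> v \<in> \<Lambda> \<Longrightarrow> poly.coeff (\<Prod>i\<in>{1..m}. [:- v i, 1:]) k \<in> \<int>"
    and dichotomy: "\<And>\<Lambda> v. \<Lambda> \<in> \<LL> \<Longrightarrow> v \<in> \<Lambda> \<Longrightarrow> inj_on v {1..m} \<or> (\<exists>c::int. \<forall>i\<in>{1..m}. v i = of_int c)"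
    and no_zero: "\<And>\<Lambda> v i j. \<Lambda> \<in> \<LL> \<Longrightarrow> v \<in> \<Lambda> \<Longrightarrow> i \<in> {1..m} \<Longrightarrow> v i = 0 \<Longrightarrow> j \<in> {1..m} \<Longrightarrow> v j = 0"
    and generator: "\<And>\<Lambda>. \<Lambda> \<in> \<LL> \<Longrightarrow> \<exists>s\<in>\<Lambda>. inj_on s {1..m}"
    and separated: "\<And>\<Lambda> \<Lambda>' v. \<Lambda> \<in> \<LL> \<Longrightarrow> \<Lambda>' \<in> \<LL> \<Longrightarrow> v \<in> \<Lambda> \<Longrightarrow> v \<in> \<Lambda>' \<Longrightarrow> inj_on v {1..m} \<Longrightarrow> \<Lambda> = \<Lambda>'"
begin

text \<open>Each coordinate has its own bound, since the roots of a polynomial may differ greatly in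
  size and only the volume of the box is under control.\<close>

definition box :: "(nat \<Rightarrow> complex) set \<Rightarrow> (nat \<Rightarrow> real) \<Rightarrow> (nat \<Rightarrow> complex) set" where
  "box \<Lambda> B = {v \<in> \<Lambda>. \<forall>i\<in>{1..m}. cmod (v i) \<le> B i}"

definition gens :: "(nat \<Rightarrow> complex) set \<Rightarrow> (nat \<Rightarrow> real) \<Rightarrow> (nat \<Rightarrow> complex) set" where
  "gens \<Lambda> B = {v \<in> box \<Lambda> B. inj_on v {1..m}}"

definition all_gens :: "(nat \<Rightarrow> real) \<Rightarrow> (nat \<Rightarrow> complex) set" where
  "all_gens B = (\<Union>\<Lambda>\<in>\<LL>. gens \<Lambda> B)"

section \<open>Points of a single lattice in a box\<close>

context
  fixes \<Lambda> assumes \<Lambda>: "\<Lambda> \<in> \<LL>"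
begin

lemma zero_in: "(\<lambda>i. 0) \<in> \<Lambda>"
proof -
  obtain s where "s \<in> \<Lambda>" using generator[OF \<Lambda>] by blast
  from diff_closed[OF \<Lambda> this this] show ?thesis by simp
qed

lemma add_closed: "v \<in> \<Lambda> \<Longrightarrow> w \<in> \<Lambda> \<Longrightarrow> (\<lambda>i. v i + w i) \<in> \<Lambda>"
  using diff_closed[OF \<Lambda> _ diff_closed[OF \<Lambda> zero_in], of v w] by simp

lemma scale_closed: "v \<in> \<Lambda> \<Longrightarrow> (\<lambda>i. of_nat n * v i) \<in> \<Lambda>"
  by (induction n) (auto simp: distrib_right intro: zero_in add_closed)

lemma power_closed: "v \<in> \<Lambda> \<Longrightarrow> (\<lambda>i. if i \<in> {1..m} then v i ^ n else 0) \<in> \<Lambda>"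
proof (induction n)
  case 0
  then show ?case using const_in[OF \<Lambda>, of 1] by (simp cong: if_cong)
next
  case (Suc n)
  have "(\<lambda>i. v i * (if i \<in> {1..m} then v i ^ n else 0)) \<in> \<Lambda>"
    by (rule mult_closed[OF \<Lambda> Suc.prems Suc.IH[OF Suc.prems]])
  also have "(\<lambda>i. v i * (if i \<in> {1..m} then v i ^ n else 0)) = (\<lambda>i. if i \<in> {1..m} then v i ^ Suc n else 0)"
    by auto
  finally show ?case .
qed

lemma sum_int: "v \<in> \<Lambda> \<Longrightarrow> (\<Sum>i\<in>{1..m}. v i) \<in> \<int>"
proof -
  assume v: "v \<in> \<Lambda>"
  have "{S. S \<subseteq> {1..m} \<and> card S + (m - 1) = card {1..m}} = (\<lambda>i. {i}) ` {1..m}"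
  proof -
    have "card S + (m - 1) = card {1..m} \<longleftrightarrow> (\<exists>i. S = {i})" if "S \<subseteq> {1..m}" for S
      using m3 by (auto simp: card_1_singleton_iff[symmetric])
    then show ?thesis by auto
  qed
  hence "poly.coeff (\<Prod>i\<in>{1..m}. [:- v i, 1:]) (m - 1) = - (\<Sum>i\<in>{1..m}. v i)"
    by (subst coeff_prod_linear) (simp_all add: sum.reindex sum_negf)
  with integral[OF \<Lambda> v, of "m - 1"] show ?thesis by simp
qed

lemma prod_int: "v \<in> \<Lambda> \<Longrightarrow> (\<Prod>i\<in>{1..m}. v i) \<in> \<int>"
proof -
  assume v: "v \<in> \<Lambda>"
  have "poly.coeff (\<Prod>i\<in>{1..m}. [:- v i, 1:]) 0 = (\<Prod>i\<in>{1..m}. - v i)"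
    by (simp add: poly_0_coeff_0[symmetric] poly_prod)
  also have "\<dots> = (-1) ^ m * (\<Prod>i\<in>{1..m}. v i)" by (simp add: prod_uminus)
  finally have "(-1) ^ m * (\<Prod>i\<in>{1..m}. v i) \<in> \<int>" using integral[OF \<Lambda> v, of 0] by simp
  then show ?thesis by (cases "even m") auto
qed

text \<open>The product of the coordinates is the norm, a rational integer, and it is nonzero
  because a vector with one vanishing coordinate vanishes altogether.\<close>

lemma norm_ge_1:
  assumes v: "v \<in> \<Lambda>" "v \<noteq> (\<lambda>i. 0)"
  shows "1 \<le> (\<Prod>i\<in>{1..m}. cmod (v i))"
proof -
  obtain j where j: "v j \<noteq> 0" using v(2) by auto
  hence jm: "j \<in> {1..m}" using outside[OF \<Lambda> v(1)] by blast
  obtain z where z: "(\<Prod>i\<in>{1..m}. v i) = of_int z" using prod_int[OF v(1)] by (auto elim: Ints_cases)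
  have "(\<Prod>i\<in>{1..m}. v i) \<noteq> 0"
    using no_zero[OF \<Lambda> v(1) _ _ jm] j by (subst prod_zero_iff) blast+
  hence "z \<noteq> 0" using z by auto
  hence "1 \<le> \<bar>z\<bar>" by simp
  hence "1 \<le> cmod (\<Prod>i\<in>{1..m}. v i)" unfolding z norm_of_int by linarith
  then show ?thesis by (simp add: prod_norm)
qed

text \<open>The traces \<open>\<Sum>i. v i * s i ^ j\<close> embed the lattice into \<open>\<int>\<^sup>m\<close> (Vandermonde).\<close>
lemma box_growth: "\<exists>C\<ge>0. \<forall>R\<ge>0. finite (box \<Lambda> (\<lambda>_. R)) \<and> real (card (box \<Lambda> (\<lambda>_. R))) \<le> (C * R + 1) ^ m"
proof -
  obtain s where s: "s \<in> \<Lambda>" "inj_on s {1..m}" using generator[OF \<Lambda>] by blast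
  define t where "t v j = (\<Sum>i\<in>{1..m}. v i * s i ^ j)" for v :: "nat \<Rightarrow> complex" and j :: nat
  have t_int: "t v j \<in> \<int>" if "v \<in> \<Lambda>" for v j
  proof -
    have "(\<lambda>i. v i * (if i \<in> {1..m} then s i ^ j else 0)) \<in> \<Lambda>"
      by (rule mult_closed[OF \<Lambda> that power_closed[OF s(1)]])
    from sum_int[OF this] show ?thesis by (simp add: t_def)
  qed
  define C where "C = 2 * (\<Sum>j<m. \<Sum>i\<in>{1..m}. cmod (s i) ^ j)"
  have C0: "C \<ge> 0" unfolding C_def by (intro mult_nonneg_nonneg sum_nonneg) auto
  define \<phi> where "\<phi> v = restrict (\<lambda>j. \<lfloor>Re (t v j)\<rfloor>) {..<m}" for v
  have floor: "of_int \<lfloor>Re (t v j)\<rfloor> = t v j" if "v \<in> \<Lambda>" for v j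
    using t_int[OF that, of j] by (auto elim!: Ints_cases)
  have inj: "inj_on \<phi> \<Lambda>"
  proof (rule inj_onI)
    fix v w assume vw: "v \<in> \<Lambda>" "w \<in> \<Lambda>" "\<phi> v = \<phi> w"
    have teq: "t v j = t w j" if "j < m" for j
    proof -
      have "\<phi> v j = \<phi> w j" using vw(3) by simp
      hence "\<lfloor>Re (t v j)\<rfloor> = \<lfloor>Re (t w j)\<rfloor>" using that by (simp add: \<phi>_def)
      then show ?thesis using floor[OF vw(1), of j] floor[OF vw(2), of j] by metis
    qed
    define d where "d i = v i - w i" for i
    have tz: "(\<Sum>i\<in>{1..m}. d i * s i ^ j) = 0" if "j < m" for j
      using teq[OF that] by (simp add: t_def d_def left_diff_distrib sum_subtractf)
    have pz: "(\<Sum>i\<in>{1..m}. d i * poly p (s i)) = 0" if "Polynomial.degree p < m" for p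
    proof -
      have "(\<Sum>i\<in>{1..m}. d i * poly p (s i)) = (\<Sum>i\<in>{1..m}. \<Sum>j\<le>Polynomial.degree p. poly.coeff p j * (d i * s i ^ j))"
        by (simp add: poly_altdef sum_distrib_left mult_ac)
      also have "\<dots> = (\<Sum>j\<le>Polynomial.degree p. poly.coeff p j * (\<Sum>i\<in>{1..m}. d i * s i ^ j))"
        by (subst sum.swap) (simp add: sum_distrib_left)
      also have "\<dots> = 0" 
      proof (intro sum.neutral ballI)
        fix j assume "j \<in> {..Polynomial.degree p}"
        hence "j < m" using that by simp
        from tz[OF this] show "poly.coeff p j * (\<Sum>i\<in>{1..m}. d i * s i ^ j) = 0" by (simp only: mult_zero_right)
      qed
      finally show ?thesis .
    qed
    have "d i = 0" if i: "i \<in> {1..m}" for i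
    proof -
      \<comment> \<open>This polynomial vanishes at all s l except s i. Since d is orthogonal to all
        values of polynomials of degree below m, its coordinate d i is isolated and must be
        zero.\<close>
      define p where "p = (\<Prod>l\<in>{1..m} - {i}. [:- s l, 1:])"
      have "Polynomial.degree p = (\<Sum>l\<in>{1..m} - {i}. 1)"
        unfolding p_def by (subst degree_prod_eq_sum_degree) auto
      hence "Polynomial.degree p < m" using i m3 by simp
      from pz[OF this] have "0 = (\<Sum>l\<in>{1..m}. d l * poly p (s l))" by simp
      also have "\<dots> = (\<Sum>l\<in>{1..m}. if l = i then d i * poly p (s i) else 0)"
        by (intro sum.cong refl) (auto simp: p_def poly_prod)
      also have "\<dots> = d i * poly p (s i)" using i by simp
      finally have "d i * poly p (s i) = 0" by simp
      moreover have "s i \<noteq> s l" if "l \<in> {1..m} - {i}" for l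
        using inj_onD[OF s(2), of i l] i that by blast
      hence "poly p (s i) \<noteq> 0" by (simp add: p_def poly_prod)
      ultimately show ?thesis by simp
    qed
    hence "v i = w i" if "i \<in> {1..m}" for i using that by (simp add: d_def)
    then show "v = w"
      using outside[OF \<Lambda> vw(1)] outside[OF \<Lambda> vw(2)] by (metis ext)
  qed
  show ?thesis
  proof (intro exI[of _ "C + C"] conjI allI impI)
    show "C + C \<ge> 0" using C0 by simp
    fix R :: real assume R: "R \<ge> 0"
    define N where "N = \<lfloor>C * R\<rfloor>"
    have N0: "N \<ge> 0" using C0 R by (simp add: N_def)
    have sub: "\<phi> ` box \<Lambda> (\<lambda>_. R) \<subseteq> {..<m} \<rightarrow>\<^sub>E {-N..N}"
    proof (rule image_subsetI)
      fix v assume v: "v \<in> box \<Lambda> (\<lambda>_. R)"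
      hence v\<Lambda>: "v \<in> \<Lambda>" and vR: "\<And>i. i \<in> {1..m} \<Longrightarrow> cmod (v i) \<le> R" by (auto simp: box_def)
      have "\<lfloor>Re (t v j)\<rfloor> \<in> {-N..N}" if j: "j < m" for j
      proof -
        have "cmod (t v j) \<le> (\<Sum>i\<in>{1..m}. cmod (v i * s i ^ j))" unfolding t_def by (rule norm_sum)
        also have "\<dots> \<le> (\<Sum>i\<in>{1..m}. R * cmod (s i) ^ j)"
          by (intro sum_mono) (auto simp: norm_mult norm_power intro!: mult_right_mono vR)
        also have "\<dots> = R * (\<Sum>i\<in>{1..m}. cmod (s i) ^ j)" by (simp add: sum_distrib_left)
        also have "\<dots> \<le> R * (\<Sum>j<m. \<Sum>i\<in>{1..m}. cmod (s i) ^ j)"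
          using R j by (intro mult_left_mono member_le_sum) (auto intro!: sum_nonneg)
        also have "\<dots> \<le> C * R" using R by (simp add: C_def mult.commute sum_nonneg)
        finally have "cmod (of_int \<lfloor>Re (t v j)\<rfloor>) \<le> C * R" by (simp add: floor[OF v\<Lambda>])
        hence "\<bar>\<lfloor>Re (t v j)\<rfloor>\<bar> \<le> N" by (simp add: N_def le_floor_iff)
        then show ?thesis by auto
      qed
      then show "\<phi> v \<in> {..<m} \<rightarrow>\<^sub>E {-N..N}" by (auto simp: \<phi>_def)
    qed
    have fin: "finite ({..<m} \<rightarrow>\<^sub>E {-N..N})" by (intro finite_PiE) auto
    have inj': "inj_on \<phi> (box \<Lambda> (\<lambda>_. R))" by (rule inj_on_subset[OF inj]) (auto simp: box_def)
    show "finite (box \<Lambda> (\<lambda>_. R))" using finite_imageD[OF finite_subset[OF sub fin] inj'] .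
    have "card (box \<Lambda> (\<lambda>_. R)) \<le> card ({..<m} \<rightarrow>\<^sub>E {-N..N})"
      by (rule card_inj_on_le[OF inj' sub fin])
    also have "\<dots> = nat (2 * N + 1) ^ m" using N0 by (simp add: card_PiE algebra_simps)
    finally have "real (card (box \<Lambda> (\<lambda>_. R))) \<le> real (nat (2 * N + 1) ^ m)" by linarith
    also have "\<dots> = (2 * of_int N + 1) ^ m" using N0 by simp
    also have "\<dots> \<le> ((C + C) * R + 1) ^ m"
    proof (rule power_mono)
      have "of_int N \<le> C * R" by (simp add: N_def)
      then show "2 * real_of_int N + 1 \<le> (C + C) * R + 1" by (simp add: algebra_simps)
    qed (use N0 in simp)
    finally show "real (card (box \<Lambda> (\<lambda>_. R))) \<le> ((C + C) * R + 1) ^ m" .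
  qed
qed

lemma finite_box: "finite (box \<Lambda> B)"
proof -
  obtain C where "\<forall>R\<ge>0. finite (box \<Lambda> (\<lambda>_. R)) \<and> real (card (box \<Lambda> (\<lambda>_. R))) \<le> (C * R + 1) ^ m"
    using box_growth by blast
  hence "finite (box \<Lambda> (\<lambda>_. \<Sum>i\<in>{1..m}. \<bar>B i\<bar>))" by (simp add: sum_nonneg)
  moreover have "box \<Lambda> B \<subseteq> box \<Lambda> (\<lambda>_. \<Sum>i\<in>{1..m}. \<bar>B i\<bar>)"
  proof
    fix v assume v: "v \<in> box \<Lambda> B"
    have "cmod (v i) \<le> (\<Sum>i\<in>{1..m}. \<bar>B i\<bar>)" if i: "i \<in> {1..m}" for i
    proof -
      have "cmod (v i) \<le> \<bar>B i\<bar>" using v i by (force simp: box_def)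
      also have "\<dots> \<le> (\<Sum>i\<in>{1..m}. \<bar>B i\<bar>)" using i by (intro member_le_sum) auto
      finally show ?thesis .
    qed
    then show "v \<in> box \<Lambda> (\<lambda>_. \<Sum>i\<in>{1..m}. \<bar>B i\<bar>)" using v by (auto simp: box_def)
  qed
  ultimately show ?thesis by (rule finite_subset[rotated])
qed

text \<open>If \<open>A\<close> were larger, the numbers with \<open>T\<close> digits from \<open>A\<close> in base \<open>q\<close> would overfill a box of size \<open>q ^ T\<close>.\<close>
lemma card_incongruent:
  assumes q: "q \<ge> 2" and A: "finite A" "A \<subseteq> \<Lambda>"
    and incong: "\<And>a b w. a \<in> A \<Longrightarrow> b \<in> A \<Longrightarrow> w \<in> \<Lambda> \<Longrightarrow> (\<And>i. a i - b i = of_nat q * w i) \<Longrightarrow> a = b"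
  shows "card A \<le> q ^ m"
proof (rule ccontr)
  assume big: "\<not> card A \<le> q ^ m"
  define S where "S = rec_nat {\<lambda>i. 0} (\<lambda>_ U. (\<lambda>(a, v). \<lambda>i. a i + of_nat q * v i) ` (A \<times> U))"
  have S0: "S 0 = {\<lambda>i. 0}" and SS: "S (Suc T) = (\<lambda>(a, v). \<lambda>i. a i + of_nat q * v i) ` (A \<times> S T)" for T
    by (simp_all add: S_def)
  define M where "M = (\<Sum>a\<in>A. \<Sum>i\<in>{1..m}. cmod (a i))"
  have M0: "M \<ge> 0" unfolding M_def by (intro sum_nonneg) auto
  have AM: "cmod (a i) \<le> M" if "a \<in> A" "i \<in> {1..m}" for a i
  proof -
    have "cmod (a i) \<le> (\<Sum>i\<in>{1..m}. cmod (a i))" using that by (intro member_le_sum) auto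
    also have "\<dots> \<le> M" unfolding M_def using that A by (intro member_le_sum[of a A "\<lambda>a. \<Sum>i\<in>{1..m}. cmod (a i)"] sum_nonneg) auto
    finally show ?thesis .
  qed
  have ST: "S T \<subseteq> box \<Lambda> (\<lambda>_. M * (real q ^ T - 1)) \<and> card (S T) = card A ^ T \<and> finite (S T)" for T
  proof (induction T)
    case 0
    then show ?case using zero_in by (auto simp: S0 box_def)
  next
    case (Suc T)
    have IH: "\<And>v. v \<in> S T \<Longrightarrow> v \<in> \<Lambda>" "\<And>v i. v \<in> S T \<Longrightarrow> i \<in> {1..m} \<Longrightarrow> cmod (v i) \<le> M * (real q ^ T - 1)"
      "card (S T) = card A ^ T" "finite (S T)"
      using Suc.IH by (auto simp: box_def)
    have inj: "inj_on (\<lambda>(a, v). \<lambda>i. a i + of_nat q * v i) (A \<times> S T)"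
    proof (rule inj_onI, clarify)
      fix a v b w assume ab: "a \<in> A" "b \<in> A" "v \<in> S T" "w \<in> S T"
        and eq: "(\<lambda>i. a i + of_nat q * v i) = (\<lambda>i. b i + of_nat q * w i)"
      have e: "a i - b i = of_nat q * (w i - v i)" for i
        using fun_cong[OF eq, of i] by (simp add: algebra_simps)
      have "a = b" using incong[OF ab(1,2) diff_closed[OF \<Lambda> IH(1)[OF ab(4)] IH(1)[OF ab(3)]]] e by blast
      moreover have "v = w"
      proof
        fix i show "v i = w i" using e[of i] \<open>a = b\<close> q by simp
      qed
      ultimately show "a = b \<and> v = w" by simp
    qed
    have "card (S (Suc T)) = card A ^ Suc T"
      unfolding SS using inj by (simp add: card_image card_cartesian_product IH)
    moreover have "finite (S (Suc T))" unfolding SS using A IH by simp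
    moreover have "S (Suc T) \<subseteq> box \<Lambda> (\<lambda>_. M * (real q ^ Suc T - 1))"
    proof
      fix u assume "u \<in> S (Suc T)"
      then obtain a v where u: "u = (\<lambda>i. a i + of_nat q * v i)" "a \<in> A" "v \<in> S T" unfolding SS by auto
      have "u \<in> \<Lambda>" unfolding u(1) using u A IH(1) by (intro add_closed scale_closed) auto
      moreover have "cmod (u i) \<le> M * (real q ^ Suc T - 1)" if i: "i \<in> {1..m}" for i
      proof -
        have "cmod (u i) \<le> cmod (a i) + real q * cmod (v i)"
          unfolding u(1) by (rule order.trans[OF norm_triangle_ineq]) (simp add: norm_mult)
        also have "\<dots> \<le> M + real q * (M * (real q ^ T - 1))"
          using AM[OF u(2) i] IH(2)[OF u(3) i] by (intro add_mono mult_left_mono) auto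
        also have "\<dots> = M * (real q ^ Suc T - 1) - M * (real q - 2)" by (simp add: algebra_simps)
        also have "\<dots> \<le> M * (real q ^ Suc T - 1)" using M0 q by simp
        finally show ?thesis .
      qed
      ultimately show "u \<in> box \<Lambda> (\<lambda>_. M * (real q ^ Suc T - 1))" by (simp add: box_def)
    qed
    ultimately show ?case by blast
  qed
  obtain C where C: "C \<ge> 0" "\<And>R. R \<ge> 0 \<Longrightarrow> real (card (box \<Lambda> (\<lambda>_. R))) \<le> (C * R + 1) ^ m"
    using box_growth by blast
  have bound: "real (card A) ^ T \<le> (C * M + 1) ^ m * (real q ^ m) ^ T" for T
  proof -
    have q1: "real q ^ T \<ge> 1" using q by (intro one_le_power) simp
    have "real (card A) ^ T = real (card (S T))" using ST[of T] by simp
    also have "\<dots> \<le> real (card (box \<Lambda> (\<lambda>_. M * (real q ^ T - 1))))"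
      using ST[of T] finite_box by (intro of_nat_mono card_mono) auto
    also have "\<dots> \<le> (C * (M * (real q ^ T - 1)) + 1) ^ m" using M0 q1 by (intro C) simp
    also have "\<dots> \<le> ((C * M + 1) * real q ^ T) ^ m"
    proof (rule power_mono)
      have "C * (M * (real q ^ T - 1)) + 1 = (C * M + 1) * real q ^ T - C * M - (real q ^ T - 1)"
        by (simp add: algebra_simps)
      also have "\<dots> \<le> (C * M + 1) * real q ^ T" using mult_nonneg_nonneg[OF C(1) M0] q1 by linarith
      finally show "C * (M * (real q ^ T - 1)) + 1 \<le> (C * M + 1) * real q ^ T" .
    qed (use C M0 q1 in simp)
    also have "\<dots> = (C * M + 1) ^ m * (real q ^ m) ^ T"
      by (simp add: power_mult_distrib mult.commute flip: power_mult)
    finally show ?thesis .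
  qed
  have qm: "real q ^ m > 0" using q by simp
  \<comment> \<open>Powers of a ratio above 1 would outgrow a bound that does not depend on the
    number T of digits.\<close>
  define \<rho> where "\<rho> = real (card A) / real q ^ m"
  have "real q ^ m < real (card A)" using big by (simp flip: of_nat_power)
  hence "\<rho> > 1" using qm by (simp add: \<rho>_def)
  then obtain T where T: "(C * M + 1) ^ m < \<rho> ^ T" using real_arch_pow by blast
  have "\<rho> ^ T \<le> (C * M + 1) ^ m"
    using bound[of T] qm by (simp add: \<rho>_def power_divide pos_divide_le_eq)
  with T show False by simp
qed

text \<open>Pigeonhole modulo q. One representative is fixed in every class that meets the box, and
  there are at most q^m classes. Subtracting the representative and dividing by q embeds each class
  into the box scaled by 2/q.\<close>

lemma card_box_le_classes:
  assumes q: "q \<ge> 2"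
  shows "card (box \<Lambda> B) \<le> q ^ m * card (box \<Lambda> (\<lambda>i. 2 / real q * B i))"
proof -
  define cong where "cong v u \<longleftrightarrow> (\<exists>w\<in>\<Lambda>. \<forall>i. v i - u i = of_nat q * w i)" for v u :: "nat \<Rightarrow> complex"
  have refl: "cong v v" for v unfolding cong_def using zero_in by auto
  have sym: "cong u v" if "cong v u" for u v
  proof -
    from that obtain w where w: "w \<in> \<Lambda>" "\<And>i. v i - u i = of_nat q * w i" unfolding cong_def by blast
    have "u i - v i = of_nat q * (0 - w i)" for i using w(2)[of i] by (simp add: algebra_simps)
    then show ?thesis unfolding cong_def by (intro bexI[OF _ diff_closed[OF \<Lambda> zero_in w(1)]]) blast
  qed
  have trans: "cong v x" if "cong v u" "cong u x" for v u x
  proof -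
    from that obtain w w' where w: "w \<in> \<Lambda>" "\<And>i. v i - u i = of_nat q * w i" "w' \<in> \<Lambda>" "\<And>i. u i - x i = of_nat q * w' i"
      unfolding cong_def by blast
    have "v i - x i = of_nat q * (w i + w' i)" for i using w(2)[of i] w(4)[of i] by (simp add: algebra_simps)
    then show ?thesis unfolding cong_def by (intro bexI[OF _ add_closed[OF w(1,3)]]) blast
  qed
  define rep where "rep v = (SOME u. u \<in> box \<Lambda> B \<and> cong v u)" for v
  have rep: "rep v \<in> box \<Lambda> B" "cong v (rep v)" if "v \<in> box \<Lambda> B" for v
    using someI[of "\<lambda>u. u \<in> box \<Lambda> B \<and> cong v u" v] that refl unfolding rep_def by auto
  have rep_eq: "rep u = rep v" if "cong u v" for u v
  proof -
    have "cong u x \<longleftrightarrow> cong v x" for x using that sym trans by blast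
    then show ?thesis unfolding rep_def by simp
  qed
  define A where "A = rep ` box \<Lambda> B"
  have "card A \<le> q ^ m"
  proof (rule card_incongruent[OF q])
    show "finite A" unfolding A_def using finite_box by simp
    show "A \<subseteq> \<Lambda>" using rep(1) by (auto simp: A_def box_def)
    fix a b w assume ab: "a \<in> A" "b \<in> A" "w \<in> \<Lambda>" "\<And>i. a i - b i = of_nat q * w i"
    then obtain u v where uv: "u \<in> box \<Lambda> B" "a = rep u" "v \<in> box \<Lambda> B" "b = rep v" by (auto simp: A_def)
    have "cong a b" unfolding cong_def using ab by blast
    hence "cong u v" using rep(2)[OF uv(1)] rep(2)[OF uv(3)] sym trans unfolding uv by blast
    then show "a = b" unfolding uv using rep_eq by blast
  qed
  moreover have "card {v \<in> box \<Lambda> B. rep v = a} \<le> card (box \<Lambda> (\<lambda>i. 2 / real q * B i))" if a: "a \<in> A" for a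
  proof (rule card_inj_on_le[OF _ _ finite_box])
    let ?h = "\<lambda>v i. (v i - a i) / of_nat q"
    show "inj_on ?h {v \<in> box \<Lambda> B. rep v = a}"
    proof (rule inj_onI)
      fix u v assume h: "?h u = ?h v"
      show "u = v"
      proof
        fix i show "u i = v i" using fun_cong[OF h, of i] q by simp
      qed
    qed
    show "?h ` {v \<in> box \<Lambda> B. rep v = a} \<subseteq> box \<Lambda> (\<lambda>i. 2 / real q * B i)"
    proof (rule image_subsetI)
      fix v assume "v \<in> {v \<in> box \<Lambda> B. rep v = a}"
      hence v: "v \<in> box \<Lambda> B" "rep v = a" by auto
      from rep(2)[OF v(1)] v(2) obtain w where w: "w \<in> \<Lambda>" "\<And>i. v i - a i = of_nat q * w i"
        unfolding cong_def by blast
      have "?h v = w" using w(2) q by (auto simp: fun_eq_iff)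
      moreover have "cmod (w i) \<le> 2 / real q * B i" if i: "i \<in> {1..m}" for i
      proof -
        have "real q * cmod (w i) = cmod (v i - a i)" unfolding w(2) by (simp add: norm_mult)
        also have "\<dots> \<le> cmod (v i) + cmod (a i)" by (rule norm_triangle_ineq4)
        also have "cmod (v i) \<le> B i" using v(1) i by (simp add: box_def)
        also have "cmod (a i) \<le> B i" using rep(1)[OF v(1)] i unfolding v(2) by (simp add: box_def)
        finally show ?thesis using q by (simp add: field_simps)
      qed
      ultimately show "?h v \<in> box \<Lambda> (\<lambda>i. 2 / real q * B i)" using w(1) by (simp add: box_def)
    qed
  qed
  moreover have "card (box \<Lambda> B) = (\<Sum>a\<in>A. card {v \<in> box \<Lambda> B. rep v = a})"
  proof -
    have "box \<Lambda> B = (\<Union>a\<in>A. {v \<in> box \<Lambda> B. rep v = a})" by (auto simp: A_def)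
    also have "card \<dots> = (\<Sum>a\<in>A. card {v \<in> box \<Lambda> B. rep v = a})"
      using finite_box by (intro card_UN_disjoint) (auto simp: A_def)
    finally show ?thesis .
  qed
  ultimately have "card (box \<Lambda> B) \<le> (\<Sum>a\<in>A. card (box \<Lambda> (\<lambda>i. 2 / real q * B i)))"
    by (simp only:) (rule sum_mono, blast)
  also have "\<dots> = card A * card (box \<Lambda> (\<lambda>i. 2 / real q * B i))" by simp
  also have "\<dots> \<le> q ^ m * card (box \<Lambda> (\<lambda>i. 2 / real q * B i))"
    using \<open>card A \<le> q ^ m\<close> by (rule mult_right_mono) simp
  finally show ?thesis .
qed

text \<open>Take q slightly above 2 Z powr (1 / m). If two points of the box differ by q w, the norm
  of w is at most 2^m Z / q^m < 1, so w = 0. All points of the box are thus incongruent modulo q,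
  and there are at most q^m of them.\<close>

lemma card_box_le:
  assumes B: "\<And>i. i \<in> {1..m} \<Longrightarrow> 1 \<le> B i" and Z: "(\<Prod>i\<in>{1..m}. B i) \<le> Z" "1 \<le> Z"
  shows "real (card (box \<Lambda> B)) \<le> 4 ^ m * Z"
proof -
  define x where "x = Z powr (1 / real m)"
  have x1: "x \<ge> 1" using Z(2) by (simp add: x_def ge_one_powr_ge_zero)
  have xm: "x ^ m = Z"
    using Z(2) m3 by (simp add: x_def powr_power)
  define q where "q = nat \<lfloor>2 * x\<rfloor> + 1"
  have fl: "\<lfloor>2 * x\<rfloor> \<ge> 2" using x1 by linarith
  have q: "2 * x < real q" "real q \<le> 2 * x + 1" "q \<ge> 2"
    using fl x1 by (simp_all add: q_def) linarith+
  have "card (box \<Lambda> B) \<le> q ^ m"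
  proof (rule card_incongruent[OF q(3) finite_box])
    show "box \<Lambda> B \<subseteq> \<Lambda>" by (auto simp: box_def)
    fix a b w assume ab: "a \<in> box \<Lambda> B" "b \<in> box \<Lambda> B" and w: "w \<in> \<Lambda>" "\<And>i. a i - b i = of_nat q * w i"
    show "a = b"
    proof (rule ccontr)
      assume "a \<noteq> b"
      have "w \<noteq> (\<lambda>i. 0)"
      proof
        assume "w = (\<lambda>i. 0)"
        hence "a i = b i" for i using w(2)[of i] by simp
        with \<open>a \<noteq> b\<close> show False by blast
      qed
      hence "1 \<le> (\<Prod>i\<in>{1..m}. cmod (w i))" using norm_ge_1[OF w(1)] by blast
      hence "real q ^ m * 1 \<le> real q ^ m * (\<Prod>i\<in>{1..m}. cmod (w i))" by (intro mult_left_mono) auto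
      hence "real q ^ m \<le> real q ^ m * (\<Prod>i\<in>{1..m}. cmod (w i))" by simp
      also have "\<dots> = (\<Prod>i\<in>{1..m}. cmod (a i - b i))"
        unfolding w(2) by (simp add: norm_mult prod.distrib)
      also have "\<dots> \<le> (\<Prod>i\<in>{1..m}. 2 * B i)"
      proof (rule prod_mono, safe)
        fix i assume i: "i \<in> {1..m}"
        have "cmod (a i - b i) \<le> cmod (a i) + cmod (b i)" by (rule norm_triangle_ineq4)
        also have "\<dots> \<le> 2 * B i" using ab i by (force simp: box_def)
        finally show "cmod (a i - b i) \<le> 2 * B i" .
      qed simp
      also have "\<dots> = 2 ^ m * (\<Prod>i\<in>{1..m}. B i)" by (simp add: prod.distrib)
      also have "\<dots> \<le> 2 ^ m * x ^ m" using Z(1) xm by simp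
      also have "\<dots> = (2 * x) ^ m" by (simp add: power_mult_distrib)
      also have "\<dots> < real q ^ m" using q(1) x1 m3 by (intro power_strict_mono) auto
      finally show False by simp
    qed
  qed
  hence "real (card (box \<Lambda> B)) \<le> real q ^ m" by (simp flip: of_nat_power)
  also have "\<dots> \<le> (4 * x) ^ m" using q x1 by (intro power_mono) auto
  also have "\<dots> = 4 ^ m * Z" by (simp add: power_mult_distrib xm)
  finally show ?thesis .
qed

end

text \<open>A generator from any lattice is a choice of one root for each of its m coordinates, the
  roots being those of its integral characteristic polynomial; this gives m^m vectors for each
  polynomial. The bound \<open>Y\<close> depends on the number k of factors because scaling a box by
  c scales k-fold products by c^k, and the whole gain of the shrunken box comes from this
  dependence.\<close>

lemma all_gens_bound:
  assumes Y: "\<And>S. S \<subseteq> {1..m} \<Longrightarrow> (\<Prod>i\<in>S. B i) \<le> Y (card S)"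
    and B: "\<And>i. i \<in> {1..m} \<Longrightarrow> 0 \<le> B i"
  shows "finite (all_gens B)"
    "real (card (all_gens B)) \<le> real m ^ m * (\<Prod>k\<in>{1..m}. 2 * 2 ^ m * Y k + 1)"
proof -
  \<comment> \<open>The coefficient of degree j is a sum of at most 2^m products of m - j
    coordinates.\<close>
  define b where "b j = \<lfloor>2 ^ m * Y (m - j)\<rfloor>" for j
  define pol where "pol c = Polynomial.monom 1 m + (\<Sum>j<m. Polynomial.monom (complex_of_int (c j)) j)" for c :: "nat \<Rightarrow> int"
  define rts where "rts p = {z. poly p z = 0}" for p :: "complex poly"
  define Cs where "Cs = (\<Pi>\<^sub>E j\<in>{..<m}. {- b j..b j})"
  define V where "V c = PiE_dflt {1..m} 0 (\<lambda>_. rts (pol c))" for c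
  have coeff_pol: "poly.coeff (pol c) j = (if j = m then 1 else if j < m then of_int (c j) else 0)" for c j
    by (simp add: pol_def coeff_sum)
  have deg: "Polynomial.degree (pol c) = m" for c
    using degree_le[of m "pol c"] le_degree[of "pol c" m] by (simp add: coeff_pol)
  have pol0: "pol c \<noteq> 0" for c using deg[of c] m3 by auto
  have fin_rts: "finite (rts (pol c))" and card_rts: "card (rts (pol c)) \<le> m" for c
    using poly_roots_finite[OF pol0] card_poly_roots_bound[OF pol0, of c] deg[of c] by (auto simp: rts_def)
  have finC: "finite Cs" unfolding Cs_def by (intro finite_PiE) auto
  have finV: "finite (V c)" for c unfolding V_def using fin_rts by (intro finite_PiE_dflt) auto
  have cardV: "card (V c) \<le> m ^ m" for c
    unfolding V_def using card_rts[of c] fin_rts by (subst card_PiE_dflt) (auto intro: power_mono)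
  have Y0: "0 \<le> Y k" if "k \<le> m" for k
  proof -
    have "0 \<le> (\<Prod>i\<in>{1..k}. B i)" using that by (intro prod_nonneg B) auto
    also have "\<dots> \<le> Y (card {1..k})" using that by (intro Y) auto
    finally show ?thesis by simp
  qed
  have sub: "all_gens B \<subseteq> (\<Union>c\<in>Cs. V c)"
  proof
    fix v assume "v \<in> all_gens B"
    then obtain \<Lambda> where \<Lambda>: "\<Lambda> \<in> \<LL>" and v: "v \<in> \<Lambda>" and vB: "\<And>i. i \<in> {1..m} \<Longrightarrow> cmod (v i) \<le> B i"
      by (auto simp: all_gens_def gens_def box_def)
    define p where "p = (\<Prod>i\<in>{1..m}. [:- v i, 1:])"
    define c where "c = restrict (\<lambda>j. \<lfloor>Re (poly.coeff p j)\<rfloor>) {..<m}"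
    have int: "of_int \<lfloor>Re (poly.coeff p j)\<rfloor> = poly.coeff p j" for j
      using integral[OF \<Lambda> v, of j] unfolding p_def[symmetric] by (auto elim!: Ints_cases)
    have degp: "Polynomial.degree p = m"
      unfolding p_def by (subst degree_prod_eq_sum_degree) auto
    have lead: "poly.coeff p m = 1"
    proof -
      have "Polynomial.lead_coeff p = 1" unfolding p_def by (simp add: lead_coeff_prod)
      then show ?thesis by (simp add: degp)
    qed
    have "p = pol c"
    proof (rule poly_eqI)
      fix j show "poly.coeff p j = poly.coeff (pol c) j"
        using lead int[of j] degp coeff_eq_0[of p j] by (auto simp: coeff_pol c_def)
    qed
    have "\<lfloor>Re (poly.coeff p j)\<rfloor> \<in> {- b j..b j}" if j: "j < m" for j
    proof -
      define SS where "SS = {S. S \<subseteq> {1..m} \<and> card S + j = card {1..m}}"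
      have "cmod (poly.coeff p j) \<le> (\<Sum>S\<in>SS. cmod (\<Prod>i\<in>S. - v i))"
        unfolding p_def coeff_prod_linear[OF finite_atLeastAtMost] SS_def by (rule norm_sum)
      also have "\<dots> \<le> (\<Sum>S\<in>SS. Y (m - j))"
      proof (rule sum_mono)
        fix S assume "S \<in> SS"
        hence S: "S \<subseteq> {1..m}" "card S = m - j" by (auto simp: SS_def)
        have "cmod (\<Prod>i\<in>S. - v i) = (\<Prod>i\<in>S. cmod (v i))" by (simp add: prod_norm[symmetric])
        also have "\<dots> \<le> (\<Prod>i\<in>S. B i)" using S(1) vB by (intro prod_mono) auto
        also have "\<dots> \<le> Y (m - j)" using Y[OF S(1)] S(2) by simp
        finally show "cmod (\<Prod>i\<in>S. - v i) \<le> Y (m - j)" .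
      qed
      also have "\<dots> = real (card SS) * Y (m - j)" by simp
      also have "\<dots> \<le> 2 ^ m * Y (m - j)"
      proof (rule mult_right_mono)
        have "card SS \<le> card (Pow {1..m})" unfolding SS_def by (intro card_mono) auto
        also have "\<dots> = 2 ^ m" by (simp add: card_Pow)
        finally have "real (card SS) \<le> real (2 ^ m)" by (rule of_nat_mono)
        then show "real (card SS) \<le> 2 ^ m" by simp
      qed (use Y0 in simp)
      finally have "cmod (of_int \<lfloor>Re (poly.coeff p j)\<rfloor>) \<le> 2 ^ m * Y (m - j)" unfolding int .
      hence "real_of_int \<bar>\<lfloor>Re (poly.coeff p j)\<rfloor>\<bar> \<le> 2 ^ m * Y (m - j)" by simp
      hence "\<bar>\<lfloor>Re (poly.coeff p j)\<rfloor>\<bar> \<le> b j" unfolding b_def le_floor_iff .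
      then show ?thesis by auto
    qed
    hence "c \<in> Cs" by (auto simp: Cs_def c_def)
    moreover have "v \<in> V c"
      unfolding V_def PiE_dflt_def rts_def \<open>p = pol c\<close>[symmetric]
      using outside[OF \<Lambda> v] by (auto simp: p_def poly_prod)
    ultimately show "v \<in> (\<Union>c\<in>Cs. V c)" by blast
  qed
  have finU: "finite (\<Union>c\<in>Cs. V c)" using finC finV by blast
  show "finite (all_gens B)" using sub finU by (rule finite_subset)
  have "card (all_gens B) \<le> card (\<Union>c\<in>Cs. V c)" by (rule card_mono[OF finU sub])
  also have "\<dots> \<le> (\<Sum>c\<in>Cs. card (V c))" by (rule card_UN_le[OF finC])
  also have "\<dots> \<le> (\<Sum>c\<in>Cs. m ^ m)" by (intro sum_mono cardV)
  finally have "card (all_gens B) \<le> card Cs * m ^ m" by simp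
  hence "real (card (all_gens B)) \<le> real (card Cs * m ^ m)" by (rule of_nat_mono)
  hence "real (card (all_gens B)) \<le> real (card Cs) * real m ^ m" by simp
  also have "real (card Cs) = (\<Prod>j<m. real (nat (2 * b j + 1)))"
    unfolding Cs_def by (subst card_PiE) (auto intro!: prod.cong simp: algebra_simps)
  also have "\<dots> \<le> (\<Prod>j<m. 2 * 2 ^ m * Y (m - j) + 1)"
  proof (rule prod_mono, safe)
    fix j assume "j < m"
    have "0 \<le> b j" unfolding b_def using Y0[of "m - j"] by simp
    moreover have "of_int (b j) \<le> 2 ^ m * Y (m - j)" unfolding b_def by simp
    ultimately show "real (nat (2 * b j + 1)) \<le> 2 * 2 ^ m * Y (m - j) + 1" by simp
  qed simp
  also have "(\<Prod>j<m. 2 * 2 ^ m * Y (m - j) + 1) = (\<Prod>k\<in>{1..m}. 2 * 2 ^ m * Y k + 1)"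
    by (rule prod.reindex_bij_witness[of _ "\<lambda>k. m - k" "\<lambda>j. m - j"]) auto
  finally show "real (card (all_gens B)) \<le> real m ^ m * (\<Prod>k\<in>{1..m}. 2 * 2 ^ m * Y k + 1)"
    by (simp add: mult.commute mult_right_mono)
qed

section \<open>Sums over the lattices of the family\<close>

lemma gens_disjoint: "\<Lambda> \<in> \<LL> \<Longrightarrow> \<Lambda>' \<in> \<LL> \<Longrightarrow> \<Lambda> \<noteq> \<Lambda>' \<Longrightarrow> gens \<Lambda> B \<inter> gens \<Lambda>' B' = {}"
  using separated by (auto simp: gens_def box_def)

lemma sum_card_gens:
  assumes "finite \<LL>'" "\<LL>' \<subseteq> \<LL>" "finite (all_gens B)"
  shows "(\<Sum>\<Lambda>\<in>\<LL>'. card (gens \<Lambda> B)) \<le> card (all_gens B)"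
proof -
  have fin: "finite (gens \<Lambda> B)" if "\<Lambda> \<in> \<LL>'" for \<Lambda>
    using finite_box[of \<Lambda> B] that assms(2) by (auto simp: gens_def)
  have "(\<Sum>\<Lambda>\<in>\<LL>'. card (gens \<Lambda> B)) = card (\<Union>\<Lambda>\<in>\<LL>'. gens \<Lambda> B)"
    using assms(1,2) fin gens_disjoint by (intro card_UN_disjoint[symmetric]) blast+
  also have "\<dots> \<le> card (all_gens B)"
    using assms by (intro card_mono) (auto simp: all_gens_def)
  finally show ?thesis .
qed

text \<open>The family may be infinite. Sending a generator to the one lattice that contains it
  shows that only finitely many lattices have a generator in a given box.\<close>

lemma finite_lattices_with_gens:
  assumes "finite (all_gens B)"
  shows "finite {\<Lambda> \<in> \<LL>. gens \<Lambda> B \<noteq> {}}"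
proof -
  define h where "h v = (THE \<Lambda>. \<Lambda> \<in> \<LL> \<and> v \<in> gens \<Lambda> B)" for v
  have "{\<Lambda> \<in> \<LL>. gens \<Lambda> B \<noteq> {}} \<subseteq> h ` all_gens B"
  proof
    fix \<Lambda> assume "\<Lambda> \<in> {\<Lambda> \<in> \<LL>. gens \<Lambda> B \<noteq> {}}"
    then obtain v where \<Lambda>: "\<Lambda> \<in> \<LL>" "v \<in> gens \<Lambda> B" by blast
    have "h v = \<Lambda>" unfolding h_def using \<Lambda> gens_disjoint by (intro the_equality) blast+
    then show "\<Lambda> \<in> h ` all_gens B" using \<Lambda> by (auto simp: all_gens_def)
  qed
  then show ?thesis using assms by (meson finite_imageI finite_subset)
qed

text \<open>By the dichotomy the remaining points are constant integral vectors, and any single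
  coordinate bounds their number. The coordinate is left open so that the shortest side can be
  used.\<close>

lemma card_box_split:
  assumes \<Lambda>: "\<Lambda> \<in> \<LL>" and i: "i \<in> {1..m}" and B: "0 \<le> B i"
  shows "real (card (box \<Lambda> B)) \<le> real (card (gens \<Lambda> B)) + (2 * B i + 1)"
proof -
  define N where "N = \<lfloor>B i\<rfloor>"
  define cst where "cst c = (\<lambda>i. if i \<in> {1..m} then complex_of_int c else 0)" for c
  have "box \<Lambda> B \<subseteq> gens \<Lambda> B \<union> cst ` {-N..N}"
  proof
    fix v assume v: "v \<in> box \<Lambda> B"
    hence v\<Lambda>: "v \<in> \<Lambda>" by (simp add: box_def)
    show "v \<in> gens \<Lambda> B \<union> cst ` {-N..N}"
    proof (cases "inj_on v {1..m}")
      case False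
      then obtain c :: int where c: "\<forall>i\<in>{1..m}. v i = of_int c" using dichotomy[OF \<Lambda> v\<Lambda>] by blast
      have "v = cst c" using c outside[OF \<Lambda> v\<Lambda>] by (auto simp: cst_def)
      moreover have "real_of_int \<bar>c\<bar> \<le> B i" using v i c by (auto simp: box_def)
      hence "\<bar>c\<bar> \<le> N" unfolding N_def le_floor_iff .
      hence "c \<in> {-N..N}" by auto
      ultimately show ?thesis by blast
    qed (use v in \<open>simp add: gens_def\<close>)
  qed
  moreover have fin: "finite (gens \<Lambda> B)" using finite_box[OF \<Lambda>, of B] by (auto simp: gens_def)
  ultimately have "card (box \<Lambda> B) \<le> card (gens \<Lambda> B \<union> cst ` {-N..N})" by (intro card_mono) auto
  also have "\<dots> \<le> card (gens \<Lambda> B) + card (cst ` {-N..N})" by (rule card_Un_le)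
  also have "card (cst ` {-N..N}) \<le> card {-N..N}" by (rule card_image_le) simp
  finally have "real (card (box \<Lambda> B)) \<le> real (card (gens \<Lambda> B)) + real (nat (2 * N + 1))" by (simp add: algebra_simps)
  also have "real (nat (2 * N + 1)) \<le> 2 * B i + 1"
  proof -
    have "0 \<le> N" "real_of_int N \<le> B i" using B by (simp_all add: N_def)
    then show ?thesis by simp
  qed
  finally show ?thesis by simp
qed

text \<open>Adding a fixed generator of the box to the constant vectors turns them into generators
  of the doubled box. So one generator suffices to bound all points of the box by
  generators.\<close>

lemma card_box_le_gens:
  assumes \<Lambda>: "\<Lambda> \<in> \<LL>" and ne: "gens \<Lambda> B \<noteq> {}" and B: "\<And>i. i \<in> {1..m} \<Longrightarrow> 0 \<le> B i"
  shows "card (box \<Lambda> B) \<le> 2 * card (gens \<Lambda> (\<lambda>i. 2 * B i))"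
proof -
  obtain u where u: "u \<in> gens \<Lambda> B" using ne by blast
  have fin2: "finite (gens \<Lambda> (\<lambda>i. 2 * B i))" using finite_box[OF \<Lambda>] by (auto simp: gens_def)
  have "card (gens \<Lambda> B) \<le> card (gens \<Lambda> (\<lambda>i. 2 * B i))"
  proof (rule card_mono[OF fin2], rule subsetI)
    fix v assume "v \<in> gens \<Lambda> B"
    then show "v \<in> gens \<Lambda> (\<lambda>i. 2 * B i)" using B by (force simp: gens_def box_def)
  qed
  moreover have "card (box \<Lambda> B - gens \<Lambda> B) \<le> card (gens \<Lambda> (\<lambda>i. 2 * B i))"
  proof (rule card_inj_on_le[OF _ _ fin2])
    show "inj_on (\<lambda>v i. v i + u i) (box \<Lambda> B - gens \<Lambda> B)"
      by (rule inj_onI) (auto simp: fun_eq_iff)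
    show "(\<lambda>v i. v i + u i) ` (box \<Lambda> B - gens \<Lambda> B) \<subseteq> gens \<Lambda> (\<lambda>i. 2 * B i)"
    proof (rule image_subsetI)
      fix v assume v: "v \<in> box \<Lambda> B - gens \<Lambda> B"
      hence v\<Lambda>: "v \<in> \<Lambda>" "\<not> inj_on v {1..m}" by (auto simp: box_def gens_def)
      then obtain c :: int where c: "\<forall>i\<in>{1..m}. v i = of_int c" using dichotomy[OF \<Lambda> v\<Lambda>(1)] by blast
      have uu: "u \<in> \<Lambda>" "inj_on u {1..m}" "\<And>i. i \<in> {1..m} \<Longrightarrow> cmod (u i) \<le> B i" using u by (auto simp: gens_def box_def)
      have "inj_on (\<lambda>i. v i + u i) {1..m}"

      proof (rule inj_onI)
        fix i j assume "i \<in> {1..m}" "j \<in> {1..m}" "v i + u i = v j + u j"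
        then show "i = j" using c inj_onD[OF uu(2), of i j] by simp
      qed
      moreover have "cmod (v i + u i) \<le> 2 * B i" if i: "i \<in> {1..m}" for i
      proof -
        have "cmod (v i) \<le> B i" using v i by (auto simp: box_def)
        then show ?thesis using norm_triangle_ineq[of "v i" "u i"] uu(3)[OF i] by linarith
      qed
      moreover have "(\<lambda>i. v i + u i) \<in> \<Lambda>" by (rule add_closed[OF \<Lambda> v\<Lambda>(1) uu(1)])
      ultimately show "(\<lambda>i. v i + u i) \<in> gens \<Lambda> (\<lambda>i. 2 * B i)" by (simp add: gens_def box_def)
    qed
  qed
  moreover have "card (box \<Lambda> B) = card (gens \<Lambda> B) + card (box \<Lambda> B - gens \<Lambda> B)"
    using finite_box[OF \<Lambda>, of B] by (subst card_Un_disjoint[symmetric]) (auto simp: gens_def intro: arg_cong[of _ _ card])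
  ultimately show ?thesis by linarith
qed

text \<open>Let N be the number of points in the box, w = Z powr (1 / m), and q^m of order w. The
  pigeonhole gives N = O(q^m (G + w)), where G counts the generators in the shrunken box and w
  bounds the constants. Multiply by N. In the first term N = O(Z), and G sums to O(Z^m / q^(m (m +
  1) / 2)) over the lattices; in the second, N sums to O(Z^m). The totals Z q^m Z^m / q^(m (m + 1) /
  2) and w^2 Z^m are both O(Z^(m + 1) / w), because m is at least 3.\<close>

lemma sum_box_squares:
  assumes B: "\<And>i. i \<in> {1..m} \<Longrightarrow> 1 \<le> B i" and Z: "(\<Prod>i\<in>{1..m}. B i) \<le> Z" "1 \<le> Z"
    and fin: "finite \<LL>'" and sub: "\<LL>' \<subseteq> {\<Lambda> \<in> \<LL>. gens \<Lambda> B \<noteq> {}}"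
  shows "(\<Sum>\<Lambda>\<in>\<LL>'. (real (card (box \<Lambda> B)))\<^sup>2) \<le> (real m * 4096) ^ (3 * m * m) * Z powr (real m + 1 - 1 / real m)"
proof -
  \<comment> \<open>Chosen so that a^m = w = Z powr (1 / m). Then q is large enough for the shrunken
    box to save a factor w, while the loss q^m on the constant vectors stays O(w).\<close>
  define a where "a = Z powr (1 / (real m)\<^sup>2)"
  have a1: "1 \<le> a" unfolding a_def using Z(2) by (intro ge_one_powr_ge_zero) auto
  define q where "q = nat \<lceil>a\<rceil> + 1"
  have q: "a \<le> real q" "real q \<le> 3 * a" "2 \<le> q"
  proof -
    have "real (nat \<lceil>a\<rceil>) = of_int \<lceil>a\<rceil>" using a1 by simp
    moreover have "a \<le> of_int \<lceil>a\<rceil>" "of_int \<lceil>a\<rceil> \<le> a + 1" by linarith+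
    ultimately show "a \<le> real q" "real q \<le> 3 * a" "2 \<le> q" using a1 by (simp_all add: q_def) linarith+
  qed
  have m0: "real m > 0" using m3 by simp
  define w where "w = Z powr (1 / real m)"
  have am: "a ^ m = w" unfolding a_def w_def using Z(2) m0 by (simp add: powr_power power2_eq_square)
  have w1: "1 \<le> w" unfolding w_def using Z(2) by (intro ge_one_powr_ge_zero) auto
  have wm: "w ^ m = Z" unfolding w_def using Z(2) m0 by (simp add: powr_power)
  have wZ: "w \<le> Z" using power_increasing[of 1 m w] w1 m3 wm by simp
  have Bprod: "(\<Prod>i\<in>S. B i) \<le> Z" if "S \<subseteq> {1..m}" for S
  proof -
    have "(\<Prod>i\<in>S. B i) \<le> (\<Prod>i\<in>{1..m}. B i)"
    proof (rule prod_mono2)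
      show "1 \<le> B b" if "b \<in> {1..m} - S" for b using B that by blast
      show "0 \<le> B a" if "a \<in> S" for a using B[of a] that \<open>S \<subseteq> {1..m}\<close> by (auto intro: order.trans[OF zero_le_one])
    qed (use that in auto)
    then show ?thesis using Z(1) by simp
  qed
  \<comment> \<open>The shortest side is at most the geometric mean of the sides.\<close>
  have "\<exists>i0\<in>{1..m}. B i0 \<le> w"
  proof (rule ccontr)
    assume nex: "\<not> ?thesis"
    have less: "w < B i" if "i \<in> {1..m}" for i using nex that by force
    have "(\<Prod>i\<in>{1..m}. w) < (\<Prod>i\<in>{1..m}. B i)"
    proof (rule prod_mono_strict[of 1])
      show "1 \<in> {1..m}" using m3 by simp
      then show "w < B 1" by (rule less)
      show "0 \<le> w \<and> w \<le> B i" if "i \<in> {1..m}" for i using less[OF that] w1 by linarith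
      show "0 < B i" if "i \<in> {1..m}" for i using less[OF that] w1 by linarith
    qed simp
    then show False using wm Z(1) by simp
  qed
  then obtain i0 where i0: "i0 \<in> {1..m}" "B i0 \<le> w" by blast
  have sub': "\<LL>' \<subseteq> \<LL>" using sub by blast
  define K where "K = (real m * 4096) ^ (2 * m * m)"
  \<comment> \<open>generators in the doubled box\<close>
  have Y2: "(\<Prod>i\<in>S. 2 * B i) \<le> 2 ^ card S * Z" if "S \<subseteq> {1..m}" for S
    using Bprod[OF that] by (simp add: prod.distrib)
  have B2: "0 \<le> 2 * B i" if "i \<in> {1..m}" for i using B[OF that] by simp
  note ag2 = all_gens_bound[of "\<lambda>i. 2 * B i" "\<lambda>k. 2 ^ k * Z", OF Y2 B2]
  have g2: "real (card (all_gens (\<lambda>i. 2 * B i))) \<le> real m ^ m * (4 * 4 ^ m) ^ m * Z ^ m"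
  proof -
    have "(\<Prod>k\<in>{1..m}. 2 * 2 ^ m * (2 ^ k * Z) + 1) \<le> (\<Prod>k\<in>{1..m}. 4 * 4 ^ m * Z)"
    proof (rule prod_mono, safe)
      fix k assume k: "k \<in> {1..m}"
      have "(2::real) ^ k \<le> 2 ^ m" using k by (intro power_increasing) auto
      hence "2 * 2 ^ m * (2 ^ k * Z) + 1 \<le> 2 * 2 ^ m * (2 ^ m * Z) + 1 * Z"
        using Z(2) by (intro add_mono mult_left_mono mult_right_mono) auto
      also have "\<dots> \<le> 4 * 4 ^ m * Z"
      proof -
        have "(1::real) \<le> 4 ^ m" by simp
        hence "1 * Z \<le> 4 ^ m * Z" using Z(2) by (intro mult_right_mono) auto
        moreover have "2 * 2 ^ m * (2 ^ m * Z) = 2 * (4 ^ m * Z)" by (simp add: power_mult_distrib[symmetric])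
        moreover have "0 \<le> 4 ^ m * Z" using Z(2) by simp
        ultimately show ?thesis by linarith
      qed
      finally show "2 * 2 ^ m * (2 ^ k * Z) + 1 \<le> 4 * 4 ^ m * Z" .
    qed (use Z(2) in simp)
    also have "\<dots> = (4 * 4 ^ m) ^ m * Z ^ m" by (simp add: power_mult_distrib)
    finally have "real m ^ m * (\<Prod>k\<in>{1..m}. 2 * 2 ^ m * (2 ^ k * Z) + 1) \<le> real m ^ m * ((4 * 4 ^ m) ^ m * Z ^ m)"
      by (intro mult_left_mono) auto
    with ag2(2) show ?thesis by (simp add: mult.assoc)
  qed
  have N_sum: "(\<Sum>\<Lambda>\<in>\<LL>'. real (card (box \<Lambda> B))) \<le> 2 * (real m ^ m * (4 * 4 ^ m) ^ m * Z ^ m)"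
  proof -
    have "(\<Sum>\<Lambda>\<in>\<LL>'. real (card (box \<Lambda> B))) \<le> (\<Sum>\<Lambda>\<in>\<LL>'. 2 * real (card (gens \<Lambda> (\<lambda>i. 2 * B i))))"
    proof (rule sum_mono)
      fix \<Lambda> assume "\<Lambda> \<in> \<LL>'"
      hence "card (box \<Lambda> B) \<le> 2 * card (gens \<Lambda> (\<lambda>i. 2 * B i))"
        using sub B by (intro card_box_le_gens) (auto intro: order.trans[OF zero_le_one])
      then show "real (card (box \<Lambda> B)) \<le> 2 * real (card (gens \<Lambda> (\<lambda>i. 2 * B i)))" by linarith
    qed
    also have "\<dots> = 2 * real (\<Sum>\<Lambda>\<in>\<LL>'. card (gens \<Lambda> (\<lambda>i. 2 * B i)))" by (simp add: sum_distrib_left)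
    also have "\<dots> \<le> 2 * real (card (all_gens (\<lambda>i. 2 * B i)))"
      using of_nat_mono[OF sum_card_gens[OF fin sub' ag2(1)], where 'a = real] by simp
    also have "\<dots> \<le> 2 * (real m ^ m * (4 * 4 ^ m) ^ m * Z ^ m)" using g2 by simp
    finally show ?thesis .
  qed
  \<comment> \<open>generators in the shrunken box\<close>
  define B' where "B' i = 2 / real q * B i" for i
  have q0: "real q > 0" using q(3) by simp
  have qm: "real q ^ m \<le> 3 ^ m * w"
    using power_mono[OF q(2), of m] by (simp add: power_mult_distrib am)
  have Yq: "(\<Prod>i\<in>S. B' i) \<le> (2 / real q) ^ card S * Z" if "S \<subseteq> {1..m}" for S
  proof -
    have "(\<Prod>i\<in>S. B' i) = (2 / real q) ^ card S * (\<Prod>i\<in>S. B i)" by (simp only: B'_def prod.distrib prod_constant)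
    then show ?thesis using Bprod[OF that] q0 by (simp add: mult_left_mono)
  qed
  have Bq: "0 \<le> B' i" if "i \<in> {1..m}" for i using B[OF that] q0 by (simp add: B'_def)
  note agq = all_gens_bound[of B' "\<lambda>k. (2 / real q) ^ k * Z", OF Yq Bq]
  have gq: "real (card (all_gens B')) * real q ^ (m * (m + 1) div 2) \<le> real m ^ m * (4 * 4 ^ m) ^ m * Z ^ m * 3 ^ (m * m)"
  proof -
    \<comment> \<open>Multiplication by q^k undoes the scaling of k-fold products. The summand 1,
      which stands for the coefficient zero, becomes q^k and remains O(Z) since q^m = O(w).\<close>
    have fac: "(2 * 2 ^ m * ((2 / real q) ^ k * Z) + 1) * real q ^ k \<le> 4 * 4 ^ m * Z * 3 ^ m" if k: "k \<in> {1..m}" for k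
    proof -
      have "(2 * 2 ^ m * ((2 / real q) ^ k * Z) + 1) * real q ^ k = 2 * 2 ^ m * 2 ^ k * Z + real q ^ k"
        using q0 by (simp add: power_divide field_simps)
      also have "\<dots> \<le> 2 * 2 ^ m * 2 ^ m * Z + 3 ^ m * Z"
      proof (intro add_mono mult_right_mono mult_left_mono)
        have "real q ^ k \<le> real q ^ m" using k q(3) by (intro power_increasing) auto
        also have "\<dots> \<le> 3 ^ m * w" by (rule qm)
        also have "\<dots> \<le> 3 ^ m * Z" using wZ by simp
        finally show "real q ^ k \<le> 3 ^ m * Z" .
        show "(2::real) ^ k \<le> 2 ^ m" using k by (intro power_increasing) auto
      qed (use Z(2) in auto)
      also have "2 * 2 ^ m * 2 ^ m * Z = 2 * (4 ^ m * Z)" by (simp add: power_mult_distrib[symmetric])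
      also have "2 * (4 ^ m * Z) + 3 ^ m * Z \<le> 4 * 4 ^ m * Z * 3 ^ m"
      proof -
        have h1: "4 ^ m * Z \<le> 3 ^ m * (4 ^ m * Z)" using mult_right_mono[of 1 "3 ^ m" "4 ^ m * Z"] Z(2) by simp
        have "1 * Z \<le> 4 ^ m * Z" using Z(2) by (intro mult_right_mono) auto
        hence h2: "3 ^ m * Z \<le> 3 ^ m * (4 ^ m * Z)" by simp
        have h3: "0 \<le> 3 ^ m * (4 ^ m * Z)" using Z(2) by simp
        have "4 * 4 ^ m * Z * 3 ^ m = 4 * (3 ^ m * (4 ^ m * Z))" by simp
        with h1 h2 h3 show ?thesis by linarith
      qed
      finally show ?thesis .
    qed
    have "(\<Prod>k\<in>{1..m}. 2 * 2 ^ m * ((2 / real q) ^ k * Z) + 1) * (\<Prod>k\<in>{1..m}. real q ^ k) =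
       (\<Prod>k\<in>{1..m}. (2 * 2 ^ m * ((2 / real q) ^ k * Z) + 1) * real q ^ k)" by (rule prod.distrib[symmetric])
    also have "\<dots> \<le> (\<Prod>k\<in>{1..m}. 4 * 4 ^ m * Z * 3 ^ m)"
      using fac Z(2) q0 by (intro prod_mono conjI) (auto intro!: mult_nonneg_nonneg add_nonneg_nonneg)
    also have "\<dots> = (4 * 4 ^ m) ^ m * Z ^ m * 3 ^ (m * m)" by (simp add: power_mult_distrib power_mult)
    also have "(\<Prod>k\<in>{1..m}. real q ^ k) = real q ^ (m * (m + 1) div 2)"
    proof -
      have "2 * \<Sum>{1..k} = k * (k + 1)" for k :: nat by (induction k) auto
      hence "\<Sum>{1..m} = m * (m + 1) div 2" by (metis nonzero_mult_div_cancel_left zero_neq_numeral)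
      then show ?thesis unfolding power_sum[symmetric] by simp
    qed
    finally have *: "(\<Prod>k\<in>{1..m}. 2 * 2 ^ m * ((2 / real q) ^ k * Z) + 1) * real q ^ (m * (m + 1) div 2)
      \<le> (4 * 4 ^ m) ^ m * Z ^ m * 3 ^ (m * m)" .
    have "real (card (all_gens B')) * real q ^ (m * (m + 1) div 2) \<le>
      (real m ^ m * (\<Prod>k\<in>{1..m}. 2 * 2 ^ m * ((2 / real q) ^ k * Z) + 1)) * real q ^ (m * (m + 1) div 2)"
      using agq(2) by (intro mult_right_mono) auto
    also have "\<dots> = real m ^ m * ((\<Prod>k\<in>{1..m}. 2 * 2 ^ m * ((2 / real q) ^ k * Z) + 1) * real q ^ (m * (m + 1) div 2))" by simp
    also have "\<dots> \<le> real m ^ m * ((4 * 4 ^ m) ^ m * Z ^ m * 3 ^ (m * m))"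
      using * by (rule mult_left_mono) simp
    finally show ?thesis by (simp add: mult_ac)
  qed
  define T where "T = real m ^ m * (4 * 4 ^ m) ^ m"
  have T0: "0 \<le> T" unfolding T_def by simp
  \<comment> \<open>the main inequality\<close>
  have sq: "(real (card (box \<Lambda> B)))\<^sup>2 \<le>
      real q ^ m * (4 ^ m * Z) * real (card (gens \<Lambda> B')) + real q ^ m * (5 * w) * real (card (box \<Lambda> B))"
    if L: "\<Lambda> \<in> \<LL>'" for \<Lambda>
  proof -
    have \<Lambda>: "\<Lambda> \<in> \<LL>" using L sub' by blast
    define N where "N = real (card (box \<Lambda> B))"
    have N0: "0 \<le> N" by (simp add: N_def)
    have NZ: "N \<le> 4 ^ m * Z" unfolding N_def by (rule card_box_le[OF \<Lambda> B Z])
    have "N \<le> real (q ^ m * card (box \<Lambda> B'))"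
      unfolding N_def B'_def using card_box_le_classes[OF \<Lambda> q(3)] by (rule of_nat_mono)
    also have "\<dots> = real q ^ m * real (card (box \<Lambda> B'))" by simp
    also have "\<dots> \<le> real q ^ m * (real (card (gens \<Lambda> B')) + (2 * B' i0 + 1))"
      using card_box_split[where B = B' and i = i0, OF \<Lambda> i0(1) Bq[OF i0(1)]] by (intro mult_left_mono) auto
    also have "\<dots> \<le> real q ^ m * (real (card (gens \<Lambda> B')) + 5 * w)"
    proof (intro mult_left_mono add_left_mono)
      have "2 / real q \<le> 1" using q(3) by simp
      hence "B' i0 \<le> 1 * B i0" unfolding B'_def using B[OF i0(1)] by (intro mult_right_mono) auto
      then show "2 * B' i0 + 1 \<le> 5 * w" using i0(2) w1 by linarith
    qed simp
    finally have "N * N \<le> N * (real q ^ m * (real (card (gens \<Lambda> B')) + 5 * w))" using N0 by (rule mult_left_mono)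
    also have "\<dots> = N * (real q ^ m * real (card (gens \<Lambda> B'))) + real q ^ m * (5 * w) * N" by (simp add: algebra_simps)
    also have "N * (real q ^ m * real (card (gens \<Lambda> B'))) \<le> 4 ^ m * Z * (real q ^ m * real (card (gens \<Lambda> B')))"
      using NZ by (rule mult_right_mono) simp
    finally show ?thesis by (simp add: N_def power2_eq_square mult_ac)
  qed
  have gsum: "(\<Sum>\<Lambda>\<in>\<LL>'. real (card (gens \<Lambda> B'))) \<le> real (card (all_gens B'))"
    using of_nat_mono[OF sum_card_gens[OF fin sub' agq(1)], where 'a = real] by simp
  have "(\<Sum>\<Lambda>\<in>\<LL>'. (real (card (box \<Lambda> B)))\<^sup>2) \<le>
     (\<Sum>\<Lambda>\<in>\<LL>'. real q ^ m * (4 ^ m * Z) * real (card (gens \<Lambda> B')) + real q ^ m * (5 * w) * real (card (box \<Lambda> B)))"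
    by (intro sum_mono sq)
  also have "\<dots> = real q ^ m * (4 ^ m * Z) * (\<Sum>\<Lambda>\<in>\<LL>'. real (card (gens \<Lambda> B'))) +
      real q ^ m * (5 * w) * (\<Sum>\<Lambda>\<in>\<LL>'. real (card (box \<Lambda> B)))"
    by (simp add: sum.distrib sum_distrib_left)
  also have "\<dots> \<le> 4 ^ m * Z * (real q ^ m * real (card (all_gens B'))) + (3 ^ m * w) * (5 * w) * (2 * (T * Z ^ m))"
  proof (rule add_mono)
    have "real q ^ m * (4 ^ m * Z) * (\<Sum>\<Lambda>\<in>\<LL>'. real (card (gens \<Lambda> B'))) \<le> real q ^ m * (4 ^ m * Z) * real (card (all_gens B'))"
      using gsum Z(2) by (intro mult_left_mono) auto
    then show "real q ^ m * (4 ^ m * Z) * (\<Sum>\<Lambda>\<in>\<LL>'. real (card (gens \<Lambda> B'))) \<le> 4 ^ m * Z * (real q ^ m * real (card (all_gens B')))"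
      by (simp add: mult_ac)
    have "real q ^ m * (5 * w) \<le> 3 ^ m * w * (5 * w)" using qm w1 by (intro mult_right_mono) auto
    moreover have "(\<Sum>\<Lambda>\<in>\<LL>'. real (card (box \<Lambda> B))) \<le> 2 * (T * Z ^ m)" using N_sum by (simp add: T_def)
    ultimately show "real q ^ m * (5 * w) * (\<Sum>\<Lambda>\<in>\<LL>'. real (card (box \<Lambda> B))) \<le> 3 ^ m * w * (5 * w) * (2 * (T * Z ^ m))"
      using w1 by (intro mult_mono sum_nonneg mult_nonneg_nonneg) auto
  qed
  also have "real q ^ m * real (card (all_gens B')) \<le> T * Z ^ m * 3 ^ (m * m) / w"
  proof -
    \<comment> \<open>The counts of the m coefficients save q^h in total. The pigeonhole spends q^m
      of this, and h - m = m (m - 1) / 2 is at least m, so a factor q^m of at least w is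
      left.\<close>
    define h where "h = m * (m + 1) div 2"
    have h: "2 * h = m * (m + 1)" by (simp add: h_def)
    have hm: "m \<le> h" using h m3 by (cases m) auto
    have "2 * (h - m) = m * (m + 1) - 2 * m" using h hm by simp
    also have "\<dots> = m * (m - 1)" using m3 by (cases m) (auto simp: algebra_simps)
    finally have "2 * (h - m) = m * (m - 1)" .
    moreover have "m * 2 \<le> m * (m - 1)" using m3 by (intro mult_le_mono2) simp
    ultimately have "m \<le> h - m" by linarith
    have "w = a ^ m" by (simp add: am)
    also have "\<dots> \<le> real q ^ m" using q(1) a1 by (intro power_mono) auto
    also have "\<dots> \<le> real q ^ (h - m)" using \<open>m \<le> h - m\<close> q(3) by (intro power_increasing) auto
    finally have wq: "w \<le> real q ^ (h - m)" .
    have "real q ^ m * real (card (all_gens B')) * w \<le> real q ^ m * real (card (all_gens B')) * real q ^ (h - m)"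
      using wq by (rule mult_left_mono) simp
    also have "\<dots> = real (card (all_gens B')) * real q ^ h" using hm by (simp flip: power_add add: mult_ac)
    also have "\<dots> \<le> T * Z ^ m * 3 ^ (m * m)" using gq by (simp add: h_def T_def)
    finally show ?thesis using w1 by (simp add: pos_le_divide_eq)
  qed
  also have "(3 ^ m * w) * (5 * w) * (2 * (T * Z ^ m)) \<le> 10 * 3 ^ m * T * (Z ^ m * Z / w)"
  proof -
    have "w ^ 3 \<le> w ^ m" using w1 m3 by (intro power_increasing) auto
    hence "w * w \<le> Z / w" using w1 wm by (simp add: pos_le_divide_eq power3_eq_cube)
    hence "10 * 3 ^ m * T * Z ^ m * (w * w) \<le> 10 * 3 ^ m * T * Z ^ m * (Z / w)" using T0 Z(2) by (intro mult_left_mono) auto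
    then show ?thesis by (simp add: mult_ac)
  qed
  also have "4 ^ m * Z * (T * Z ^ m * 3 ^ (m * m) / w) + 10 * 3 ^ m * T * (Z ^ m * Z / w) =
     (4 ^ m * 3 ^ (m * m) + 10 * 3 ^ m) * T * (Z ^ m * Z / w)" by (simp add: algebra_simps add_divide_distrib)
  also have "\<dots> \<le> (real m * 4096) ^ (3 * m * m) * (Z ^ m * Z / w)"
  proof (rule mult_right_mono)
    have m1: "1 \<le> m * m" "m \<le> m * m" using m3 by auto
    have e4: "(4::real) ^ m \<le> 4 ^ (m * m)" "(3::real) ^ m \<le> 3 ^ (m * m)" using m1 by (auto intro: power_increasing)
    have "(3::real) ^ (m * m) \<le> 4 ^ (m * m)" by (intro power_mono) auto
    hence e3: "(3::real) ^ m \<le> 4 ^ (m * m)" using e4(2) by linarith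
    have p16: "(4::real) ^ (m * m) * 4 ^ (m * m) = 16 ^ (m * m)" using power_mult_distrib[of "4::real" 4 "m * m"] by simp
    have p1024: "(64::real) ^ (m * m) * 16 ^ (m * m) = 1024 ^ (m * m)" using power_mult_distrib[of "64::real" 16 "m * m"] by simp
    have four: "(4::real) ^ 2 \<le> 4 ^ (m * m)" using m3 mult_le_mono[of 3 m 3 m] by (intro power_increasing) auto
    have "4 ^ m * 3 ^ (m * m) + 10 * 3 ^ m \<le> 4 ^ (m * m) * 4 ^ (m * m) + 4 ^ (m * m) * (4::real) ^ (m * m)"
      using e4 e3 \<open>(3::real) ^ (m * m) \<le> 4 ^ (m * m)\<close> four by (intro add_mono mult_mono) auto
    also have "\<dots> \<le> 4 ^ (m * m) * (4 ^ (m * m) * (4::real) ^ (m * m))"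
      using mult_right_mono[of 2 "4 ^ (m * m)" "4 ^ (m * m) * (4::real) ^ (m * m)"] four by simp
    also have "\<dots> = 64 ^ (m * m)" unfolding p16 using power_mult_distrib[of "4::real" 16 "m * m"] by simp
    finally have c1: "4 ^ m * 3 ^ (m * m) + 10 * 3 ^ m \<le> (64::real) ^ (m * m)" .
    have "(4 * 4 ^ m) ^ m = 4 ^ m * (4::real) ^ (m * m)" by (simp add: power_mult_distrib power_mult)
    also have "\<dots> \<le> 4 ^ (m * m) * 4 ^ (m * m)" using e4 by (intro mult_right_mono) auto
    finally have f4: "(4 * 4 ^ m) ^ m \<le> (16::real) ^ (m * m)" unfolding p16 .
    have "real m ^ m \<le> real m ^ (m * m)" using m3 m1 by (intro power_increasing) auto
    hence c2: "T \<le> real m ^ (m * m) * 16 ^ (m * m)" unfolding T_def using f4 by (intro mult_mono) auto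
    have "(4 ^ m * 3 ^ (m * m) + 10 * 3 ^ m) * T \<le> 64 ^ (m * m) * (real m ^ (m * m) * 16 ^ (m * m))"
      using c1 c2 T0 by (intro mult_mono) auto
    also have "\<dots> = (real m * 1024) ^ (m * m)" unfolding power_mult_distrib p1024[symmetric] by (simp only: mult_ac)
    also have "\<dots> \<le> (real m * 4096) ^ (m * m)" by (intro power_mono) auto
    also have "\<dots> \<le> (real m * 4096) ^ (3 * m * m)" using m3 by (intro power_increasing) auto
    finally show "(4 ^ m * 3 ^ (m * m) + 10 * 3 ^ m) * T \<le> (real m * 4096) ^ (3 * m * m)" .
  qed (use Z(2) w1 in simp)
  also have "Z ^ m * Z / w = Z powr (real m + 1 - 1 / real m)"
    using Z(2) by (simp add: w_def powr_diff powr_add powr_realpow)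
  finally show ?thesis using Z(2) by (simp add: mult_left_mono)
qed

end

section \<open>The discriminant of an even polynomial\<close>

text \<open>Multiplying the Sylvester matrix by \<open>[E | V]\<close>, where \<open>E\<close> extracts the top coefficients and \<open>V\<close>
  evaluates at the roots, makes it block triangular, with blocks a unitriangular matrix and
  the Vandermonde matrix times the diagonal matrix of the values \<open>h (a j)\<close>.\<close>
lemma resultant_distinct_roots:
  fixes f h :: "complex poly" and a :: "nat \<Rightarrow> complex"
  assumes f: "f = (\<Prod>j<n. [:- a j, 1:])" and inj: "inj_on a {..<n}"
  shows "resultant f h = (\<Prod>j<n. poly h (a j))"
proof -
  define k where "k = Polynomial.degree h"
  have df: "Polynomial.degree f = n" unfolding f by (subst degree_prod_eq_sum_degree) auto
  have lf: "poly.coeff f n = 1"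
  proof -
    have "Polynomial.lead_coeff f = 1" unfolding f by (simp add: lead_coeff_prod)
    then show ?thesis by (simp add: df)
  qed
  have root: "poly f (a j) = 0" if "j < n" for j unfolding f using that by (auto simp: poly_prod)
  define S where "S = sylvester_mat f h"
  have S: "S \<in> carrier_mat (n + k) (n + k)"
    unfolding S_def using sylvester_carrier_mat[of f h] by (simp add: df k_def)
  have Sij: "S $$ (i, j) = (if i < k then poly.coeff (Polynomial.monom 1 (k - 1 - i) * f) (n + k - 1 - j)
     else poly.coeff (Polynomial.monom 1 (n + k - 1 - i) * h) (n + k - 1 - j))" if ij: "i < n + k" "j < n + k" for i j
  proof -
    have "S $$ (i, j) = (if i < k then poly.coeff (Polynomial.monom 1 (k - i) * f) (n + k - j)
       else poly.coeff (Polynomial.monom 1 (n + k - i) * h) (n + k - j))"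
      unfolding S_def using sylvester_index_mat2[of i f h j] ij by (simp add: df k_def)
    moreover have "k - i = Suc (k - 1 - i)" if "i < k" using that by simp
    moreover have "n + k - i = Suc (n + k - 1 - i)" "n + k - j = Suc (n + k - 1 - j)" using ij by simp_all
    ultimately show ?thesis by (simp add: coeff_monom_mult)
  qed
  \<comment> \<open>The polynomials behind the rows of the Sylvester matrix: multiples of f by
    powers of X in the first k rows and of h in the other n, their coefficients listed from degree n
    + k - 1 downwards.\<close>
  define p where "p i = (if i < k then Polynomial.monom 1 (k - 1 - i) * f else Polynomial.monom 1 (n + k - 1 - i) * h)" for i
  have Sp: "S $$ (i, j) = poly.coeff (p i) (n + k - 1 - j)" if "i < n + k" "j < n + k" for i j
    using Sij[OF that] by (simp add: p_def)
  have degp: "Polynomial.degree (p i) < n + k" if i: "i < n + k" for i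
  proof (cases "i < k")
    case True
    have "Polynomial.degree (p i) \<le> (k - 1 - i) + n"
      unfolding p_def using True df degree_mult_le[of "Polynomial.monom 1 (k - 1 - i)" f] by (simp add: degree_monom_eq)
    then show ?thesis using True by simp
  next
    case False
    have "Polynomial.degree (p i) \<le> (n + k - 1 - i) + k"
      unfolding p_def using False degree_mult_le[of "Polynomial.monom 1 (n + k - 1 - i)" h] by (simp add: degree_monom_eq k_def)
    then show ?thesis using False i by simp
  qed
  have evalp: "poly (p i) x = (\<Sum>j<n + k. S $$ (i, j) * x ^ (n + k - 1 - j))" if i: "i < n + k" for i x
  proof -
    have "poly (p i) x = (\<Sum>l<n + k. poly.coeff (p i) l * x ^ l)"
      unfolding poly_altdef using degp[OF i]
      by (intro sum.mono_neutral_left) (auto simp: coeff_eq_0)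
    also have "\<dots> = (\<Sum>j<n + k. poly.coeff (p i) (n + k - 1 - j) * x ^ (n + k - 1 - j))"
      by (rule sum.nat_diff_reindex[symmetric, THEN trans]) (auto intro!: sum.cong)
    also have "\<dots> = (\<Sum>j<n + k. S $$ (i, j) * x ^ (n + k - 1 - j))"
      using i by (intro sum.cong refl) (simp add: Sp)
    finally show ?thesis .
  qed
  define W where "W = mat n n (\<lambda>(i, j). a j ^ (n - 1 - i))"
  define WD where "WD = mat n n (\<lambda>(i, j). a j ^ (n - 1 - i) * poly h (a j))"
  define U where "U = mat k n (\<lambda>(i, j). a j ^ (n + k - 1 - i))"
  define M where "M = four_block_mat (1\<^sub>m k) U (0\<^sub>m n k) W"
  define T where "T = mat k k (\<lambda>(i, j). poly.coeff (p i) (n + k - 1 - j))"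
  define Q where "Q = mat n k (\<lambda>(i, j). poly.coeff (p (k + i)) (n + k - 1 - j))"
  have M: "M \<in> carrier_mat (n + k) (n + k)"
    unfolding M_def U_def W_def by (auto simp: add.commute)
  have Mij: "M $$ (i, j) = (if j < k then (if i = j then 1 else 0) else a (j - k) ^ (n + k - 1 - i))"
    if "i < n + k" "j < n + k" for i j
    unfolding M_def using that by (auto simp: U_def W_def)
  have SM: "S * M = four_block_mat T (0\<^sub>m k n) Q WD"
  proof (rule eq_matI)
    fix i j assume "i < dim_row (four_block_mat T (0\<^sub>m k n) Q WD)" "j < dim_col (four_block_mat T (0\<^sub>m k n) Q WD)"
    hence ij: "i < n + k" "j < n + k" by (auto simp: T_def WD_def)
    have "(S * M) $$ (i, j) = (\<Sum>l<n + k. S $$ (i, l) * M $$ (l, j))"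
      using S M ij by (auto simp: scalar_prod_def atLeast0LessThan intro!: sum.cong)
    also have "\<dots> = (if j < k then S $$ (i, j) else poly (p i) (a (j - k)))"
    proof (cases "j < k")
      case True
      have "(\<Sum>l<n + k. S $$ (i, l) * M $$ (l, j)) = (\<Sum>l<n + k. if l = j then S $$ (i, j) else 0)"
        using ij True by (intro sum.cong refl) (auto simp: Mij)
      then show ?thesis using ij True by simp
    next
      case False
      have "(\<Sum>l<n + k. S $$ (i, l) * M $$ (l, j)) = (\<Sum>l<n + k. S $$ (i, l) * a (j - k) ^ (n + k - 1 - l))"
        using ij False by (intro sum.cong refl) (auto simp: Mij)
      then show ?thesis using evalp[OF ij(1)] False by simp
    qed
    also have "\<dots> = four_block_mat T (0\<^sub>m k n) Q WD $$ (i, j)"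
      using ij by (auto simp: T_def Q_def WD_def Sp p_def poly_monom root)
    finally show "(S * M) $$ (i, j) = four_block_mat T (0\<^sub>m k n) Q WD $$ (i, j)" .
  qed (use S M in \<open>auto simp: T_def WD_def\<close>)
  have detM: "det M = det W"
    unfolding M_def by (subst det_four_block_mat_lower_left_zero[where n = k and m = n]) (auto simp: U_def W_def)
  have detSM: "det (four_block_mat T (0\<^sub>m k n) Q WD) = det T * det WD"
    by (rule det_four_block_mat_upper_right_zero[where n = k and m = n]) (auto simp: T_def Q_def WD_def)
  have "upper_triangular T"
  proof (rule upper_triangularI)
    fix i j assume ij: "j < i" "i < dim_row T"
    hence "i < k" by (simp add: T_def)
    have "Polynomial.degree (p i) \<le> (k - 1 - i) + n"
      unfolding p_def using \<open>i < k\<close> df degree_mult_le[of "Polynomial.monom 1 (k - 1 - i)" f] by (simp add: degree_monom_eq)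
    hence "Polynomial.degree (p i) < n + k - 1 - j" using ij \<open>i < k\<close> by simp
    then show "T $$ (i, j) = 0" using ij \<open>i < k\<close> by (simp add: T_def coeff_eq_0)
  qed
  hence "det T = prod_list (diag_mat T)" by (rule det_upper_triangular[where n = k]) (simp add: T_def)
  also have "diag_mat T = replicate k 1"
    unfolding diag_mat_def by (rule nth_equalityI) (auto simp: T_def p_def coeff_monom_mult lf)
  finally have detT: "det T = 1" by simp
  have "WD = W * mat n n (\<lambda>(i, j). if i = j then poly h (a j) else 0)" (is "_ = W * ?D")
  proof (rule eq_matI)
    fix i j assume "i < dim_row (W * ?D)" "j < dim_col (W * ?D)"
    hence ij: "i < n" "j < n" by (auto simp: W_def)
    have "(W * ?D) $$ (i, j) = (\<Sum>l<n. W $$ (i, l) * (if l = j then poly h (a j) else 0))"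
      using ij by (auto simp: W_def scalar_prod_def atLeast0LessThan intro!: sum.cong)
    also have "\<dots> = W $$ (i, j) * poly h (a j)" using ij by (simp add: if_distrib cong: if_cong)
    finally show "WD $$ (i, j) = (W * ?D) $$ (i, j)" using ij by (simp add: WD_def W_def)
  qed (auto simp: WD_def W_def)
  hence "det WD = det W * det ?D" by (simp add: det_mult[where n = n] W_def)
  also have "det ?D = prod_list (diag_mat ?D)" by (rule det_upper_triangular[where n = n]) (auto intro!: upper_triangularI)
  also have "\<dots> = (\<Prod>j<n. poly h (a j))"
    unfolding diag_mat_def by (simp add: prod.list_conv_set_nth atLeast0LessThan)
  finally have detWD: "det WD = det W * (\<Prod>j<n. poly h (a j))" .
  \<comment> \<open>A kernel vector of the transposed Vandermonde matrix is the coefficient vector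
    of a nonzero polynomial of degree below n that vanishes at the n distinct points a j.\<close>
  have detW: "det W \<noteq> 0"
  proof
    assume "det W = 0"
    then obtain v where v: "v \<in> carrier_vec n" "v \<noteq> 0\<^sub>v n" "W\<^sup>T *\<^sub>v v = 0\<^sub>v n"
      using det_0_iff_vec_prod_zero[of "W\<^sup>T" n] by (auto simp: W_def det_transpose[where n = n])
    define w where "w = (\<Sum>i<n. Polynomial.monom (v $ i) (n - 1 - i))"
    have cw: "poly.coeff w (n - 1 - i) = v $ i" if "i < n" for i
    proof -
      have "poly.coeff w (n - 1 - i) = (\<Sum>l<n. if l = i then v $ i else 0)"
        unfolding w_def coeff_sum using that by (intro sum.cong refl) auto
      then show ?thesis using that by simp
    qed
    have w0: "w \<noteq> 0"
    proof
      assume "w = 0"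
      hence "v = 0\<^sub>v n" using cw v(1) by (intro eq_vecI) auto
      with v(2) show False by simp
    qed
    have "n > 0" using v(1,2) by (cases n) (auto intro: eq_vecI)
    have "Polynomial.degree w \<le> n - 1"
      unfolding w_def by (intro degree_sum_le) (auto intro: order.trans[OF degree_monom_le])
    have "poly w (a j) = 0" if j: "j < n" for j
    proof -
      have "0 = (W\<^sup>T *\<^sub>v v) $ j" using v(3) j by simp
      also have "\<dots> = (\<Sum>i<n. a j ^ (n - 1 - i) * v $ i)"
        using j v(1) by (auto simp: W_def scalar_prod_def atLeast0LessThan intro!: sum.cong)
      also have "\<dots> = poly w (a j)" by (simp add: w_def poly_sum poly_monom mult.commute)
      finally show ?thesis by simp
    qed
    hence "a ` {..<n} \<subseteq> {x. poly w x = 0}" by auto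
    hence "card (a ` {..<n}) \<le> card {x. poly w x = 0}" using poly_roots_finite[OF w0] by (intro card_mono)
    also have "\<dots> \<le> Polynomial.degree w" by (rule card_poly_roots_bound[OF w0])
    also have "\<dots> \<le> n - 1" by fact
    finally show False using inj \<open>n > 0\<close> by (simp add: card_image)
  qed
  have "det S * det W = det W * (\<Prod>j<n. poly h (a j))"
    using det_mult[OF S M] unfolding SM detSM detM detT detWD by auto
  then show ?thesis using detW by (simp add: resultant_def S_def)
qed

text \<open>From f'(X) = 2 X g'(X^2) the two roots over y i contribute -4 y i g'(y i)^2 to the
  resultant. It equals (-4)^m Res(g, g')^2 times the product of the y i, which is k^2, and the sign
  (-1)^(m (2m - 1)) = (-1)^m in the discriminant makes the remaining factor 4^m.\<close>

lemma is_square_discriminant_even: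
  fixes g :: "int poly" and y :: "nat \<Rightarrow> complex"
  assumes g: "map_poly of_int g = (\<Prod>i<m. [:- y i, 1:])" and inj: "inj_on y {..<m}"
    and y0: "\<And>i. i < m \<Longrightarrow> y i \<noteq> 0" and g0: "poly g 0 = (-1) ^ m * k\<^sup>2"
  shows "is_square (discriminant (g \<circ>\<^sub>p [:0, 0, 1:]))"
proof -
  define f where "f = g \<circ>\<^sub>p [:0, 0, 1:]"
  define r where "r i = (if i < m then csqrt (y i) else - csqrt (y (i - m)))" for i
  have dg: "Polynomial.degree g = m"
  proof -
    have "Polynomial.degree (map_poly of_int g :: complex poly) = m"
      unfolding g by (subst degree_prod_eq_sum_degree) auto
    then show ?thesis by simp
  qed
  have lg: "Polynomial.lead_coeff g = 1"
  proof -
    have "Polynomial.lead_coeff (map_poly of_int g :: complex poly) = 1"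
      unfolding g by (simp add: lead_coeff_prod)
    then show ?thesis by simp
  qed
  have df: "Polynomial.degree f = 2 * m" unfolding f_def by (simp add: degree_pcompose dg)
  have lf: "Polynomial.lead_coeff f = 1" unfolding f_def by (subst lead_coeff_comp) (simp_all add: lg)
  have split: "(\<Prod>i<2 * m. F i) = (\<Prod>i<m. F i) * (\<Prod>i<m. F (m + i))" for F :: "nat \<Rightarrow> 'b::comm_monoid_mult"
  proof -
    have "(\<Prod>i<2 * m. F i) = (\<Prod>i\<in>{0..<m}. F i) * (\<Prod>i\<in>{m..<m + m}. F i)"
      by (simp add: mult_2 lessThan_atLeast0 prod.atLeastLessThan_concat)
    also have "(\<Prod>i\<in>{m..<m + m}. F i) = (\<Prod>i\<in>{0..<m}. F (i + m))"
      using prod.shift_bounds_nat_ivl[of F 0 m m] by simp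
    finally show ?thesis by (simp add: lessThan_atLeast0 add.commute)
  qed
  have rsq: "(r i)\<^sup>2 = y i" "r (m + i) = - r i" if "i < m" for i using that by (auto simp: r_def)
  have fr: "map_poly of_int f = (\<Prod>i<2 * m. [:- r i, 1:])"
  proof -
    have "map_poly of_int f = (map_poly of_int g :: complex poly) \<circ>\<^sub>p [:0, 0, 1:]"
      by (simp add: f_def of_int_hom.map_poly_pcompose map_poly_pCons)
    also have "\<dots> = (\<Prod>i<m. [:- y i, 0, 1:])"
      unfolding g pcompose_prod by (intro prod.cong refl) (simp add: pcompose_pCons)
    also have "\<dots> = (\<Prod>i<m. [:- r i, 1:] * [:- r (m + i), 1:])"
    proof (intro prod.cong refl)
      fix i assume "i \<in> {..<m}"
      then show "[:- y i, 0, 1:] = [:- r i, 1:] * [:- r (m + i), 1:]"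
        using rsq[of i] by (simp add: power2_eq_square)
    qed
    also have "\<dots> = (\<Prod>i<2 * m. [:- r i, 1:])" by (simp only: split prod.distrib)
    finally show ?thesis .
  qed
  have rinj: "inj_on r {..<2 * m}"
  proof (rule inj_onI)
    fix a b assume ab: "a \<in> {..<2 * m}" "b \<in> {..<2 * m}" "r a = r b"
    define a' where "a' = (if a < m then a else a - m)"
    define b' where "b' = (if b < m then b else b - m)"
    have a'b': "a' \<in> {..<m}" "b' \<in> {..<m}" using ab by (auto simp: a'_def b'_def)
    have sq: "(r a)\<^sup>2 = y a'" "(r b)\<^sup>2 = y b'" by (auto simp: r_def a'_def b'_def)
    hence "a' = b'" using ab(3) inj_onD[OF inj _ a'b'] by simp
    moreover have "(a < m) = (b < m)"
    proof (rule ccontr)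
      assume "(a < m) \<noteq> (b < m)"
      hence "r a = - r b" using \<open>a' = b'\<close> by (auto simp: r_def a'_def b'_def)
      hence "r b = 0" using ab(3) by simp
      hence "y b' = 0" using sq by simp
      then show False using y0 a'b' by simp
    qed
    ultimately show "a = b" using ab by (auto simp: a'_def b'_def split: if_splits)
  qed
  have res_g: "complex_of_int (resultant g (pderiv g)) = (\<Prod>i<m. poly (map_poly of_int (pderiv g)) (y i))"
    using resultant_distinct_roots[OF g inj, of "map_poly of_int (pderiv g)"]
    by (simp add: of_int_hom.resultant_hom)
  have "complex_of_int (resultant f (pderiv f)) = (\<Prod>i<2 * m. poly (map_poly of_int (pderiv f)) (r i))"
    using resultant_distinct_roots[OF fr rinj, of "map_poly of_int (pderiv f)"]
    by (simp add: of_int_hom.resultant_hom)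
  also have "\<dots> = (\<Prod>i<m. poly (map_poly of_int (pderiv f)) (r i) * poly (map_poly of_int (pderiv f)) (r (m + i)))"
    by (simp only: split prod.distrib)
  also have "\<dots> = (\<Prod>i<m. (-4) * y i * (poly (map_poly of_int (pderiv g)) (y i))\<^sup>2)"
  proof (intro prod.cong refl)
    fix i assume "i \<in> {..<m}"
    hence i: "i < m" by simp
    have pf: "pderiv f = (pderiv g \<circ>\<^sub>p [:0, 0, 1:]) * [:0, 2:]"
      unfolding f_def pderiv_pcompose by (simp add: pderiv_pCons numeral_poly)
    have ev: "poly (map_poly complex_of_int (pderiv f)) z = poly (map_poly of_int (pderiv g)) (z\<^sup>2) * (2 * z)" for z
      unfolding pf of_int_poly_hom.hom_mult poly_mult
      by (simp add: of_int_hom.map_poly_pcompose map_poly_pCons poly_pcompose power2_eq_square)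
    show "poly (map_poly complex_of_int (pderiv f)) (r i) * poly (map_poly of_int (pderiv f)) (r (m + i)) =
      (-4) * y i * (poly (map_poly of_int (pderiv g)) (y i))\<^sup>2"
      unfolding ev rsq(2)[OF i] using rsq(1)[OF i] by (simp add: power2_eq_square algebra_simps)
  qed
  also have "\<dots> = (-4) ^ m * (\<Prod>i<m. y i) * (complex_of_int (resultant g (pderiv g)))\<^sup>2"
    unfolding res_g by (simp only: prod.distrib prod_constant card_lessThan prod_power_distrib)
  also have "(\<Prod>i<m. y i) = of_int (k\<^sup>2)"
  proof -
    have "complex_of_int (poly g 0) = poly (map_poly of_int g) (of_int 0)" by (rule of_int_hom.poly_map_poly[symmetric])
    also have "\<dots> = (-1) ^ m * (\<Prod>i<m. y i)" unfolding g by (simp add: poly_prod prod_uminus)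
    finally have "(-1) ^ m * (\<Prod>i<m. y i) = (-1) ^ m * (of_int (k\<^sup>2))" by (simp add: g0)
    then show ?thesis by simp
  qed
  finally have "complex_of_int (resultant f (pderiv f)) = complex_of_int ((-4) ^ m * k\<^sup>2 * (resultant g (pderiv g))\<^sup>2)" by simp
  hence res: "resultant f (pderiv f) = (-4) ^ m * k\<^sup>2 * (resultant g (pderiv g))\<^sup>2" by (simp only: of_int_eq_iff)
  have "2 * m * (2 * m - 1) div 2 = m * (2 * m - 1)" by simp
  moreover have "(-1 :: int) ^ (m * (2 * m - 1)) = (-1) ^ m"
    by (cases m) (auto simp: minus_one_power_iff)
  ultimately have "discriminant f = (-1) ^ m * ((-4) ^ m * k\<^sup>2 * (resultant g (pderiv g))\<^sup>2)"
    using lf df by (simp add: discriminant_def res)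
  also have "\<dots> = (2 ^ m * k * resultant g (pderiv g))\<^sup>2"
  proof -
    have "(-1 :: int) ^ m * (-4) ^ m = (2 ^ m)\<^sup>2" by (simp add: power2_eq_square flip: power_mult_distrib)
    then show ?thesis by (simp add: power_mult_distrib mult.assoc[symmetric])
  qed
  finally show ?thesis unfolding f_def by (auto simp: is_nth_power_def)
qed

text \<open>Two monic polynomials of the same degree differ by one of smaller degree, which cannot
  have that many roots.\<close>

lemma monic_eq_prod_of_roots:
  fixes p :: "'a :: field poly"
  assumes p: "Polynomial.lead_coeff p = 1" and I: "finite I" "card I = Polynomial.degree p"
    and r: "inj_on r I" "\<And>i. i \<in> I \<Longrightarrow> poly p (r i) = 0"
  shows "p = (\<Prod>i\<in>I. [:- r i, 1:])"
proof (rule ccontr)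
  define D where "D = (\<Prod>i\<in>I. [:- r i, 1:])"
  assume "p \<noteq> (\<Prod>i\<in>I. [:- r i, 1:])"
  hence ne: "p - D \<noteq> 0" by (simp add: D_def)
  have dD: "Polynomial.degree D = Polynomial.degree p"
    unfolding D_def using I by (subst degree_prod_eq_sum_degree) auto
  have lD: "poly.coeff D (Polynomial.degree p) = 1"
  proof -
    have "Polynomial.lead_coeff D = 1" unfolding D_def by (simp add: lead_coeff_prod)
    then show ?thesis by (simp add: dD)
  qed
  have le: "Polynomial.degree (p - D) \<le> Polynomial.degree p" using dD by (intro degree_diff_le) auto
  have "poly.coeff (p - D) (Polynomial.degree p) = 0" using p lD by simp
  hence lt: "Polynomial.degree (p - D) < Polynomial.degree p"
    using le ne by (metis leading_coeff_0_iff order_le_less)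
  have "r ` I \<subseteq> {z. poly (p - D) z = 0}"
  proof (rule image_subsetI)
    fix i assume i: "i \<in> I"
    moreover have "poly D (r i) = 0" unfolding D_def using i I by (auto simp: poly_prod)
    ultimately show "r i \<in> {z. poly (p - D) z = 0}" using r(2) by simp
  qed
  hence "card (r ` I) \<le> card {z. poly (p - D) z = 0}" by (rule card_mono[OF poly_roots_finite[OF ne]])
  also have "\<dots> \<le> Polynomial.degree (p - D)" by (rule card_poly_roots_bound[OF ne])
  finally show False using lt r I by (simp add: card_image)
qed

section \<open>The lattice of a polynomial\<close>

text \<open>The algebraic numbers form a subfield containing the roots, so minimality of
  \<open>F\<close> applies.\<close>

lemma (in splitting) F_algebraic: "x \<in> F \<Longrightarrow> algebraic x"
proof -
  have "algebraic (inverse z)" if "algebraic z" for z :: complex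
    using that by (rule algebraic_inverse)
  moreover have "algebraic (z - w)" if "algebraic z" "algebraic w" for z w :: complex
    using algebraic_add[OF that(1), of "- w"] that(2) by simp
  moreover have "algebraic (1 :: complex)" by (rule algebraic_int_imp_algebraic) simp
  ultimately have "is_subfield {z. algebraic z}"
    unfolding is_subfield_def using algebraic_mult by blast
  moreover have "{z. poly (map_poly of_int f) z = 0} \<subseteq> {z::complex. algebraic z}"
    using f0 by (auto intro!: algebraicI[of "map_poly of_int f"])
  ultimately have "F \<subseteq> {z. algebraic z}" by (rule generated)
  then show "x \<in> F \<Longrightarrow> algebraic x" by blast
qed

lemma lagrange_interpolation:
  assumes F: "is_subfield F" and v: "inj_on v {1..m}" "\<And>i. i \<in> {1..m} \<Longrightarrow> v i \<in> F" and w: "\<And>i. i \<in> {1..m} \<Longrightarrow> w i \<in> F"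
    and m: "0 < m"
  shows "\<exists>g. coeffs_in F g \<and> Polynomial.degree g < m \<and> (\<forall>i\<in>{1..m}. poly g (v i) = w i)"
proof -
  define l where "l i = (\<Prod>j\<in>{1..m} - {i}. [:- v j, 1:])" for i
  define g where "g = (\<Sum>i\<in>{1..m}. Polynomial.smult (w i / poly (l i) (v i)) (l i))"
  have lF: "coeffs_in F (l i)" for i unfolding l_def
    by (intro coeffs_in_prod[OF F] coeffs_in_arith(7)[OF F] coeffs_in_arith(1)[OF F] subfield_uminus[OF F] subfield_1[OF F] v) auto
  have dl: "Polynomial.degree (l i) = m - 1" if "i \<in> {1..m}" for i
    unfolding l_def using that by (subst degree_prod_eq_sum_degree) auto
  have "coeffs_in F g" unfolding g_def
    by (intro coeffs_in_sum[OF F] coeffs_in_arith(9)[OF F] lF subfield_divide[OF F] subfield_poly[OF F] w v)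
  moreover have "Polynomial.degree g \<le> m - 1" unfolding g_def
    using dl by (intro degree_sum_le) (auto intro: order.trans[OF degree_smult_le])
  hence "Polynomial.degree g < m" using m by simp
  moreover have "poly g (v i) = w i" if i: "i \<in> {1..m}" for i
  proof -
    have nz: "poly (l i) (v i) \<noteq> 0"
    proof -
      have "v i \<noteq> v j" if "j \<in> {1..m} - {i}" for j using inj_onD[OF v(1), of i j] i that by blast
      then show ?thesis by (simp add: l_def poly_prod)
    qed
    have "poly g (v i) = (\<Sum>j\<in>{1..m}. if j = i then w i else 0)"
      unfolding g_def poly_sum
    proof (intro sum.cong refl)
      fix j assume j: "j \<in> {1..m}"
      show "poly (Polynomial.smult (w j / poly (l j) (v j)) (l j)) (v i) = (if j = i then w i else 0)"
      proof (cases "j = i")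
        case False
        hence "poly (l j) (v i) = 0" using i by (auto simp: l_def poly_prod)
        then show ?thesis using False by simp
      qed (use nz in simp)
    qed
    then show ?thesis using i by simp
  qed
  ultimately show ?thesis by blast
qed

lemma poly_eq_by_values:
  fixes g h :: "complex poly"
  assumes "Polynomial.degree g < m" "Polynomial.degree h < m" "inj_on v {1..m}" "\<And>i. i \<in> {1..m} \<Longrightarrow> poly g (v i) = poly h (v i)"
  shows "g = h"
proof (rule ccontr)
  assume "g \<noteq> h"
  hence ne: "g - h \<noteq> 0" by simp
  have "v ` {1..m} \<subseteq> {z. poly (g - h) z = 0}" using assms(4) by auto
  hence "card (v ` {1..m}) \<le> card {z. poly (g - h) z = 0}" by (rule card_mono[OF poly_roots_finite[OF ne]])
  also have "\<dots> \<le> Polynomial.degree (g - h)" by (rule card_poly_roots_bound[OF ne])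
  also have "\<dots> < m" using assms(1,2) by (rule degree_diff_less)
  finally show False using assms(3) by (simp add: card_image)
qed

text \<open>One numbering of the roots is fixed for which the Galois group is the given permutation
  group itself and not a conjugate; the pairs r i, r (m + i) are then blocks of the action.\<close>

locale wreath_poly =
  fixes m :: nat and f :: "int poly" and r :: "nat \<Rightarrow> complex"
  assumes m3: "3 \<le> m" and monic: "Polynomial.lead_coeff f = 1" and deg: "Polynomial.degree f = 2 * m"
    and r_bij: "bij_betw r {1..2*m} (complex_roots f)"
    and gal: "galois_perms (2 * m) r f = signed_perm_group m \<inter> carrier (alt_group (2 * m))"
begin

definition "F = carrier (splitting_field f)"

lemma f_nonzero: "f \<noteq> 0" using monic by auto

sublocale splitting F f unfolding F_def by (rule splitting_field_splitting[OF f_nonzero])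

lemma aut: "field_automorphisms f = Aut" unfolding F_def by (rule field_automorphisms_eq_Aut[OF f_nonzero])

lemma r_inj: "inj_on r {1..2*m}" and r_root: "k \<in> {1..2*m} \<Longrightarrow> poly (map_poly of_int f) (r k) = 0"
  using r_bij by (auto simp: bij_betw_def complex_roots_def)

lemma r_F: "k \<in> {1..2*m} \<Longrightarrow> r k \<in> F"
  using r_root roots_in by blast

lemma f_prod: "map_poly of_int f = (\<Prod>k\<in>{1..2*m}. [:- r k, 1:])"
  using r_inj r_root monic deg by (intro monic_eq_prod_of_roots) auto

text \<open>Comparing unordered pairs forgets the sign changes: \<tau> is the image of \<sigma>
  under the projection of the wreath product to the permutations of the pairs.\<close>

definition acts :: "(complex \<Rightarrow> complex) \<Rightarrow> (nat \<Rightarrow> nat) \<Rightarrow> bool" where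
  "acts \<sigma> \<tau> \<longleftrightarrow> \<tau> permutes {1..m} \<and> (\<forall>i\<in>{1..m}. {\<sigma> (r i), \<sigma> (r (m + i))} = {r (\<tau> i), r (m + \<tau> i)})"

lemma acts_pair_perm_flip:
  assumes \<tau>: "\<tau> permutes {1..m}" and D: "D \<subseteq> {1..m}"
    and eq: "\<And>k. k \<in> {1..2*m} \<Longrightarrow> \<sigma> (r k) = r ((pair_perm m \<tau> \<circ> flip m D) k)"
  shows "acts \<sigma> \<tau>"
  unfolding acts_def
proof (intro conjI ballI \<tau>)
  fix i assume i: "i \<in> {1..m}"
  hence "i \<in> {1..2*m}" "m + i \<in> {1..2*m}" by auto
  from eq[OF this(1)] eq[OF this(2)] show "{\<sigma> (r i), \<sigma> (r (m + i))} = {r (\<tau> i), r (m + \<tau> i)}"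
    unfolding pair_perm_flip_apply[OF D i] by auto
qed

lemma ex_acts:
  assumes \<sigma>: "\<sigma> \<in> Aut"
  shows "\<exists>\<tau>. acts \<sigma> \<tau>"
proof -
  have "\<forall>k\<in>{1..2*m}. \<exists>l. l \<in> {1..2*m} \<and> \<sigma> (r k) = r l"
  proof
    fix k assume k: "k \<in> {1..2*m}"
    have "\<sigma> (r k) \<in> complex_roots f"
      using hom_root[OF Aut_hom[OF \<sigma>] r_F[OF k] r_root[OF k]] by (simp add: complex_roots_def)
    then have "\<sigma> (r k) \<in> r ` {1..2*m}" using r_bij by (simp add: bij_betw_def del: atLeastAtMost_iff)
    then show "\<exists>l. l \<in> {1..2*m} \<and> \<sigma> (r k) = r l" by blast
  qed
  from bchoice[OF this] obtain p where p: "\<forall>k\<in>{1..2*m}. p k \<in> {1..2*m} \<and> \<sigma> (r k) = r (p k)" ..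
  define \<pi> where "\<pi> k = (if k \<in> {1..2*m} then p k else k)" for k
  have "inj_on \<pi> {1..2*m}"
  proof (rule inj_onI)
    fix k l assume kl: "k \<in> {1..2*m}" "l \<in> {1..2*m}" "\<pi> k = \<pi> l"
    hence "\<sigma> (r k) = \<sigma> (r l)" using p by (simp add: \<pi>_def)
    hence "r k = r l" using inj_onD[OF bij_betw_imp_inj_on[OF Aut_bij[OF \<sigma>]]] r_F kl by blast
    then show "k = l" using inj_onD[OF r_inj _ kl(1,2)] by simp
  qed
  moreover have "\<pi> ` {1..2*m} \<subseteq> {1..2*m}" using p by (auto simp: \<pi>_def)
  ultimately have "bij_betw \<pi> {1..2*m} {1..2*m}" by (simp add: bij_betw_def endo_inj_surj)
  hence \<pi>: "\<pi> permutes {1..2*m}" by (rule bij_imp_permutes) (simp add: \<pi>_def del: atLeastAtMost_iff)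
  have eq: "\<sigma> (r k) = r (\<pi> k)" if "k \<in> {1..2*m}" for k using p that by (simp add: \<pi>_def)
  have "\<exists>\<sigma>\<in>Aut. \<forall>k\<in>{1..2*m}. \<sigma> (r k) = r (\<pi> k)" by (intro bexI[OF _ \<sigma>] ballI eq)
  hence "\<pi> \<in> galois_perms (2 * m) r f"
    unfolding galois_perms_def mem_Collect_eq sym_group_carrier aut using \<pi> by (intro conjI)
  hence "\<pi> \<in> signed_perm_group m" unfolding gal by blast
  then obtain \<tau> D where "\<pi> = pair_perm m \<tau> \<circ> flip m D" "\<tau> permutes {1..m}" "D \<subseteq> {1..m}"
    unfolding signed_perm_group_eq by blast
  then show ?thesis using acts_pair_perm_flip[of \<tau> D \<sigma>] eq by blast
qed

text \<open>The lift of \<tau> without sign changes is even, so the restriction to the alternating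
  group loses no permutation of the pairs.\<close>

lemma acts_ex:
  assumes \<tau>: "\<tau> permutes {1..m}"
  shows "\<exists>\<sigma>\<in>Aut. acts \<sigma> \<tau>"
proof -
  define \<pi> where "\<pi> = pair_perm m \<tau> \<circ> flip m {}"
  have "\<pi> \<in> signed_perm_group m" unfolding signed_perm_group_eq \<pi>_def using \<tau> by blast
  moreover have "\<pi> permutes {1..2*m}" "evenperm \<pi>"
    using pair_perm_flip[OF \<tau>, of "{}"] by (simp_all add: \<pi>_def)
  ultimately have "\<pi> \<in> galois_perms (2 * m) r f" unfolding gal Int_iff alt_group_carrier by blast
  then obtain \<sigma> where \<sigma>: "\<sigma> \<in> Aut" "\<And>k. k \<in> {1..2*m} \<Longrightarrow> \<sigma> (r k) = r (\<pi> k)"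
    unfolding galois_perms_def aut by blast
  have "acts \<sigma> \<tau>" by (rule acts_pair_perm_flip[OF \<tau>, of "{}"]) (use \<sigma>(2) in \<open>auto simp: \<pi>_def\<close>)
  with \<sigma>(1) show ?thesis by blast
qed

text \<open>In terms of fields: tuples of conjugates of an algebraic integer of the degree m field
  that is fixed by the stabiliser of a pair. The vector form makes the lattices of different
  polynomials comparable, since they all live in the same space.\<close>

definition \<Lambda> :: "(nat \<Rightarrow> complex) set" where
  "\<Lambda> = {v. (\<forall>i. i \<notin> {1..m} \<longrightarrow> v i = 0) \<and> (\<forall>i\<in>{1..m}. v i \<in> F \<and> algebraic_int (v i)) \<and>
     (\<forall>\<sigma>\<in>Aut. \<forall>\<tau>. acts \<sigma> \<tau> \<longrightarrow> (\<forall>i\<in>{1..m}. \<sigma> (v i) = v (\<tau> i)))}"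

lemma \<Lambda>_outside: "v \<in> \<Lambda> \<Longrightarrow> i \<notin> {1..m} \<Longrightarrow> v i = 0"
  and \<Lambda>_F: "v \<in> \<Lambda> \<Longrightarrow> i \<in> {1..m} \<Longrightarrow> v i \<in> F"
  and \<Lambda>_int: "v \<in> \<Lambda> \<Longrightarrow> i \<in> {1..m} \<Longrightarrow> algebraic_int (v i)"
  and \<Lambda>_equi: "v \<in> \<Lambda> \<Longrightarrow> \<sigma> \<in> Aut \<Longrightarrow> acts \<sigma> \<tau> \<Longrightarrow> i \<in> {1..m} \<Longrightarrow> \<sigma> (v i) = v (\<tau> i)"
  unfolding \<Lambda>_def by blast+

lemma \<Lambda>I:
  assumes "\<And>i. i \<notin> {1..m} \<Longrightarrow> v i = 0" "\<And>i. i \<in> {1..m} \<Longrightarrow> v i \<in> F" "\<And>i. i \<in> {1..m} \<Longrightarrow> algebraic_int (v i)"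
    "\<And>\<sigma> \<tau> i. \<sigma> \<in> Aut \<Longrightarrow> acts \<sigma> \<tau> \<Longrightarrow> i \<in> {1..m} \<Longrightarrow> \<sigma> (v i) = v (\<tau> i)"
  shows "v \<in> \<Lambda>"
  unfolding \<Lambda>_def using assms by blast

lemma acts_in: "acts \<sigma> \<tau> \<Longrightarrow> i \<in> {1..m} \<Longrightarrow> \<tau> i \<in> {1..m}"
  using permutes_in_image unfolding acts_def by metis

lemma \<Lambda>_diff:
  assumes v: "v \<in> \<Lambda>" and w: "w \<in> \<Lambda>"
  shows "(\<lambda>i. v i - w i) \<in> \<Lambda>"
proof (rule \<Lambda>I)
  fix i assume i: "i \<notin> {1..m}"
  show "v i - w i = 0" unfolding \<Lambda>_outside[OF v i] \<Lambda>_outside[OF w i] by simp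
next
  fix i assume i: "i \<in> {1..m}"
  show "v i - w i \<in> F" by (rule subfield_diff[OF F \<Lambda>_F[OF v i] \<Lambda>_F[OF w i]])
  show "algebraic_int (v i - w i)" by (rule algebraic_int_diff[OF \<Lambda>_int[OF v i] \<Lambda>_int[OF w i]])
next
  fix \<sigma> \<tau> i assume \<sigma>: "\<sigma> \<in> Aut" and \<tau>: "acts \<sigma> \<tau>" and i: "i \<in> {1..m}"
  show "\<sigma> (v i - w i) = v (\<tau> i) - w (\<tau> i)"
    unfolding hom_diff[OF F Aut_hom[OF \<sigma>] \<Lambda>_F[OF v i] \<Lambda>_F[OF w i]] \<Lambda>_equi[OF v \<sigma> \<tau> i] \<Lambda>_equi[OF w \<sigma> \<tau> i] ..
qed

lemma \<Lambda>_mult: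
  assumes v: "v \<in> \<Lambda>" and w: "w \<in> \<Lambda>"
  shows "(\<lambda>i. v i * w i) \<in> \<Lambda>"
proof (rule \<Lambda>I)
  fix i assume i: "i \<notin> {1..m}"
  show "v i * w i = 0" unfolding \<Lambda>_outside[OF v i] \<Lambda>_outside[OF w i] by simp
next
  fix i assume i: "i \<in> {1..m}"
  show "v i * w i \<in> F" by (rule subfield_mult[OF F \<Lambda>_F[OF v i] \<Lambda>_F[OF w i]])
  show "algebraic_int (v i * w i)" by (rule algebraic_int_mult[OF \<Lambda>_int[OF v i] \<Lambda>_int[OF w i]])
next
  fix \<sigma> \<tau> i assume \<sigma>: "\<sigma> \<in> Aut" and \<tau>: "acts \<sigma> \<tau>" and i: "i \<in> {1..m}"
  show "\<sigma> (v i * w i) = v (\<tau> i) * w (\<tau> i)"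
    unfolding hom_mult[OF F Aut_hom[OF \<sigma>] \<Lambda>_F[OF v i] \<Lambda>_F[OF w i]] \<Lambda>_equi[OF v \<sigma> \<tau> i] \<Lambda>_equi[OF w \<sigma> \<tau> i] ..
qed

lemma \<Lambda>_const: "(\<lambda>i. if i \<in> {1..m} then of_int c else 0) \<in> \<Lambda>"
proof (rule \<Lambda>I)
  fix i assume i: "i \<in> {1..m}"
  show "(if i \<in> {1..m} then of_int c else 0) \<in> F" unfolding if_P[OF i] by (rule subfield_of_int[OF F])
  show "algebraic_int (if i \<in> {1..m} then of_int c else 0 :: complex)" unfolding if_P[OF i] by simp
next
  fix \<sigma> \<tau> i assume \<sigma>: "\<sigma> \<in> Aut" and \<tau>: "acts \<sigma> \<tau>" and i: "i \<in> {1..m}"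
  show "\<sigma> (if i \<in> {1..m} then of_int c else 0) = (if \<tau> i \<in> {1..m} then of_int c else 0)"
    unfolding if_P[OF i] if_P[OF acts_in[OF \<tau> i]] by (rule hom_of_int[OF F Aut_hom[OF \<sigma>]])
qed (simp only: if_False)

text \<open>The coefficients are symmetric in the coordinates, which every automorphism permutes;
  being algebraic integers they are rational integers.\<close>

lemma \<Lambda>_integral:
  assumes v: "v \<in> \<Lambda>"
  shows "poly.coeff (\<Prod>i\<in>{1..m}. [:- v i, 1:]) k \<in> \<int>"
proof -
  define c where "c w = poly.coeff (\<Prod>i\<in>{1..m}. [:- w i, 1:]) k" for w :: "nat \<Rightarrow> complex"
  define SS where "SS = {S. S \<subseteq> {1..m} \<and> card S + k = card {1..m}}"
  have c: "c w = (\<Sum>S\<in>SS. \<Prod>i\<in>S. - w i)" for w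
    unfolding c_def SS_def by (rule coeff_prod_linear) simp
  have sub: "i \<in> {1..m}" if "S \<in> SS" "i \<in> S" for S i using that by (auto simp: SS_def)
  have "c v \<in> \<int>"
  proof (rule fixed_integral_imp_int)
    show "c v \<in> F" unfolding c
      by (intro subfield_sum[OF F] subfield_prod[OF F] subfield_uminus[OF F] \<Lambda>_F[OF v] sub)
    show "algebraic_int (c v)" unfolding c
      by (intro algebraic_int_sum algebraic_int_prod algebraic_int_minus \<Lambda>_int[OF v] sub)
    fix \<sigma> assume \<sigma>: "\<sigma> \<in> Aut"
    note h = Aut_hom[OF \<sigma>]
    obtain \<tau> where \<tau>: "acts \<sigma> \<tau>" using ex_acts[OF \<sigma>] by blast
    have "\<sigma> (c v) = (\<Sum>S\<in>SS. \<sigma> (\<Prod>i\<in>S. - v i))" unfolding c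
      by (rule hom_sum[OF F h]) (intro subfield_prod[OF F] subfield_uminus[OF F] \<Lambda>_F[OF v] sub)
    also have "\<dots> = (\<Sum>S\<in>SS. \<Prod>i\<in>S. - v (\<tau> i))"
    proof (rule sum.cong[OF refl])
      fix S assume S: "S \<in> SS"
      have "\<sigma> (\<Prod>i\<in>S. - v i) = (\<Prod>i\<in>S. \<sigma> (- v i))"
        by (rule hom_prod[OF F h]) (intro subfield_uminus[OF F] \<Lambda>_F[OF v] sub[OF S])
      also have "\<dots> = (\<Prod>i\<in>S. - v (\<tau> i))"
      proof (rule prod.cong[OF refl])
        fix i assume "i \<in> S"
        hence i: "i \<in> {1..m}" by (rule sub[OF S])
        show "\<sigma> (- v i) = - v (\<tau> i)"
          unfolding hom_uminus[OF F h \<Lambda>_F[OF v i]] \<Lambda>_equi[OF v \<sigma> \<tau> i] ..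
      qed
      finally show "\<sigma> (\<Prod>i\<in>S. - v i) = (\<Prod>i\<in>S. - v (\<tau> i))" .
    qed
    also have "\<dots> = c (\<lambda>i. v (\<tau> i))" by (rule c[symmetric])
    also have "\<dots> = c v" unfolding c_def
      using prod.permute[of \<tau> "{1..m}" "\<lambda>i. [:- v i, 1:]"] \<tau> by (simp add: acts_def comp_def)
    finally show "\<sigma> (c v) = c v" .
  qed
  then show ?thesis by (simp add: c_def)
qed

lemma transpose_acts:
  assumes "i \<in> {1..m}" "j \<in> {1..m}"
  obtains \<sigma> where "\<sigma> \<in> Aut" "acts \<sigma> (Transposition.transpose i j)"
  using acts_ex[OF permutes_swap_id[OF assms]] by blast

text \<open>If v i = v j, an automorphism exchanging the pairs j and k turns this into v i = v k, so
  all coordinates agree. Their common value is fixed by every automorphism.\<close>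

lemma \<Lambda>_dichotomy:
  assumes v: "v \<in> \<Lambda>"
  shows "inj_on v {1..m} \<or> (\<exists>c::int. \<forall>i\<in>{1..m}. v i = of_int c)"
proof (rule disjCI)
  assume "\<not> (\<exists>c::int. \<forall>i\<in>{1..m}. v i = of_int c)"
  show "inj_on v {1..m}"
  proof (rule ccontr)
    assume "\<not> inj_on v {1..m}"
    then obtain i j where ij: "i \<in> {1..m}" "j \<in> {1..m}" "v i = v j" "i \<noteq> j" by (auto simp: inj_on_def)
    have all: "v k = v i" if k: "k \<in> {1..m}" for k
    proof (cases "k = i \<or> k = j")
      case False
      obtain \<sigma> where \<sigma>: "\<sigma> \<in> Aut" "acts \<sigma> (Transposition.transpose j k)" using transpose_acts[OF ij(2) k] .
      have "\<sigma> (v i) = v i" using \<Lambda>_equi[OF v \<sigma> ij(1)] ij(4) False by (simp add: Transposition.transpose_def)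
      moreover have "\<sigma> (v j) = v k" using \<Lambda>_equi[OF v \<sigma> ij(2)] by (simp add: Transposition.transpose_def)
      ultimately show ?thesis using ij(3) by simp
    qed (use ij in auto)
    have "v i \<in> \<int>"
    proof (rule fixed_integral_imp_int[OF \<Lambda>_F[OF v ij(1)] \<Lambda>_int[OF v ij(1)]])
      fix \<sigma> assume \<sigma>: "\<sigma> \<in> Aut"
      obtain \<tau> where \<tau>: "acts \<sigma> \<tau>" using ex_acts[OF \<sigma>] by blast
      show "\<sigma> (v i) = v i" unfolding \<Lambda>_equi[OF v \<sigma> \<tau> ij(1)] by (rule all[OF acts_in[OF \<tau> ij(1)]])
    qed
    then obtain c where "v i = of_int c" by (auto elim: Ints_cases)
    with all \<open>\<not> (\<exists>c::int. \<forall>i\<in>{1..m}. v i = of_int c)\<close> show False by metis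
  qed
qed

lemma \<Lambda>_no_zero:
  assumes v: "v \<in> \<Lambda>" "i \<in> {1..m}" "v i = 0" "j \<in> {1..m}"
  shows "v j = 0"
proof -
  obtain \<sigma> where \<sigma>: "\<sigma> \<in> Aut" "acts \<sigma> (Transposition.transpose i j)" using transpose_acts[OF v(2,4)] .
  have "\<sigma> (v i) = v j" using \<Lambda>_equi[OF v(1) \<sigma> v(2)] by (simp add: Transposition.transpose_def)
  then show ?thesis using hom_0[OF F Aut_hom[OF \<sigma>(1)]] v(3) by simp
qed

definition s :: "nat \<Rightarrow> complex" where "s i = (if i \<in> {1..m} then r i + r (m + i) else 0)"
definition t :: "nat \<Rightarrow> complex" where "t i = (if i \<in> {1..m} then r i * r (m + i) else 0)"

lemma r_int: "k \<in> {1..2*m} \<Longrightarrow> algebraic_int (r k)"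
  unfolding algebraic_int_altdef_ipoly using monic r_root by blast

lemma pair_in: "i \<in> {1..m} \<Longrightarrow> i \<in> {1..2*m}" "i \<in> {1..m} \<Longrightarrow> m + i \<in> {1..2*m}"
  by auto

lemma s_\<Lambda>: "s \<in> \<Lambda>"
proof (rule \<Lambda>I)
  fix \<sigma> \<tau> i assume \<sigma>: "\<sigma> \<in> Aut" and \<tau>: "acts \<sigma> \<tau>" and i: "i \<in> {1..m}"
  have "\<sigma> (s i) = \<sigma> (r i) + \<sigma> (r (m + i))"
    unfolding s_def if_P[OF i] by (rule hom_add[OF F Aut_hom[OF \<sigma>] r_F[OF pair_in(1)[OF i]] r_F[OF pair_in(2)[OF i]]])
  also have "\<dots> = r (\<tau> i) + r (m + \<tau> i)"
  proof -
    have "{\<sigma> (r i), \<sigma> (r (m + i))} = {r (\<tau> i), r (m + \<tau> i)}" using \<tau> i unfolding acts_def by blast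
    then show ?thesis unfolding doubleton_eq_iff by (auto simp: add.commute)
  qed
  also have "\<dots> = s (\<tau> i)" unfolding s_def if_P[OF acts_in[OF \<tau> i]] ..
  finally show "\<sigma> (s i) = s (\<tau> i)" .
next
  fix i assume i: "i \<in> {1..m}"
  show "s i \<in> F" unfolding s_def if_P[OF i] by (intro subfield_add[OF F] r_F pair_in i)
  show "algebraic_int (s i)" unfolding s_def if_P[OF i] by (intro algebraic_int_add r_int pair_in i)
qed (auto simp: s_def)

lemma t_\<Lambda>: "t \<in> \<Lambda>"
proof (rule \<Lambda>I)
  fix \<sigma> \<tau> i assume \<sigma>: "\<sigma> \<in> Aut" and \<tau>: "acts \<sigma> \<tau>" and i: "i \<in> {1..m}"
  have "\<sigma> (t i) = \<sigma> (r i) * \<sigma> (r (m + i))"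
    unfolding t_def if_P[OF i] by (rule hom_mult[OF F Aut_hom[OF \<sigma>] r_F[OF pair_in(1)[OF i]] r_F[OF pair_in(2)[OF i]]])
  also have "\<dots> = r (\<tau> i) * r (m + \<tau> i)"
  proof -
    have "{\<sigma> (r i), \<sigma> (r (m + i))} = {r (\<tau> i), r (m + \<tau> i)}" using \<tau> i unfolding acts_def by blast
    then show ?thesis unfolding doubleton_eq_iff by (auto simp: mult.commute)
  qed
  also have "\<dots> = t (\<tau> i)" unfolding t_def if_P[OF acts_in[OF \<tau> i]] ..
  finally show "\<sigma> (t i) = t (\<tau> i)" .
next
  fix i assume i: "i \<in> {1..m}"
  show "t i \<in> F" unfolding t_def if_P[OF i] by (intro subfield_mult[OF F] r_F pair_in i)
  show "algebraic_int (t i)" unfolding t_def if_P[OF i] by (intro algebraic_int_mult r_int pair_in i)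
qed (auto simp: t_def)

text \<open>Were both vectors constant, all pairs would consist of the roots of one and the same
  quadratic, although the roots are distinct. Hence the lattice has a generator, and one of the two
  vectors counted for f is such.\<close>

lemma s_or_t_inj: "inj_on s {1..m} \<or> inj_on t {1..m}"
proof (rule ccontr)
  assume "\<not> ?thesis"
  then obtain c d :: int where cd: "\<forall>i\<in>{1..m}. s i = of_int c" "\<forall>i\<in>{1..m}. t i = of_int d"
    using \<Lambda>_dichotomy[OF s_\<Lambda>] \<Lambda>_dichotomy[OF t_\<Lambda>] by blast
  have in12: "1 \<in> {1..m}" "2 \<in> {1..m}" using m3 by auto
  have "s 1 = s 2" "t 1 = t 2" using cd in12 by simp_all
  hence eq: "r 1 + r (m + 1) = r 2 + r (m + 2)" "r 1 * r (m + 1) = r 2 * r (m + 2)"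
    using in12 by (simp_all add: s_def t_def)
  have "(r 2 - r 1) * (r 2 - r (m + 1)) = r 2 * r 2 - r 2 * (r 1 + r (m + 1)) + r 1 * r (m + 1)"
    by (simp add: algebra_simps)
  also have "\<dots> = 0" unfolding eq by (simp add: algebra_simps)
  finally have "r 2 = r 1 \<or> r 2 = r (m + 1)" by simp
  moreover have "2 \<in> {1..2*m}" "1 \<in> {1..2*m}" "m + 1 \<in> {1..2*m}" using m3 by auto
  ultimately have "(2::nat) = 1 \<or> 2 = m + 1" using inj_onD[OF r_inj] by blast
  then show False using m3 by simp
qed

lemma f_quadratics: "map_poly of_int f = (\<Prod>i\<in>{1..m}. [:t i, - s i, 1:])"
proof -
  have "{1..2*m} = {1..m} \<union> (\<lambda>i. m + i) ` {1..m}"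
  proof (intro equalityI subsetI)
    fix k assume "k \<in> {1..2*m}"
    hence "k \<in> {1..m} \<or> (k = m + (k - m) \<and> k - m \<in> {1..m})" by auto
    then show "k \<in> {1..m} \<union> (\<lambda>i. m + i) ` {1..m}" by blast
  qed auto
  hence "map_poly of_int f = (\<Prod>k\<in>{1..m}. [:- r k, 1:]) * (\<Prod>k\<in>(\<lambda>i. m + i) ` {1..m}. [:- r k, 1:])"
    unfolding f_prod by (simp only:) (intro prod.union_disjoint, auto)
  also have "(\<Prod>k\<in>(\<lambda>i. m + i) ` {1..m}. [:- r k, 1:]) = (\<Prod>i\<in>{1..m}. [:- r (m + i), 1:])"
    by (subst prod.reindex) auto
  also have "(\<Prod>k\<in>{1..m}. [:- r k, 1:]) * \<dots> = (\<Prod>i\<in>{1..m}. [:t i, - s i, 1:])"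
    unfolding prod.distrib[symmetric] by (intro prod.cong refl) (simp add: s_def t_def)
  finally show ?thesis .
qed

text \<open>The interpolation polynomial of degree below m through the points (v i, w i) is unique,
  and an automorphism merely permutes these points. Its coefficients are therefore fixed, that is,
  rational.\<close>

lemma \<Lambda>_polynomial:
  assumes v: "v \<in> \<Lambda>" "inj_on v {1..m}" and w: "w \<in> \<Lambda>"
  shows "\<exists>g. coeffs_in \<rat> g \<and> (\<forall>i\<in>{1..m}. w i = poly g (v i))"
proof -
  have "0 < m" using m3 by simp
  have "\<exists>g. coeffs_in F g \<and> Polynomial.degree g < m \<and> (\<forall>i\<in>{1..m}. poly g (v i) = w i)"
    by (rule lagrange_interpolation[OF F v(2) _ _ \<open>0 < m\<close>]) (rule \<Lambda>_F[OF v(1)] \<Lambda>_F[OF w], assumption)+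
  then obtain g where g: "coeffs_in F g" "Polynomial.degree g < m" "\<And>i. i \<in> {1..m} \<Longrightarrow> poly g (v i) = w i" by blast
  have "poly.coeff g k \<in> \<rat>" for k
  proof (rule fixed_imp_rational)
    show gF: "poly.coeff g k \<in> F" using g(1) by (simp add: coeffs_in_def)
    show "algebraic (poly.coeff g k)" by (rule F_algebraic[OF gF])
    fix \<sigma> assume \<sigma>: "\<sigma> \<in> Aut"
    note h = Aut_hom[OF \<sigma>]
    obtain \<tau> where \<tau>: "acts \<sigma> \<tau>" using ex_acts[OF \<sigma>] by blast
    have "map_poly \<sigma> g = g"
    proof (rule poly_eq_by_values[OF _ g(2) v(2)])
      show "Polynomial.degree (map_poly \<sigma> g) < m" using degree_map_poly_le[of \<sigma> g] g(2) by simp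
      fix i assume i: "i \<in> {1..m}"
      define j where "j = Hilbert_Choice.inv \<tau> i"
      have p: "\<tau> permutes {1..m}" using \<tau> by (simp add: acts_def)
      have j: "j \<in> {1..m}" "\<tau> j = i"
        using permutes_inverses(1)[OF p] permutes_in_image[OF permutes_inv[OF p]] i by (simp_all add: j_def)
      have "poly (map_poly \<sigma> g) (v i) = poly (map_poly \<sigma> g) (\<sigma> (v j))"
        using \<Lambda>_equi[OF v(1) \<sigma> \<tau> j(1)] j(2) by simp
      also have "\<dots> = \<sigma> (poly g (v j))" by (rule hom_poly[OF F h g(1) \<Lambda>_F[OF v(1) j(1)], symmetric])
      also have "\<dots> = w i" unfolding g(3)[OF j(1)] using \<Lambda>_equi[OF w \<sigma> \<tau> j(1)] j(2) by simp
      also have "\<dots> = poly g (v i)" using g(3)[OF i] by simp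
      finally show "poly (map_poly \<sigma> g) (v i) = poly g (v i)" .
    qed
    then show "\<sigma> (poly.coeff g k) = poly.coeff g k" by (metis coeff_map_hom[OF F h])
  qed
  hence "coeffs_in \<rat> g" by (simp add: coeffs_in_def)
  then show ?thesis using g(3) by (intro exI[of _ g] conjI ballI) simp_all
qed

lemma \<Lambda>_of_polynomial:
  assumes v: "v \<in> \<Lambda>" and g: "coeffs_in \<rat> g" and w: "\<And>i. i \<in> {1..m} \<Longrightarrow> w i = poly g (v i)"
    and out: "\<And>i. i \<notin> {1..m} \<Longrightarrow> w i = 0" and int: "\<And>i. i \<in> {1..m} \<Longrightarrow> algebraic_int (w i)"
  shows "w \<in> \<Lambda>"
proof (rule \<Lambda>I[OF out _ int])
  have gF: "coeffs_in F g" using g subfield_Rats[OF F] by (simp add: coeffs_in_def)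
  fix i assume i: "i \<in> {1..m}"
  show "w i \<in> F" unfolding w[OF i] by (rule subfield_poly[OF F gF \<Lambda>_F[OF v i]])
  fix \<sigma> \<tau> assume \<sigma>: "\<sigma> \<in> Aut" and \<tau>: "acts \<sigma> \<tau>"
  note h = Aut_hom[OF \<sigma>]
  have "map_poly \<sigma> g = g"
    using g by (intro poly_eqI) (simp add: coeff_map_hom[OF F h] coeffs_in_def hom_Rats[OF F h])
  then show "\<sigma> (w i) = w (\<tau> i)"
    unfolding w[OF i] w[OF acts_in[OF \<tau> i]] hom_poly[OF F h gF \<Lambda>_F[OF v i]] \<Lambda>_equi[OF v \<sigma> \<tau> i] by simp
qed

end

text \<open>Each w in one lattice is g(v) with rational g. Since v also lies in the other lattice,
  g(v) is equivariant there too, and integrality of the coordinates does not refer to either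
  polynomial. By symmetry the lattices agree.\<close>

lemma wreath_separated:
  assumes "wreath_poly m f r" "wreath_poly m f' r'"
    and v: "v \<in> wreath_poly.\<Lambda> m f r" "v \<in> wreath_poly.\<Lambda> m f' r'" "inj_on v {1..m}"
  shows "wreath_poly.\<Lambda> m f r = wreath_poly.\<Lambda> m f' r'"
proof -
  have sub: "wreath_poly.\<Lambda> m f r \<subseteq> wreath_poly.\<Lambda> m f' r'"
    if sep: "wreath_poly m f r" "wreath_poly m f' r'" "v \<in> wreath_poly.\<Lambda> m f r" "v \<in> wreath_poly.\<Lambda> m f' r'" for f r f' r'
  proof
    interpret A: wreath_poly m f r by (rule sep(1))
    interpret B: wreath_poly m f' r' by (rule sep(2))
    fix w assume w: "w \<in> A.\<Lambda>"
    obtain g where g: "coeffs_in \<rat> g" "\<And>i. i \<in> {1..m} \<Longrightarrow> w i = poly g (v i)"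
      using A.\<Lambda>_polynomial[OF sep(3) v(3) w] by blast
    show "w \<in> B.\<Lambda>" by (rule B.\<Lambda>_of_polynomial[OF sep(4) g A.\<Lambda>_outside[OF w] A.\<Lambda>_int[OF w]])
  qed
  show ?thesis using sub[OF assms(1,2) v(1,2)] sub[OF assms(2,1) v(2,1)] by blast
qed

lemma wreath_lattice_family:
  assumes m: "3 \<le> m" and W: "\<And>f r. (f, r) \<in> W \<Longrightarrow> wreath_poly m f r"
  shows "lattice_family m ((\<lambda>(f, r). wreath_poly.\<Lambda> m f r) ` W)"
proof
  show "3 \<le> m" by (rule m)
next
  fix \<Lambda> v i assume "\<Lambda> \<in> (\<lambda>(f, r). wreath_poly.\<Lambda> m f r) ` W" and v: "v \<in> \<Lambda>" and i: "i \<notin> {1..m}"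
  then obtain f r where fr: "(f, r) \<in> W" "\<Lambda> = wreath_poly.\<Lambda> m f r" by auto
  interpret wreath_poly m f r by (rule W[OF fr(1)])
  show "v i = 0" using \<Lambda>_outside v i unfolding fr(2) by blast
next
  fix \<Lambda> v w assume "\<Lambda> \<in> (\<lambda>(f, r). wreath_poly.\<Lambda> m f r) ` W" and v: "v \<in> \<Lambda>" and w: "w \<in> \<Lambda>"
  then obtain f r where fr: "(f, r) \<in> W" "\<Lambda> = wreath_poly.\<Lambda> m f r" by auto
  interpret wreath_poly m f r by (rule W[OF fr(1)])
  show "(\<lambda>i. v i - w i) \<in> \<Lambda>" using \<Lambda>_diff v w unfolding fr(2) by blast
  show "(\<lambda>i. v i * w i) \<in> \<Lambda>" using \<Lambda>_mult v w unfolding fr(2) by blast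
next
  fix \<Lambda> and c :: int assume "\<Lambda> \<in> (\<lambda>(f, r). wreath_poly.\<Lambda> m f r) ` W"
  then obtain f r where fr: "(f, r) \<in> W" "\<Lambda> = wreath_poly.\<Lambda> m f r" by auto
  interpret wreath_poly m f r by (rule W[OF fr(1)])
  show "(\<lambda>i. if i \<in> {1..m} then of_int c else 0) \<in> \<Lambda>" unfolding fr(2) by (rule \<Lambda>_const)
next
  fix \<Lambda> v k assume "\<Lambda> \<in> (\<lambda>(f, r). wreath_poly.\<Lambda> m f r) ` W" and v: "v \<in> \<Lambda>"
  then obtain f r where fr: "(f, r) \<in> W" "\<Lambda> = wreath_poly.\<Lambda> m f r" by auto
  interpret wreath_poly m f r by (rule W[OF fr(1)])
  show "poly.coeff (\<Prod>i\<in>{1..m}. [:- v i, 1:]) k \<in> \<int>" using \<Lambda>_integral v unfolding fr(2) by blast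
next
  fix \<Lambda> v assume "\<Lambda> \<in> (\<lambda>(f, r). wreath_poly.\<Lambda> m f r) ` W" and v: "v \<in> \<Lambda>"
  then obtain f r where fr: "(f, r) \<in> W" "\<Lambda> = wreath_poly.\<Lambda> m f r" by auto
  interpret wreath_poly m f r by (rule W[OF fr(1)])
  show "inj_on v {1..m} \<or> (\<exists>c::int. \<forall>i\<in>{1..m}. v i = of_int c)" using \<Lambda>_dichotomy v unfolding fr(2) by blast
next
  fix \<Lambda> v i j assume "\<Lambda> \<in> (\<lambda>(f, r). wreath_poly.\<Lambda> m f r) ` W" and v: "v \<in> \<Lambda>" "i \<in> {1..m}" "v i = 0" "j \<in> {1..m}"
  then obtain f r where fr: "(f, r) \<in> W" "\<Lambda> = wreath_poly.\<Lambda> m f r" by auto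
  interpret wreath_poly m f r by (rule W[OF fr(1)])
  show "v j = 0" using \<Lambda>_no_zero v unfolding fr(2) by blast
next
  fix \<Lambda> assume "\<Lambda> \<in> (\<lambda>(f, r). wreath_poly.\<Lambda> m f r) ` W"
  then obtain f r where fr: "(f, r) \<in> W" "\<Lambda> = wreath_poly.\<Lambda> m f r" by auto
  interpret wreath_poly m f r by (rule W[OF fr(1)])
  show "\<exists>s\<in>\<Lambda>. inj_on s {1..m}" unfolding fr(2) using s_\<Lambda> t_\<Lambda> s_or_t_inj by blast
next
  fix \<Lambda> \<Lambda>' v assume "\<Lambda> \<in> (\<lambda>(f, r). wreath_poly.\<Lambda> m f r) ` W" "\<Lambda>' \<in> (\<lambda>(f, r). wreath_poly.\<Lambda> m f r) ` W"
    and v: "v \<in> \<Lambda>" "v \<in> \<Lambda>'" "inj_on v {1..m}"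
  then obtain f r f' r' where fr: "(f, r) \<in> W" "\<Lambda> = wreath_poly.\<Lambda> m f r" "(f', r') \<in> W" "\<Lambda>' = wreath_poly.\<Lambda> m f' r'" by auto
  show "\<Lambda> = \<Lambda>'" using wreath_separated[OF W[OF fr(1)] W[OF fr(3)]] v unfolding fr(2,4) by blast
qed

section \<open>Construction of even polynomials\<close>

lemma card_residue_class_in_interval:
  fixes M a :: int and x y :: real
  assumes M: "0 < M"
  shows "finite {z :: int. x \<le> real_of_int z \<and> real_of_int z \<le> y \<and> [z = a] (mod M)}"
    "(y - x) / real_of_int M - 1 \<le> real (card {z :: int. x \<le> real_of_int z \<and> real_of_int z \<le> y \<and> [z = a] (mod M)})"
proof -
  let ?Z = "{z :: int. x \<le> real_of_int z \<and> real_of_int z \<le> y \<and> [z = a] (mod M)}"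
  have "?Z \<subseteq> {\<lfloor>x\<rfloor>..\<lceil>y\<rceil>}" by (auto simp: floor_le_iff le_ceiling_iff)
  then show fin: "finite ?Z" by (rule finite_subset) simp
  define A where "A = {\<lceil>(x - a) / M\<rceil>..\<lfloor>(y - a) / M\<rfloor>}"
  have M': "0 < real_of_int M" using M by simp
  have "(\<lambda>t. a + M * t) ` A \<subseteq> ?Z"
  proof (rule image_subsetI)
    fix t assume t: "t \<in> A"
    have "(x - a) / M \<le> t" "t \<le> (y - a) / M" using t by (auto simp: A_def ceiling_le_iff le_floor_iff)
    hence "x - a \<le> t * M" "t * M \<le> y - a" using M' by (simp_all add: pos_divide_le_eq pos_le_divide_eq)
    moreover have "[a + M * t = a] (mod M)" by (simp add: cong_def)
    ultimately show "a + M * t \<in> ?Z" by (simp add: algebra_simps)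
  qed
  moreover have "inj_on (\<lambda>t. a + M * t) A" using M by (auto simp: inj_on_def)
  ultimately have "card A \<le> card ?Z" using fin by (intro card_inj_on_le)
  moreover have "(y - x) / M - 1 \<le> real (card A)"
  proof -
    have "(y - x) / M = (y - a) / M - (x - a) / M" by (simp add: diff_divide_distrib)
    moreover have "real_of_int (\<lfloor>(y - a) / M\<rfloor> - \<lceil>(x - a) / M\<rceil> + 1) \<le> real (card A)" unfolding A_def by simp
    ultimately show ?thesis by linarith
  qed
  ultimately show "(y - x) / M - 1 \<le> real (card ?Z)" by linarith
qed

section \<open>Polynomials with a prescribed pattern of real roots\<close>

definition monic_poly :: "nat \<Rightarrow> (nat \<Rightarrow> int) \<Rightarrow> int poly" where
  "monic_poly m h = Polynomial.monom 1 m + (\<Sum>i<m. Polynomial.monom (h i) i)"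

lemma coeff_monic_poly: "poly.coeff (monic_poly m h) j = (if j = m then 1 else if j < m then h j else 0)"
  by (simp add: monic_poly_def coeff_sum)

lemma degree_monic_poly: "Polynomial.degree (monic_poly m h) = m"
  using degree_le[of m "monic_poly m h"] le_degree[of "monic_poly m h" m] by (simp add: coeff_monic_poly)

lemma monic_poly_pcompose_square:
  "monic_poly m h \<circ>\<^sub>p [:0, 0, 1:] =
     Polynomial.monom 1 (2 * m) + (\<Sum>j<2 * m. Polynomial.monom (if even j then h (j div 2) else 0) j)"
proof -
  have x2: "[:0, 0, 1:] = Polynomial.monom (1::int) 2" by (simp add: monom_altdef numeral_2_eq_2)
  have pm: "Polynomial.monom c i \<circ>\<^sub>p [:0, 0, 1:] = Polynomial.monom c (2 * i)" for c :: int and i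
  proof -
    have "Polynomial.monom c i = Polynomial.smult c ([:0, 1:] ^ i)" by (simp add: monom_altdef)
    hence "Polynomial.monom c i \<circ>\<^sub>p [:0, 0, 1:] = Polynomial.smult c ([:0, 0, 1:] ^ i)"
      by (simp add: pcompose_smult pcompose_pCons pcompose_hom.hom_power)
    also have "\<dots> = Polynomial.monom c (2 * i)" unfolding x2 by (simp add: monom_power smult_monom mult.commute)
    finally show ?thesis .
  qed
  have "(\<Sum>j<2 * m. Polynomial.monom (if even j then h (j div 2) else 0) j) =
      (\<Sum>j\<in>(\<lambda>i. 2 * i) ` {..<m}. Polynomial.monom (h (j div 2)) j)"
    by (rule sum.mono_neutral_cong_right) (auto elim!: evenE)
  also have "\<dots> = (\<Sum>i<m. Polynomial.monom (h i) (2 * i))" by (subst sum.reindex) (auto simp: inj_on_def)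
  finally show ?thesis unfolding monic_poly_def pcompose_add pcompose_sum pm by simp
qed

text \<open>The coefficients of \<open>g\<close> are chosen close to a multiple of this polynomial, which changes sign
  between consecutive points \<open>j - 2\<close>.\<close>
definition shape :: "nat \<Rightarrow> real poly" where
  "shape m = - (\<Prod>i<m - 1. [:3 / 2 - real i, 1:])"

lemma shape_degree: "Polynomial.degree (shape m) \<le> m - 1"
  unfolding shape_def by (simp add: degree_prod_eq_sum_degree)

text \<open>The roots i - 3/2 are half-integers and the points j - 2 are integers, so no factor is
  smaller than 1/2 in absolute value. There are m - 1 - j roots to the right of the point, and the
  leading minus sign adds one more change.\<close>

lemma shape_sign:
  assumes m: "1 \<le> m" and j: "j < m"
  shows "(1 / 2) ^ (m - 1) \<le> (-1) ^ (m - j) * poly (shape m) (real j - 2)"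
proof -
  define s where "s i = (if i < j then 1 else -1 :: real)" for i
  have "poly (shape m) (real j - 2) = - (\<Prod>i<m - 1. s i * \<bar>real j - real i - 1 / 2\<bar>)"
    unfolding shape_def poly_minus poly_prod
  proof (intro arg_cong[of _ _ uminus] prod.cong refl)
    fix i assume "i \<in> {..<m - 1}"
    show "poly [:3 / 2 - real i, 1:] (real j - 2) = s i * \<bar>real j - real i - 1 / 2\<bar>"
    proof (cases "i < j")
      case True
      hence "real i + 1 \<le> real j" by linarith
      then show ?thesis using True by (simp add: s_def)
    next
      case False
      hence "real j \<le> real i" by simp
      then show ?thesis using False by (simp add: s_def)
    qed
  qed
  also have "\<dots> = - ((\<Prod>i<m - 1. s i) * (\<Prod>i<m - 1. \<bar>real j - real i - 1 / 2\<bar>))" by (simp add: prod.distrib)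
  also have "(\<Prod>i<m - 1. s i) = (-1) ^ (m - 1 - j)"
  proof -
    have "(\<Prod>i<m - 1. s i) = (\<Prod>i\<in>{j..<m - 1}. -1)"
      unfolding s_def by (rule prod.mono_neutral_cong_right) auto
    then show ?thesis by simp
  qed
  finally have eq: "(-1) ^ (m - j) * poly (shape m) (real j - 2) = (\<Prod>i<m - 1. \<bar>real j - real i - 1 / 2\<bar>)"
  proof -
    assume *: "poly (shape m) (real j - 2) = - ((-1) ^ (m - 1 - j) * (\<Prod>i<m - 1. \<bar>real j - real i - 1 / 2\<bar>))"
    have "m - j = Suc (m - 1 - j)" using j by simp
    then show ?thesis unfolding * by (simp flip: power_add mult.assoc)
  qed
  have "(1 / 2) ^ (m - 1) = (\<Prod>i<m - 1. 1 / 2 :: real)" by simp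
  also have "\<dots> \<le> (\<Prod>i<m - 1. \<bar>real j - real i - 1 / 2\<bar>)"
  proof (rule prod_mono, rule conjI)
    fix i
    have "i + 1 \<le> j \<or> j \<le> i" by linarith
    hence "real (i + 1) \<le> real j \<or> real j \<le> real i" by (simp only: of_nat_le_iff)
    hence "real i + 1 \<le> real j \<or> real j \<le> real i" by (simp add: add.commute)
    then show "1 / 2 \<le> \<bar>real j - real i - 1 / 2\<bar>" by linarith
  qed simp
  finally show ?thesis unfolding eq .
qed

text \<open>The points begin with -2, -1, 0, so exactly two roots are negative. The m points give m
  - 1 roots; at the last point the value is negative while the polynomial is monic, so one more root
  lies beyond it.\<close>

lemma real_roots_of_sign_changes:
  fixes g :: "int poly"
  assumes m: "3 \<le> m" and g: "Polynomial.lead_coeff g = 1" "Polynomial.degree g = m"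
    and sgn: "\<And>j. j < m \<Longrightarrow> 0 < (-1) ^ (m - j) * poly (map_poly real_of_int g) (real j - 2)"
  shows "\<exists>y. inj_on y {1..m} \<and> y 1 < 0 \<and> y 2 < 0 \<and> (\<forall>i\<in>{3..m}. 0 < y i) \<and>
    map_poly of_int g = (\<Prod>i\<in>{1..m}. [:- complex_of_real (y i), 1:])"
proof -
  define p where "p = map_poly real_of_int g"
  have lp: "Polynomial.lead_coeff p = 1" using g by (simp add: p_def)
  obtain b0 where b0: "\<And>x. b0 \<le> x \<Longrightarrow> 1 \<le> poly p x"
    using poly_pinfty_gt_lc[of p] lp by auto
  define u where "u j = (if j < m then real j - 2 else max b0 (real m))" for j
  have usgn: "0 < (-1) ^ (m - j) * poly p (u j)" if "j \<le> m" for j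
  proof (cases "j < m")
    case True
    then show ?thesis using sgn[OF True] by (simp add: u_def p_def)
  next
    case False
    have "1 \<le> poly p (max b0 (real m))" by (rule b0) simp
    then show ?thesis using False that by (simp add: u_def)
  qed
  have ex: "\<exists>x. u (i - 1) < x \<and> x < u i \<and> poly p x = 0" if i: "i \<in> {1..m}" for i
  proof -
    have lt: "u (i - 1) < u i" using i by (auto simp: u_def)
    define \<epsilon> where "\<epsilon> = (-1 :: real) ^ (m - i)"
    have e: "\<epsilon> = 1 \<or> \<epsilon> = -1" unfolding \<epsilon>_def by (simp add: minus_one_power_iff)
    have "m - (i - 1) = Suc (m - i)" using i by auto
    hence "0 < - \<epsilon> * poly p (u (i - 1))" using usgn[of "i - 1"] i by (simp add: \<epsilon>_def)
    moreover have "0 < \<epsilon> * poly p (u i)" using usgn[of i] i by (simp add: \<epsilon>_def)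
    ultimately have "poly p (u (i - 1)) * poly p (u i) < 0" using e by (auto simp: mult_less_0_iff)
    from poly_IVT[OF lt this] show ?thesis by blast
  qed
  have "\<forall>i\<in>{1..m}. \<exists>x. u (i - 1) < x \<and> x < u i \<and> poly p x = 0" using ex by blast
  from bchoice[OF this] obtain y where y: "\<forall>i\<in>{1..m}. u (i - 1) < y i \<and> y i < u i \<and> poly p (y i) = 0" ..
  have umono: "u i \<le> u j" if "i \<le> j" "j \<le> m" for i j using that by (auto simp: u_def)
  have ylt: "y i < y j" if "i \<in> {1..m}" "j \<in> {1..m}" "i < j" for i j
  proof -
    have "y i < u i" using y that by blast
    also have "u i \<le> u (j - 1)" using that by (intro umono) auto
    also have "u (j - 1) < y j" using y that by blast
    finally show ?thesis .
  qed
  have yinj: "inj_on y {1..m}"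
  proof (rule inj_onI, rule ccontr)
    fix i j assume ij: "i \<in> {1..m}" "j \<in> {1..m}" "y i = y j" "i \<noteq> j"
    then show False using ylt[of i j] ylt[of j i] by (cases "i < j") auto
  qed
  have in12: "1 \<in> {1..m}" "2 \<in> {1..m}" using m by auto
  have "y 2 < u 2" using y in12 by blast
  also have "u 2 = 0" using m by (simp add: u_def)
  finally have y2: "y 2 < 0" .
  hence y1: "y 1 < 0" using ylt[OF in12] by simp
  have y3: "0 < y i" if i: "i \<in> {3..m}" for i
  proof -
    have "u 2 \<le> u (i - 1)" using i by (intro umono) auto
    moreover have "u (i - 1) < y i" using y i by auto
    moreover have "u 2 = 0" using m by (simp add: u_def)
    ultimately show ?thesis by linarith
  qed
  have "map_poly complex_of_int g = (\<Prod>i\<in>{1..m}. [:- complex_of_real (y i), 1:])"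
  proof (rule monic_eq_prod_of_roots)
    show "inj_on (\<lambda>i. complex_of_real (y i)) {1..m}"
    proof (rule inj_onI)
      fix i j assume "i \<in> {1..m}" "j \<in> {1..m}" "complex_of_real (y i) = complex_of_real (y j)"
      then show "i = j" using inj_onD[OF yinj, of i j] by simp
    qed
    fix i assume i: "i \<in> {1..m}"
    have "map_poly complex_of_int g = map_poly of_real p"
      unfolding p_def by (simp add: map_poly_map_poly comp_def)
    hence "poly (map_poly complex_of_int g) (of_real (y i)) = of_real (poly p (y i))"
      by (simp add: of_real_hom.poly_map_poly)
    then show "poly (map_poly complex_of_int g) (of_real (y i)) = 0" using y i by simp
  qed (use g in auto)
  with yinj y1 y2 y3 show ?thesis by (intro exI[of _ y]) auto
qed

section \<open>Congruence conditions modulo the squares of primes\<close>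

lemma poly_inertia_model_1: "1 \<le> e \<Longrightarrow> poly (inertia_model m e) 1 = 0"
  by (simp add: inertia_model_def)

lemma poly_inertia_model_0:
  assumes "e \<le> m"
  shows "poly (inertia_model m e) 0 = (-1) ^ m * (\<Prod>t\<in>{2..m - e + 1}. int t)\<^sup>2"
proof -
  have "poly (inertia_model m e) 0 = (-1) ^ e * (\<Prod>t\<in>{2..m - e + 1}. (-1) * (int t)\<^sup>2)"
    by (simp add: inertia_model_def poly_prod)
  also have "\<dots> = (-1) ^ e * ((-1) ^ (m - e) * (\<Prod>t\<in>{2..m - e + 1}. (int t)\<^sup>2))"
    unfolding prod.distrib by simp
  also have "\<dots> = (-1) ^ m * (\<Prod>t\<in>{2..m - e + 1}. int t)\<^sup>2"
  proof -
    have "(-1) ^ e * (-1) ^ (m - e) = (-1 :: int) ^ m" using assms by (simp flip: power_add)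
    then show ?thesis unfolding prod_power_distrib mult.assoc[symmetric] by (simp only:)
  qed
  finally show ?thesis .
qed

lemma degree_inertia_model:
  assumes "e \<le> m"
  shows "Polynomial.degree (inertia_model m e) = m" "Polynomial.lead_coeff (inertia_model m e) = 1"
proof -
  have "Polynomial.degree ([:-1, 1:] ^ e * (\<Prod>t\<in>{2..N}. [:- (int t)\<^sup>2, 1:])) = e + (N - 1)" for N
  proof -
    have "Polynomial.degree (\<Prod>t\<in>{2..N}. [:- (int t)\<^sup>2, 1:]) = N - 1" by (simp add: degree_prod_eq_sum_degree)
    then show ?thesis by (subst degree_mult_eq) (simp_all add: degree_power_eq)
  qed
  from this[of "m - e + 1"] have "Polynomial.degree (inertia_model m e) = e + (m - e)" unfolding inertia_model_def by simp
  then show "Polynomial.degree (inertia_model m e) = m" using assms by simp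
  show "Polynomial.lead_coeff (inertia_model m e) = 1"
    unfolding inertia_model_def lead_coeff_mult lead_coeff_power lead_coeff_prod by simp
qed

lemma crt3:
  fixes a b c u v w :: int
  assumes "Rings.coprime a b" "Rings.coprime a c" "Rings.coprime b c"
  shows "\<exists>x. [x = u] (mod a) \<and> [x = v] (mod b) \<and> [x = w] (mod c)"
proof -
  obtain y where y: "[y = u] (mod a)" "[y = v] (mod b)" using binary_chinese_remainder_int[OF assms(1)] by blast
  have "Rings.coprime (a * b) c" using assms by simp
  then obtain x where x: "[x = y] (mod a * b)" "[x = w] (mod c)" using binary_chinese_remainder_int by blast
  have "[x = y] (mod a)" "[x = y] (mod b)" using x(1) cong_modulus_mult[of x y a b] cong_modulus_mult[of x y b a] by (simp_all add: mult.commute)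
  with x(2) y show ?thesis by (meson cong_trans)
qed

text \<open>Residues modulo \<open>M\<close> of the coefficients, and of the square root of the constant one, that enforce
  the hypotheses on the three primes.\<close>
lemma exists_residues:
  assumes m: "3 \<le> m"
  shows "\<exists>M a k0. 0 < M \<and> (\<forall>h k. (\<forall>i\<in>{1..<m}. [h i = a i] (mod M)) \<and> [k = k0] (mod M) \<and> h 0 = (-1) ^ m * k\<^sup>2 \<longrightarrow>
    (\<forall>e\<in>{m, m - 1, 2}. \<exists>q. Factorial_Ring.prime q \<and> prime_bound m < q \<and>
        (\<forall>i. q dvd poly.coeff (monic_poly m h - inertia_model m e) i) \<and> \<not> q\<^sup>2 dvd poly (monic_poly m h) 1))"
proof -
  obtain q1 where q1: "Factorial_Ring.prime q1" "nat (prime_bound m) < q1" using bigger_prime by blast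
  obtain q2 where q2: "Factorial_Ring.prime q2" "q1 < q2" using bigger_prime by blast
  obtain q3 where q3: "Factorial_Ring.prime q3" "q2 < q3" using bigger_prime by blast
  have P: "Factorial_Ring.prime (int q1)" "Factorial_Ring.prime (int q2)" "Factorial_Ring.prime (int q3)"
    using q1 q2 q3 by simp_all
  have gt: "prime_bound m < int q1" "prime_bound m < int q2" "prime_bound m < int q3" using q1(2) q2(2) q3(2) by linarith+
  have cop: "Rings.coprime ((int q1)\<^sup>2) ((int q2)\<^sup>2)" "Rings.coprime ((int q1)\<^sup>2) ((int q3)\<^sup>2)" "Rings.coprime ((int q2)\<^sup>2) ((int q3)\<^sup>2)"
    using P q2(2) q3(2) by (auto intro!: primes_coprime simp: coprime_power_left_iff coprime_power_right_iff)
  \<comment> \<open>Squares of the primes, because only modulo q^2 can it be decided that q divides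
    g(1) just once.\<close>
  define M where "M = (int q1)\<^sup>2 * (int q2)\<^sup>2 * (int q3)\<^sup>2"
  have M0: "0 < M" unfolding M_def using q1(2) q2(2) q3(2) by auto
  \<comment> \<open>The added term q X changes neither the residues modulo q nor the constant term,
    but it moves the value at 1 from 0 to q.\<close>
  define G where "G q e = inertia_model m e + [:0, q:]" for q :: int and e
  \<comment> \<open>The square root of (-1)^m times the constant term of the model. The constant
    coefficient of g is not chosen freely but as (-1)^m k^2, so its congruence has to be imposed on
    k.\<close>
  define \<kappa> where "\<kappa> e = (\<Prod>t\<in>{2..m - e + 1}. int t)" for e
  have "\<forall>i. \<exists>x. [x = poly.coeff (G q1 m) i] (mod (int q1)\<^sup>2) \<and> [x = poly.coeff (G q2 (m - 1)) i] (mod (int q2)\<^sup>2) \<and>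
      [x = poly.coeff (G q3 2) i] (mod (int q3)\<^sup>2)" using crt3[OF cop] by blast
  from choice[OF this] obtain a where a: "\<And>i. [a i = poly.coeff (G q1 m) i] (mod (int q1)\<^sup>2)"
    "\<And>i. [a i = poly.coeff (G q2 (m - 1)) i] (mod (int q2)\<^sup>2)" "\<And>i. [a i = poly.coeff (G q3 2) i] (mod (int q3)\<^sup>2)" by blast
  obtain k0 where k0: "[k0 = \<kappa> m] (mod (int q1)\<^sup>2)" "[k0 = \<kappa> (m - 1)] (mod (int q2)\<^sup>2)" "[k0 = \<kappa> 2] (mod (int q3)\<^sup>2)"
    using crt3[OF cop] by blast
  have one: "(\<forall>i. q dvd poly.coeff (monic_poly m h - inertia_model m e) i) \<and> \<not> q\<^sup>2 dvd poly (monic_poly m h) 1"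
    if q: "Factorial_Ring.prime q" and e: "2 \<le> e" "e \<le> m" and qM: "q\<^sup>2 dvd M"
      and aq: "\<And>i. [a i = poly.coeff (G q e) i] (mod q\<^sup>2)" and kq: "[k0 = \<kappa> e] (mod q\<^sup>2)"
      and h: "\<forall>i\<in>{1..<m}. [h i = a i] (mod M)" "[k = k0] (mod M)" "h 0 = (-1) ^ m * k\<^sup>2" for q e h k
  proof -
    have co: "[poly.coeff (monic_poly m h) i = poly.coeff (G q e) i] (mod q\<^sup>2)" for i
    proof -
      consider "i = 0" | "i \<in> {1..<m}" | "i = m" | "m < i" by force
      then show ?thesis
      proof cases
        case 1
        have "[k = \<kappa> e] (mod q\<^sup>2)" using cong_dvd_modulus[OF h(2) qM] kq by (rule cong_trans)
        hence "[(-1) ^ m * k\<^sup>2 = (-1) ^ m * (\<kappa> e)\<^sup>2] (mod q\<^sup>2)" by (intro cong_mult cong_pow cong_refl)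
        moreover have "poly.coeff (G q e) 0 = (-1) ^ m * (\<kappa> e)\<^sup>2"
          using poly_inertia_model_0[OF e(2)] by (simp add: G_def \<kappa>_def poly_0_coeff_0)
        ultimately show ?thesis using 1 h(3) m by (simp add: coeff_monic_poly)
      next
        case 2
        hence "[h i = a i] (mod q\<^sup>2)" using h(1) cong_dvd_modulus[OF _ qM] by blast
        from cong_trans[OF this aq] show ?thesis using 2 by (simp add: coeff_monic_poly)
      next
        case 3
        have "poly.coeff (inertia_model m e) m = 1" using degree_inertia_model[OF e(2)] by simp
        then show ?thesis using 3 m by (simp add: coeff_monic_poly G_def coeff_pCons split: nat.splits)
      next
        case 4
        have "poly.coeff (inertia_model m e) i = 0" using degree_inertia_model(1)[OF e(2)] 4 by (intro coeff_eq_0) simp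
        then show ?thesis using 4 m by (simp add: coeff_monic_poly G_def coeff_pCons split: nat.splits)
      qed
    qed
    have dv: "q\<^sup>2 dvd poly.coeff (monic_poly m h - G q e) i" for i
      using co[of i] by (simp add: cong_iff_dvd_diff)
    have "q dvd poly.coeff (monic_poly m h - inertia_model m e) i" for i
    proof -
      have "q dvd q\<^sup>2" by (simp add: power2_eq_square)
      hence "q dvd poly.coeff (monic_poly m h - G q e) i" using dv dvd_trans by blast
      moreover have "q dvd poly.coeff [:0, q:] i" by (simp add: coeff_pCons split: nat.splits)
      ultimately have "q dvd poly.coeff (monic_poly m h - G q e) i + poly.coeff [:0, q:] i" by (rule dvd_add)
      also have "\<dots> = poly.coeff (monic_poly m h - inertia_model m e) i" by (simp add: G_def)
      finally show ?thesis .
    qed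
    moreover have "\<not> q\<^sup>2 dvd poly (monic_poly m h) 1"
    proof
      assume "q\<^sup>2 dvd poly (monic_poly m h) 1"
      moreover have "q\<^sup>2 dvd poly (monic_poly m h - G q e) 1"
        unfolding poly_altdef using dv by (intro dvd_sum dvd_mult2) auto
      ultimately have "q\<^sup>2 dvd poly (monic_poly m h) 1 - poly (monic_poly m h - G q e) 1" by (rule dvd_diff)
      also have "\<dots> = q" using poly_inertia_model_1[of e m] e by (simp add: G_def)
      finally have "q * q dvd q * 1" by (simp add: power2_eq_square)
      hence "q dvd 1" using q by (subst (asm) dvd_times_left_cancel_iff) auto
      then show False using q not_prime_unit by blast
    qed
    ultimately show ?thesis by blast
  qed
  have dM: "(int q1)\<^sup>2 dvd M" "(int q2)\<^sup>2 dvd M" "(int q3)\<^sup>2 dvd M" unfolding M_def by simp_all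
  show ?thesis
  proof (rule exI[of _ M], rule exI[of _ a], rule exI[of _ k0], rule conjI[OF M0], intro allI impI, rule ballI)
    fix h k e assume h: "(\<forall>i\<in>{1..<m}. [h i = a i] (mod M)) \<and> [k = k0] (mod M) \<and> h 0 = (-1) ^ m * k\<^sup>2"
      and e: "e \<in> {m, m - 1, 2}"
    have e2: "2 \<le> m" "2 \<le> m - 1" "m - 1 \<le> m" using m by auto
    note h1 = h[THEN conjunct1] and h2 = h[THEN conjunct2, THEN conjunct1] and h3 = h[THEN conjunct2, THEN conjunct2]
    from e consider "e = m" | "e = m - 1" | "e = 2" by blast
    then show "\<exists>q. Factorial_Ring.prime q \<and> prime_bound m < q \<and>
        (\<forall>i. q dvd poly.coeff (monic_poly m h - inertia_model m e) i) \<and> \<not> q\<^sup>2 dvd poly (monic_poly m h) 1"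
    proof cases
      case 1
      show ?thesis unfolding 1 using one[OF P(1) e2(1) le_refl dM(1) a(1) k0(1) h1 h2 h3] P(1) gt(1) by blast
    next
      case 2
      show ?thesis unfolding 2 using one[OF P(2) e2(2,3) dM(2) a(2) k0(2) h1 h2 h3] P(2) gt(2) by blast
    next
      case 3
      show ?thesis unfolding 3 using one[OF P(3) le_refl e2(1) dM(3) a(3) k0(3) h1 h2 h3] P(3) gt(3) by blast
    qed
  qed
qed

section \<open>Counting\<close>

text \<open>For monic f the left side is the Mahler measure. Landau's inequality bounds it by the
  Euclidean norm of the n + 1 coefficients.\<close>

lemma prod_max_roots_le:
  fixes f :: "int poly" and r :: "nat \<Rightarrow> complex"
  assumes f: "map_poly of_int f = (\<Prod>k\<in>{1..n}. [:- r k, 1:])"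
    and c: "\<And>i. \<bar>real_of_int (poly.coeff f i)\<bar> \<le> L"
  shows "(\<Prod>k\<in>{1..n}. max 1 (cmod (r k))) \<le> real (n + 1) * L"
proof -
  define p where "p = (map_poly of_int f :: complex poly)"
  have conv: "(\<Prod>k\<in>{1..n}. g k) = (\<Prod>k\<leftarrow>[1..<Suc n]. g k)" for g :: "nat \<Rightarrow> 'b::comm_monoid_mult"
    using prod.distinct_set_conv_list[of "[1..<Suc n]" g] by (simp add: atLeastLessThanSuc_atLeastAtMost del: upt_Suc)
  have L: "0 \<le> L" using c[of 0] abs_ge_zero order.trans by blast
  have p: "p = Polynomial.smult 1 (\<Prod>a\<leftarrow>map r [1..<Suc n]. [:- a, 1:])"
    unfolding p_def f conv by (simp del: upt_Suc add: comp_def)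
  have "(\<Prod>k\<in>{1..n}. max 1 (cmod (r k))) = mahler_measure_poly p"
    unfolding p mahler_measure_poly_explicit conv by (simp del: upt_Suc add: comp_def)
  also have "\<dots> \<le> l2norm_complex p" by (rule Landau_inequality)
  also have "\<dots> \<le> real (n + 1) * L"
  proof (rule real_le_lsqrt)
    have len: "length (coeffs p) = n + 1"
    proof -
      have "Polynomial.degree p = n" unfolding p_def f by (subst degree_prod_eq_sum_degree) auto
      moreover have "p \<noteq> 0" unfolding p_def f by simp
      ultimately show ?thesis by (simp add: length_coeffs)
    qed
    have "(\<Sum>a\<leftarrow>coeffs p. (cmod a)\<^sup>2) \<le> (\<Sum>a\<leftarrow>coeffs p. L\<^sup>2)"
    proof (rule sum_list_mono)
      fix a assume "a \<in> set (coeffs p)"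
      then obtain i where "a = poly.coeff p i" by (auto simp: coeffs_def split: if_splits)
      hence "cmod a = \<bar>real_of_int (poly.coeff f i)\<bar>" by (simp add: p_def)
      then show "(cmod a)\<^sup>2 \<le> L\<^sup>2" using c[of i] by (intro power_mono) auto
    qed
    also have "\<dots> = real (n + 1) * L\<^sup>2" by (simp add: sum_list_triv len)
    also have "\<dots> \<le> real (n + 1) ^ 2 * L\<^sup>2" by (intro mult_right_mono) (auto simp: power2_eq_square)
    finally show "(\<Sum>a\<leftarrow>coeffs p. (cmod a)\<^sup>2) \<le> (real (n + 1) * L)\<^sup>2" by (simp add: power_mult_distrib)
  qed (use L in simp)
  finally show ?thesis .
qed

section \<open>Upper bound: polynomials with the given Galois group\<close>

definition wreath_polys :: "nat \<Rightarrow> real \<Rightarrow> int poly set" where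
  "wreath_polys m L = {f. Polynomial.lead_coeff f = 1 \<and> Polynomial.degree f = 2 * m \<and>
     (\<forall>i. \<bar>real_of_int (poly.coeff f i)\<bar> \<le> L) \<and>
     is_galois_group (2 * m) f (signed_perm_group m \<inter> carrier (alt_group (2 * m)))}"

lemma dyadic_bound:
  fixes b :: real
  assumes "1 \<le> b"
  shows "b \<le> 2 ^ nat \<lceil>log 2 b\<rceil>" "2 ^ nat \<lceil>log 2 b\<rceil> \<le> 2 * b"
proof -
  have l: "0 \<le> log 2 b" using assms by simp
  have k: "real (nat \<lceil>log 2 b\<rceil>) = of_int \<lceil>log 2 b\<rceil>" using l by simp
  have "b = 2 powr (log 2 b)" using assms by simp
  also have "\<dots> \<le> 2 powr (real (nat \<lceil>log 2 b\<rceil>))" unfolding k by (intro powr_mono) auto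
  finally show "b \<le> 2 ^ nat \<lceil>log 2 b\<rceil>" by (simp add: powr_realpow)
  have "(2::real) ^ nat \<lceil>log 2 b\<rceil> = 2 powr (real (nat \<lceil>log 2 b\<rceil>))" by (simp add: powr_realpow)
  also have "\<dots> \<le> 2 powr (1 + log 2 b)" unfolding k by (intro powr_mono) linarith+
  also have "\<dots> = 2 * b" using assms by (simp add: powr_add)
  finally show "2 ^ nat \<lceil>log 2 b\<rceil> \<le> 2 * b" .
qed

text \<open>Polynomials are sorted by the dyadic sizes \<kappa> of their quadratic factors. Within
  one class f is determined by its lattice together with the two points s and t in the common box,
  and one of them is a generator; so the class has at most the sum of the squared point counts as
  its size. The factor 4^m in \<open>Z\<close> has two sources: s i and t i are at most 2 max(1, |r
  i|) max(1, |r (m + i)|), and rounding up to a power of 2 costs another 2.\<close>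

lemma card_wreath_polys:
  fixes m :: nat and L :: real
  assumes m: "3 \<le> m" and L: "1 \<le> L"
  defines "Z \<equiv> 4 ^ m * (real (2 * m + 1) * L)"
  shows "finite (wreath_polys m L)"
    "real (card (wreath_polys m L)) \<le> (log 2 Z + 1) ^ m * ((real m * 4096) ^ (3 * m * m) * Z powr (real m + 1 - 1 / real m))"
proof -
  define FF where "FF = wreath_polys m L"
  define R where "R f = (SOME r. wreath_poly m f r)" for f
  have R: "wreath_poly m f (R f)" if "f \<in> FF" for f
  proof -
    have "\<exists>r. wreath_poly m f r"
      using that m unfolding FF_def wreath_polys_def is_galois_group_def wreath_poly_def by blast
    then show ?thesis unfolding R_def by (rule someI_ex)
  qed
  define W where "W = (\<lambda>f. (f, R f)) ` FF"
  define LL where "LL = (\<lambda>(f, r). wreath_poly.\<Lambda> m f r) ` W"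
  interpret lattice_family m LL
    unfolding LL_def by (rule wreath_lattice_family[OF m]) (auto simp: W_def R)
  define S where "S f = wreath_poly.s m (R f)" for f
  define T where "T f = wreath_poly.t m (R f)" for f
  define Lat where "Lat f = wreath_poly.\<Lambda> m f (R f)" for f
  \<comment> \<open>The maximum with 1 makes the logarithm nonnegative and gives the box sides of
    length at least 1, as the lattice estimates require.\<close>
  define \<beta> where "\<beta> f i = max 1 (max (cmod (S f i)) (cmod (T f i)))" for f i
  define \<kappa> where "\<kappa> f i = (if i \<in> {1..m} then nat \<lceil>log 2 (\<beta> f i)\<rceil> else 0)" for f i
  define N where "N = nat \<lfloor>log 2 Z\<rfloor>"
  define KK where "KK = PiE_dflt {1..m} 0 (\<lambda>_. {0..N})"
  have Z1: "1 \<le> Z"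
  proof -
    have "1 * (1 * 1) \<le> Z" unfolding Z_def using L by (intro mult_mono) auto
    then show ?thesis by simp
  qed
  have LatLL: "Lat f \<in> LL" if "f \<in> FF" for f unfolding LL_def W_def Lat_def using that by auto
  have \<beta>1: "1 \<le> \<beta> f i" for f i by (simp add: \<beta>_def)
  have B: "\<beta> f i \<le> 2 ^ \<kappa> f i" "2 ^ \<kappa> f i \<le> 2 * \<beta> f i" if "i \<in> {1..m}" for f i
    using dyadic_bound[OF \<beta>1[of f i]] that by (simp_all add: \<kappa>_def del: atLeastAtMost_iff)
  have Bprod: "(\<Prod>i\<in>{1..m}. 2 ^ \<kappa> f i) \<le> Z" if f: "f \<in> FF" for f
  proof -
    interpret A: wreath_poly m f "R f" by (rule R[OF f])
    let ?M = "\<lambda>k. max 1 (cmod (R f k))"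
    have \<beta>M: "\<beta> f i \<le> 2 * (?M i * ?M (m + i))" if i: "i \<in> {1..m}" for i
    proof -
      have M1: "1 \<le> ?M i" "1 \<le> ?M (m + i)" by simp_all
      have p1: "1 \<le> ?M i * ?M (m + i)" using mult_mono[OF M1] by simp
      have "cmod (S f i) \<le> cmod (R f i) + cmod (R f (m + i))"
        using i by (simp add: S_def A.s_def norm_triangle_ineq del: atLeastAtMost_iff)
      also have "\<dots> \<le> ?M i + ?M (m + i)" by simp
      also have "\<dots> \<le> 2 * (?M i * ?M (m + i))"
        using mult_left_mono[OF M1(2) order.trans[OF zero_le_one M1(1)]]
          mult_right_mono[OF M1(1) order.trans[OF zero_le_one M1(2)]] by linarith
      finally have 1: "cmod (S f i) \<le> 2 * (?M i * ?M (m + i))" .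
      have "cmod (T f i) = cmod (R f i) * cmod (R f (m + i))"
        using i by (simp add: T_def A.t_def norm_mult del: atLeastAtMost_iff)
      also have "\<dots> \<le> ?M i * ?M (m + i)" by (intro mult_mono) auto
      finally have 2: "cmod (T f i) \<le> 2 * (?M i * ?M (m + i))" using p1 by linarith
      show ?thesis unfolding \<beta>_def using 1 2 p1 by simp
    qed
    have "(\<Prod>i\<in>{1..m}. 2 ^ \<kappa> f i) \<le> (\<Prod>i\<in>{1..m}. 4 * (?M i * ?M (m + i)))"
    proof (rule prod_mono, rule conjI)
      fix i assume i: "i \<in> {1..m}"
      show "2 ^ \<kappa> f i \<le> 4 * (?M i * ?M (m + i))" using B(2)[OF i, of f] \<beta>M[OF i] by linarith
    qed simp
    also have "\<dots> = 4 ^ m * ((\<Prod>i\<in>{1..m}. ?M i) * (\<Prod>i\<in>{1..m}. ?M (m + i)))" by (simp only: prod.distrib prod_constant) simp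
    also have "(\<Prod>i\<in>{1..m}. ?M (m + i)) = (\<Prod>k\<in>(\<lambda>i. m + i) ` {1..m}. ?M k)" by (subst prod.reindex) auto
    also have "(\<Prod>i\<in>{1..m}. ?M i) * \<dots> = (\<Prod>k\<in>{1..2*m}. ?M k)"
    proof -
      have "{1..2*m} = {1..m} \<union> (\<lambda>i. m + i) ` {1..m}"
      proof (intro equalityI subsetI)
        fix k assume "k \<in> {1..2*m}"
        hence "k \<in> {1..m} \<or> (k = m + (k - m) \<and> k - m \<in> {1..m})" by auto
        then show "k \<in> {1..m} \<union> (\<lambda>i. m + i) ` {1..m}" by blast
      qed auto
      then show ?thesis by (simp only:) (intro prod.union_disjoint[symmetric], auto)
    qed
    also have "\<dots> \<le> real (2 * m + 1) * L"
      using f by (intro prod_max_roots_le[OF A.f_prod]) (simp add: FF_def wreath_polys_def)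
    finally show ?thesis by (simp add: Z_def)
  qed
  have \<kappa>KK: "\<kappa> f \<in> KK" if f: "f \<in> FF" for f
  proof -
    have "\<kappa> f i \<le> N" if i: "i \<in> {1..m}" for i
    proof -
      have "(2::real) ^ \<kappa> f i = (\<Prod>j\<in>{i}. 2 ^ \<kappa> f j)" by simp
      also have "\<dots> \<le> (\<Prod>j\<in>{1..m}. 2 ^ \<kappa> f j)" using i by (intro prod_mono2) auto
      also have "\<dots> \<le> Z" by (rule Bprod[OF f])
      finally have "real (\<kappa> f i) \<le> log 2 Z" using Z1 by (simp add: le_log_iff powr_realpow)
      then show ?thesis unfolding N_def by linarith
    qed
    then show ?thesis by (auto simp: KK_def PiE_dflt_def \<kappa>_def)
  qed
  have finKK: "finite KK" unfolding KK_def by (intro finite_PiE_dflt) auto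
  define bound where "bound = (real m * 4096) ^ (3 * m * m) * Z powr (real m + 1 - 1 / real m)"
  have cls: "finite {f \<in> FF. \<kappa> f = k} \<and> real (card {f \<in> FF. \<kappa> f = k}) \<le> bound" for k
  proof (cases "{f \<in> FF. \<kappa> f = k} = {}")
    case True
    have "0 \<le> bound" unfolding bound_def by simp
    then show ?thesis unfolding True by simp
  next
    case False
    then obtain f0 where f0: "f0 \<in> FF" "\<kappa> f0 = k" by blast
    define BB where "BB i = (2::real) ^ k i" for i
    have BB1: "\<And>i. i \<in> {1..m} \<Longrightarrow> 1 \<le> BB i" by (simp add: BB_def)
    have BBZ: "(\<Prod>i\<in>{1..m}. BB i) \<le> Z" using Bprod[OF f0(1)] by (simp add: BB_def f0(2))
    define LL' where "LL' = {\<Lambda> \<in> LL. gens \<Lambda> BB \<noteq> {}}"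
    have "finite (all_gens BB)"
    proof (rule all_gens_bound(1)[of BB "\<lambda>_. Z"])
      fix U assume U: "U \<subseteq> {1..m}"
      have "(\<Prod>i\<in>U. BB i) \<le> (\<Prod>i\<in>{1..m}. BB i)" using U by (intro prod_mono2) (auto simp: BB_def)
      then show "(\<Prod>i\<in>U. BB i) \<le> Z" using BBZ by simp
    qed (simp add: BB_def)
    hence finLL': "finite LL'" unfolding LL'_def by (rule finite_lattices_with_gens)
    have ST: "S f \<in> box (Lat f) BB" "T f \<in> box (Lat f) BB" "Lat f \<in> LL'" if f: "f \<in> FF" "\<kappa> f = k" for f
    proof -
      interpret A: wreath_poly m f "R f" by (rule R[OF f(1)])
      have le: "cmod (S f i) \<le> BB i" "cmod (T f i) \<le> BB i" if i: "i \<in> {1..m}" for i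
        using B(1)[OF i, of f] f(2) by (simp_all add: \<beta>_def BB_def)
      show 1: "S f \<in> box (Lat f) BB" using A.s_\<Lambda> le by (simp add: box_def S_def Lat_def)
      show 2: "T f \<in> box (Lat f) BB" using A.t_\<Lambda> le by (simp add: box_def T_def Lat_def)
      have "gens (Lat f) BB \<noteq> {}" using 1 2 A.s_or_t_inj unfolding gens_def S_def T_def by blast
      then show "Lat f \<in> LL'" using LatLL[OF f(1)] by (simp add: LL'_def)
    qed
    define h where "h f = (Lat f, S f, T f)" for f
    define tgt where "tgt = Sigma LL' (\<lambda>\<Lambda>. box \<Lambda> BB \<times> box \<Lambda> BB)"
    have LL'LL: "LL' \<subseteq> LL" by (auto simp: LL'_def)
    have fin_tgt: "finite tgt" unfolding tgt_def using finLL' finite_box LL'LL by blast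
    have inj: "inj_on h {f \<in> FF. \<kappa> f = k}"
    proof (rule inj_onI)
      fix f g assume fg: "f \<in> {f \<in> FF. \<kappa> f = k}" "g \<in> {f \<in> FF. \<kappa> f = k}" "h f = h g"
      interpret A: wreath_poly m f "R f" by (rule R) (use fg in simp)
      interpret A': wreath_poly m g "R g" by (rule R) (use fg in simp)
      have "map_poly complex_of_int f = map_poly of_int g"
        unfolding A.f_quadratics A'.f_quadratics using fg(3) by (simp add: h_def S_def T_def)
      then show "f = g" by (simp add: poly_eq_iff)
    qed
    have sub: "h ` {f \<in> FF. \<kappa> f = k} \<subseteq> tgt" using ST by (auto simp: h_def tgt_def)
    have "card {f \<in> FF. \<kappa> f = k} \<le> card tgt" by (rule card_inj_on_le[OF inj sub fin_tgt])
    also have "card tgt = (\<Sum>\<Lambda>\<in>LL'. card (box \<Lambda> BB) * card (box \<Lambda> BB))"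
      unfolding tgt_def using finLL' finite_box LL'LL by (subst card_SigmaI) (auto simp: card_cartesian_product)
    finally have "real (card {f \<in> FF. \<kappa> f = k}) \<le> real (\<Sum>\<Lambda>\<in>LL'. card (box \<Lambda> BB) * card (box \<Lambda> BB))" by (rule of_nat_mono)
    also have "\<dots> = (\<Sum>\<Lambda>\<in>LL'. (real (card (box \<Lambda> BB)))\<^sup>2)" by (simp add: power2_eq_square)
    also have "\<dots> \<le> bound" unfolding bound_def by (rule sum_box_squares[OF BB1 BBZ Z1 finLL']) (auto simp: LL'_def)
    finally have "real (card {f \<in> FF. \<kappa> f = k}) \<le> bound" .
    moreover have "finite {f \<in> FF. \<kappa> f = k}" by (rule finite_imageD[OF finite_subset[OF sub fin_tgt] inj])
    ultimately show ?thesis by blast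
  qed
  have U: "FF = (\<Union>k\<in>KK. {f \<in> FF. \<kappa> f = k})" using \<kappa>KK by blast
  have "finite (\<Union>k\<in>KK. {f \<in> FF. \<kappa> f = k})" using finKK cls by blast
  with U show "finite (wreath_polys m L)" unfolding FF_def by simp
  have "card FF \<le> (\<Sum>k\<in>KK. card {f \<in> FF. \<kappa> f = k})"
    by (subst U) (rule card_UN_le[OF finKK])
  hence "real (card FF) \<le> real (\<Sum>k\<in>KK. card {f \<in> FF. \<kappa> f = k})" by (rule of_nat_mono)
  also have "\<dots> = (\<Sum>k\<in>KK. real (card {f \<in> FF. \<kappa> f = k}))" by simp
  also have "\<dots> \<le> (\<Sum>k\<in>KK. bound)" using cls by (intro sum_mono) blast
  also have "\<dots> = real (card KK) * bound" by simp
  also have "card KK = (N + 1) ^ m" unfolding KK_def by (subst card_PiE_dflt) auto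
  also have "real ((N + 1) ^ m) * bound \<le> (log 2 Z + 1) ^ m * bound"
  proof (rule mult_right_mono)
    have "real (N + 1) \<le> log 2 Z + 1" unfolding N_def using Z1 by simp
    hence "real (N + 1) ^ m \<le> (log 2 Z + 1) ^ m" by (rule power_mono) simp
    then show "real ((N + 1) ^ m) \<le> (log 2 Z + 1) ^ m" by simp
    show "0 \<le> bound" unfolding bound_def by simp
  qed
  finally show "real (card (wreath_polys m L)) \<le> (log 2 Z + 1) ^ m * ((real m * 4096) ^ (3 * m * m) * Z powr (real m + 1 - 1 / real m))"
    by (simp add: FF_def bound_def)
qed

section \<open>Lower bound: counting the constructed polynomials\<close>

lemma poly_monic_poly:
  "poly (map_poly real_of_int (monic_poly m h)) u = u ^ m + (\<Sum>i<m. real_of_int (h i) * u ^ i)"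
proof -
  have "poly (map_poly real_of_int (monic_poly m h)) u =
      (\<Sum>i\<le>m. real_of_int (poly.coeff (monic_poly m h) i) * u ^ i)"
    unfolding poly_altdef by (simp add: degree_monic_poly)
  also have "{..m} = insert m {..<m}" by auto
  also have "(\<Sum>i\<in>\<dots>. real_of_int (poly.coeff (monic_poly m h) i) * u ^ i) = u ^ m + (\<Sum>i<m. real_of_int (h i) * u ^ i)"
    by (simp add: coeff_monic_poly)
  finally show ?thesis .
qed

lemma poly_shape:
  assumes "1 \<le> m"
  shows "poly (shape m) u = (\<Sum>i<m. poly.coeff (shape m) i * u ^ i)"
proof -
  have le: "Polynomial.degree (shape m) \<le> m - 1" by (rule shape_degree)
  show ?thesis unfolding poly_altdef
  proof (rule sum.mono_neutral_left)
    show "{..Polynomial.degree (shape m)} \<subseteq> {..<m}" using le assms by auto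
    show "\<forall>i\<in>{..<m} - {..Polynomial.degree (shape m)}. poly.coeff (shape m) i * u ^ i = 0"
      by (simp add: coeff_eq_0)
  qed simp
qed

text \<open>At the points in question w times the shape has absolute value at least w (1/2)^(m - 1).
  The leading power contributes at most a quarter of this once w is large, and the m deviating
  coefficients, each off by at most \<delta> w, contribute another quarter; half of the main term
  survives.\<close>

lemma monic_poly_near_shape_sign:
  fixes w \<delta> :: real
  assumes m: "3 \<le> m" and w: "0 < w" and \<delta>: "0 \<le> \<delta>" "\<delta> * (4 * real m * real m ^ m) \<le> (1 / 2) ^ (m - 1)"
    and large: "4 * real m ^ m \<le> w * (1 / 2) ^ (m - 1)"
    and near: "\<And>i. i < m \<Longrightarrow> \<bar>real_of_int (h i) - w * poly.coeff (shape m) i\<bar> \<le> \<delta> * w"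
    and j: "j < m"
  shows "0 < (-1) ^ (m - j) * poly (map_poly real_of_int (monic_poly m h)) (real j - 2)"
proof -
  define u where "u = real j - 2"
  define \<eta> where "\<eta> = (1 / 2 :: real) ^ (m - 1)"
  have \<eta>: "0 < \<eta>" by (simp add: \<eta>_def)
  have u: "\<bar>u\<bar> \<le> real m" using j m by (auto simp: u_def)
  have up: "\<bar>u ^ i\<bar> \<le> real m ^ m" if "i \<le> m" for i
  proof -
    have "\<bar>u ^ i\<bar> \<le> real m ^ i" unfolding power_abs by (rule power_mono[OF u]) simp
    also have "\<dots> \<le> real m ^ m" using that m by (intro power_increasing) auto
    finally show ?thesis .
  qed
  let ?p = "poly (map_poly real_of_int (monic_poly m h)) u"
  let ?q = "poly (shape m) u"
  have "?p - w * ?q = u ^ m + (\<Sum>i<m. (real_of_int (h i) - w * poly.coeff (shape m) i) * u ^ i)"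
    unfolding poly_monic_poly using m
    by (subst poly_shape) (auto simp: sum_distrib_left sum_subtractf left_diff_distrib mult.assoc)
  hence "\<bar>?p - w * ?q\<bar> \<le> \<bar>u ^ m\<bar> + (\<Sum>i<m. \<bar>(real_of_int (h i) - w * poly.coeff (shape m) i) * u ^ i\<bar>)"
    by (simp only:) (rule order.trans[OF abs_triangle_ineq], intro add_left_mono sum_abs)
  also have "\<dots> \<le> real m ^ m + (\<Sum>i<m. \<delta> * w * real m ^ m)"
  proof (rule add_mono)
    show "\<bar>u ^ m\<bar> \<le> real m ^ m" by (rule up) simp
    show "(\<Sum>i<m. \<bar>(real_of_int (h i) - w * poly.coeff (shape m) i) * u ^ i\<bar>) \<le> (\<Sum>i<m. \<delta> * w * real m ^ m)"
      unfolding abs_mult by (rule sum_mono) (use near up \<delta> w in \<open>auto intro!: mult_mono\<close>)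
  qed
  also have "\<dots> = real m ^ m + w * (\<delta> * (real m * real m ^ m))" by simp
  also have "\<dots> \<le> w * \<eta> / 4 + w * (\<eta> / 4)"
    using large \<delta> w by (intro add_mono mult_left_mono) (auto simp: \<eta>_def)
  finally have err: "\<bar>?p - w * ?q\<bar> \<le> w * \<eta> / 2" by (simp add: mult.commute)
  define s where "s = (-1 :: real) ^ (m - j)"
  have s: "s = 1 \<or> s = -1" unfolding s_def by (simp add: minus_one_power_iff)
  have "w * \<eta> \<le> w * (s * ?q)"
    using shape_sign[OF _ j] m w by (intro mult_left_mono) (auto simp: \<eta>_def s_def u_def)
  moreover have "0 < w * \<eta>" using w \<eta> by simp
  moreover have "?p - w * ?q \<le> w * \<eta> / 2" "w * ?q - ?p \<le> w * \<eta> / 2" using err by linarith+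
  moreover have "w * (s * ?q) = w * ?q \<and> s * ?p = ?p \<or> w * (s * ?q) = - (w * ?q) \<and> s * ?p = - ?p" using s by auto
  ultimately have "0 < s * ?p" by linarith
  then show ?thesis by (simp add: s_def u_def)
qed

lemma even_poly_good:
  assumes m: "3 \<le> m" and sgn: "\<And>j. j < m \<Longrightarrow> 0 < (-1) ^ (m - j) * poly (map_poly real_of_int (monic_poly m h)) (real j - 2)"
    and h0: "h 0 = (-1) ^ m * k\<^sup>2"
    and primes: "\<And>e. e \<in> {m, m - 1, 2} \<Longrightarrow> \<exists>q. Factorial_Ring.prime q \<and> prime_bound m < q \<and>
        (\<forall>i. q dvd poly.coeff (monic_poly m h - inertia_model m e) i) \<and> \<not> q\<^sup>2 dvd poly (monic_poly m h) 1"
  shows "is_galois_group (2 * m) (monic_poly m h \<circ>\<^sub>p [:0, 0, 1:]) (signed_perm_group m \<inter> carrier (alt_group (2 * m)))"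
    and "is_square (discriminant (monic_poly m h \<circ>\<^sub>p [:0, 0, 1:]))"
proof -
  let ?g = "monic_poly m h"
  have g: "Polynomial.lead_coeff ?g = 1" "Polynomial.degree ?g = m"
    by (simp_all add: degree_monic_poly coeff_monic_poly)
  obtain y where y: "inj_on y {1..m}" "y 1 < 0" "y 2 < 0" "\<forall>i\<in>{3..m}. 0 < y i"
    and gy: "map_poly of_int ?g = (\<Prod>i\<in>{1..m}. [:- complex_of_real (y i), 1:])"
    using real_roots_of_sign_changes[OF m g sgn] by blast
  have g0: "poly ?g 0 = (-1) ^ m * k\<^sup>2" using m h0 by (simp add: poly_0_coeff_0 coeff_monic_poly)
  show "is_galois_group (2 * m) (?g \<circ>\<^sub>p [:0, 0, 1:]) (signed_perm_group m \<inter> carrier (alt_group (2 * m)))"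
    by (rule is_galois_group_even_signed[OF m gy y(1-3) y(4)[rule_format] g0 primes])
  show "is_square (discriminant (?g \<circ>\<^sub>p [:0, 0, 1:]))"
  proof (rule is_square_discriminant_even)
    show "map_poly of_int ?g = (\<Prod>i<m. [:- complex_of_real (y (Suc i)), 1:])"
      unfolding gy by (simp add: prod.atLeast1_atMost_eq)
    show "inj_on (\<lambda>i. complex_of_real (y (Suc i))) {..<m}"
    proof (rule inj_onI)
      fix i j assume "i \<in> {..<m}" "j \<in> {..<m}" "complex_of_real (y (Suc i)) = complex_of_real (y (Suc j))"
      then show "i = j" using inj_onD[OF y(1), of "Suc i" "Suc j"] by simp
    qed
    fix i assume i: "i < m"
    have "y l \<noteq> 0" if "l \<in> {1..m}" for l
    proof -
      have "l = 1 \<or> l = 2 \<or> l \<in> {3..m}" using that by auto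
      then show ?thesis using y(2,3) y(4)[rule_format, of l] by auto
    qed
    from this[of "Suc i"] i show "complex_of_real (y (Suc i)) \<noteq> 0" by simp
  qed (rule g0)
qed

text \<open>There are m - 1 coefficients that run through intervals of length proportional to L, and
  a square root k of the constant one that runs through an interval of length proportional to sqrt
  L. Fixing residues modulo the constant M costs only a constant factor, so the count has order L
  powr (m - 1/2).\<close>

lemma many_good_even_polys:
  assumes m: "3 \<le> m"
  shows "\<exists>c>0. \<exists>L0. \<forall>L\<ge>L0. \<exists>Hs. finite Hs \<and> c * L powr (real m - 1 / 2) \<le> real (card Hs) \<and>
    (\<forall>h\<in>Hs. (\<forall>i\<ge>m. h i = 0) \<and> (\<forall>i<m. \<bar>real_of_int (h i)\<bar> \<le> L) \<and>
       is_galois_group (2 * m) (monic_poly m h \<circ>\<^sub>p [:0, 0, 1:]) (signed_perm_group m \<inter> carrier (alt_group (2 * m))) \<and>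
       is_square (discriminant (monic_poly m h \<circ>\<^sub>p [:0, 0, 1:])))"
proof -
  obtain M a k0 where M: "0 < M" and Mak: "\<And>h k e. \<forall>i\<in>{1..<m}. [h i = a i] (mod M) \<Longrightarrow> [k = k0] (mod M) \<Longrightarrow>
      h 0 = (-1) ^ m * k\<^sup>2 \<Longrightarrow> e \<in> {m, m - 1, 2} \<Longrightarrow> \<exists>q. Factorial_Ring.prime q \<and> prime_bound m < q \<and>
        (\<forall>i. q dvd poly.coeff (monic_poly m h - inertia_model m e) i) \<and> \<not> q\<^sup>2 dvd poly (monic_poly m h) 1"
    using exists_residues[OF m] by metis
  define \<eta> where "\<eta> = (1 / 2 :: real) ^ (m - 1)"
  define \<delta> where "\<delta> = \<eta> / (4 * real m * real m ^ m)"
  define b where "b i = poly.coeff (shape m) i" for i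
  \<comment> \<open>The sign makes b0 positive, since 0 is the point with j = 2. As \<delta> <
    \<eta> \<le> b0, the interval for k^2 around w b0 stays on the positive side.\<close>
  define b0 where "b0 = (-1) ^ m * b 0"
  \<comment> \<open>Scaled so that with w = \<theta> L every coefficient within \<delta> w of w b i
    is bounded by L.\<close>
  define \<theta> where "\<theta> = 1 / ((\<Sum>i<m. \<bar>b i\<bar>) + \<delta>)"
  have M': "0 < real_of_int M" using M by simp
  have \<eta>: "0 < \<eta>" by (simp add: \<eta>_def)
  have m4: "1 \<le> real m * real m ^ m" using m mult_mono[of 1 "real m" 1 "real m ^ m"] one_le_power[of "real m" m] by simp
  have \<delta>: "0 < \<delta>" using \<eta> m by (simp add: \<delta>_def)
  have \<delta>\<eta>: "\<delta> < \<eta>"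
  proof -
    have "\<eta> / (4 * real m * real m ^ m) < \<eta> / 1" using m4 \<eta> by (intro divide_strict_left_mono) auto
    then show ?thesis by (simp add: \<delta>_def)
  qed
  have "\<eta> \<le> b0"
  proof -
    have "(-1::real) ^ (m - 2) = (-1) ^ m" using m by (simp add: minus_one_power_iff)
    then show ?thesis using shape_sign[of m 2] m by (simp add: b0_def b_def \<eta>_def poly_0_coeff_0)
  qed
  with \<delta>\<eta> have b0: "\<delta> < b0" "0 < b0" using \<delta> by linarith+
  have sum0: "0 < (\<Sum>i<m. \<bar>b i\<bar>) + \<delta>" 
  proof -
    have "0 \<le> (\<Sum>i<m. \<bar>b i\<bar>)" by (intro sum_nonneg) simp
    with \<delta> show ?thesis by linarith
  qed
  have \<theta>: "0 < \<theta>" using sum0 by (simp add: \<theta>_def)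
  have \<theta>b: "\<theta> * (\<bar>b i\<bar> + \<delta>) \<le> 1" if "i < m" for i
  proof -
    have "\<bar>b i\<bar> \<le> (\<Sum>i<m. \<bar>b i\<bar>)" using that by (intro member_le_sum) auto
    then show ?thesis using sum0 by (simp add: \<theta>_def pos_divide_le_eq)
  qed
  define d where "d = sqrt (\<theta> * (b0 + \<delta>)) - sqrt (\<theta> * (b0 - \<delta>))"
  have d: "0 < d" using \<theta> \<delta> by (simp add: d_def)
  define c where "c = (\<delta> * \<theta> / M) ^ (m - 1) * (d / (2 * M))"
  have c: "0 < c" using \<delta> \<theta> d M' by (simp add: c_def)
  \<comment> \<open>The second and third entries make half the expected number of residues in the
    intervals at least 1, so that the loss of 1 in the count takes away at most half. The last entry
    makes w large enough for the shape to dominate the leading power.\<close>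
  define L0 where "L0 = Max {1, M / (\<delta> * \<theta>), (2 * M / d)\<^sup>2, 4 * real m ^ m / (\<theta> * \<eta>)}"
  show ?thesis
  proof (rule exI[of _ c], rule conjI[OF c], rule exI[of _ L0], intro allI impI)
    fix L assume "L0 \<le> L"
    hence L: "1 \<le> L" "M / (\<delta> * \<theta>) \<le> L" "(2 * M / d)\<^sup>2 \<le> L" "4 * real m ^ m / (\<theta> * \<eta>) \<le> L"
      by (simp_all add: L0_def)
    define w where "w = \<theta> * L"
    have w: "0 < w" using \<theta> L by (simp add: w_def)
    define H where "H i = {z :: int. w * b i - \<delta> * w \<le> real_of_int z \<and> real_of_int z \<le> w * b i + \<delta> * w \<and> [z = a i] (mod M)}" for i
    define K where "K = {z :: int. sqrt (w * (b0 - \<delta>)) \<le> real_of_int z \<and> real_of_int z \<le> sqrt (w * (b0 + \<delta>)) \<and> [z = k0] (mod M)}"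
    define D where "D = PiE_dflt {1..<m} 0 H \<times> K"
    \<comment> \<open>Position 0 is left empty by the product over {1..<m} and filled from k. All
      admissible k are positive, so k can be recovered from its square.\<close>
    define emb where "emb = (\<lambda>(h :: nat \<Rightarrow> int, k :: int). h(0 := (-1) ^ m * k\<^sup>2))"
    define Hs where "Hs = emb ` D"
    have finH: "finite (H i)" for i unfolding H_def by (rule card_residue_class_in_interval[OF M])
    have finK: "finite K" unfolding K_def by (rule card_residue_class_in_interval[OF M])
    have finD: "finite D" unfolding D_def using finH finK by blast
    have Kpos: "0 < k" if "k \<in> K" for k
    proof -
      have "0 < sqrt (w * (b0 - \<delta>))" using w b0 by simp
      moreover have "sqrt (w * (b0 - \<delta>)) \<le> real_of_int k" using that by (simp add: K_def)
      ultimately have "0 < real_of_int k" by linarith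
      then show ?thesis by simp
    qed
    have "inj_on emb D"
    proof (rule inj_onI)
      fix p p' assume pp: "p \<in> D" "p' \<in> D" "emb p = emb p'"
      obtain h k h' k' where p: "p = (h, k)" "p' = (h', k')" by fastforce
      have hk: "h \<in> PiE_dflt {1..<m} 0 H" "k \<in> K" "h' \<in> PiE_dflt {1..<m} 0 H" "k' \<in> K"
        using pp(1,2) by (simp_all add: p D_def)
      have e: "(h(0 := (-1) ^ m * k\<^sup>2)) i = (h'(0 := (-1) ^ m * k'\<^sup>2)) i" for i using pp(3) by (simp add: p emb_def)
      have "k\<^sup>2 = k'\<^sup>2" using e[of 0] by simp
      hence "k = k'" using Kpos[OF hk(2)] Kpos[OF hk(4)] by (simp add: power2_eq_iff)
      moreover have "h i = h' i" for i
      proof (cases "i = 0")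
        case True
        then show ?thesis using hk by (simp add: PiE_dflt_def)
      qed (use e[of i] in simp)
      ultimately show "p = p'" by (auto simp: p)
    qed
    hence "card Hs = card D" unfolding Hs_def by (rule card_image)
    also have "card D = (\<Prod>i\<in>{1..<m}. card (H i)) * card K"
      unfolding D_def by (simp add: card_cartesian_product card_PiE_dflt finH)
    finally have cardHs: "real (card Hs) = (\<Prod>i\<in>{1..<m}. real (card (H i))) * real (card K)" by simp
    have cH: "\<delta> * \<theta> / M * L \<le> real (card (H i))" for i
    proof -
      have "(w * b i + \<delta> * w - (w * b i - \<delta> * w)) / M - 1 \<le> real (card (H i))"
        unfolding H_def by (rule card_residue_class_in_interval[OF M])
      moreover have "(w * b i + \<delta> * w - (w * b i - \<delta> * w)) / M = 2 * (\<delta> * \<theta> / M * L)" by (simp add: w_def)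
      moreover have "1 \<le> \<delta> * \<theta> / M * L"
      proof -
        have "0 < \<delta> * \<theta>" using \<delta> \<theta> by simp
        then show ?thesis using L(2) M' by (simp add: pos_divide_le_eq pos_le_divide_eq mult.commute)
      qed
      ultimately show ?thesis by linarith
    qed
    have cK: "d / (2 * M) * sqrt L \<le> real (card K)"
    proof -
      have "(sqrt (w * (b0 + \<delta>)) - sqrt (w * (b0 - \<delta>))) / M - 1 \<le> real (card K)"
        unfolding K_def by (rule card_residue_class_in_interval[OF M])
      moreover have "(sqrt (w * (b0 + \<delta>)) - sqrt (w * (b0 - \<delta>))) / M = 2 * (d / (2 * M) * sqrt L)"
      proof -
        have e: "sqrt (w * v) = sqrt (\<theta> * v) * sqrt L" for v by (simp add: w_def real_sqrt_mult mult_ac)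
        have "(u * q - v * q) / M = 2 * ((u - v) / (2 * M) * q)" for u v q :: real using M' by (simp add: field_simps)
        then show ?thesis unfolding e d_def .
      qed
      moreover have "1 \<le> d / (2 * M) * sqrt L"
      proof -
        have "2 * M / d \<le> sqrt L" using L(3) by (rule real_le_rsqrt)
        then show ?thesis using d M' by (simp add: pos_divide_le_eq pos_le_divide_eq mult.commute)
      qed
      ultimately show ?thesis by linarith
    qed
    have "c * L powr (real m - 1 / 2) = (\<Prod>i\<in>{1..<m}. \<delta> * \<theta> / M * L) * (d / (2 * M) * sqrt L)"
    proof -
      have "L powr (real m - 1 / 2) = L powr (real (m - 1) + 1 / 2)" using m by (simp add: of_nat_diff)
      also have "\<dots> = L ^ (m - 1) * sqrt L" using L(1) by (simp add: powr_add powr_realpow powr_half_sqrt)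
      finally have "c * L powr (real m - 1 / 2) = c * (L ^ (m - 1) * sqrt L)" by simp
      also have "\<dots> = (\<delta> * \<theta> / M * L) ^ (m - 1) * (d / (2 * M) * sqrt L)"
        unfolding c_def power_mult_distrib by (simp only: mult_ac)
      finally show ?thesis by simp
    qed
    also have "\<dots> \<le> real (card Hs)" unfolding cardHs
      using cH cK \<delta> \<theta> M' L(1) d by (intro mult_mono prod_mono) (auto intro!: prod_nonneg)
    finally have card: "c * L powr (real m - 1 / 2) \<le> real (card Hs)" .
    have good: "(\<forall>i\<ge>m. h i = 0) \<and> (\<forall>i<m. \<bar>real_of_int (h i)\<bar> \<le> L) \<and>
       is_galois_group (2 * m) (monic_poly m h \<circ>\<^sub>p [:0, 0, 1:]) (signed_perm_group m \<inter> carrier (alt_group (2 * m))) \<and>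
       is_square (discriminant (monic_poly m h \<circ>\<^sub>p [:0, 0, 1:]))" if hHs: "h \<in> Hs" for h
    proof -
      obtain p where p: "p \<in> D" "h = emb p" using hHs unfolding Hs_def by blast
      obtain g k where gk: "p = (g, k)" by fastforce
      have g: "g \<in> PiE_dflt {1..<m} 0 H" "k \<in> K" "h = g(0 := (-1) ^ m * k\<^sup>2)"
        using p by (simp_all add: gk D_def emb_def)
      have h0: "h 0 = (-1) ^ m * k\<^sup>2" using g by simp
      have hH: "h i \<in> H i" if "i \<in> {1..<m}" for i using g that by (auto simp: PiE_dflt_def)
      have near: "\<bar>real_of_int (h i) - w * b i\<bar> \<le> \<delta> * w" if i: "i < m" for i
      proof (cases "i = 0")
        case False
        then show ?thesis using hH[of i] i by (simp add: H_def abs_le_iff)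
      next
        case True
        have k: "sqrt (w * (b0 - \<delta>)) \<le> k" "k \<le> sqrt (w * (b0 + \<delta>))" "0 < k" using g(2) Kpos by (auto simp: K_def)
        have "(sqrt (w * (b0 - \<delta>)))\<^sup>2 \<le> (real_of_int k)\<^sup>2" by (rule power_mono[OF k(1)]) (use w b0 in simp)
        hence k1: "w * (b0 - \<delta>) \<le> (real_of_int k)\<^sup>2" using w b0 by simp
        have "(real_of_int k)\<^sup>2 \<le> (sqrt (w * (b0 + \<delta>)))\<^sup>2" by (rule power_mono[OF k(2)]) (use k in simp)
        hence k2: "(real_of_int k)\<^sup>2 \<le> w * (b0 + \<delta>)" using w b0 \<delta> by simp
        define s where "s = (-1 :: real) ^ m"
        have s: "s = 1 \<or> s = -1" unfolding s_def by (simp add: minus_one_power_iff)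
        have "b 0 = s * b0" using s by (auto simp: b0_def s_def[symmetric])
        hence "real_of_int (h i) - w * b i = s * ((real_of_int k)\<^sup>2 - w * b0)"
          unfolding True h0 by (simp add: s_def algebra_simps)
        hence "\<bar>real_of_int (h i) - w * b i\<bar> = \<bar>(real_of_int k)\<^sup>2 - w * b0\<bar>" using s by (auto simp: abs_mult)
        also have "\<dots> \<le> \<delta> * w" using k1 k2 by (simp add: abs_le_iff algebra_simps)
        finally show ?thesis .
      qed
      have 1: "\<forall>i\<ge>m. h i = 0" using g m by (auto simp: PiE_dflt_def)
      have 2: "\<bar>real_of_int (h i)\<bar> \<le> L" if i: "i < m" for i
      proof -
        have "\<bar>real_of_int (h i)\<bar> \<le> \<bar>w * b i\<bar> + \<delta> * w" using near[OF i] by linarith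
        also have "\<dots> = L * (\<theta> * (\<bar>b i\<bar> + \<delta>))" using \<theta> L(1) by (simp add: w_def abs_mult algebra_simps)
        also have "\<dots> \<le> L * 1" using \<theta>b[OF i] L(1) by (intro mult_left_mono) auto
        finally show ?thesis by simp
      qed
      have sgn: "0 < (-1) ^ (m - j) * poly (map_poly real_of_int (monic_poly m h)) (real j - 2)" if "j < m" for j
      proof (rule monic_poly_near_shape_sign[OF m w _ _ _ _ that])
        show "\<delta> * (4 * real m * real m ^ m) \<le> (1 / 2) ^ (m - 1)" using m by (simp add: \<delta>_def \<eta>_def)
        have "0 < \<theta> * \<eta>" using \<theta> \<eta> by simp
        then show "4 * real m ^ m \<le> w * (1 / 2) ^ (m - 1)"
          using L(4) unfolding \<eta>_def[symmetric] w_def by (simp add: pos_divide_le_eq mult_ac)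
      qed (use near \<delta> in \<open>auto simp: b_def\<close>)
      have "\<forall>i\<in>{1..<m}. [h i = a i] (mod M)" using hH by (auto simp: H_def)
      moreover have "[k = k0] (mod M)" using g(2) by (simp add: K_def)
      ultimately have primes: "\<exists>q. Factorial_Ring.prime q \<and> prime_bound m < q \<and>
          (\<forall>i. q dvd poly.coeff (monic_poly m h - inertia_model m e) i) \<and> \<not> q\<^sup>2 dvd poly (monic_poly m h) 1"
        if "e \<in> {m, m - 1, 2}" for e using Mak[of h k e] h0 that by blast
      from 1 2 even_poly_good[OF m sgn h0 primes] show ?thesis by blast
    qed
    show "\<exists>Hs. finite Hs \<and> c * L powr (real m - 1 / 2) \<le> real (card Hs) \<and>
      (\<forall>h\<in>Hs. (\<forall>i\<ge>m. h i = 0) \<and> (\<forall>i<m. \<bar>real_of_int (h i)\<bar> \<le> L) \<and>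
       is_galois_group (2 * m) (monic_poly m h \<circ>\<^sub>p [:0, 0, 1:]) (signed_perm_group m \<inter> carrier (alt_group (2 * m))) \<and>
       is_square (discriminant (monic_poly m h \<circ>\<^sub>p [:0, 0, 1:])))"
      by (rule exI[of _ Hs], intro conjI card ballI good) (simp add: Hs_def finD)
  qed
qed

section \<open>Probabilities\<close>

definition coeff_box :: "nat \<Rightarrow> real \<Rightarrow> (nat \<Rightarrow> int) set" where
  "coeff_box n L = PiE_dflt {..<n} 0 (\<lambda>_. {a. - L \<le> of_int a \<and> of_int a \<le> L})"

lemma int_box_eq: "{a :: int. - L \<le> of_int a \<and> of_int a \<le> (L :: real)} = {- \<lfloor>L\<rfloor>..\<lfloor>L\<rfloor>}"
proof (intro equalityI subsetI)
  fix a assume "a \<in> {a :: int. - L \<le> of_int a \<and> of_int a \<le> L}"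
  hence "of_int (- a) \<le> L" "of_int a \<le> L" by auto
  hence "- a \<le> \<lfloor>L\<rfloor>" "a \<le> \<lfloor>L\<rfloor>" by (simp_all only: le_floor_iff)
  then show "a \<in> {- \<lfloor>L\<rfloor>..\<lfloor>L\<rfloor>}" by simp
next
  fix a assume "a \<in> {- \<lfloor>L\<rfloor>..\<lfloor>L\<rfloor>}"
  hence "- a \<le> \<lfloor>L\<rfloor>" "a \<le> \<lfloor>L\<rfloor>" by auto
  hence "of_int (- a) \<le> L" "of_int a \<le> L" by (simp_all only: le_floor_iff)
  then show "a \<in> {a :: int. - L \<le> of_int a \<and> of_int a \<le> L}" by simp
qed

text \<open>For L \<ge> 1 the number 2 \<lfloor>L\<rfloor> + 1 of values of a coefficient lies
  between L and 3 L; constant factors do not matter for the asymptotics.\<close>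

lemma coeff_box:
  assumes "1 \<le> L"
  shows "finite (coeff_box n L)" "L ^ n \<le> real (card (coeff_box n L))" "real (card (coeff_box n L)) \<le> (3 * L) ^ n"
proof -
  show "finite (coeff_box n L)" unfolding coeff_box_def int_box_eq by (intro finite_PiE_dflt) auto
  have "card (coeff_box n L) = (nat (2 * \<lfloor>L\<rfloor> + 1)) ^ n"
    unfolding coeff_box_def int_box_eq by (subst card_PiE_dflt) auto
  hence c: "real (card (coeff_box n L)) = real (nat (2 * \<lfloor>L\<rfloor> + 1)) ^ n" by simp
  have fl: "1 \<le> \<lfloor>L\<rfloor>" using assms by simp
  have "real (nat (2 * \<lfloor>L\<rfloor> + 1)) = 2 * of_int \<lfloor>L\<rfloor> + 1" using fl by simp
  hence "L \<le> real (nat (2 * \<lfloor>L\<rfloor> + 1))" "real (nat (2 * \<lfloor>L\<rfloor> + 1)) \<le> 3 * L" using assms by linarith+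
  then show "L ^ n \<le> real (card (coeff_box n L))" "real (card (coeff_box n L)) \<le> (3 * L) ^ n"
    unfolding c using assms by (rule_tac [!] power_mono) simp_all
qed

lemma prob_random_monic_poly:
  assumes "1 \<le> L"
  shows "measure_pmf.prob (random_monic_poly n L) G =
    real (card {c \<in> coeff_box n L. monic_poly n c \<in> G}) / real (card (coeff_box n L))"
proof -
  have ne: "{a :: int. - L \<le> of_int a \<and> of_int a \<le> L} \<noteq> {}" using assms by (auto intro!: exI[of _ 0])
  have "random_monic_poly n L = map_pmf (monic_poly n) (pmf_of_set (coeff_box n L))"
    unfolding random_monic_poly_def coeff_box_def monic_poly_def[abs_def]
    by (subst Pi_pmf_of_set) (use ne in \<open>auto simp: int_box_eq\<close>)
  moreover have "coeff_box n L \<noteq> {}"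
  proof -
    have "0 < L ^ n" using assms by simp
    with coeff_box(2)[OF assms, of n] have "0 < real (card (coeff_box n L))" by linarith
    then show ?thesis by auto
  qed
  ultimately have "measure_pmf.prob (random_monic_poly n L) G =
      real (card (coeff_box n L \<inter> monic_poly n -` G)) / real (card (coeff_box n L))"
    using coeff_box(1)[OF assms] by (simp add: measure_pmf_of_set)
  also have "coeff_box n L \<inter> monic_poly n -` G = {c \<in> coeff_box n L. monic_poly n c \<in> G}" by auto
  finally show ?thesis .
qed

lemma monic_poly_inj: "inj_on (monic_poly n) (coeff_box n L)"
proof (rule inj_onI, rule ext)
  fix c d i assume "c \<in> coeff_box n L" "d \<in> coeff_box n L" and eq: "monic_poly n c = monic_poly n d"
  hence "i \<ge> n \<Longrightarrow> c i = d i" by (auto simp: coeff_box_def PiE_dflt_def)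
  moreover have "i < n \<Longrightarrow> c i = d i" using arg_cong[OF eq, of "\<lambda>p. poly.coeff p i"] by (simp add: coeff_monic_poly)
  ultimately show "c i = d i" by linarith
qed

lemma prob_wreath_upper:
  assumes m: "3 \<le> m" and L: "1 \<le> L"
  shows "measure_pmf.prob (random_monic_poly (2 * m) L)
      {f. is_galois_group (2 * m) f (signed_perm_group m \<inter> carrier (alt_group (2 * m)))} \<le> real (card (wreath_polys m L)) / L ^ (2 * m)"
proof -
  let ?G = "{f. is_galois_group (2 * m) f (signed_perm_group m \<inter> carrier (alt_group (2 * m)))}"
  let ?C = "{c \<in> coeff_box (2 * m) L. monic_poly (2 * m) c \<in> ?G}"
  have "monic_poly (2 * m) ` ?C \<subseteq> wreath_polys m L"
  proof (rule image_subsetI)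
    fix c assume c: "c \<in> ?C"
    have "\<bar>real_of_int (c i)\<bar> \<le> L" if "i < 2 * m" for i
    proof -
      have "- L \<le> of_int (c i) \<and> of_int (c i) \<le> L" using c that by (auto simp: coeff_box_def PiE_dflt_def)
      then show ?thesis by linarith
    qed
    hence "\<bar>real_of_int (poly.coeff (monic_poly (2 * m) c) i)\<bar> \<le> L" for i using L by (simp add: coeff_monic_poly)
    then show "monic_poly (2 * m) c \<in> wreath_polys m L"
      using c by (simp add: wreath_polys_def degree_monic_poly coeff_monic_poly)
  qed
  moreover have "inj_on (monic_poly (2 * m)) ?C" by (rule inj_on_subset[OF monic_poly_inj]) blast
  ultimately have "card ?C \<le> card (wreath_polys m L)" using card_wreath_polys(1)[OF m L] by (intro card_inj_on_le)
  then show ?thesis unfolding prob_random_monic_poly[OF L]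
    using coeff_box(2)[OF L, of "2 * m"] L by (intro frac_le) auto
qed

lemma prob_lower:
  fixes G :: "int poly set"
  assumes L: "1 \<le> L" and fin: "finite Hs"
    and Hs: "\<And>h i. h \<in> Hs \<Longrightarrow> m \<le> i \<Longrightarrow> h i = 0" "\<And>h i. h \<in> Hs \<Longrightarrow> i < m \<Longrightarrow> \<bar>real_of_int (h i)\<bar> \<le> L"
    "\<And>h. h \<in> Hs \<Longrightarrow> monic_poly m h \<circ>\<^sub>p [:0, 0, 1:] \<in> G"
  shows "real (card Hs) / (3 * L) ^ (2 * m) \<le> measure_pmf.prob (random_monic_poly (2 * m) L) G"
proof -
  \<comment> \<open>The coefficient vector of g(X^2): coefficient 2 i is h i, and the odd ones are
    0, which belongs to the range of every coefficient.\<close>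
  define emb where "emb h j = (if j < 2 * m \<and> even j then h (j div 2) else (0::int))" for h j
  let ?C = "{c \<in> coeff_box (2 * m) L. monic_poly (2 * m) c \<in> G}"
  have emb: "monic_poly (2 * m) (emb h) = monic_poly m h \<circ>\<^sub>p [:0, 0, 1:]" for h
    unfolding monic_poly_pcompose_square unfolding monic_poly_def by (simp add: emb_def)
  have "emb ` Hs \<subseteq> ?C"
  proof (rule image_subsetI)
    fix h assume h: "h \<in> Hs"
    have "- L \<le> of_int (emb h j) \<and> of_int (emb h j) \<le> L" if "j < 2 * m" for j
    proof (cases "even j")
      case True
      have "j div 2 < m" using that by linarith
      hence "- L \<le> of_int (h (j div 2)) \<and> of_int (h (j div 2)) \<le> L" using Hs(2)[OF h] by (simp add: abs_le_iff minus_le_iff)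
      then show ?thesis using that True by (simp add: emb_def)
    qed (use L in \<open>simp add: emb_def\<close>)
    hence "emb h \<in> coeff_box (2 * m) L" by (auto simp: coeff_box_def PiE_dflt_def emb_def)
    then show "emb h \<in> ?C" using Hs(3)[OF h] emb by simp
  qed
  moreover have "inj_on emb Hs"
  proof (rule inj_onI, rule ext)
    fix h h' i assume h: "h \<in> Hs" "h' \<in> Hs" "emb h = emb h'"
    show "h i = h' i"
    proof (cases "i < m")
      case True
      then show ?thesis using fun_cong[OF h(3), of "2 * i"] by (simp add: emb_def)
    qed (use Hs(1)[OF h(1)] Hs(1)[OF h(2)] in simp)
  qed
  ultimately have "card Hs \<le> card ?C" using coeff_box(1)[OF L] by (intro card_inj_on_le[of emb]) auto
  moreover have "0 < real (card (coeff_box (2 * m) L))"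
    using coeff_box(2)[OF L, of "2 * m"] L zero_less_power[of L "2 * m"] by linarith
  ultimately show ?thesis unfolding prob_random_monic_poly[OF L]
    using coeff_box(3)[OF L, of "2 * m"] by (intro frac_le) auto
qed

lemma log_power_bigo:
  fixes A \<epsilon> :: real
  assumes "0 < A" "0 < \<epsilon>"
  shows "(\<lambda>L. (log 2 (A * L) + 1) ^ m) \<in> O[at_top](\<lambda>L. L powr \<epsilon>)"
  using assms by real_asymp

theorem theorem1p3:
  fixes n :: nat
  assumes "n \<ge> 6" and "even n"
  shows
    "(\<forall>\<epsilon>::real. \<epsilon> > 0 \<longrightarrow>
       (\<lambda>L::real. measure_pmf.prob (random_monic_poly n L)
          {f. is_galois_group n f (signed_perm_group (n div 2) \<inter> carrier (alt_group n))})
       \<in> O[at_top](\<lambda>L. L powr (- real n / 2 - 2 / real n + 1 + \<epsilon>)))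
     \<and> (\<lambda>L::real. measure_pmf.prob (random_monic_poly n L)
          {f. is_galois_group n f (signed_perm_group (n div 2) \<inter> carrier (alt_group n))})
       \<in> \<Omega>[at_top](\<lambda>L. L powr (- (real n + 1) / 2))
     \<and> (\<lambda>L::real. measure_pmf.prob (random_monic_poly n L) {f. is_square (discriminant f)})
       \<in> \<Omega>[at_top](\<lambda>L. L powr (- (real n + 1) / 2))"
proof -
  obtain m where n: "n = 2 * m" using assms(2) by blast
  have m: "3 \<le> m" using assms(1) n by simp
  let ?W = "{f. is_galois_group (2 * m) f (signed_perm_group m \<inter> carrier (alt_group (2 * m)))}"
  let ?S = "{f. is_square (discriminant f)}"
  have upper: "(\<lambda>L. measure_pmf.prob (random_monic_poly (2 * m) L) ?W)
      \<in> O[at_top](\<lambda>L. L powr (- real (2 * m) / 2 - 2 / real (2 * m) + 1 + \<epsilon>))" if \<epsilon>: "0 < \<epsilon>" for \<epsilon> :: real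
  proof -
    define A where "A = 4 ^ m * real (2 * m + 1)"
    define e where "e = real m + 1 - 1 / real m"
    define K where "K = (real m * 4096) ^ (3 * m * m) * A powr e"
    have A: "0 < A" by (simp add: A_def)
    have K: "0 \<le> K" by (simp add: K_def)
    have "(\<lambda>L. measure_pmf.prob (random_monic_poly (2 * m) L) ?W) \<in>
        O[at_top](\<lambda>L. (log 2 (A * L) + 1) ^ m * L powr (e - real (2 * m)))"
    proof (rule bigoI[of _ K], rule eventually_mono[OF eventually_ge_at_top[of 1]])
      fix L :: real assume L: "1 \<le> L"
      define lg where "lg = (log 2 (A * L) + 1) ^ m"
      have Z: "4 ^ m * (real (2 * m + 1) * L) = A * L" by (simp add: A_def)
      have "real (card (wreath_polys m L)) \<le> lg * ((real m * 4096) ^ (3 * m * m) * (A * L) powr e)"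
        using card_wreath_polys(2)[OF m L] unfolding Z lg_def e_def .
      also have "(A * L) powr e = A powr e * L powr e" using A L by (simp add: powr_mult)
      finally have "real (card (wreath_polys m L)) \<le> K * (lg * L powr e)" by (simp add: K_def mult_ac)
      hence "real (card (wreath_polys m L)) / L ^ (2 * m) \<le> K * (lg * L powr e) / L ^ (2 * m)"
        using L by (intro divide_right_mono) auto
      also have "\<dots> = K * (lg * L powr (e - real (2 * m)))"
        using L by (simp add: powr_diff powr_realpow[of L "2 * m", symmetric] del: of_nat_mult)
      also have "\<dots> \<le> K * norm (lg * L powr (e - real (2 * m)))" using K by (intro mult_left_mono) auto
      finally show "norm (measure_pmf.prob (random_monic_poly (2 * m) L) ?W) \<le> K * norm ((log 2 (A * L) + 1) ^ m * L powr (e - real (2 * m)))"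
        using prob_wreath_upper[OF m L] by (simp add: lg_def)
    qed
    \<comment> \<open>The number of dyadic classes is the only source of the \<epsilon> in the
      exponent.\<close>
    also have "(\<lambda>L. (log 2 (A * L) + 1) ^ m * L powr (e - real (2 * m))) \<in> O[at_top](\<lambda>L. L powr \<epsilon> * L powr (e - real (2 * m)))"
      by (intro landau_o.big.mult log_power_bigo A \<epsilon> landau_o.big_refl)
    also have "(\<lambda>L. L powr \<epsilon> * L powr (e - real (2 * m))) = (\<lambda>L. L powr (- real (2 * m) / 2 - 2 / real (2 * m) + 1 + \<epsilon>))"
    proof
      fix L :: real
      have "\<epsilon> + (e - real (2 * m)) = - real (2 * m) / 2 - 2 / real (2 * m) + 1 + \<epsilon>" by (simp add: e_def)
      then show "L powr \<epsilon> * L powr (e - real (2 * m)) = L powr (- real (2 * m) / 2 - 2 / real (2 * m) + 1 + \<epsilon>)"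
        by (simp only: powr_add[symmetric])
    qed
    finally show ?thesis .
  qed
  obtain c L0 where c: "0 < c" and many: "\<And>L. L0 \<le> L \<Longrightarrow> \<exists>Hs. finite Hs \<and> c * L powr (real m - 1 / 2) \<le> real (card Hs) \<and>
    (\<forall>h\<in>Hs. (\<forall>i\<ge>m. h i = 0) \<and> (\<forall>i<m. \<bar>real_of_int (h i)\<bar> \<le> L) \<and>
       is_galois_group (2 * m) (monic_poly m h \<circ>\<^sub>p [:0, 0, 1:]) (signed_perm_group m \<inter> carrier (alt_group (2 * m))) \<and>
       is_square (discriminant (monic_poly m h \<circ>\<^sub>p [:0, 0, 1:])))"
    using many_good_even_polys[OF m] by blast
  \<comment> \<open>One family serves both lower bounds: its members have the prescribed group, and
    their discriminants were shown to be squares by direct computation.\<close>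
  have lower: "(\<lambda>L. measure_pmf.prob (random_monic_poly (2 * m) L) G) \<in> \<Omega>[at_top](\<lambda>L. L powr (- (real (2 * m) + 1) / 2))"
    if G: "G = ?W \<or> G = ?S" for G
  proof (rule landau_omega.bigI[of "c / 3 ^ (2 * m)"], use c in simp, rule eventually_mono[OF eventually_ge_at_top[of "max 1 L0"]])
    fix L assume "max 1 L0 \<le> L"
    hence L: "1 \<le> L" "L0 \<le> L" by simp_all
    obtain Hs where Hs: "finite Hs" "c * L powr (real m - 1 / 2) \<le> real (card Hs)"
      and good: "\<forall>h\<in>Hs. (\<forall>i\<ge>m. h i = 0) \<and> (\<forall>i<m. \<bar>real_of_int (h i)\<bar> \<le> L) \<and>
       is_galois_group (2 * m) (monic_poly m h \<circ>\<^sub>p [:0, 0, 1:]) (signed_perm_group m \<inter> carrier (alt_group (2 * m))) \<and>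
       is_square (discriminant (monic_poly m h \<circ>\<^sub>p [:0, 0, 1:]))" using many[OF L(2)] by blast
    have "c / 3 ^ (2 * m) * L powr (- (real (2 * m) + 1) / 2) = c * L powr (real m - 1 / 2) / (3 * L) ^ (2 * m)"
    proof -
      have "- (real (2 * m) + 1) / 2 = (real m - 1 / 2) - real (2 * m)" by simp
      hence "L powr (- (real (2 * m) + 1) / 2) = L powr (real m - 1 / 2) / L powr real (2 * m)" by (simp only: powr_diff)
      also have "L powr real (2 * m) = L ^ (2 * m)" using L(1) by (intro powr_realpow) simp
      finally show ?thesis by (simp add: power_mult_distrib)
    qed
    also have "\<dots> \<le> real (card Hs) / (3 * L) ^ (2 * m)" using Hs(2) L(1) by (intro divide_right_mono) auto
    also have "\<dots> \<le> measure_pmf.prob (random_monic_poly (2 * m) L) G"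
      by (rule prob_lower[OF L(1) Hs(1)]) (use good G in auto)
    finally show "c / 3 ^ (2 * m) * norm (L powr (- (real (2 * m) + 1) / 2)) \<le> norm (measure_pmf.prob (random_monic_poly (2 * m) L) G)"
      by simp
  qed
  have "2 * m div 2 = m" by simp
  then show ?thesis unfolding n using upper lower[of ?W] lower[of ?S] by (simp only:) blast
qed

end
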